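(* Let $f\in L^2(\mathbb{P}_\eta)$ have the chaotic expansion $f(\eta)=\sum_{n=0}^\infty I_n(f_n)$, where $f_n=\frac1{n!}T_nf\in\mathbf{H}_n$, and assume that $$\sum_{n=1}^\infty n\cdot n!\int f_n^2\,d\lambda^n<\infty .$$ Then, for $\lambda$-a.e. $y\in\mathbb{Y}$, $$D_yf(\eta)=D'_yf(\eta)\qquad\mathbb{P}\text{-a.s.}$$
   Context: Let $(\mathbb{Y},\mathcal{Y})$ be an arbitrary measurable space and $\lambda$ an arbitrary $\sigma$-finite measure on it. Let $\mathbf{N}$ be the space of all $\sigma$-finite measures $\mu$ on $\mathbb{Y}$ with values in $\{0,1,2,\ldots\}\cup\{\infty\}$, equipped with the smallest $\sigma$-field making $\mu\mapsto\mu(B)$ measurable for every $B\in\mathcal{Y}$. On a probability space $(\Omega,\mathcal{F},\mathbb{P})$, $\eta$ is a Poisson process on $\mathbb{Y}$ with intensity measure $\lambda$: a random element of $\mathbf{N}$ such that $\eta(B)$ is Poisson distributed with parameter $\lambda(B)$ for each $B\in\mathcal{Y}$, and $\eta(B_1),\ldots,\eta(B_k)$ are independent for pairwise disjoint $B_1,\ldots,B_k\in\mathcal{Y}$. $\eta$ is taken in a version of the form $\eta=\sum_{i=1}^{\eta(\mathbb{Y})}\delta_{X_i}$ with random elements $X_i$ of $\mathbb{Y}$ (such a version always exists). $\mathbb{P}_\eta$ is the distribution of $\eta$, and $L^2(\mathbb{P}_\eta)$ is the space of measurable $f:\mathbf{N}\to\mathbb{R}$ with $\mathbb{E}f(\eta)^2<\infty$.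 Difference operators: for measurable $f:\mathbf{N}\to\mathbb{R}$ and $y\in\mathbb{Y}$, $D_yf(\mu):=f(\mu+\delta_y)-f(\mu)$; $D^1:=D$, and $D^n_{y_1,\ldots,y_n}f:=D^1_{y_1}D^{n-1}_{y_2,\ldots,y_n}f$ for $n\ge2$. For $n\ge1$, $T_nf(y_1,\ldots,y_n):=\mathbb{E}D^n_{y_1,\ldots,y_n}f(\eta)$ (defined $\lambda^n$-a.e. for $f\in L^2(\mathbb{P}_\eta)$) and $T_0f:=\mathbb{E}f(\eta)$. For $n\ge1$, $\mathbf{H}_n$ is the space of symmetric functions in $L^2(\lambda^n)$, with scalar product $\langle\cdot,\cdot\rangle_n$; $\mathbf{H}_0:=\mathbb{R}$. Multiple Wiener-Itô integral $I_n$: $I_0(c):=c$ for $c\in\mathbb{R}$. For $\mu=\sum_i\delta_{x_i}$ and $m\ge1$, $\mu^{(m)}$ is the measure on $\mathbb{Y}^m$ such that $\mu^{(m)}(B)$ is the number of $m$-tuples of pairwise distinct indices $(i_1,\ldots,i_m)$ with $(x_{i_1},\ldots,x_{i_m})\in B$; $\mu^{(m)}(h)$ denotes the integral of $h$ with respect to it. Let $\mathcal{Y}_0:=\{B\in\mathcal{Y}:\lambda(B)<\infty\}$. For $n\geq 1$, a function $g:\mathbb{Y}^n\to\mathbb{R}$ is of product form if $g(y_1,\ldots,y_n)=\prod_{i=1}^ng_i(y_i)$ (written $g=\otimes_{i=1}^ng_i$) with each $g_i$ bounded, measurable and vanishing outside some $B\in\mathcal{Y}_0$; then $$I_n(g):=\sum_{J\subset\{1,\ldots,n\}}(-1)^{n-|J|}\,\eta^{(|J|)}(\otimes_{j\in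 J}g_j)\,\lambda^{n-|J|}(\otimes_{j'\in\{1,\ldots,n\}\setminus J}\,g_{j'}),$$ where the factors corresponding to an empty index set are $1$. $I_n$ is extended by linearity to finite sums of functions of product form (functions of sum-product form), and then, using the isometry $\mathbb{E}I_m(g)I_n(h)=\mathbf{1}\{m=n\}\,m!\,\langle\tilde g,\tilde h\rangle_n$ (where $\tilde g(y_1,\ldots,y_n)=\frac1{n!}\sum_\pi g(y_{\pi(1)},\ldots,y_{\pi(n)})$ is the symmetrization) and the density of functions of sum-product form, by continuity to a linear map $I_n:L^2(\lambda^n)\to L^2(\mathbb{P})$. Every $f\in L^2(\mathbb{P}_\eta)$ satisfies $f(\eta)=\sum_{n\ge0}I_n(f_n)$ with $f_n:=\frac1{n!}T_nf$ and convergence in $L^2(\mathbb{P})$; this is its chaotic expansion. Derivative operator: for $n\ge1$, $g\in\mathbf{H}_n$ and $y\in\mathbb{Y}$, put $g_y(y_1,\ldots,y_{n-1}):=g(y_1,\ldots,y_{n-1},y)$. Set $I_{n-1}g(y):=I_{n-1}(g_y)$ if $g_y\in L^2(\lambda^{n-1})$ (which holds for $\lambda$-a.e. $y$), and $I_{n-1}g(y):=0$ otherwise, choosing a version jointly measurable in $(\omega,y)$. Under the summability condition in the claim, $$D'_yf(\eta):=\sum_{n=1}^\infty n\,I_{n-1}f_n(y),$$ the series converging in $L^2(\mathbb{P}\otimes\lambda)$. *)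

theory Defs
  imports "HOL-Probability.Probability"
begin

subsection \<open>Square-integrable functions\<close>

definition L2 :: "'a measure \<Rightarrow> ('a \<Rightarrow> real) set" where
  "L2 M = {h \<in> borel_measurable M. integrable M (\<lambda>x. (h x)\<^sup>2)}"

definition L2_tendsto :: "'a measure \<Rightarrow> (nat \<Rightarrow> 'a \<Rightarrow> real) \<Rightarrow> ('a \<Rightarrow> real) \<Rightarrow> bool" where
  "L2_tendsto M h l \<longleftrightarrow> (\<forall>k. h k \<in> L2 M) \<and> l \<in> L2 M \<and>
     (\<lambda>k. \<integral>\<^sup>+ x. ennreal ((h k x - l x)\<^sup>2) \<partial>M) \<longlonglongrightarrow> 0"


subsection \<open>Integer-valued measures and Poisson processes\<close>

text \<open>
  Throughout, the measurable space \<open>\<bbbY>\<close> and the measure on it are given together by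
  \<open>lam :: 'a measure\<close>.
\<close>

definition int_measures :: "'a measure \<Rightarrow> 'a measure set" where
  "int_measures lam = {\<mu>. sets \<mu> = sets lam \<and> sigma_finite_measure \<mu> \<and>
     (\<forall>B\<in>sets lam. emeasure \<mu> B \<in> range of_nat \<union> {\<infinity>})}"

definition int_measure_space :: "'a measure \<Rightarrow> 'a measure measure" where
  "int_measure_space lam = sigma (int_measures lam)
     {{\<mu> \<in> int_measures lam. emeasure \<mu> B \<in> U} | B U. B \<in> sets lam \<and> U \<in> sets borel}"

text \<open>A Poisson distribution with infinite parameter is the point mass at infinity.\<close>

definition poisson_distributed :: "'w measure \<Rightarrow> ('w \<Rightarrow> ennreal) \<Rightarrow> ennreal \<Rightarrow> bool" where
  "poisson_distributed P Z r \<longleftrightarrow> Z \<in> borel_measurable P \<and>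
     (if r = \<infinity> then AE \<omega> in P. Z \<omega> = \<infinity>
      else \<forall>k::nat. measure P {\<omega> \<in> space P. Z \<omega> = of_nat k}
             = exp (- enn2real r) * enn2real r ^ k / fact k)"

definition poisson_process :: "'w measure \<Rightarrow> 'a measure \<Rightarrow> ('w \<Rightarrow> 'a measure) \<Rightarrow> bool" where
  "poisson_process P lam \<eta> \<longleftrightarrow>
     \<eta> \<in> measurable P (int_measure_space lam) \<and>
     (\<forall>B\<in>sets lam. poisson_distributed P (\<lambda>\<omega>. emeasure (\<eta> \<omega>) B) (emeasure lam B)) \<and>
     (\<forall>(k::nat) B. (\<forall>i<k. B i \<in> sets lam) \<and> disjoint_family_on B {..<k} \<longrightarrow>
        prob_space.indep_vars P (\<lambda>_. borel) (\<lambda>i \<omega>. emeasure (\<eta> \<omega>) (B i)) {..<k})"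

text \<open>
  \<open>{i. i < \<mu>(\<bbbY>)}\<close>, the indices of the points of a measure \<open>\<mu>\<close>, counted from \<open>0\<close>;
  the image of counting measure on this set under \<open>x\<close> is the sum of the Dirac measures
  at the points \<open>x i\<close>.
\<close>

definition point_index :: "'a measure \<Rightarrow> nat set" where
  "point_index \<mu> = {i. of_nat i < emeasure \<mu> (space \<mu>)}"

definition point_representation ::
    "'w measure \<Rightarrow> 'a measure \<Rightarrow> ('w \<Rightarrow> 'a measure) \<Rightarrow> (nat \<Rightarrow> 'w \<Rightarrow> 'a) \<Rightarrow> bool" where
  "point_representation P lam \<eta> X \<longleftrightarrow> (\<forall>i. X i \<in> measurable P lam) \<and>
     (\<forall>\<omega>\<in>space P. \<eta> \<omega> = distr (count_space (point_index (\<eta> \<omega>))) lam (\<lambda>i. X i \<omega>))"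


subsection \<open>Difference operators and chaos kernels\<close>

definition add_point :: "'a measure \<Rightarrow> 'a \<Rightarrow> 'a measure" where
  "add_point \<mu> y = measure_of (space \<mu>) (sets \<mu>) (\<lambda>B. emeasure \<mu> B + emeasure (return \<mu> y) B)"

definition diff_op :: "'a \<Rightarrow> ('a measure \<Rightarrow> real) \<Rightarrow> 'a measure \<Rightarrow> real" where
  "diff_op y f \<mu> = f (add_point \<mu> y) - f \<mu>"

text \<open>
  Here and below, an \<open>n\<close>-tuple \<open>(y\<^sub>1, \<dots>, y\<^sub>n)\<close> is a function \<open>y\<close> on \<open>{..<n}\<close>, with \<open>y 0\<close> in
  the role of \<open>y\<^sub>1\<close>, and \<open>lam\<^sup>n\<close> is the product measure on \<open>{..<n} \<rightarrow>\<^sub>E space lam\<close>.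
  For \<open>n = 0\<close> this is a unit mass at the single point \<open>\<lambda>_. undefined\<close>, so that
  functions of \<open>0\<close> variables are constants.
\<close>

primrec diff_iter :: "nat \<Rightarrow> (nat \<Rightarrow> 'a) \<Rightarrow> ('a measure \<Rightarrow> real) \<Rightarrow> 'a measure \<Rightarrow> real" where
  "diff_iter 0 y f = f"
| "diff_iter (Suc n) y f = diff_op (y 0) (diff_iter n (\<lambda>i. y (Suc i)) f)"

abbreviation pow_measure :: "'a measure \<Rightarrow> nat \<Rightarrow> (nat \<Rightarrow> 'a) measure" where
  "pow_measure lam n \<equiv> PiM {..<n} (\<lambda>_. lam)"

definition T_op ::
    "'w measure \<Rightarrow> ('w \<Rightarrow> 'a measure) \<Rightarrow> nat \<Rightarrow> ('a measure \<Rightarrow> real) \<Rightarrow> (nat \<Rightarrow> 'a) \<Rightarrow> real" where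
  "T_op P \<eta> n f y = (\<integral>\<omega>. diff_iter n y f (\<eta> \<omega>) \<partial>P)"

definition chaos_kernel ::
    "'w measure \<Rightarrow> ('w \<Rightarrow> 'a measure) \<Rightarrow> ('a measure \<Rightarrow> real) \<Rightarrow> nat \<Rightarrow> (nat \<Rightarrow> 'a) \<Rightarrow> real" where
  "chaos_kernel P \<eta> f n y = T_op P \<eta> n f y / fact n"


subsection \<open>Multiple Wiener-Ito integrals\<close>

text \<open>
  The factorial measure of the points \<open>x i\<close>, \<open>i \<in> I\<close>, with coordinates labelled by a finite
  set \<open>J\<close>: a \<open>J\<close>-tuple of pairwise distinct indices is an injective \<open>t \<in> J \<rightarrow>\<^sub>E I\<close>.
  For \<open>J = {..<m}\<close> this is \<open>\<mu>\<^sup>(\<^sup>m\<^sup>)\<close>; labelling the coordinates by \<open>J\<close> itself avoids an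
  enumeration of the subsets \<open>J\<close> in the definition of the integral.
\<close>

definition factorial_measure ::
    "'a measure \<Rightarrow> nat set \<Rightarrow> (nat \<Rightarrow> 'a) \<Rightarrow> nat set \<Rightarrow> (nat \<Rightarrow> 'a) measure" where
  "factorial_measure lam I x J =
     distr (count_space {t \<in> J \<rightarrow>\<^sub>E I. inj_on t J}) (PiM J (\<lambda>_. lam)) (\<lambda>t. \<lambda>j\<in>J. x (t j))"

definition admissible_factor :: "'a measure \<Rightarrow> ('a \<Rightarrow> real) \<Rightarrow> bool" where
  "admissible_factor lam h \<longleftrightarrow> h \<in> borel_measurable lam \<and>
     (\<exists>c. \<forall>y\<in>space lam. \<bar>h y\<bar> \<le> c) \<and>
     (\<exists>B\<in>sets lam. emeasure lam B < \<infinity> \<and> (\<forall>y\<in>space lam - B. h y = 0))"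

definition wiener_ito_prod ::
    "'a measure \<Rightarrow> ('w \<Rightarrow> 'a measure) \<Rightarrow> (nat \<Rightarrow> 'w \<Rightarrow> 'a) \<Rightarrow>
     nat \<Rightarrow> (nat \<Rightarrow> 'a \<Rightarrow> real) \<Rightarrow> 'w \<Rightarrow> real" where
  "wiener_ito_prod lam \<eta> X n g \<omega> =
     (\<Sum>J\<in>Pow {..<n}. (-1) ^ (n - card J) *
        (\<integral>y. (\<Prod>j\<in>J. g j (y j))
           \<partial>factorial_measure lam (point_index (\<eta> \<omega>)) (\<lambda>i. X i \<omega>) J) *
        (\<integral>y. (\<Prod>j\<in>{..<n} - J. g j (y j)) \<partial>PiM ({..<n} - J) (\<lambda>_. lam)))"

text \<open>
  A list of \<open>n\<close>-tuples of factors represents a function of sum-product form.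
\<close>

definition sum_product :: "nat \<Rightarrow> (nat \<Rightarrow> 'a \<Rightarrow> real) list \<Rightarrow> (nat \<Rightarrow> 'a) \<Rightarrow> real" where
  "sum_product n gs y = (\<Sum>g\<leftarrow>gs. \<Prod>i<n. g i (y i))"

definition wiener_ito_sum_product ::
    "'a measure \<Rightarrow> ('w \<Rightarrow> 'a measure) \<Rightarrow> (nat \<Rightarrow> 'w \<Rightarrow> 'a) \<Rightarrow>
     nat \<Rightarrow> (nat \<Rightarrow> 'a \<Rightarrow> real) list \<Rightarrow> 'w \<Rightarrow> real" where
  "wiener_ito_sum_product lam \<eta> X n gs \<omega> = (\<Sum>g\<leftarrow>gs. wiener_ito_prod lam \<eta> X n g \<omega>)"

text \<open>
  Extension by continuity: \<open>F\<close> is a version of \<open>I\<^sub>n(g)\<close> if it is the \<open>L\<^sup>2\<close>-limit of the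
  integrals of functions of sum-product form that converge to \<open>g\<close> in \<open>L\<^sup>2\<close>.  By the isometry,
  such an \<open>F\<close> exists for every \<open>g \<in> L\<^sup>2\<close> and is unique up to almost sure equality.
\<close>

definition is_wiener_ito ::
    "'w measure \<Rightarrow> 'a measure \<Rightarrow> ('w \<Rightarrow> 'a measure) \<Rightarrow> (nat \<Rightarrow> 'w \<Rightarrow> 'a) \<Rightarrow>
     nat \<Rightarrow> ((nat \<Rightarrow> 'a) \<Rightarrow> real) \<Rightarrow> ('w \<Rightarrow> real) \<Rightarrow> bool" where
  "is_wiener_ito P lam \<eta> X n g F \<longleftrightarrow>
     (\<exists>gs :: nat \<Rightarrow> (nat \<Rightarrow> 'a \<Rightarrow> real) list.
        (\<forall>k. \<forall>h\<in>set (gs k). \<forall>i<n. admissible_factor lam (h i)) \<and>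
        L2_tendsto (pow_measure lam n) (\<lambda>k. sum_product n (gs k)) g \<and>
        L2_tendsto P (\<lambda>k. wiener_ito_sum_product lam \<eta> X n (gs k)) F)"

definition wiener_ito ::
    "'w measure \<Rightarrow> 'a measure \<Rightarrow> ('w \<Rightarrow> 'a measure) \<Rightarrow> (nat \<Rightarrow> 'w \<Rightarrow> 'a) \<Rightarrow>
     nat \<Rightarrow> ((nat \<Rightarrow> 'a) \<Rightarrow> real) \<Rightarrow> 'w \<Rightarrow> real" where
  "wiener_ito P lam \<eta> X n g =
     (if n = 0 then (\<lambda>_. g (\<lambda>_. undefined)) else (SOME F. is_wiener_ito P lam \<eta> X n g F))"


subsection \<open>The derivative operator defined through the chaos expansion\<close>

text \<open>For \<open>g\<close> of \<open>n + 1\<close> variables, \<open>slice n g y\<close> fixes the last one.\<close>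

definition slice :: "nat \<Rightarrow> ((nat \<Rightarrow> 'a) \<Rightarrow> real) \<Rightarrow> 'a \<Rightarrow> (nat \<Rightarrow> 'a) \<Rightarrow> real" where
  "slice n g y z = g (z(n := y))"

text \<open>
  A jointly measurable version of \<open>(\<omega>, y) \<mapsto> I\<^sub>n(g\<^sub>y)(\<omega>)\<close> for \<open>g\<close> of \<open>n + 1\<close> variables; it is
  determined up to equality almost everywhere with respect to \<open>P \<Otimes>\<^sub>M lam\<close>.
\<close>

definition wiener_ito_slices ::
    "'w measure \<Rightarrow> 'a measure \<Rightarrow> ('w \<Rightarrow> 'a measure) \<Rightarrow> (nat \<Rightarrow> 'w \<Rightarrow> 'a) \<Rightarrow>
     nat \<Rightarrow> ((nat \<Rightarrow> 'a) \<Rightarrow> real) \<Rightarrow> 'w \<times> 'a \<Rightarrow> real" where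
  "wiener_ito_slices P lam \<eta> X n g =
     (SOME G. G \<in> borel_measurable (P \<Otimes>\<^sub>M lam) \<and>
        (AE y in lam. AE \<omega> in P. G (\<omega>, y) =
           (if slice n g y \<in> L2 (pow_measure lam n)
            then wiener_ito P lam \<eta> X n (slice n g y) \<omega> else 0)))"

text \<open>
  \<open>D'f\<close>, the \<open>L\<^sup>2\<close>-sum over \<open>n \<ge> 0\<close> of \<open>(n + 1) I\<^sub>n(f\<^sub>n\<^sub>+\<^sub>1(\<cdot>, y))\<close>, as a function of \<open>(\<omega>, y)\<close>.
\<close>

definition chaos_derivative ::
    "'w measure \<Rightarrow> 'a measure \<Rightarrow> ('w \<Rightarrow> 'a measure) \<Rightarrow> (nat \<Rightarrow> 'w \<Rightarrow> 'a) \<Rightarrow>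
     ('a measure \<Rightarrow> real) \<Rightarrow> 'w \<times> 'a \<Rightarrow> real" where
  "chaos_derivative P lam \<eta> X f =
     (SOME D. L2_tendsto (P \<Otimes>\<^sub>M lam)
        (\<lambda>N p. \<Sum>n<N. real (Suc n) *
           wiener_ito_slices P lam \<eta> X n (chaos_kernel P \<eta> f (Suc n)) p) D)"

end

theory Submission imports Defs begin

text \<open>
  Write \<open>I\<^sub>n(g)\<close> for the multiple integral of a product \<open>g\<^sub>1 \<otimes> \<dots> \<otimes> g\<^sub>n\<close>.  The Mecke equation gives
  \<open>E I\<^sub>n\<^sub>+\<^sub>1(g \<otimes> h) H(\<eta>) = E \<integral> h(y) I\<^sub>n(g) D\<^sub>yH(\<eta>) \<lambda>(dy)\<close>, hence by iteration
  \<open>E I\<^sub>n(g) H(\<eta>) = \<integral> T\<^sub>nH g d\<lambda>\<^sup>n\<close> for every \<open>H\<close> with exponential moments, in particular for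
  \<open>H\<close> in \<open>L\<^sup>2\<close>; the isometry and the convergence of the series \<open>D'f\<close> follow.  Let
  \<open>\<Phi> = exp(- \<eta>(B\<^sub>1) - \<dots> - \<eta>(B\<^sub>m))\<close> with all \<open>\<lambda>(B\<^sub>i)\<close> finite.  Then \<open>D\<^sub>y\<Phi> = w(y) \<Phi>\<close> for a bounded \<open>w\<close>
  of finite support, and \<open>\<Phi> / E\<Phi> = \<Sum>n. I\<^sub>n(w\<^sup>\<otimes>\<^sup>n) / n!\<close> with an integrable majorant.  Integrating this
  expansion against \<open>D\<^sub>yf(\<eta>)\<close> over \<open>y \<in> C\<close>, and using the two identities above, gives the series of the
  \<open>\<integral> T\<^sub>n\<^sub>+\<^sub>1f (w\<^sup>\<otimes>\<^sup>n \<otimes> 1\<^sub>C) d\<lambda>\<^sup>n\<^sup>+\<^sup>1 / n!\<close>, which is also the pairing of \<open>D'f\<close> with \<open>\<Phi> 1\<^sub>C / E\<Phi>\<close>.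
  Since the products \<open>\<Phi> 1\<^sub>C\<close> determine an integrable function, \<open>Df = D'f\<close> almost everywhere.
\<close>

section \<open>Sums over tuples of distinct indices\<close>

text \<open>D_y f is not known to be square integrable beforehand, so Df and D'f cannot be compared
  in L2 from the start. What the Mecke equation does give is that D_y f(mu) exp(c mu(B)) is
  integrable under \<open>Q \<Otimes>\<^sub>M lam\<close> over y in B, for B of finite intensity and
  every c. This dictates the class \<open>exp_integrable\<close>: it contains L2, passes to D_y H
  for almost every y in B, and survives multiplication by multiple integrals of product forms, which
  are bounded by a multiple of exp(mu(B)). It also dictates the test functionals: they are bounded,
  and the partial sums of their expansions are dominated by a multiple of exp(mu(A)), A being the
  union of the sets involved, so the expansions can be integrated term by term against Df. A second
  obstacle is that the multiple integrals are defined through the enumeration \<open>X\<close>,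
  whereas adding and removing points acts on measures. Each integral of a product form is therefore
  replaced by a measurable functional of the configuration, and the analysis takes place under the
  distribution \<open>Q\<close> of the process; \<open>P\<close> returns only when versions of the
  integrals are identified and in the conclusion.\<close>

definition tuple_sum :: "'i set \<Rightarrow> nat set \<Rightarrow> (nat \<Rightarrow> 'i \<Rightarrow> real) \<Rightarrow> real" where
  "tuple_sum I J a = (\<Sum>t\<in>{t \<in> J \<rightarrow>\<^sub>E I. inj_on t J}. \<Prod>j\<in>J. a j (t j))"

lemma finite_inj_tuples:
  "finite I \<Longrightarrow> finite J \<Longrightarrow> finite {t \<in> J \<rightarrow>\<^sub>E I. inj_on t J}"
  by (rule finite_subset[of _ "J \<rightarrow>\<^sub>E I"]) (auto intro: finite_PiE)

lemma tuple_sum_empty [simp]: "tuple_sum I {} a = 1"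
  by (simp add: tuple_sum_def)

lemma tuple_sum_cong:
  assumes "\<And>j i. j \<in> J \<Longrightarrow> i \<in> I \<Longrightarrow> a j i = b j i"
  shows "tuple_sum I J a = tuple_sum I J b"
  unfolding tuple_sum_def using assms by (intro sum.cong prod.cong) (auto simp: PiE_iff)

text \<open>Tuples are grouped by the index \<open>i\<close> they give to \<open>j\<close>;
  injectivity leaves \<open>I - {i}\<close> for the other coordinates. For the points of a
  configuration this is a sum over one point with the remaining factors evaluated after its removal,
  the shape to which the Mecke equation applies.\<close>

lemma tuple_sum_insert:
  assumes "finite I" "finite J" "j \<notin> J"
  shows "tuple_sum I (insert j J) a = (\<Sum>i\<in>I. a j i * tuple_sum (I - {i}) J a)"
proof -
  let ?A = "\<lambda>I J. {t \<in> J \<rightarrow>\<^sub>E I. inj_on t J}"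
  have "(\<Sum>i\<in>I. a j i * tuple_sum (I - {i}) J a)
      = (\<Sum>i\<in>I. \<Sum>t\<in>?A (I - {i}) J. a j i * (\<Prod>k\<in>J. a k (t k)))"
    by (simp add: tuple_sum_def sum_distrib_left)
  also have "\<dots> = (\<Sum>(i, t)\<in>(SIGMA i:I. ?A (I - {i}) J). a j i * (\<Prod>k\<in>J. a k (t k)))"
    using assms by (intro sum.Sigma) (auto intro!: finite_inj_tuples)
  also have "\<dots> = (\<Sum>t\<in>?A I (insert j J). \<Prod>k\<in>insert j J. a k (t k))"
  proof (rule sum.reindex_bij_witness[of _ "\<lambda>t. (t j, t(j := undefined))" "\<lambda>(i, t). t(j := i)"])
    fix t assume "t \<in> ?A I (insert j J)"
    then have t: "t \<in> insert j J \<rightarrow>\<^sub>E I" "inj_on t (insert j J)" by auto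
    show "(t j, t(j := undefined)) \<in> (SIGMA i:I. ?A (I - {i}) J)"
      using t assms(3) by (auto simp: PiE_iff extensional_def inj_on_def)
    show "(case (t j, t(j := undefined)) of (i, t) \<Rightarrow> t(j := i)) = t" by simp
  next
    fix p assume "p \<in> (SIGMA i:I. ?A (I - {i}) J)"
    then obtain i t where p: "p = (i, t)" "i \<in> I" "t \<in> J \<rightarrow>\<^sub>E (I - {i})" "inj_on t J" by auto
    show "(case p of (i, t) \<Rightarrow> t(j := i)) \<in> ?A I (insert j J)"
      using p assms(3) by (auto simp: PiE_iff extensional_def inj_on_def)
    have "t j = undefined" using p(3) assms(3) by (auto simp: PiE_iff extensional_def)
    then show "((case p of (i, t) \<Rightarrow> t(j := i)) j, (case p of (i, t) \<Rightarrow> t(j := i))(j := undefined)) = p"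
      using p by (auto simp: fun_eq_iff)
    have "(\<Prod>k\<in>J. a k ((t(j := i)) k)) = (\<Prod>k\<in>J. a k (t k))"
      using assms(3) by (intro prod.cong) auto
    then show "(\<Prod>k\<in>insert j J. a k ((case p of (i, t) \<Rightarrow> t(j := i)) k))
        = (case p of (i, t) \<Rightarrow> a j i * (\<Prod>k\<in>J. a k (t k)))"
      using p assms by simp
  qed
  finally show ?thesis
    unfolding tuple_sum_def by simp
qed

text \<open>By injectivity the new index \<open>i\<close> occurs in at most one coordinate
  \<open>j\<close>, and deleting that coordinate leaves a tuple over \<open>I\<close>. This is the
  combinatorial source of the effect of D_y on factorial integrals.\<close>

lemma tuple_sum_insert_point:
  assumes "finite I" "finite J" "i \<notin> I"
  shows "tuple_sum (insert i I) J a
    = tuple_sum I J a + (\<Sum>j\<in>J. a j i * tuple_sum I (J - {j}) a)"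
  using assms(2,1,3)
proof (induction J arbitrary: I rule: finite_induct)
  case empty
  then show ?case by simp
next
  case (insert j J)
  have *: "tuple_sum (insert i I - {k}) J a
      = tuple_sum (I - {k}) J a + (\<Sum>l\<in>J. a l i * tuple_sum (I - {k}) (J - {l}) a)"
    if "k \<in> I" for k
  proof -
    have "insert i I - {k} = insert i (I - {k})" using that insert.prems by auto
    then show ?thesis using insert.IH[of "I - {k}"] insert.prems by simp
  qed
  have l: "tuple_sum I (insert j J - {l}) a = (\<Sum>k\<in>I. a j k * tuple_sum (I - {k}) (J - {l}) a)"
    if "l \<in> J" for l
  proof -
    have "insert j J - {l} = insert j (J - {l})" using that insert.hyps by auto
    then show ?thesis using tuple_sum_insert[of I "J - {l}" j a] insert by simp
  qed
  have "tuple_sum (insert i I) (insert j J) a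
     = a j i * tuple_sum I J a + (\<Sum>k\<in>I. a j k * tuple_sum (insert i I - {k}) J a)"
    using insert by (subst tuple_sum_insert) auto
  also have "(\<Sum>k\<in>I. a j k * tuple_sum (insert i I - {k}) J a)
    = (\<Sum>k\<in>I. a j k * tuple_sum (I - {k}) J a)
      + (\<Sum>k\<in>I. \<Sum>l\<in>J. a l i * (a j k * tuple_sum (I - {k}) (J - {l}) a))"
    by (simp add: * distrib_left sum.distrib sum_distrib_left mult.left_commute cong: sum.cong)
  also have "(\<Sum>k\<in>I. \<Sum>l\<in>J. a l i * (a j k * tuple_sum (I - {k}) (J - {l}) a))
     = (\<Sum>l\<in>J. a l i * tuple_sum I (insert j J - {l}) a)"
    by (subst sum.swap) (simp add: l sum_distrib_left cong: sum.cong)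
  also have "(\<Sum>k\<in>I. a j k * tuple_sum (I - {k}) J a) = tuple_sum I (insert j J) a"
    using insert by (simp add: tuple_sum_insert)
  finally show ?case
    using insert by (simp add: algebra_simps)
qed

text \<open>Letting the new coordinate run over all of \<open>I\<close> overcounts the tuples in
  which it meets a coordinate \<open>k\<close>; there the factors \<open>a k\<close> and
  \<open>a j\<close> sit at the same index and merge into one. Iteration reduces sums over distinct
  indices to polynomials in plain sums, which are visibly measurable functions of a point
  measure.\<close>

lemma tuple_sum_insert_diagonal:
  assumes "finite I" "finite J" "j \<notin> J"
  shows "tuple_sum I (insert j J) a = (\<Sum>i\<in>I. a j i) * tuple_sum I J a
    - (\<Sum>k\<in>J. tuple_sum I J (a(k := (\<lambda>i. a k i * a j i))))"
proof -
  \<comment> \<open>The formula for adding an index, solved for the smaller index set after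
    \<open>i\<close> has been removed and put back.\<close>
  have 1: "tuple_sum (I - {i}) J a = tuple_sum I J a - (\<Sum>k\<in>J. a k i * tuple_sum (I - {i}) (J - {k}) a)"
    if "i \<in> I" for i
    using tuple_sum_insert_point[of "I - {i}" J i a] that assms by (simp add: insert_absorb)
  have 2: "tuple_sum I J (a(k := (\<lambda>i. a k i * a j i)))
      = (\<Sum>i\<in>I. a j i * (a k i * tuple_sum (I - {i}) (J - {k}) a))" if "k \<in> J" for k
  proof -
    have "tuple_sum I (insert k (J - {k})) (a(k := (\<lambda>i. a k i * a j i)))
      = (\<Sum>i\<in>I. (a k i * a j i) * tuple_sum (I - {i}) (J - {k}) (a(k := (\<lambda>i. a k i * a j i))))"
      using assms by (subst tuple_sum_insert) auto
    also have "\<dots> = (\<Sum>i\<in>I. a j i * (a k i * tuple_sum (I - {i}) (J - {k}) a))"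
      by (auto intro!: sum.cong tuple_sum_cong)
    finally show ?thesis using that by (simp add: insert_absorb)
  qed
  have "tuple_sum I (insert j J) a = (\<Sum>i\<in>I. a j i * tuple_sum (I - {i}) J a)"
    using assms by (rule tuple_sum_insert)
  also have "\<dots> = (\<Sum>i\<in>I. a j i * tuple_sum I J a)
      - (\<Sum>i\<in>I. \<Sum>k\<in>J. a j i * (a k i * tuple_sum (I - {i}) (J - {k}) a))"
    by (simp add: 1 right_diff_distrib sum_subtractf sum_distrib_left cong: sum.cong)
  also have "(\<Sum>i\<in>I. \<Sum>k\<in>J. a j i * (a k i * tuple_sum (I - {i}) (J - {k}) a))
     = (\<Sum>k\<in>J. tuple_sum I J (a(k := (\<lambda>i. a k i * a j i))))"
    by (subst sum.swap) (simp add: 2 cong: sum.cong)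
  finally show ?thesis by (simp add: sum_distrib_right)
qed

lemma tuple_sum_reindex:
  assumes "inj_on r I"
  shows "tuple_sum (r ` I) J a = tuple_sum I J (\<lambda>j i. a j (r i))"
  unfolding tuple_sum_def
proof (rule sum.reindex_bij_witness[of _ "\<lambda>t. \<lambda>j\<in>J. r (t j)" "\<lambda>t. \<lambda>j\<in>J. the_inv_into I r (t j)"])
  fix t assume "t \<in> {t \<in> J \<rightarrow>\<^sub>E r ` I. inj_on t J}"
  then have t: "t \<in> J \<rightarrow>\<^sub>E r ` I" "inj_on t J" by auto
  have r: "r (the_inv_into I r (t j)) = t j" "the_inv_into I r (t j) \<in> I" if "j \<in> J" for j
    using t(1) that assms by (auto intro!: f_the_inv_into_f the_inv_into_into simp: PiE_iff)
  show "(\<lambda>j\<in>J. r ((\<lambda>j\<in>J. the_inv_into I r (t j)) j)) = t"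
    using t r by (intro extensionalityI[of _ J]) (auto simp: PiE_iff)
  show "(\<lambda>j\<in>J. the_inv_into I r (t j)) \<in> {t \<in> J \<rightarrow>\<^sub>E I. inj_on t J}"
    using t r by (auto simp: inj_on_def) metis
  show "(\<Prod>j\<in>J. a j (r ((\<lambda>j\<in>J. the_inv_into I r (t j)) j))) = (\<Prod>j\<in>J. a j (t j))"
    using r by (intro prod.cong) auto
next
  fix t assume "t \<in> {t \<in> J \<rightarrow>\<^sub>E I. inj_on t J}"
  then have t: "t \<in> J \<rightarrow>\<^sub>E I" "inj_on t J" by auto
  then have ti: "t j \<in> I" if "j \<in> J" for j using that by auto
  show "(\<lambda>j\<in>J. the_inv_into I r ((\<lambda>j\<in>J. r (t j)) j)) = t"
    using t ti assms by (intro extensionalityI[of _ J]) (auto simp: PiE_iff the_inv_into_f_f)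
  show "(\<lambda>j\<in>J. r (t j)) \<in> {t \<in> J \<rightarrow>\<^sub>E r ` I. inj_on t J}"
    using t ti assms by (auto simp: inj_on_def)
qed

lemma tuple_sum_bound:
  assumes "finite I" "finite J" "\<And>j i. j \<in> J \<Longrightarrow> i \<in> I \<Longrightarrow> \<bar>a j i\<bar> \<le> c" "0 \<le> c"
  shows "\<bar>tuple_sum I J a\<bar> \<le> (c * real (card I)) ^ card J"
  using assms(2,1,3)
proof (induction J arbitrary: I rule: finite_induct)
  case empty
  then show ?case by simp
next
  case (insert j J)
  have "\<bar>tuple_sum I (insert j J) a\<bar> \<le> (\<Sum>i\<in>I. \<bar>a j i\<bar> * \<bar>tuple_sum (I - {i}) J a\<bar>)"
    using insert by (simp add: tuple_sum_insert sum_abs[THEN order_trans] abs_mult)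
  also have "\<dots> \<le> (\<Sum>i\<in>I. c * (c * real (card I)) ^ card J)"
  proof (intro sum_mono mult_mono)
    fix i assume i: "i \<in> I"
    have "\<bar>tuple_sum (I - {i}) J a\<bar> \<le> (c * real (card (I - {i}))) ^ card J"
      using insert.IH[of "I - {i}"] insert.prems by auto
    also have "\<dots> \<le> (c * real (card I)) ^ card J"
      using assms(4) insert.prems by (intro power_mono mult_left_mono) (auto simp: card_Diff1_le)
    finally show "\<bar>tuple_sum (I - {i}) J a\<bar> \<le> (c * real (card I)) ^ card J" .
  qed (use insert.prems assms(4) in auto)
  also have "\<dots> = (c * real (card I)) ^ card (insert j J)"
    using insert by simp
  finally show ?case .
qed

text \<open>The elementary symmetric polynomial of the values \<open>w i\<close> is \<open>tuple_sum\<close> divided by \<open>k!\<close>.\<close>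

lemma tuple_sum_const_card:
  assumes "finite I" "finite J"
  shows "tuple_sum I J (\<lambda>_. w) = tuple_sum I {..<card J} (\<lambda>_. w)"
  using assms(2,1)
proof (induction J arbitrary: I rule: finite_induct)
  case (insert j J)
  have "tuple_sum I (insert j J) (\<lambda>_. w) = (\<Sum>i\<in>I. w i * tuple_sum (I - {i}) {..<card J} (\<lambda>_. w))"
    using insert by (simp add: tuple_sum_insert)
  also have "\<dots> = tuple_sum I (insert (card J) {..<card J}) (\<lambda>_. w)"
    using insert.prems by (subst tuple_sum_insert) auto
  finally show ?case using insert by (simp add: lessThan_Suc)
qed auto

text \<open>Generating function of the elementary symmetric polynomials. Terms with \<open>k\<close>
  above \<open>card I\<close> vanish; the form of a series is kept because it later becomes one
  factor of a Cauchy product. The induction uses that adding \<open>i\<close> turns the polynomial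
  of order k + 1 into itself plus \<open>w i\<close> times that of order k.\<close>

lemma tuple_sum_generating:
  assumes "finite I"
  shows "(\<lambda>k. tuple_sum I {..<k} (\<lambda>_. w) / fact k) sums (\<Prod>i\<in>I. 1 + w i)"
  using assms
proof (induction I rule: finite_induct)
  case empty
  have "(\<lambda>k. tuple_sum {} {..<k} (\<lambda>_. w) / fact k) = (\<lambda>k. if k = 0 then 1 else 0)"
  proof
    fix k :: nat
    show "tuple_sum ({}::'a set) {..<k} (\<lambda>_. w) / fact k = (if k = 0 then 1 else 0)"
    proof (cases k)
      case (Suc m)
      then show ?thesis
        using tuple_sum_insert[of "{}::'a set" "{..<m}" m "\<lambda>_. w"] by (simp add: lessThan_Suc)
    qed simp
  qed
  then show ?case using sums_single[of 0 "\<lambda>_. 1::real"] by simp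
next
  case (insert i I)
  let ?e = "\<lambda>I k. tuple_sum I {..<k} (\<lambda>_. w) / fact k"
  have 1: "?e (insert i I) (Suc k) = ?e I (Suc k) + w i * ?e I k" for k
  proof -
    have "tuple_sum I ({..<Suc k} - {j}) (\<lambda>_. w) = tuple_sum I {..<k} (\<lambda>_. w)" if "j < Suc k" for j
      using tuple_sum_const_card[of I "{..<Suc k} - {j}" w] that insert by simp
    then have "(\<Sum>j\<in>{..<Suc k}. w i * tuple_sum I ({..<Suc k} - {j}) (\<lambda>_. w))
       = real (Suc k) * (w i * tuple_sum I {..<k} (\<lambda>_. w))"
      by (simp del: sum.lessThan_Suc of_nat_Suc)
    then have "tuple_sum (insert i I) {..<Suc k} (\<lambda>_. w)
      = tuple_sum I {..<Suc k} (\<lambda>_. w) + real (Suc k) * (w i * tuple_sum I {..<k} (\<lambda>_. w))"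
      using insert by (subst tuple_sum_insert_point) auto
    then show ?thesis
      by (simp add: field_simps fact_Suc del: of_nat_Suc)
  qed
  have "(\<lambda>k. ?e I (Suc k)) sums ((\<Prod>i\<in>I. 1 + w i) - 1)"
    using insert.IH by (subst sums_Suc_iff) simp
  moreover have "(\<lambda>k. w i * ?e I k) sums (w i * (\<Prod>i\<in>I. 1 + w i))"
    using insert.IH by (rule sums_mult)
  ultimately have "(\<lambda>k. ?e (insert i I) (Suc k)) sums ((\<Prod>i\<in>I. 1 + w i) - 1 + w i * (\<Prod>i\<in>I. 1 + w i))"
    unfolding 1 by (rule sums_add)
  then show ?case
    using insert by (subst (asm) sums_Suc_iff) (simp add: algebra_simps)
qed

section \<open>The space of integer-valued measures\<close>

lemma space_int_measure_space: "space (int_measure_space lam) = int_measures lam"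
  by (simp add: int_measure_space_def space_measure_of_conv)

lemma sets_int_measure_space:
  "sets (int_measure_space lam) = sigma_sets (int_measures lam)
     {{\<mu> \<in> int_measures lam. emeasure \<mu> B \<in> U} | B U. B \<in> sets lam \<and> U \<in> sets borel}"
  unfolding int_measure_space_def by (rule sets_measure_of) auto

lemma int_measuresD:
  assumes "\<mu> \<in> int_measures lam"
  shows "sets \<mu> = sets lam" "space \<mu> = space lam" "sigma_finite_measure \<mu>"
    "B \<in> sets lam \<Longrightarrow> emeasure \<mu> B \<in> range of_nat \<union> {\<infinity>}"
  using assms by (auto simp: int_measures_def dest: sets_eq_imp_space_eq)

lemma measurable_emeasure_int_measure_space [measurable (raw)]:
  assumes "B \<in> sets lam"
  shows "(\<lambda>\<mu>. emeasure \<mu> B) \<in> borel_measurable (int_measure_space lam)"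
proof (rule measurableI)
  fix U :: "ennreal set" assume "U \<in> sets borel"
  then have "{\<mu> \<in> int_measures lam. emeasure \<mu> B \<in> U} \<in> sets (int_measure_space lam)"
    unfolding sets_int_measure_space using assms by (intro sigma_sets.Basic) auto
  then show "(\<lambda>\<mu>. emeasure \<mu> B) -` U \<inter> space (int_measure_space lam) \<in> sets (int_measure_space lam)"
    by (simp add: space_int_measure_space Int_def vimage_def conj_commute)
qed simp

lemma measurable_int_measure_spaceI:
  assumes "\<And>x. x \<in> space N \<Longrightarrow> F x \<in> int_measures lam"
    and "\<And>B. B \<in> sets lam \<Longrightarrow> (\<lambda>x. emeasure (F x) B) \<in> borel_measurable N"
  shows "F \<in> measurable N (int_measure_space lam)"
  unfolding int_measure_space_def
proof (rule measurable_measure_of)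
  fix A assume "A \<in> {{\<mu> \<in> int_measures lam. emeasure \<mu> B \<in> U} | B U. B \<in> sets lam \<and> U \<in> sets borel}"
  then obtain B U where A: "A = {\<mu> \<in> int_measures lam. emeasure \<mu> B \<in> U}" "B \<in> sets lam" "U \<in> sets borel"
    by blast
  have "F -` A \<inter> space N = (\<lambda>x. emeasure (F x) B) -` U \<inter> space N"
    using assms(1) A(1) by auto
  also have "\<dots> \<in> sets N" using assms(2)[OF A(2)] A(3) by measurable
  finally show "F -` A \<inter> space N \<in> sets N" .
qed (use assms in auto)

text \<open>\<open>add_point\<close> is built by \<open>measure_of\<close>, which yields the zero
  measure unless its argument is a measure. Countable additivity therefore comes before any value
  can be read off. Sigma-finiteness is inherited because each set of a countable cover gains at most
  mass 1.\<close>

lemma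
  assumes \<mu>: "\<mu> \<in> int_measures lam"
  shows emeasure_add_point:
      "B \<in> sets lam \<Longrightarrow> emeasure (add_point \<mu> y) B = emeasure \<mu> B + indicator B y"
    and add_point_in_int_measures: "add_point \<mu> y \<in> int_measures lam"
proof -
  note D = int_measuresD[OF \<mu>]
  have "measure_space (space \<mu>) (sets \<mu>) (\<lambda>B. emeasure \<mu> B + emeasure (return \<mu> y) B)"
  proof -
    have "countably_additive (sets \<mu>) (\<lambda>B. emeasure \<mu> B + emeasure (return \<mu> y) B)"
    proof (rule countably_additiveI)
      fix A :: "nat \<Rightarrow> _" assume A: "range A \<subseteq> sets \<mu>" "disjoint_family A"
      have "(\<Sum>i. emeasure \<mu> (A i) + emeasure (return \<mu> y) (A i))
         = (\<Sum>i. emeasure \<mu> (A i)) + (\<Sum>i. emeasure (return \<mu> y) (A i))"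
        by (rule suminf_add[symmetric]) auto
      then show "(\<Sum>i. emeasure \<mu> (A i) + emeasure (return \<mu> y) (A i))
         = emeasure \<mu> (\<Union> (range A)) + emeasure (return \<mu> y) (\<Union> (range A))"
        using A by (simp add: suminf_emeasure suminf_indicator)
    qed
    then show ?thesis
      by (simp add: measure_space_def positive_def sets.sigma_algebra_axioms)
  qed
  then have em: "emeasure (add_point \<mu> y) B = emeasure \<mu> B + indicator B y" if "B \<in> sets lam" for B
    using that D unfolding add_point_def
    by (subst emeasure_measure_of_sigma) (auto simp: measure_space_def)
  have s: "sets (add_point \<mu> y) = sets lam" "space (add_point \<mu> y) = space lam"
    using D by (auto simp: add_point_def space_measure_of_conv)
  show "B \<in> sets lam \<Longrightarrow> emeasure (add_point \<mu> y) B = emeasure \<mu> B + indicator B y" by (rule em)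
  obtain A where A: "countable A" "A \<subseteq> sets \<mu>" "\<Union>A = space \<mu>" "\<forall>a\<in>A. emeasure \<mu> a \<noteq> \<infinity>"
    using D(3) unfolding sigma_finite_measure_def by blast
  have sf: "sigma_finite_measure (add_point \<mu> y)"
    unfolding sigma_finite_measure_def
    using A s D by (intro exI[of _ A]) (auto simp: em subset_eq indicator_def)
  have r: "emeasure (add_point \<mu> y) B \<in> range of_nat \<union> {\<infinity>}" if B: "B \<in> sets lam" for B
  proof -
    consider k :: nat where "emeasure \<mu> B = of_nat k" | "emeasure \<mu> B = \<infinity>"
      using D(4)[OF B] by auto
    then show ?thesis
    proof cases
      case (1 k)
      then have "emeasure (add_point \<mu> y) B = of_nat (if y \<in> B then Suc k else k)"
        using em[OF B] by (simp add: add.commute)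
      then show ?thesis by blast
    qed (simp add: em[OF B])
  qed
  show "add_point \<mu> y \<in> int_measures lam"
    using s sf r by (simp add: int_measures_def)
qed

lemma measurable_add_point [measurable (raw)]:
  assumes [measurable]: "g \<in> measurable N (int_measure_space lam)" "h \<in> measurable N lam"
  shows "(\<lambda>x. add_point (g x) (h x)) \<in> measurable N (int_measure_space lam)"
proof (rule measurable_int_measure_spaceI)
  fix x assume "x \<in> space N"
  then have "g x \<in> int_measures lam"
    using measurable_space[OF assms(1)] by (simp add: space_int_measure_space)
  then show "add_point (g x) (h x) \<in> int_measures lam" by (rule add_point_in_int_measures)
next
  fix B assume B[measurable]: "B \<in> sets lam"
  have [measurable]: "(\<lambda>x. emeasure (g x) B) \<in> borel_measurable N"
    by (rule measurable_compose[OF assms(1) measurable_emeasure_int_measure_space[OF B]])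
  have "(\<lambda>x. emeasure (g x) B + indicator B (h x)) \<in> borel_measurable N"
    by measurable
  moreover have "emeasure (add_point (g x) (h x)) B = emeasure (g x) B + indicator B (h x)"
    if "x \<in> space N" for x
    using measurable_space[OF assms(1) that] B
    by (simp add: space_int_measure_space emeasure_add_point)
  ultimately show "(\<lambda>x. emeasure (add_point (g x) (h x)) B) \<in> borel_measurable N"
    by (simp cong: measurable_cong)
qed

lemma int_measures_eqI:
  assumes "\<mu> \<in> int_measures lam" "\<nu> \<in> int_measures lam"
    and "\<And>B. B \<in> sets lam \<Longrightarrow> emeasure \<mu> B = emeasure \<nu> B"
  shows "\<mu> = \<nu>"
  using assms by (intro measure_eqI) (auto simp: int_measuresD)

lemma emeasure_points:
  assumes "x \<in> I \<rightarrow> space lam" "B \<in> sets lam"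
  shows "emeasure (distr (count_space I) lam x) B = emeasure (count_space UNIV) {i \<in> I. x i \<in> B}"
  using assms by (subst emeasure_distr) (auto simp: emeasure_count_space vimage_def Int_def conj_commute)

text \<open>The series runs over all indices and hides \<open>I\<close> in the summands, so that
  measurability can be read off when the set of indices depends on the sample point.\<close>

lemma emeasure_points_nat:
  fixes I :: "nat set"
  assumes "x \<in> I \<rightarrow> space lam" "B \<in> sets lam"
  shows "emeasure (distr (count_space I) lam x) B
    = (\<Sum>i. if i \<in> I then indicator B (x i) else 0)"
proof -
  have "emeasure (count_space UNIV) {i \<in> I. x i \<in> B}
     = (\<integral>\<^sup>+i. indicator {i \<in> I. x i \<in> B} i \<partial>count_space UNIV)"
    by simp
  also have "\<dots> = (\<Sum>i. indicator {i \<in> I. x i \<in> B} i)"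
    by (rule nn_integral_count_space_nat)
  also have "\<dots> = (\<Sum>i. if i \<in> I then indicator B (x i) else 0)"
    by (intro suminf_cong) (auto simp: indicator_def)
  finally show ?thesis using emeasure_points[OF assms] by simp
qed

section \<open>Poisson processes and the Mecke equation\<close>

definition poisson_weight :: "real \<Rightarrow> nat \<Rightarrow> real" where
  "poisson_weight r k = exp (- r) * r ^ k / fact k"

lemma poisson_weight_sums: "poisson_weight r sums 1"
proof -
  have "(\<lambda>k. exp (- r) * (r ^ k /\<^sub>R fact k)) sums (exp (- r) * exp r)"
    by (intro sums_mult exp_converges)
  then show ?thesis
    by (simp add: poisson_weight_def[abs_def] field_simps exp_minus)
qed

section \<open>The process as a sum of its points, and the removal of a point\<close>

locale poisson_points = prob_space P + lam: sigma_finite_measure lam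
  for P :: "'w measure" and lam :: "'a measure" +
  fixes \<eta> :: "'w \<Rightarrow> 'a measure" and X :: "nat \<Rightarrow> 'w \<Rightarrow> 'a"
  assumes process: "poisson_process P lam \<eta>"
    and points: "point_representation P lam \<eta> X"
begin

abbreviation N :: "'a measure measure" where "N \<equiv> int_measure_space lam"

lemma measurable_eta [measurable]: "\<eta> \<in> measurable P N"
  using process by (simp add: poisson_process_def)

lemma measurable_X [measurable]: "X i \<in> measurable P lam"
  using points by (simp add: point_representation_def)

lemma X_space: "\<omega> \<in> space P \<Longrightarrow> X i \<omega> \<in> space lam"
  using measurable_space[OF measurable_X] .

lemma eta_int: "\<omega> \<in> space P \<Longrightarrow> \<eta> \<omega> \<in> int_measures lam"
  using measurable_space[OF measurable_eta] by (simp add: space_int_measure_space)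

abbreviation pts :: "'w \<Rightarrow> nat set" where "pts \<omega> \<equiv> point_index (\<eta> \<omega>)"

text \<open>The process without its \<open>i\<close>-th point. It is rebuilt from the remaining
  points instead of subtracting a Dirac measure from the process, because counts may be infinite.
  For \<open>i\<close> outside \<open>pts \<omega>\<close> nothing is removed.\<close>

definition del :: "nat \<Rightarrow> 'w \<Rightarrow> 'a measure" where
  "del i \<omega> = distr (count_space (pts \<omega> - {i})) lam (\<lambda>i. X i \<omega>)"

lemma eta_points: "\<omega> \<in> space P \<Longrightarrow> \<eta> \<omega> = distr (count_space (pts \<omega>)) lam (\<lambda>i. X i \<omega>)"
  using points by (simp add: point_representation_def)

lemma pred_pts [measurable]: "Measurable.pred P (\<lambda>\<omega>. i \<in> pts \<omega>)"
proof -
  have "Measurable.pred P (\<lambda>\<omega>. of_nat i < emeasure (\<eta> \<omega>) (space lam))" by measurable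
  moreover have "i \<in> pts \<omega> \<longleftrightarrow> of_nat i < emeasure (\<eta> \<omega>) (space lam)" if "\<omega> \<in> space P" for \<omega>
    using that by (simp add: point_index_def int_measuresD(2)[OF eta_int])
  ultimately show ?thesis by (simp cong: measurable_cong)
qed

lemma emeasure_eta_sum:
  assumes "\<omega> \<in> space P" "B \<in> sets lam"
  shows "emeasure (\<eta> \<omega>) B = (\<Sum>i. if i \<in> pts \<omega> then indicator B (X i \<omega>) else 0)"
  by (subst eta_points[OF assms(1)], subst emeasure_points_nat) (use assms X_space in auto)

lemma emeasure_del_sum:
  assumes "\<omega> \<in> space P" "B \<in> sets lam"
  shows "emeasure (del i \<omega>) B = (\<Sum>k. if k \<in> pts \<omega> \<and> k \<noteq> i then indicator B (X k \<omega>) else 0)"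
  unfolding del_def by (subst emeasure_points_nat) (use assms X_space in auto)

lemma emeasure_eta_del:
  assumes "\<omega> \<in> space P" "B \<in> sets lam" "i \<in> pts \<omega>"
  shows "emeasure (\<eta> \<omega>) B = emeasure (del i \<omega>) B + indicator B (X i \<omega>)"
proof -
  have "(\<Sum>k. if k \<in> pts \<omega> then indicator B (X k \<omega>) else 0)
     = (\<Sum>k. (if k \<in> pts \<omega> \<and> k \<noteq> i then indicator B (X k \<omega>) else 0)
          + (if k = i then indicator B (X i \<omega>) else (0::ennreal)))"
    using assms(3) by (intro suminf_cong) auto
  also have "\<dots> = (\<Sum>k. if k \<in> pts \<omega> \<and> k \<noteq> i then indicator B (X k \<omega>) else 0)
     + (\<Sum>k. if k = i then indicator B (X i \<omega>) else 0)"
    by (rule suminf_add[symmetric]) auto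
  also have "(\<Sum>k. if k = i then indicator B (X i \<omega>) else 0) = (indicator B (X i \<omega>) :: ennreal)"
    by (subst suminf_finite[of "{i}"]) auto
  finally show ?thesis
    using assms by (simp add: emeasure_eta_sum emeasure_del_sum)
qed

lemma del_int:
  assumes "\<omega> \<in> space P"
  shows "del i \<omega> \<in> int_measures lam"
proof -
  have le: "emeasure (del i \<omega>) B \<le> emeasure (\<eta> \<omega>) B" if "B \<in> sets lam" for B
    unfolding emeasure_eta_sum[OF assms that] emeasure_del_sum[OF assms that]
    by (intro suminf_le) auto
  obtain A where A: "countable A" "A \<subseteq> sets lam" "\<Union>A = space lam" "\<forall>a\<in>A. emeasure (\<eta> \<omega>) a \<noteq> \<infinity>"
    using int_measuresD[OF eta_int[OF assms]] unfolding sigma_finite_measure_def by auto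
  have "\<forall>a\<in>A. emeasure (del i \<omega>) a \<noteq> \<infinity>"
    using A le by (metis infinity_ennreal_def neq_top_trans subsetD)
  then have "sigma_finite_measure (del i \<omega>)"
    unfolding sigma_finite_measure_def using A by (intro exI[of _ A]) (auto simp: del_def)
  moreover have "emeasure (del i \<omega>) B \<in> range of_nat \<union> {\<infinity>}" if "B \<in> sets lam" for B
    unfolding del_def using assms that X_space
    by (subst emeasure_points) (auto simp: emeasure_count_space)
  ultimately show ?thesis by (simp add: int_measures_def del_def)
qed

lemma add_point_del:
  assumes "\<omega> \<in> space P" "i \<in> pts \<omega>"
  shows "add_point (del i \<omega>) (X i \<omega>) = \<eta> \<omega>"
  using assms
  by (intro int_measures_eqI[of _ lam])
     (auto simp: add_point_in_int_measures[OF del_int] eta_int emeasure_add_point[OF del_int] emeasure_eta_del)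

lemma measurable_del [measurable]: "(\<lambda>\<omega>. del i \<omega>) \<in> measurable P N"
proof (rule measurable_int_measure_spaceI)
  fix B assume [measurable]: "B \<in> sets lam"
  have "(\<lambda>\<omega>. \<Sum>k. if k \<in> pts \<omega> \<and> k \<noteq> i then indicator B (X k \<omega>) else 0 :: ennreal) \<in> borel_measurable P"
    by measurable
  then show "(\<lambda>\<omega>. emeasure (del i \<omega>) B) \<in> borel_measurable P"
    by (simp add: emeasure_del_sum cong: measurable_cong)
qed (rule del_int)

lemma poisson_emeasure: "B \<in> sets lam \<Longrightarrow> poisson_distributed P (\<lambda>\<omega>. emeasure (\<eta> \<omega>) B) (emeasure lam B)"
  using process by (simp add: poisson_process_def)

text \<open>The Poisson weights sum to 1, so the events that \<open>Z\<close> equals a natural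
  number exhaust the space up to a null set; in particular \<open>Z\<close> is almost surely finite,
  and integrals of functions of \<open>Z\<close> become series.\<close>

lemma
  assumes Z: "poisson_distributed P Z r" "r < \<infinity>"
  shows poisson_AE_nat: "AE \<omega> in P. Z \<omega> \<in> range of_nat"
    and poisson_nn_integral: "\<psi> \<in> borel_measurable borel \<Longrightarrow>
      (\<integral>\<^sup>+\<omega>. \<psi> (Z \<omega>) \<partial>P) = (\<Sum>k. \<psi> (of_nat k) * ennreal (poisson_weight (enn2real r) k))"
proof -
  have [measurable]: "Z \<in> borel_measurable P"
    and pk: "prob {\<omega> \<in> space P. Z \<omega> = of_nat k} = poisson_weight (enn2real r) k" for k
    using Z by (auto simp: poisson_distributed_def poisson_weight_def)
  let ?A = "\<lambda>k::nat. {\<omega> \<in> space P. Z \<omega> = of_nat k}"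
  have A[measurable]: "?A k \<in> sets P" for k by measurable
  have "(\<lambda>k. prob (?A k)) sums prob (\<Union>k. ?A k)"
    by (intro finite_measure_UNION) (auto simp: disjoint_family_on_def)
  moreover have "(\<lambda>k. prob (?A k)) sums 1"
    unfolding pk by (rule poisson_weight_sums)
  ultimately have "prob (\<Union>k. ?A k) = 1" by (rule sums_unique2)
  then have "AE \<omega> in P. \<omega> \<in> (\<Union>k. ?A k)" by (subst (asm) prob_eq_1) auto
  then show AE: "AE \<omega> in P. Z \<omega> \<in> range of_nat" by eventually_elim auto
  show "(\<integral>\<^sup>+\<omega>. \<psi> (Z \<omega>) \<partial>P) = (\<Sum>k. \<psi> (of_nat k) * ennreal (poisson_weight (enn2real r) k))"
    if [measurable]: "\<psi> \<in> borel_measurable borel"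
  proof -
    have "(\<integral>\<^sup>+\<omega>. \<psi> (Z \<omega>) \<partial>P) = (\<integral>\<^sup>+\<omega>. (\<Sum>k. \<psi> (of_nat k) * indicator (?A k) \<omega>) \<partial>P)"
    proof (rule nn_integral_cong_AE, use AE AE_space in eventually_elim)
      fix \<omega> assume "Z \<omega> \<in> range of_nat" "\<omega> \<in> space P"
      then obtain m where m: "Z \<omega> = of_nat m" by auto
      have "(\<Sum>k. \<psi> (of_nat k) * indicator (?A k) \<omega>) = (\<Sum>k\<in>{m}. \<psi> (of_nat k) * indicator (?A k) \<omega>)"
        using m by (intro suminf_finite) (auto simp: indicator_def)
      then show "\<psi> (Z \<omega>) = (\<Sum>k. \<psi> (of_nat k) * indicator (?A k) \<omega>)"
        using m \<open>\<omega> \<in> space P\<close> by simp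
    qed
    also have "\<dots> = (\<Sum>k. \<psi> (of_nat k) * ennreal (poisson_weight (enn2real r) k))"
      by (subst nn_integral_suminf)
         (auto intro!: suminf_cong simp: nn_integral_cmult pk emeasure_eq_measure)
    finally show ?thesis .
  qed
qed

text \<open>The identity k p(k) = r p(k - 1) of Poisson weights, summed against a test function;
  this is the Mecke equation for a single count. The truncated subtraction
  \<open>Z \<omega> - 1\<close> is harmless, because at \<open>Z \<omega> = 0\<close> the factor in
  front vanishes.\<close>

lemma poisson_shift:
  assumes Z: "poisson_distributed P Z r" "r < \<infinity>" and [measurable]: "\<phi> \<in> borel_measurable borel"
  shows "(\<integral>\<^sup>+\<omega>. Z \<omega> * \<phi> (Z \<omega> - 1) \<partial>P) = r * (\<integral>\<^sup>+\<omega>. \<phi> (Z \<omega>) \<partial>P)"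
proof -
  let ?r = "enn2real r"
  have r: "ennreal ?r = r" "0 \<le> ?r" using Z(2) by auto
  have w: "of_nat (Suc k) * ennreal (poisson_weight ?r (Suc k)) = r * ennreal (poisson_weight ?r k)" for k
  proof -
    have "real (Suc k) * poisson_weight ?r (Suc k) = ?r * poisson_weight ?r k"
      by (simp add: poisson_weight_def field_simps del: of_nat_Suc)
    then have "ennreal (real (Suc k)) * ennreal (poisson_weight ?r (Suc k)) = ennreal ?r * ennreal (poisson_weight ?r k)"
      using r(2) by (simp add: ennreal_mult'[symmetric] poisson_weight_def del: of_nat_Suc)
    then show ?thesis using r(1) by (simp add: ennreal_of_nat_eq_real_of_nat del: of_nat_Suc)
  qed
  have "(\<integral>\<^sup>+\<omega>. Z \<omega> * \<phi> (Z \<omega> - 1) \<partial>P)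
      = (\<Sum>k. of_nat k * \<phi> (of_nat k - 1) * ennreal (poisson_weight ?r k))"
    by (rule poisson_nn_integral[OF Z, of "\<lambda>z. z * \<phi> (z - 1)"]) measurable
  also have "\<dots> = (\<Sum>k. of_nat (Suc k) * \<phi> (of_nat (Suc k) - 1) * ennreal (poisson_weight ?r (Suc k)))"
    by (subst suminf_offset[of _ 1]) auto
  also have "\<dots> = (\<Sum>k. r * (\<phi> (of_nat k) * ennreal (poisson_weight ?r k)))"
  proof (rule suminf_cong)
    fix k
    have "of_nat (Suc k) - (1::ennreal) = of_nat k"
      by (metis ennreal_add_diff_cancel_right ennreal_one_neq_top of_nat_Suc add.commute)
    then show "of_nat (Suc k) * \<phi> (of_nat (Suc k) - 1) * ennreal (poisson_weight ?r (Suc k))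
       = r * (\<phi> (of_nat k) * ennreal (poisson_weight ?r k))"
      using w[of k] by (metis mult.assoc mult.commute)
  qed
  also have "\<dots> = r * (\<integral>\<^sup>+\<omega>. \<phi> (Z \<omega>) \<partial>P)"
    by (subst poisson_nn_integral[OF Z]) auto
  finally show ?thesis .
qed

end

section \<open>Independence of counts and the Mecke equation\<close>

context poisson_points
begin

abbreviation Q :: "'a measure measure" where "Q \<equiv> distr P N \<eta>"

abbreviation QL :: "('a measure \<times> 'a) measure" where "QL \<equiv> Q \<Otimes>\<^sub>M lam"

text \<open>Independence is only given for counts of disjoint sets, while the sets
  \<open>B - D\<close> may overlap. They are cut into the atoms that \<open>F\<close> generates
  outside \<open>D\<close>: the count of \<open>D\<close> is independent of the family of atom
  counts, and each count of \<open>B - D\<close> is a finite sum of these.\<close>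

lemma joint_counts:
  assumes D: "D \<in> sets lam" and F: "finite F" "F \<subseteq> sets lam"
  defines "V \<equiv> \<lambda>\<omega>. \<lambda>B\<in>F. emeasure (\<eta> \<omega>) (B - D)"
  shows "V \<in> measurable P (PiM F (\<lambda>_. borel))"
    and "distr P (borel \<Otimes>\<^sub>M PiM F (\<lambda>_. borel)) (\<lambda>\<omega>. (emeasure (\<eta> \<omega>) D, V \<omega>))
      = distr P borel (\<lambda>\<omega>. emeasure (\<eta> \<omega>) D) \<Otimes>\<^sub>M distr P (PiM F (\<lambda>_. borel)) V"
proof -
  have m[measurable]: "(\<lambda>\<omega>. emeasure (\<eta> \<omega>) B) \<in> borel_measurable P" if "B \<in> sets lam" for B
    by (rule measurable_compose[OF measurable_eta measurable_emeasure_int_measure_space[OF that]])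
  show V: "V \<in> measurable P (PiM F (\<lambda>_. borel))"
    unfolding V_def using assms by (intro measurable_restrict m) auto
  obtain e where e: "bij_betw e {0..<card (Pow F)} (Pow F)"
    using ex_bij_betw_nat_finite[of "Pow F"] F by auto
  define n where "n = card (Pow F)"
  \<comment> \<open>The atom outside \<open>D\<close> whose points lie in exactly the members of
    \<open>e i\<close>. Distinct indices give distinct subsets of \<open>F\<close>, hence disjoint
    atoms.\<close>
  define A where "A i = {y \<in> space lam. y \<notin> D \<and> (\<forall>B\<in>F. y \<in> B \<longleftrightarrow> B \<in> e i)}" for i
  \<comment> \<open>Index 0 carries \<open>D\<close>, index i + 1 carries the atom
    \<open>A i\<close>; below, \<open>?f\<close> reads the former and \<open>?g\<close> reassembles
    the counts of \<open>B - D\<close> from the latter.\<close>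
  define K where "K = case_nat D A"
  have [measurable]: "B \<in> sets lam" if "B \<in> F" for B using that F by auto
  have A[measurable]: "A i \<in> sets lam" for i
    unfolding A_def using F(1) D by measurable
  have K: "K i \<in> sets lam" for i
    using D A by (simp add: K_def split: nat.split)
  have dA: "A i \<inter> A j = {}" if "i < n" "j < n" "i \<noteq> j" for i j
  proof -
    have ij: "i \<in> {0..<n}" "j \<in> {0..<n}" using that by auto
    have "e i \<noteq> e j"
      using inj_onD[OF bij_betw_imp_inj_on[OF e], folded n_def, OF _ ij] that(3) by blast
    moreover have "e i \<in> Pow F" "e j \<in> Pow F"
      using bij_betwE[OF e, folded n_def] ij by auto
    ultimately obtain B where "B \<in> F" "B \<in> e i \<longleftrightarrow> B \<notin> e j" by blast
    then show ?thesis unfolding A_def by blast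
  qed
  have dis: "disjoint_family_on K {..<Suc n}"
    unfolding disjoint_family_on_def
  proof (intro ballI impI)
    fix i j assume "i \<in> {..<Suc n}" "j \<in> {..<Suc n}" "i \<noteq> j"
    then show "K i \<inter> K j = {}"
      using dA[of "i - 1" "j - 1"] by (cases i; cases j) (auto simp: K_def A_def)
  qed
  have ind: "indep_vars (\<lambda>_. borel) (\<lambda>i \<omega>. emeasure (\<eta> \<omega>) (K i)) {..<Suc n}"
    using process K dis unfolding poisson_process_def by blast
  let ?f = "\<lambda>x::nat \<Rightarrow> ennreal. x 0"
  let ?g = "\<lambda>x. \<lambda>B\<in>F. \<Sum>i\<in>{i. i < n \<and> B \<in> e i}. (x (Suc i) :: ennreal)"
  have g: "?g \<in> measurable (PiM {Suc 0..n} (\<lambda>_. borel)) (PiM F (\<lambda>_. borel))"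
    by (intro measurable_restrict borel_measurable_sum measurable_component_singleton) auto
  let ?X = "\<lambda>J \<omega>. restrict (\<lambda>i. emeasure (\<eta> \<omega>) (K i)) J"
  let ?S = "PiM {0} (\<lambda>_. borel :: ennreal measure)" and ?T = "PiM {Suc 0..n} (\<lambda>_. borel :: ennreal measure)"
    and ?F = "PiM F (\<lambda>_. borel :: ennreal measure)"
  have f: "?f \<in> measurable ?S borel"
    by (intro measurable_component_singleton) auto
  have m0: "?X {0} \<in> measurable P ?S" and m1: "?X {Suc 0..n} \<in> measurable P ?T"
    using K by (auto intro!: measurable_restrict m)
  have "indep_var ?S (?X {0}) ?T (?X {Suc 0..n})"
    by (rule indep_var_restrict[OF ind]) auto
  then have eq0: "distr P ?S (?X {0}) \<Otimes>\<^sub>M distr P ?T (?X {Suc 0..n})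
      = distr P (?S \<Otimes>\<^sub>M ?T) (\<lambda>\<omega>. (?X {0} \<omega>, ?X {Suc 0..n} \<omega>))"
    unfolding indep_var_distribution_eq by blast
  have "distr P borel (?f \<circ> ?X {0}) \<Otimes>\<^sub>M distr P ?F (?g \<circ> ?X {Suc 0..n})
     = distr (distr P ?S (?X {0})) borel ?f \<Otimes>\<^sub>M distr (distr P ?T (?X {Suc 0..n})) ?F ?g"
    using f g m0 m1 by (simp add: distr_distr)
  also have "\<dots> = distr (distr P ?S (?X {0}) \<Otimes>\<^sub>M distr P ?T (?X {Suc 0..n})) (borel \<Otimes>\<^sub>M ?F) (\<lambda>(x, y). (?f x, ?g y))"
  proof (rule pair_measure_distr)
    have "prob_space (distr P ?T (?X {Suc 0..n}))" by (rule prob_space_distr[OF m1])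
    then have "prob_space (distr (distr P ?T (?X {Suc 0..n})) ?F ?g)"
      by (rule prob_space.prob_space_distr) (use g in simp)
    then show "sigma_finite_measure (distr (distr P ?T (?X {Suc 0..n})) ?F ?g)"
      by (simp add: prob_space_imp_sigma_finite)
  qed (use f g in auto)
  also have "\<dots> = distr P (borel \<Otimes>\<^sub>M ?F) ((\<lambda>(x, y). (?f x, ?g y)) \<circ> (\<lambda>\<omega>. (?X {0} \<omega>, ?X {Suc 0..n} \<omega>)))"
    unfolding eq0
  proof (rule distr_distr)
    show "(\<lambda>(x, y). (?f x, ?g y)) \<in> measurable (?S \<Otimes>\<^sub>M ?T) (borel \<Otimes>\<^sub>M ?F)"
      unfolding case_prod_beta
      by (intro measurable_Pair measurable_compose[OF measurable_fst f] measurable_compose[OF measurable_snd g])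
  qed (rule measurable_Pair[OF m0 m1])
  finally have eq: "distr P borel (?f \<circ> ?X {0}) \<Otimes>\<^sub>M distr P ?F (?g \<circ> ?X {Suc 0..n})
     = distr P (borel \<Otimes>\<^sub>M ?F) (\<lambda>\<omega>. ((?f \<circ> ?X {0}) \<omega>, (?g \<circ> ?X {Suc 0..n}) \<omega>))"
    by (simp add: comp_def case_prod_beta)
  have 1: "(?f \<circ> (\<lambda>\<omega>. restrict (\<lambda>i. emeasure (\<eta> \<omega>) (K i)) {0})) = (\<lambda>\<omega>. emeasure (\<eta> \<omega>) D)"
    by (simp add: fun_eq_iff K_def)
  have 2: "(?g \<circ> (\<lambda>\<omega>. restrict (\<lambda>i. emeasure (\<eta> \<omega>) (K i)) {Suc 0..n})) \<omega> = V \<omega>"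
    if w: "\<omega> \<in> space P" for \<omega>
  proof -
    have "(\<Sum>i\<in>{i. i < n \<and> B \<in> e i}. emeasure (\<eta> \<omega>) (A i)) = emeasure (\<eta> \<omega>) (B - D)" if B: "B \<in> F" for B
    proof -
      have "(\<Sum>i\<in>{i. i < n \<and> B \<in> e i}. emeasure (\<eta> \<omega>) (A i))
         = emeasure (\<eta> \<omega>) (\<Union>i\<in>{i. i < n \<and> B \<in> e i}. A i)"
        using dA A int_measuresD(1)[OF eta_int[OF w]]
        by (intro sum_emeasure) (auto simp: disjoint_family_on_def)
      also have "(\<Union>i\<in>{i. i < n \<and> B \<in> e i}. A i) = B - D"
      proof (intro equalityI subsetI)
        fix y assume y: "y \<in> B - D"
        then have "y \<in> space lam" using B F sets.sets_into_space by blast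
        have "{B \<in> F. y \<in> B} \<in> e ` {0..<n}" using e by (auto simp: n_def bij_betw_def)
        then obtain i where i: "i < n" "e i = {B \<in> F. y \<in> B}" by auto
        then show "y \<in> (\<Union>i\<in>{i. i < n \<and> B \<in> e i}. A i)"
          using y B \<open>y \<in> space lam\<close> by (intro UN_I[of i]) (auto simp: A_def)
      qed (use B in \<open>auto simp: A_def\<close>)
      finally show ?thesis .
    qed
    moreover have "{i. i < n \<and> B \<in> e i} \<subseteq> {..<n}" for B by auto
    ultimately show ?thesis
      by (auto simp: V_def K_def fun_eq_iff intro!: sum.cong)
  qed
  have "distr P (PiM F (\<lambda>_. borel)) (?g \<circ> (\<lambda>\<omega>. restrict (\<lambda>i. emeasure (\<eta> \<omega>) (K i)) {Suc 0..n}))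
     = distr P (PiM F (\<lambda>_. borel)) V"
    by (rule distr_cong) (auto simp only: 2)
  moreover have "distr P (borel \<Otimes>\<^sub>M PiM F (\<lambda>_. borel)) (\<lambda>\<omega>. (emeasure (\<eta> \<omega>) D,
        (?g \<circ> (\<lambda>\<omega>. restrict (\<lambda>i. emeasure (\<eta> \<omega>) (K i)) {Suc 0..n})) \<omega>))
     = distr P (borel \<Otimes>\<^sub>M PiM F (\<lambda>_. borel)) (\<lambda>\<omega>. (emeasure (\<eta> \<omega>) D, V \<omega>))"
    by (rule distr_cong) (auto simp only: 2)
  ultimately show "distr P (borel \<Otimes>\<^sub>M PiM F (\<lambda>_. borel)) (\<lambda>\<omega>. (emeasure (\<eta> \<omega>) D, V \<omega>))
      = distr P borel (\<lambda>\<omega>. emeasure (\<eta> \<omega>) D) \<Otimes>\<^sub>M distr P (PiM F (\<lambda>_. borel)) V"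
    using eq unfolding 1 by simp
qed

text \<open>With the counts outside \<open>D\<close> frozen, which independence permits, this is
  \<open>poisson_shift\<close> for the one remaining variable, the count of
  \<open>D\<close>.\<close>

lemma joint_counts_shift:
  assumes D: "D \<in> sets lam" "emeasure lam D < \<infinity>" and F: "finite F" "F \<subseteq> sets lam"
    and [measurable]: "case_prod \<phi> \<in> borel_measurable (borel \<Otimes>\<^sub>M PiM F (\<lambda>_. borel))"
  defines "V \<equiv> \<lambda>\<omega>. \<lambda>B\<in>F. emeasure (\<eta> \<omega>) (B - D)"
  shows "(\<integral>\<^sup>+\<omega>. emeasure (\<eta> \<omega>) D * \<phi> (emeasure (\<eta> \<omega>) D - 1) (V \<omega>) \<partial>P)
    = emeasure lam D * (\<integral>\<^sup>+\<omega>. \<phi> (emeasure (\<eta> \<omega>) D) (V \<omega>) \<partial>P)"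
proof -
  let ?Z = "\<lambda>\<omega>. emeasure (\<eta> \<omega>) D" and ?F = "PiM F (\<lambda>_. borel :: ennreal measure)"
  have [measurable]: "?Z \<in> borel_measurable P"
    by (rule measurable_compose[OF measurable_eta measurable_emeasure_int_measure_space[OF D(1)]])
  have V[measurable]: "V \<in> measurable P ?F" unfolding V_def by (rule joint_counts(1)[OF D(1) F])
  have eq: "distr P (borel \<Otimes>\<^sub>M ?F) (\<lambda>\<omega>. (?Z \<omega>, V \<omega>)) = distr P borel ?Z \<Otimes>\<^sub>M distr P ?F V"
    unfolding V_def by (rule joint_counts(2)[OF D(1) F])
  interpret Z: prob_space "distr P borel ?Z" by (rule prob_space_distr) simp
  interpret V: prob_space "distr P ?F V" by (rule prob_space_distr) simp
  interpret ZV: pair_sigma_finite "distr P borel ?Z" "distr P ?F V" ..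
  have *: "(\<integral>\<^sup>+\<omega>. g (?Z \<omega>) (V \<omega>) \<partial>P) = (\<integral>\<^sup>+v. (\<integral>\<^sup>+\<omega>. g (?Z \<omega>) v \<partial>P) \<partial>distr P ?F V)"
    if [measurable]: "case_prod g \<in> borel_measurable (borel \<Otimes>\<^sub>M ?F)" for g :: "ennreal \<Rightarrow> _ \<Rightarrow> ennreal"
  proof -
    have "(\<integral>\<^sup>+\<omega>. g (?Z \<omega>) (V \<omega>) \<partial>P)
       = (\<integral>\<^sup>+p. case_prod g p \<partial>distr P (borel \<Otimes>\<^sub>M ?F) (\<lambda>\<omega>. (?Z \<omega>, V \<omega>)))"
      by (subst nn_integral_distr) auto
    also have "\<dots> = (\<integral>\<^sup>+v. (\<integral>\<^sup>+z. g z v \<partial>distr P borel ?Z) \<partial>distr P ?F V)"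
      unfolding eq using that
      by (subst ZV.nn_integral_snd[symmetric]) (auto simp: measurable_distr_eq1 cong: measurable_cong_sets)
    also have "\<dots> = (\<integral>\<^sup>+v. (\<integral>\<^sup>+\<omega>. g (?Z \<omega>) v \<partial>P) \<partial>distr P ?F V)"
      by (intro nn_integral_cong) (subst nn_integral_distr, auto)
    finally show ?thesis .
  qed
  have "(\<integral>\<^sup>+\<omega>. ?Z \<omega> * \<phi> (?Z \<omega> - 1) (V \<omega>) \<partial>P)
     = (\<integral>\<^sup>+v. (\<integral>\<^sup>+\<omega>. ?Z \<omega> * \<phi> (?Z \<omega> - 1) v \<partial>P) \<partial>distr P ?F V)"
    by (rule *[of "\<lambda>z v. z * \<phi> (z - 1) v"]) measurable
  also have "\<dots> = (\<integral>\<^sup>+v. emeasure lam D * (\<integral>\<^sup>+\<omega>. \<phi> (?Z \<omega>) v \<partial>P) \<partial>distr P ?F V)"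
    by (intro nn_integral_cong poisson_shift[OF poisson_emeasure[OF D(1)] D(2)]) auto
  also have "\<dots> = emeasure lam D * (\<integral>\<^sup>+v. (\<integral>\<^sup>+\<omega>. \<phi> (?Z \<omega>) v \<partial>P) \<partial>distr P ?F V)"
    by (intro nn_integral_cmult) measurable
  also have "\<dots> = emeasure lam D * (\<integral>\<^sup>+\<omega>. \<phi> (?Z \<omega>) (V \<omega>) \<partial>P)"
    by (subst *) auto
  finally show ?thesis .
qed

text \<open>Finite-dimensional cylinders of the configuration space. They generate its sigma-field
  and are closed under intersection, so two measures can be compared on them.\<close>

definition count_event :: "'a set set \<Rightarrow> ('a set \<Rightarrow> ennreal set) \<Rightarrow> 'a measure set" where
  "count_event F U = {\<mu> \<in> int_measures lam. \<forall>B\<in>F. emeasure \<mu> B \<in> U B}"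

definition count_events :: "'a measure set set" where
  "count_events = {count_event F U | F U. finite F \<and> F \<subseteq> sets lam \<and> range U \<subseteq> sets borel}"

lemma sets_N_count_events: "sets N = sigma_sets (int_measures lam) count_events"
proof
  show "sets N \<subseteq> sigma_sets (int_measures lam) count_events"
    unfolding sets_int_measure_space
  proof (rule sigma_sets_mono, safe)
    fix B and U :: "ennreal set" assume "B \<in> sets lam" "U \<in> sets borel"
    then have "count_event {B} (\<lambda>_. U) \<in> count_events"
      unfolding count_events_def by blast
    then show "{\<mu> \<in> int_measures lam. emeasure \<mu> B \<in> U} \<in> sigma_sets (int_measures lam) count_events"
      by (auto simp: count_event_def intro: sigma_sets.Basic)
  qed
  have "count_events \<subseteq> sets N"
  proof
    fix S assume "S \<in> count_events"
    then obtain F U where S: "S = count_event F U" and F: "finite F" "F \<subseteq> sets lam" "range U \<subseteq> sets borel"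
      unfolding count_events_def by blast
    have "{\<mu> \<in> space N. emeasure \<mu> B \<in> U B} \<in> sets N" if "B \<in> F" for B
      using that F by (intro measurable_sets_Collect[OF measurable_emeasure_int_measure_space]) auto
    then have "{\<mu> \<in> space N. \<forall>B\<in>F. emeasure \<mu> B \<in> U B} \<in> sets N"
      using F by (intro sets.sets_Collect_finite_All) auto
    then show "S \<in> sets N" by (simp add: S count_event_def space_int_measure_space)
  qed
  then show "sigma_sets (int_measures lam) count_events \<subseteq> sets N"
    using sets.sigma_sets_subset[of count_events N] by (simp add: space_int_measure_space)
qed

lemma count_event_Int:
  "count_event F U \<inter> count_event F' U'
    = count_event (F \<union> F') (\<lambda>B. (if B \<in> F then U B else UNIV) \<inter> (if B \<in> F' then U' B else UNIV))"
  by (auto simp: count_event_def)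

lemma Int_stable_count_events: "Int_stable count_events"
proof (rule Int_stableI)
  fix a b assume "a \<in> count_events" "b \<in> count_events"
  then obtain F U F' U' where ab: "a = count_event F U" "b = count_event F' U'"
      "finite F" "F \<subseteq> sets lam" "range U \<subseteq> sets borel"
      "finite F'" "F' \<subseteq> sets lam" "range U' \<subseteq> sets borel"
    unfolding count_events_def by blast
  show "a \<inter> b \<in> count_events"
    unfolding ab(1,2) count_event_Int count_events_def
    using ab by (intro CollectI exI[of _ "F \<union> F'"]
      exI[of _ "\<lambda>B. (if B \<in> F then U B else UNIV) \<inter> (if B \<in> F' then U' B else UNIV)"]) auto
qed

text \<open>\<open>S\<close> restricts the counts of the finitely many sets in \<open>F\<close>.
  Cutting \<open>C\<close> along \<open>F\<close> makes the effect of removing a point uniform on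
  each piece, so that the sum over the points of a piece collapses to its count times a function of
  the lowered count. \<open>joint_counts_shift\<close> then evaluates every piece.\<close>

lemma mecke_rectangle:
  assumes S: "S \<in> count_events" and C: "C \<in> sets lam" "emeasure lam C < \<infinity>"
  shows "(\<integral>\<^sup>+\<omega>. (\<Sum>i. if i \<in> pts \<omega> then indicator S (del i \<omega>) * indicator C (X i \<omega>) else 0) \<partial>P)
    = emeasure Q S * emeasure lam C"
proof -
  obtain F U where SF: "S = count_event F U" and F: "finite F" "F \<subseteq> sets lam" "range U \<subseteq> sets borel"
    using S unfolding count_events_def by blast
  have SN: "S \<in> sets N" using S unfolding sets_N_count_events by (rule sigma_sets.Basic)
  have [measurable]: "B \<in> sets lam" if "B \<in> F" for B using that F by auto
  have [measurable]: "U B \<in> sets borel" for B using F by auto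
  \<comment> \<open>A point of \<open>D \<sigma>\<close> lies in exactly the members of
    \<open>\<sigma>\<close> among \<open>F\<close>, so its removal lowers precisely those counts by
    one.\<close>
  define D where "D \<sigma> = {y \<in> space lam. y \<in> C \<and> (\<forall>B\<in>F. y \<in> B \<longleftrightarrow> B \<in> \<sigma>)}" for \<sigma>
  have D[measurable]: "D \<sigma> \<in> sets lam" for \<sigma>
    unfolding D_def using F(1) C(1) by measurable
  have DC: "D \<sigma> \<subseteq> C" for \<sigma> by (auto simp: D_def)
  have Dfin: "emeasure lam (D \<sigma>) < \<infinity>" for \<sigma>
    using emeasure_mono[OF DC C(1)] C(2) by (rule le_less_trans)
  have Ddisj: "D \<sigma> \<inter> D \<tau> = {}" if "\<sigma> \<in> Pow F" "\<tau> \<in> Pow F" "\<sigma> \<noteq> \<tau>" for \<sigma> \<tau>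
  proof -
    obtain B where "B \<in> F" "B \<in> \<sigma> \<longleftrightarrow> B \<notin> \<tau>" using \<open>\<sigma> \<noteq> \<tau>\<close> \<open>\<sigma> \<in> Pow F\<close> \<open>\<tau> \<in> Pow F\<close> by blast
    then show ?thesis unfolding D_def by blast
  qed
  have DU: "(\<Union>\<sigma>\<in>Pow F. D \<sigma>) = C"
  proof (intro equalityI subsetI)
    fix y assume "y \<in> C"
    moreover from this have "y \<in> space lam" using C(1) sets.sets_into_space by blast
    ultimately show "y \<in> (\<Union>\<sigma>\<in>Pow F. D \<sigma>)"
      by (intro UN_I[of "{B \<in> F. y \<in> B}"]) (auto simp: D_def)
  qed (auto simp: D_def)
  have indC: "indicator C y = (\<Sum>\<sigma>\<in>Pow F. indicator (D \<sigma>) y :: ennreal)" for y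
  proof -
    have "indicator (\<Union>\<sigma>\<in>Pow F. D \<sigma>) y = (\<Sum>\<sigma>\<in>Pow F. indicator (D \<sigma>) y :: ennreal)"
      using F(1) Ddisj by (intro indicator_UN_disjoint) (auto simp: disjoint_family_on_def)
    then show ?thesis by (simp add: DU)
  qed
  define V where "V \<sigma> = (\<lambda>\<omega>. \<lambda>B\<in>F. emeasure (\<eta> \<omega>) (B - D \<sigma>))" for \<sigma>
  \<comment> \<open>Membership in \<open>S\<close> as a condition on the count \<open>z\<close> of
    \<open>D \<sigma>\<close> and the counts \<open>v\<close> outside it. The same function at
    \<open>z - 1\<close> describes membership after a point of \<open>D \<sigma>\<close> has been
    removed.\<close>
  define \<phi> where "\<phi> \<sigma> = (\<lambda>z v. indicator {p \<in> space (borel \<Otimes>\<^sub>M PiM F (\<lambda>_. borel)).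
     \<forall>B\<in>F. snd p B + (if B \<in> \<sigma> then fst p else 0) \<in> U B} (z, v) :: ennreal)" for \<sigma>
  have \<phi>_meas: "case_prod (\<phi> \<sigma>) \<in> borel_measurable (borel \<Otimes>\<^sub>M PiM F (\<lambda>_. borel))" for \<sigma>
  proof -
    have "{p \<in> space (borel \<Otimes>\<^sub>M PiM F (\<lambda>_. borel)). \<forall>B\<in>F. snd p B + (if B \<in> \<sigma> then fst p else 0) \<in> U B}
        \<in> sets (borel \<Otimes>\<^sub>M PiM F (\<lambda>_. borel :: ennreal measure))"
    proof (intro sets.sets_Collect_finite_All F(1))
      fix B assume B: "B \<in> F"
      have [measurable]: "(\<lambda>p. snd p B) \<in> borel_measurable (borel \<Otimes>\<^sub>M PiM F (\<lambda>_. borel :: ennreal measure) :: (ennreal \<times> _) measure)"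
        by (rule measurable_compose[OF measurable_snd measurable_component_singleton[OF B]])
      have "(\<lambda>p. snd p B + (if B \<in> \<sigma> then fst p else 0)) \<in> borel_measurable (borel \<Otimes>\<^sub>M PiM F (\<lambda>_. borel :: ennreal measure))"
        by measurable
      then show "{p \<in> space (borel \<Otimes>\<^sub>M PiM F (\<lambda>_. borel)). snd p B + (if B \<in> \<sigma> then fst p else 0) \<in> U B}
        \<in> sets (borel \<Otimes>\<^sub>M PiM F (\<lambda>_. borel :: ennreal measure))"
        by (rule measurable_sets_Collect) auto
    qed
    then show ?thesis unfolding \<phi>_def by (simp add: case_prod_beta)
  qed
  have \<phi>V: "\<phi> \<sigma> z (V \<sigma> \<omega>) = (if \<forall>B\<in>F. emeasure (\<eta> \<omega>) (B - D \<sigma>) + (if B \<in> \<sigma> then z else 0) \<in> U B then 1 else 0)"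
    for \<sigma> z \<omega>
    by (auto simp: \<phi>_def V_def indicator_def space_pair_measure space_PiM)
  have DB: "D \<sigma> \<subseteq> B" if "B \<in> \<sigma>" "B \<in> F" for B \<sigma>
    using that by (auto simp: D_def)
  have DnB: "D \<sigma> \<inter> B = {}" if "B \<notin> \<sigma>" "B \<in> F" for B \<sigma>
    using that by (auto simp: D_def)
  have split_eta: "emeasure (\<eta> \<omega>) B
      = emeasure (\<eta> \<omega>) (B - D \<sigma>) + (if B \<in> \<sigma> then emeasure (\<eta> \<omega>) (D \<sigma>) else 0)"
    if "\<omega> \<in> space P" "B \<in> F" for B \<sigma> \<omega>
  proof (cases "B \<in> \<sigma>")
    case True
    have "emeasure (\<eta> \<omega>) (B - D \<sigma>) + emeasure (\<eta> \<omega>) (D \<sigma>) = emeasure (\<eta> \<omega>) ((B - D \<sigma>) \<union> D \<sigma>)"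
      using that by (intro plus_emeasure) (auto simp: int_measuresD(1)[OF eta_int])
    moreover have "(B - D \<sigma>) \<union> D \<sigma> = B" using DB[OF True] that by auto
    ultimately show ?thesis using True by simp
  next
    case False
    then have "B - D \<sigma> = B" using DnB[OF False] that by auto
    then show ?thesis using False by simp
  qed
  have S_eta: "indicator S (\<eta> \<omega>) = \<phi> \<sigma> (emeasure (\<eta> \<omega>) (D \<sigma>)) (V \<sigma> \<omega>)"
    if w: "\<omega> \<in> space P" for \<omega> \<sigma>
    using split_eta[OF w, of _ \<sigma>] eta_int[OF w]
    by (auto simp: \<phi>V SF count_event_def indicator_def)
  have S_del: "indicator S (del i \<omega>) = \<phi> \<sigma> (emeasure (\<eta> \<omega>) (D \<sigma>) - 1) (V \<sigma> \<omega>)"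
    if w: "\<omega> \<in> space P" and i: "i \<in> pts \<omega>" "X i \<omega> \<in> D \<sigma>" for \<omega> i \<sigma>
  proof -
    have "emeasure (del i \<omega>) B = emeasure (\<eta> \<omega>) (B - D \<sigma>) + (if B \<in> \<sigma> then emeasure (\<eta> \<omega>) (D \<sigma>) - 1 else 0)"
      if B: "B \<in> F" for B
    proof -
      have 1: "emeasure (\<eta> \<omega>) (B - D \<sigma>) = emeasure (del i \<omega>) (B - D \<sigma>)"
        using emeasure_eta_del[OF w _ i(1), of "B - D \<sigma>"] i(2) B by simp
      have 2: "emeasure (\<eta> \<omega>) (D \<sigma>) - 1 = emeasure (del i \<omega>) (D \<sigma>)"
        using emeasure_eta_del[OF w _ i(1), of "D \<sigma>"] i(2) by simp
      show ?thesis
      proof (cases "B \<in> \<sigma>")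
        case True
        have "emeasure (del i \<omega>) (B - D \<sigma>) + emeasure (del i \<omega>) (D \<sigma>) = emeasure (del i \<omega>) ((B - D \<sigma>) \<union> D \<sigma>)"
          using B by (intro plus_emeasure) (auto simp: int_measuresD(1)[OF del_int[OF w]])
        moreover have "(B - D \<sigma>) \<union> D \<sigma> = B" using DB[OF True] B by auto
        ultimately show ?thesis using True 1 2 by simp
      next
        case False
        then have "B - D \<sigma> = B" using DnB[OF False] B by auto
        then show ?thesis using False 1 by simp
      qed
    qed
    then show ?thesis using del_int[OF w, of i]
      by (auto simp: \<phi>V SF count_event_def indicator_def)
  qed
  have "(\<integral>\<^sup>+\<omega>. (\<Sum>i. if i \<in> pts \<omega> then indicator S (del i \<omega>) * indicator C (X i \<omega>) else 0) \<partial>P)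
     = (\<integral>\<^sup>+\<omega>. (\<Sum>\<sigma>\<in>Pow F. emeasure (\<eta> \<omega>) (D \<sigma>) * \<phi> \<sigma> (emeasure (\<eta> \<omega>) (D \<sigma>) - 1) (V \<sigma> \<omega>)) \<partial>P)"
  proof (rule nn_integral_cong)
    \<comment> \<open>Pathwise, each point in \<open>C\<close> falls into one piece, and the value
      of \<open>\<phi>\<close> does not depend on which point of the piece was removed.\<close>
    fix \<omega> assume w: "\<omega> \<in> space P"
    have "(\<Sum>i. if i \<in> pts \<omega> then indicator S (del i \<omega>) * indicator C (X i \<omega>) else (0::ennreal))
       = (\<Sum>i. \<Sum>\<sigma>\<in>Pow F. (if i \<in> pts \<omega> then indicator (D \<sigma>) (X i \<omega>) else 0) * \<phi> \<sigma> (emeasure (\<eta> \<omega>) (D \<sigma>) - 1) (V \<sigma> \<omega>))"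
    proof (rule suminf_cong)
      fix i
      show "(if i \<in> pts \<omega> then indicator S (del i \<omega>) * indicator C (X i \<omega>) else (0::ennreal))
        = (\<Sum>\<sigma>\<in>Pow F. (if i \<in> pts \<omega> then indicator (D \<sigma>) (X i \<omega>) else 0) * \<phi> \<sigma> (emeasure (\<eta> \<omega>) (D \<sigma>) - 1) (V \<sigma> \<omega>))"
      proof (cases "i \<in> pts \<omega>")
        case True
        have "indicator S (del i \<omega>) * indicator (D \<sigma>) (X i \<omega>)
          = indicator (D \<sigma>) (X i \<omega>) * \<phi> \<sigma> (emeasure (\<eta> \<omega>) (D \<sigma>) - 1) (V \<sigma> \<omega>)" for \<sigma>
          by (cases "X i \<omega> \<in> D \<sigma>") (auto simp: S_del[OF w True, of \<sigma>])
        with True show ?thesis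
          unfolding indC sum_distrib_left by simp
      qed simp
    qed
    also have "\<dots> = (\<Sum>\<sigma>\<in>Pow F. \<Sum>i. (if i \<in> pts \<omega> then indicator (D \<sigma>) (X i \<omega>) else 0) * \<phi> \<sigma> (emeasure (\<eta> \<omega>) (D \<sigma>) - 1) (V \<sigma> \<omega>))"
      by (intro suminf_sum summableI)
    also have "\<dots> = (\<Sum>\<sigma>\<in>Pow F. emeasure (\<eta> \<omega>) (D \<sigma>) * \<phi> \<sigma> (emeasure (\<eta> \<omega>) (D \<sigma>) - 1) (V \<sigma> \<omega>))"
      by (subst ennreal_suminf_multc) (simp add: emeasure_eta_sum[OF w D])
    finally show "(\<Sum>i. if i \<in> pts \<omega> then indicator S (del i \<omega>) * indicator C (X i \<omega>) else 0)
      = (\<Sum>\<sigma>\<in>Pow F. emeasure (\<eta> \<omega>) (D \<sigma>) * \<phi> \<sigma> (emeasure (\<eta> \<omega>) (D \<sigma>) - 1) (V \<sigma> \<omega>))" .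
  qed
  also have "\<dots> = (\<Sum>\<sigma>\<in>Pow F. \<integral>\<^sup>+\<omega>. emeasure (\<eta> \<omega>) (D \<sigma>) * \<phi> \<sigma> (emeasure (\<eta> \<omega>) (D \<sigma>) - 1) (V \<sigma> \<omega>) \<partial>P)"
  proof (rule nn_integral_sum)
    fix \<sigma>
    have z[measurable]: "(\<lambda>\<omega>. emeasure (\<eta> \<omega>) (D \<sigma>)) \<in> borel_measurable P"
      by (rule measurable_compose[OF measurable_eta measurable_emeasure_int_measure_space[OF D]])
    have [measurable]: "V \<sigma> \<in> measurable P (PiM F (\<lambda>_. borel))"
      unfolding V_def by (rule joint_counts(1)[OF D F(1,2)])
    have [measurable]: "(\<lambda>\<omega>. \<phi> \<sigma> (emeasure (\<eta> \<omega>) (D \<sigma>) - 1) (V \<sigma> \<omega>)) \<in> borel_measurable P"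
      using \<phi>_meas by (rule measurable_compose_rev[of "case_prod (\<phi> \<sigma>)" "borel \<Otimes>\<^sub>M PiM F (\<lambda>_. borel)" _ "\<lambda>\<omega>. (emeasure (\<eta> \<omega>) (D \<sigma>) - 1, V \<sigma> \<omega>)", simplified]) measurable
    show "(\<lambda>\<omega>. emeasure (\<eta> \<omega>) (D \<sigma>) * \<phi> \<sigma> (emeasure (\<eta> \<omega>) (D \<sigma>) - 1) (V \<sigma> \<omega>)) \<in> borel_measurable P"
      by measurable
  qed
  also have "\<dots> = (\<Sum>\<sigma>\<in>Pow F. emeasure lam (D \<sigma>) * (\<integral>\<^sup>+\<omega>. \<phi> \<sigma> (emeasure (\<eta> \<omega>) (D \<sigma>)) (V \<sigma> \<omega>) \<partial>P))"
    unfolding V_def using D Dfin F \<phi>_meas by (intro sum.cong refl joint_counts_shift)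
  also have "\<dots> = (\<Sum>\<sigma>\<in>Pow F. emeasure lam (D \<sigma>) * emeasure Q S)"
  proof (intro sum.cong refl arg_cong2[where f="(*)"])
    fix \<sigma>
    have "(\<integral>\<^sup>+\<omega>. \<phi> \<sigma> (emeasure (\<eta> \<omega>) (D \<sigma>)) (V \<sigma> \<omega>) \<partial>P) = (\<integral>\<^sup>+\<omega>. indicator S (\<eta> \<omega>) \<partial>P)"
      by (intro nn_integral_cong S_eta[symmetric])
    also have "\<dots> = (\<integral>\<^sup>+\<mu>. indicator S \<mu> \<partial>Q)"
      using SN by (subst nn_integral_distr) auto
    also have "\<dots> = emeasure Q S" using SN by simp
    finally show "(\<integral>\<^sup>+\<omega>. \<phi> \<sigma> (emeasure (\<eta> \<omega>) (D \<sigma>)) (V \<sigma> \<omega>) \<partial>P) = emeasure Q S" .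
  qed
  also have "\<dots> = (\<Sum>\<sigma>\<in>Pow F. emeasure lam (D \<sigma>)) * emeasure Q S"
    by (simp add: sum_distrib_right)
  also have "(\<Sum>\<sigma>\<in>Pow F. emeasure lam (D \<sigma>)) = emeasure lam C"
    using F(1) Ddisj by (subst sum_emeasure) (auto simp: disjoint_family_on_def DU)
  finally show ?thesis by (simp add: mult.commute)
qed

sublocale Q: prob_space Q
  by (rule prob_space_distr) (rule measurable_eta)

sublocale QL: pair_sigma_finite Q lam ..

sublocale PL: pair_sigma_finite P lam ..

lemma measurable_points [measurable]:
  "(\<lambda>p. (del (snd p) (fst p), X (snd p) (fst p))) \<in> measurable (P \<Otimes>\<^sub>M count_space UNIV) (N \<Otimes>\<^sub>M lam)"
proof (rule measurable_compose_countable'[where f="\<lambda>i p. (del i (fst p), X i (fst p))" and g=snd and I=UNIV])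
  fix i show "(\<lambda>p. (del i (fst p), X i (fst p))) \<in> measurable (P \<Otimes>\<^sub>M count_space UNIV) (N \<Otimes>\<^sub>M lam)"
    by measurable
qed auto

lemma measurable_pred_points [measurable]:
  "Measurable.pred (P \<Otimes>\<^sub>M count_space UNIV) (\<lambda>p. snd p \<in> pts (fst p))"
proof (rule measurable_compose_countable'[where f="\<lambda>i p. i \<in> pts (fst p)" and g=snd and I=UNIV])
  fix i show "Measurable.pred (P \<Otimes>\<^sub>M count_space UNIV) (\<lambda>p. i \<in> pts (fst p))"
    by measurable
qed auto

text \<open>The reduced Campbell measure of the process: the expected number of points whose pair
  (rest of the configuration, position) falls into a given set. It is written as an image of a
  density over indices so that it is a measure by construction.\<close>

definition point_pairs :: "('a measure \<times> 'a) measure" where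
  "point_pairs = distr (density (P \<Otimes>\<^sub>M count_space UNIV) (\<lambda>p. if snd p \<in> pts (fst p) then 1 else 0))
     (N \<Otimes>\<^sub>M lam) (\<lambda>p. (del (snd p) (fst p), X (snd p) (fst p)))"

lemma nn_integral_point_pairs:
  assumes h[measurable]: "h \<in> borel_measurable (N \<Otimes>\<^sub>M lam)"
  shows "(\<integral>\<^sup>+p. h p \<partial>point_pairs) = (\<integral>\<^sup>+\<omega>. (\<Sum>i. if i \<in> pts \<omega> then h (del i \<omega>, X i \<omega>) else 0) \<partial>P)"
proof -
  interpret C: sigma_finite_measure "count_space (UNIV :: nat set)"
    by (rule sigma_finite_measure_count_space)
  have "(\<integral>\<^sup>+p. h p \<partial>point_pairs)
     = (\<integral>\<^sup>+p. (if snd p \<in> pts (fst p) then 1 else 0) * h (del (snd p) (fst p), X (snd p) (fst p)) \<partial>(P \<Otimes>\<^sub>M count_space UNIV))"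
    unfolding point_pairs_def by (subst nn_integral_distr) (auto simp: nn_integral_density)
  also have "\<dots> = (\<integral>\<^sup>+\<omega>. \<integral>\<^sup>+i. (if i \<in> pts \<omega> then 1 else 0) * h (del i \<omega>, X i \<omega>) \<partial>count_space UNIV \<partial>P)"
    by (subst C.nn_integral_fst[symmetric]) auto
  also have "\<dots> = (\<integral>\<^sup>+\<omega>. (\<Sum>i. if i \<in> pts \<omega> then h (del i \<omega>, X i \<omega>) else 0) \<partial>P)"
    by (intro nn_integral_cong) (auto simp: nn_integral_count_space_nat intro!: suminf_cong)
  finally show ?thesis .
qed

text \<open>The Mecke equation: removing a point of the process, chosen according to counting measure,
  leaves an independent copy of the pair \<open>(\<eta>, y)\<close> with \<open>y\<close> distributed according to \<open>\<lambda>\<close>.\<close>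

theorem mecke: "point_pairs = QL"
proof -
  obtain A :: "nat \<Rightarrow> 'a set" where A: "range A \<subseteq> sets lam" "(\<Union>i. A i) = space lam"
      "\<And>i. emeasure lam (A i) \<noteq> \<infinity>"
    using lam.sigma_finite by blast
  \<comment> \<open>The comparison on rectangles is available for second factors of finite intensity
    only; sigma-finiteness makes these a generator and provides the exhausting sequence that the
    uniqueness theorem for measures asks for.\<close>
  let ?Y0 = "{C \<in> sets lam. emeasure lam C < \<infinity>}"
  let ?E = "{S \<times> C | S C. S \<in> count_events \<and> C \<in> ?Y0}"
  have top: "int_measures lam \<in> count_events"
    unfolding count_events_def
    by (intro CollectI exI[of _ "{}"] exI[of _ "\<lambda>_. UNIV"]) (auto simp: count_event_def)
  have subN: "count_events \<subseteq> Pow (space N)"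
    by (auto simp: count_events_def count_event_def space_int_measure_space)
  have A': "A i \<in> ?Y0" for i
    using A(1) A(3)[of i] by (auto simp: top.not_eq_extremum)
  have subY: "?Y0 \<subseteq> Pow (space lam)" using sets.sets_into_space by auto
  have lamY: "sets lam = sigma_sets (space lam) ?Y0"
  proof
    show "sets lam \<subseteq> sigma_sets (space lam) ?Y0"
    proof
      fix B assume B: "B \<in> sets lam"
      have "B \<inter> A i \<in> ?Y0" for i
        using emeasure_mono[of "B \<inter> A i" "A i" lam] A'[of i] B by (auto intro: le_less_trans)
      then have "(\<Union>i. B \<inter> A i) \<in> sigma_sets (space lam) ?Y0"
        by (intro sigma_sets.Union sigma_sets.Basic)
      moreover have "(\<Union>i. B \<inter> A i) = B" using A(2) sets.sets_into_space[OF B] by auto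
      ultimately show "B \<in> sigma_sets (space lam) ?Y0" by simp
    qed
    show "sigma_sets (space lam) ?Y0 \<subseteq> sets lam"
      by (rule sets.sigma_sets_subset) auto
  qed
  have gen: "sets (N \<Otimes>\<^sub>M lam) = sigma_sets (space N \<times> space lam) ?E"
  proof -
    have "sets (N \<Otimes>\<^sub>M lam) = sets (sigma (space N \<times> space lam) ?E)"
    proof (rule sets_pair_eq[where Ea=count_events and A=N and Ca="{space N}" and Eb="?Y0" and B=lam and Cb="range A"])
      show "sets N = sigma_sets (space N) count_events"
        by (simp add: space_int_measure_space sets_N_count_events)
    qed (use subN subY top A' A lamY in \<open>auto simp: space_int_measure_space\<close>)
    also have "\<dots> = sigma_sets (space N \<times> space lam) ?E"
      using subN subY by (intro sets_measure_of) blast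
    finally show ?thesis .
  qed
  have em1: "emeasure point_pairs (S \<times> C) = emeasure Q S * emeasure lam C"
    if S: "S \<in> count_events" and C: "C \<in> ?Y0" for S C
  proof -
    have [measurable]: "S \<in> sets N" using S unfolding sets_N_count_events by (rule sigma_sets.Basic)
    have [measurable]: "C \<in> sets lam" using C by auto
    have "emeasure point_pairs (S \<times> C) = (\<integral>\<^sup>+p. indicator (S \<times> C) p \<partial>point_pairs)"
      by (rule nn_integral_indicator[symmetric]) (simp add: point_pairs_def)
    also have "\<dots> = (\<integral>\<^sup>+\<omega>. (\<Sum>i. if i \<in> pts \<omega> then indicator (S \<times> C) (del i \<omega>, X i \<omega>) else 0) \<partial>P)"
      by (rule nn_integral_point_pairs) simp
    also have "\<dots> = (\<integral>\<^sup>+\<omega>. (\<Sum>i. if i \<in> pts \<omega> then indicator S (del i \<omega>) * indicator C (X i \<omega>) else 0) \<partial>P)"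
      by (intro nn_integral_cong suminf_cong) (auto simp: indicator_def)
    also have "\<dots> = emeasure Q S * emeasure lam C"
      using mecke_rectangle[OF S] C by auto
    finally show ?thesis .
  qed
  have em2: "emeasure QL (S \<times> C) = emeasure Q S * emeasure lam C"
    if S: "S \<in> count_events" and C: "C \<in> ?Y0" for S C
    using C S by (intro lam.emeasure_pair_measure_Times) (auto simp: sets_N_count_events)
  show ?thesis
  proof (rule measure_eqI_generator_eq[of ?E "space N \<times> space lam" _ _ "\<lambda>i. int_measures lam \<times> A i"])
    show "Int_stable ?E"
    proof (rule Int_stableI)
      fix a b assume "a \<in> ?E" "b \<in> ?E"
      then obtain S C S' C' where ab: "a = S \<times> C" "b = S' \<times> C'" "S \<in> count_events" "S' \<in> count_events"
          "C \<in> ?Y0" "C' \<in> ?Y0" by blast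
      have "S \<inter> S' \<in> count_events" using Int_stableD[OF Int_stable_count_events] ab by auto
      moreover have "C \<inter> C' \<in> ?Y0"
        using ab emeasure_mono[of "C \<inter> C'" C lam] by (auto intro: le_less_trans)
      ultimately show "a \<inter> b \<in> ?E" unfolding ab(1,2) Times_Int_Times by blast
    qed
    show "?E \<subseteq> Pow (space N \<times> space lam)" using subN subY by blast
    show "emeasure point_pairs Z = emeasure QL Z" if "Z \<in> ?E" for Z
      using that em1 em2 by auto
    show "sets point_pairs = sigma_sets (space N \<times> space lam) ?E"
      by (simp add: point_pairs_def gen)
    have "sets QL = sets (N \<Otimes>\<^sub>M lam)" by (intro sets_pair_measure_cong) auto
    then show "sets QL = sigma_sets (space N \<times> space lam) ?E" using gen by simp
    show "range (\<lambda>i. int_measures lam \<times> A i) \<subseteq> ?E" using top A' by blast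
    show "(\<Union>i. int_measures lam \<times> A i) = space N \<times> space lam"
      using A(2) by (auto simp: space_int_measure_space)
    show "emeasure point_pairs (int_measures lam \<times> A i) \<noteq> \<infinity>" for i
      using A'[of i] unfolding em1[OF top A']
      by (auto simp: ennreal_mult_eq_top_iff Q.emeasure_eq_measure)
  qed
qed

corollary mecke_nn_integral:
  assumes "h \<in> borel_measurable (N \<Otimes>\<^sub>M lam)"
  shows "(\<integral>\<^sup>+p. h p \<partial>QL) = (\<integral>\<^sup>+\<omega>. (\<Sum>i. if i \<in> pts \<omega> then h (del i \<omega>, X i \<omega>) else 0) \<partial>P)"
  using nn_integral_point_pairs[OF assms] by (simp add: mecke)

text \<open>Since the Mecke equation is an equality of measures, it transfers to signed integrands
  directly, without splitting them into positive and negative parts.\<close>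

corollary mecke_integral:
  fixes h :: "'a measure \<times> 'a \<Rightarrow> real"
  assumes h: "integrable QL h"
  shows "(\<integral>p. h p \<partial>QL)
    = (\<integral>\<omega>. (\<integral>i. (if i \<in> pts \<omega> then h (del i \<omega>, X i \<omega>) else 0) \<partial>count_space UNIV) \<partial>P)"
proof -
  interpret C: sigma_finite_measure "count_space (UNIV :: nat set)"
    by (rule sigma_finite_measure_count_space)
  interpret PC: pair_sigma_finite P "count_space (UNIV :: nat set)" ..
  have [measurable]: "h \<in> borel_measurable (N \<Otimes>\<^sub>M lam)"
    using borel_measurable_integrable[OF h]
    by (simp add: measurable_cong_sets[OF sets_pair_measure_cong[of Q N lam lam] refl])
  let ?g = "\<lambda>p. (if snd p \<in> pts (fst p) then 1 else 0 :: real)"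
  let ?T = "\<lambda>p. (del (snd p) (fst p), X (snd p) (fst p))"
  have pp: "point_pairs = distr (density (P \<Otimes>\<^sub>M count_space UNIV) (\<lambda>p. ennreal (?g p))) (N \<Otimes>\<^sub>M lam) ?T"
    unfolding point_pairs_def by (intro arg_cong[where f="\<lambda>g. distr (density _ g) _ _"]) auto
  have T: "?T \<in> measurable (density (P \<Otimes>\<^sub>M count_space UNIV) (\<lambda>p. ennreal (?g p))) (N \<Otimes>\<^sub>M lam)"
    using measurable_points by simp
  have int: "integrable (P \<Otimes>\<^sub>M count_space UNIV) (\<lambda>p. ?g p *\<^sub>R h (?T p))"
    using h unfolding mecke[symmetric] pp
    by (subst (asm) integrable_distr_eq[OF T]) (auto simp: integrable_density)
  have "(\<integral>p. h p \<partial>QL) = (\<integral>p. ?g p *\<^sub>R h (?T p) \<partial>(P \<Otimes>\<^sub>M count_space UNIV))"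
    unfolding mecke[symmetric] pp
    by (subst integral_distr[OF T]) (auto simp: integral_density)
  also have "\<dots> = (\<integral>\<omega>. (\<integral>i. ?g (\<omega>, i) *\<^sub>R h (?T (\<omega>, i)) \<partial>count_space UNIV) \<partial>P)"
    by (rule PC.integral_fst'[OF int, symmetric])
  also have "\<dots> = (\<integral>\<omega>. (\<integral>i. (if i \<in> pts \<omega> then h (del i \<omega>, X i \<omega>) else 0) \<partial>count_space UNIV) \<partial>P)"
    by (intro Bochner_Integration.integral_cong refl) auto
  finally show ?thesis .
qed

end

section \<open>Factorial measures of product functions as functionals of the process\<close>

lemma measurable_nn_integral_int_measure_space:
  assumes "h \<in> borel_measurable lam"
  shows "(\<lambda>\<mu>. \<integral>\<^sup>+y. h y \<partial>\<mu>) \<in> borel_measurable (int_measure_space lam)"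
  using assms
proof (induction rule: borel_measurable_induct)
  case (cong f g)
  have "(\<integral>\<^sup>+y. f y \<partial>\<mu>) = (\<integral>\<^sup>+y. g y \<partial>\<mu>)" if "\<mu> \<in> space (int_measure_space lam)" for \<mu>
    using that cong(3) by (intro nn_integral_cong) (auto simp: space_int_measure_space int_measuresD)
  then show ?case using cong(4) by (simp cong: measurable_cong)
next
  case (set A)
  have "(\<integral>\<^sup>+y. indicator A y \<partial>\<mu>) = emeasure \<mu> A" if "\<mu> \<in> space (int_measure_space lam)" for \<mu>
    using that set by (intro nn_integral_indicator) (auto simp: space_int_measure_space int_measuresD)
  then show ?case
    using measurable_emeasure_int_measure_space[OF set] by (simp cong: measurable_cong)
next
  case (mult u c)
  have "(\<integral>\<^sup>+y. c * u y \<partial>\<mu>) = c * (\<integral>\<^sup>+y. u y \<partial>\<mu>)" if "\<mu> \<in> space (int_measure_space lam)" for \<mu>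
    using that mult by (intro nn_integral_cmult)
      (auto simp: space_int_measure_space int_measuresD cong: measurable_cong_sets)
  then show ?case using mult by (simp cong: measurable_cong)
next
  case (add u v)
  have "(\<integral>\<^sup>+y. v y + u y \<partial>\<mu>) = (\<integral>\<^sup>+y. v y \<partial>\<mu>) + (\<integral>\<^sup>+y. u y \<partial>\<mu>)"
    if "\<mu> \<in> space (int_measure_space lam)" for \<mu>
    using that add by (intro nn_integral_add)
      (auto simp: space_int_measure_space int_measuresD cong: measurable_cong_sets)
  then show ?case using add by (simp cong: measurable_cong)
next
  case (seq U)
  have "(\<integral>\<^sup>+y. (SUP i. U i) y \<partial>\<mu>) = (SUP i. \<integral>\<^sup>+y. U i y \<partial>\<mu>)"
    if "\<mu> \<in> space (int_measure_space lam)" for \<mu>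
    unfolding SUP_apply using that seq by (intro nn_integral_monotone_convergence_SUP)
      (auto simp: space_int_measure_space int_measuresD cong: measurable_cong_sets)
  then show ?case using seq by (simp cong: measurable_cong)
qed

text \<open>The integral of \<open>h\<close> as a function of the measure, in a form that is visibly measurable.\<close>

definition linear_functional :: "('a \<Rightarrow> real) \<Rightarrow> 'a measure \<Rightarrow> real" where
  "linear_functional h \<mu> = enn2real (\<integral>\<^sup>+y. ennreal (h y) \<partial>\<mu>) - enn2real (\<integral>\<^sup>+y. ennreal (- h y) \<partial>\<mu>)"

lemma measurable_linear_functional [measurable]:
  assumes [measurable]: "h \<in> borel_measurable lam"
  shows "linear_functional h \<in> borel_measurable (int_measure_space lam)"
proof -
  have [measurable]: "(\<lambda>\<mu>. \<integral>\<^sup>+y. ennreal (h y) \<partial>\<mu>) \<in> borel_measurable (int_measure_space lam)"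
    "(\<lambda>\<mu>. \<integral>\<^sup>+y. ennreal (- h y) \<partial>\<mu>) \<in> borel_measurable (int_measure_space lam)"
    by (intro measurable_nn_integral_int_measure_space; measurable)+
  show ?thesis unfolding linear_functional_def[abs_def] by measurable
qed

lemma linear_functional_points:
  assumes [measurable]: "h \<in> borel_measurable lam" and x: "x \<in> I \<rightarrow> space lam"
    and B: "finite {i \<in> I. x i \<in> B}" "\<And>y. y \<in> space lam \<Longrightarrow> y \<notin> B \<Longrightarrow> h y = 0"
  shows "linear_functional h (distr (count_space I) lam x) = (\<Sum>i\<in>{i \<in> I. x i \<in> B}. h (x i))"
proof -
  have *: "(\<integral>\<^sup>+y. ennreal (g y) \<partial>distr (count_space I) lam x) = ennreal (\<Sum>i\<in>{i \<in> I. x i \<in> B}. max 0 (g (x i)))"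
    if [measurable]: "g \<in> borel_measurable lam" and g: "\<And>y. y \<in> space lam \<Longrightarrow> y \<notin> B \<Longrightarrow> g y = 0" for g
  proof -
    have "(\<integral>\<^sup>+y. ennreal (g y) \<partial>distr (count_space I) lam x) = (\<integral>\<^sup>+i. ennreal (g (x i)) \<partial>count_space I)"
      using x by (subst nn_integral_distr) auto
    also have "\<dots> = (\<Sum>i\<in>{i \<in> I. x i \<in> B}. ennreal (g (x i)))"
      using B x g by (intro nn_integral_count_space') (auto simp: Pi_iff)
    also have "\<dots> = (\<Sum>i\<in>{i \<in> I. x i \<in> B}. ennreal (max 0 (g (x i))))"
      by (intro sum.cong refl) (auto simp: max_def ennreal_neg)
    also have "\<dots> = ennreal (\<Sum>i\<in>{i \<in> I. x i \<in> B}. max 0 (g (x i)))"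
      by (rule sum_ennreal) auto
    finally show ?thesis .
  qed
  have "linear_functional h (distr (count_space I) lam x)
     = (\<Sum>i\<in>{i \<in> I. x i \<in> B}. max 0 (h (x i))) - (\<Sum>i\<in>{i \<in> I. x i \<in> B}. max 0 (- h (x i)))"
    unfolding linear_functional_def using B(2) by (subst (1 2) *) (auto simp: sum_nonneg)
  also have "\<dots> = (\<Sum>i\<in>{i \<in> I. x i \<in> B}. h (x i))"
    unfolding sum_subtractf[symmetric] by (intro sum.cong) auto
  finally show ?thesis .
qed

text \<open>The quantifiers over \<open>I\<close> and \<open>x\<close> make the value independent of
  the enumeration of the points, so one functional can be evaluated at the process, after removal
  and after addition of a point. The quantifier over \<open>B\<close> allows any set that carries
  the factors and contains finitely many points.\<close>

definition represents_tuple_sum ::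
    "'a measure \<Rightarrow> nat set \<Rightarrow> (nat \<Rightarrow> 'a \<Rightarrow> real) \<Rightarrow> ('a measure \<Rightarrow> real) \<Rightarrow> bool" where
  "represents_tuple_sum lam J g F \<longleftrightarrow> F \<in> borel_measurable (int_measure_space lam) \<and>
     (\<forall>B (I :: nat set) x. x \<in> I \<rightarrow> space lam \<longrightarrow> finite {i \<in> I. x i \<in> B} \<longrightarrow>
        (\<forall>j\<in>J. \<forall>y\<in>space lam. y \<notin> B \<longrightarrow> g j y = 0) \<longrightarrow>
        F (distr (count_space I) lam x) = tuple_sum {i \<in> I. x i \<in> B} J (\<lambda>j i. g j (x i)))"

lemma represents_tuple_sumD:
  fixes I :: "nat set"
  assumes "represents_tuple_sum lam J g F" "x \<in> I \<rightarrow> space lam" "finite {i \<in> I. x i \<in> B}"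
    and "\<And>j y. j \<in> J \<Longrightarrow> y \<in> space lam \<Longrightarrow> y \<notin> B \<Longrightarrow> g j y = 0"
  shows "F (distr (count_space I) lam x) = tuple_sum {i \<in> I. x i \<in> B} J (\<lambda>j i. g j (x i))"
  using assms(1)[unfolded represents_tuple_sum_def, THEN conjunct2, rule_format, OF assms(2,3)] assms(4)
  by simp

text \<open>Recursion along \<open>tuple_sum_insert_diagonal\<close>: the plain sum becomes
  \<open>linear_functional (g j)\<close>, and the merged terms are represented by the induction
  hypothesis for the factor \<open>g k\<close> times \<open>g j\<close>, which still vanishes
  outside \<open>B\<close>.\<close>

lemma represents_tuple_sum_exists:
  assumes "finite J" "\<And>j. j \<in> J \<Longrightarrow> g j \<in> borel_measurable lam"
  shows "\<exists>F. represents_tuple_sum lam J g F"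
  using assms
proof (induction J arbitrary: g rule: finite_induct)
  case empty
  have "represents_tuple_sum lam {} g (\<lambda>_. 1)" for g
    by (simp add: represents_tuple_sum_def)
  then show ?case by blast
next
  case (insert j J)
  let ?g = "\<lambda>k. g(k := \<lambda>y. g k y * g j y)"
  obtain F where F: "represents_tuple_sum lam J g F" using insert by blast
  have "\<exists>F. represents_tuple_sum lam J (?g k) F" if "k \<in> J" for k
    using insert.prems that by (intro insert.IH) auto
  then obtain G where G: "represents_tuple_sum lam J (?g k) (G k)" if "k \<in> J" for k by metis
  let ?F = "\<lambda>\<mu>. linear_functional (g j) \<mu> * F \<mu> - (\<Sum>k\<in>J. G k \<mu>)"
  have "represents_tuple_sum lam (insert j J) g ?F"
    unfolding represents_tuple_sum_def
  proof (intro conjI allI impI)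
    have [measurable]: "F \<in> borel_measurable (int_measure_space lam)"
      "\<And>k. k \<in> J \<Longrightarrow> G k \<in> borel_measurable (int_measure_space lam)" "g j \<in> borel_measurable lam"
      using F G insert.prems by (auto simp: represents_tuple_sum_def)
    show "?F \<in> borel_measurable (int_measure_space lam)" by measurable
  next
    fix B and I :: "nat set" and x
    assume x: "x \<in> I \<rightarrow> space lam" and fin: "finite {i \<in> I. x i \<in> B}"
      and z: "\<forall>j\<in>insert j J. \<forall>y\<in>space lam. y \<notin> B \<longrightarrow> g j y = 0"
    let ?I = "{i \<in> I. x i \<in> B}" and ?\<mu> = "distr (count_space I) lam x"
    have 1: "linear_functional (g j) ?\<mu> = (\<Sum>i\<in>?I. g j (x i))"
      using z insert.prems by (intro linear_functional_points x fin) auto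
    have 2: "F ?\<mu> = tuple_sum ?I J (\<lambda>j i. g j (x i))"
      using z by (intro represents_tuple_sumD[OF F x fin]) auto
    have 3: "G k ?\<mu> = tuple_sum ?I J ((\<lambda>j i. g j (x i))(k := \<lambda>i. g k (x i) * g j (x i)))" if "k \<in> J" for k
    proof -
      have "G k ?\<mu> = tuple_sum ?I J (\<lambda>l i. ?g k l (x i))"
        using z that by (intro represents_tuple_sumD[OF G[OF that] x fin]) auto
      also have "\<dots> = tuple_sum ?I J ((\<lambda>j i. g j (x i))(k := \<lambda>i. g k (x i) * g j (x i)))"
        by (rule tuple_sum_cong) auto
      finally show ?thesis .
    qed
    show "?F ?\<mu> = tuple_sum ?I (insert j J) (\<lambda>j i. g j (x i))"
      using insert.hyps fin by (simp add: tuple_sum_insert_diagonal 1 2 3)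
  qed
  then show ?case by blast
qed

text \<open>The choice is harmless: at point measures with finitely many points in a set carrying
  the factors the value is prescribed, and these are the only places where it is evaluated.
  Elsewhere just measurability matters.\<close>

definition factorial_functional ::
    "'a measure \<Rightarrow> nat set \<Rightarrow> (nat \<Rightarrow> 'a \<Rightarrow> real) \<Rightarrow> 'a measure \<Rightarrow> real" where
  "factorial_functional lam J g = (SOME F. represents_tuple_sum lam J g F)"

lemma represents_factorial_functional:
  assumes "finite J" "\<And>j. j \<in> J \<Longrightarrow> g j \<in> borel_measurable lam"
  shows "represents_tuple_sum lam J g (factorial_functional lam J g)"
  unfolding factorial_functional_def using represents_tuple_sum_exists[OF assms] by (rule someI_ex)

text \<open>\<open>wick_functional lam {..<n} g\<close> is the multiple integral \<open>I\<^sub>n(g)\<close> of a product form as a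
  function of the realization of the process.\<close>

definition wick_functional ::
    "'a measure \<Rightarrow> nat set \<Rightarrow> (nat \<Rightarrow> 'a \<Rightarrow> real) \<Rightarrow> 'a measure \<Rightarrow> real" where
  "wick_functional lam J g \<mu> = (\<Sum>K\<in>Pow J. (-1) ^ (card J - card K) *
     factorial_functional lam K g \<mu> * (\<Prod>j\<in>J - K. \<integral>y. g j y \<partial>lam))"

lemma wick_functional_empty [simp]:
  "wick_functional lam {} g \<mu> = factorial_functional lam {} g \<mu>"
  by (simp add: wick_functional_def)

text \<open>Quantitative form of \<open>admissible_factor\<close> with the set and the bound
  exposed, so that one pair \<open>B\<close>, \<open>c\<close> can serve a whole family of
  factors.\<close>

definition supported_in :: "'a measure \<Rightarrow> 'a set \<Rightarrow> real \<Rightarrow> ('a \<Rightarrow> real) \<Rightarrow> bool" where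
  "supported_in lam B c h \<longleftrightarrow> h \<in> borel_measurable lam \<and> (\<forall>y\<in>space lam. \<bar>h y\<bar> \<le> c) \<and>
     (\<forall>y\<in>space lam. y \<notin> B \<longrightarrow> h y = 0)"

lemma supported_inD:
  assumes "supported_in lam B c h"
  shows "h \<in> borel_measurable lam" "y \<in> space lam \<Longrightarrow> \<bar>h y\<bar> \<le> c"
    "y \<in> space lam \<Longrightarrow> y \<notin> B \<Longrightarrow> h y = 0"
  using assms by (auto simp: supported_in_def)

lemma supported_in_mono:
  assumes "supported_in lam B c h" "B \<subseteq> B'" "c \<le> c'"
  shows "supported_in lam B' c' h"
  using assms by (fastforce simp: supported_in_def)

lemma supported_in_integrable:
  assumes "supported_in lam B c h" "B \<in> sets lam" "emeasure lam B < \<infinity>"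
  shows "integrable lam h"
proof (rule Bochner_Integration.integrable_bound)
  show "integrable lam (\<lambda>y. c * indicator B y)"
    using assms by simp
  show "AE y in lam. norm (h y) \<le> norm (c * indicator B y)"
  proof (rule AE_I2)
    fix y assume y: "y \<in> space lam"
    have "\<bar>h y\<bar> \<le> c" "y \<notin> B \<Longrightarrow> h y = 0" using supported_inD[OF assms(1)] y by auto
    then show "norm (h y) \<le> norm (c * indicator B y)"
      by (cases "y \<in> B") auto
  qed
qed (use supported_inD[OF assms(1)] in auto)

lemma common_support:
  fixes g :: "'i \<Rightarrow> 'a \<Rightarrow> real"
  assumes "finite A" "\<And>i. i \<in> A \<Longrightarrow> admissible_factor lam (g i)"
  shows "\<exists>B c. B \<in> sets lam \<and> emeasure lam B < \<infinity> \<and> 0 \<le> c \<and> (\<forall>i\<in>A. supported_in lam B c (g i))"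
  using assms
proof (induction A rule: finite_induct)
  case empty
  then show ?case by (intro exI[of _ "{}"] exI[of _ 0]) auto
next
  case (insert i A)
  then obtain B c where B: "B \<in> sets lam" "emeasure lam B < \<infinity>" "0 \<le> c"
    "\<forall>i\<in>A. supported_in lam B c (g i)" by auto
  have "admissible_factor lam (g i)" using insert by auto
  then obtain B' c' where B': "B' \<in> sets lam" "emeasure lam B' < \<infinity>" "\<forall>y\<in>space lam. \<bar>g i y\<bar> \<le> c'"
    "\<forall>y\<in>space lam - B'. g i y = 0" "g i \<in> borel_measurable lam"
    unfolding admissible_factor_def by auto
  have "supported_in lam B' c' (g i)" using B' by (auto simp: supported_in_def)
  then have "supported_in lam (B \<union> B') (max c c') (g i)" by (rule supported_in_mono) auto
  moreover have "supported_in lam (B \<union> B') (max c c') (g k)" if "k \<in> A" for k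
    using bspec[OF B(4) that] by (rule supported_in_mono) auto
  moreover have "emeasure lam (B \<union> B') < \<infinity>"
    using emeasure_subadditive[OF B(1) B'(1)] B(2) B'(2)
    by (metis ennreal_add_less_top infinity_ennreal_def le_less_trans)
  ultimately show ?case using B B'
    by (intro exI[of _ "B \<union> B'"] exI[of _ "max c c'"]) auto
qed

lemma supported_in_admissible:
  "supported_in lam B c h \<Longrightarrow> B \<in> sets lam \<Longrightarrow> emeasure lam B < \<infinity> \<Longrightarrow> admissible_factor lam h"
  unfolding admissible_factor_def supported_in_def by blast

lemma measurable_factorial_functional [measurable]:
  assumes "finite J" "\<And>j. j \<in> J \<Longrightarrow> g j \<in> borel_measurable lam"
  shows "factorial_functional lam J g \<in> borel_measurable (int_measure_space lam)"
  using represents_factorial_functional[OF assms] by (simp add: represents_tuple_sum_def)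

lemma measurable_wick_functional [measurable]:
  assumes "finite J" "\<And>j. j \<in> J \<Longrightarrow> g j \<in> borel_measurable lam"
  shows "wick_functional lam J g \<in> borel_measurable (int_measure_space lam)"
proof -
  have [measurable]: "factorial_functional lam K g \<in> borel_measurable (int_measure_space lam)" if "K \<in> Pow J" for K
    using assms that by (intro measurable_factorial_functional) (auto intro: finite_subset)
  show ?thesis unfolding wick_functional_def[abs_def] by measurable
qed

section \<open>Evaluation at the process and after removing or adding a point\<close>

context poisson_points
begin

definition pts_in :: "'a set \<Rightarrow> 'w \<Rightarrow> nat set" where
  "pts_in B \<omega> = {i \<in> pts \<omega>. X i \<omega> \<in> B}"

lemma AE_finite_pts_in:
  assumes "B \<in> sets lam" "emeasure lam B < \<infinity>"
  shows "AE \<omega> in P. finite (pts_in B \<omega>)"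
  using poisson_AE_nat[OF poisson_emeasure[OF assms(1)] assms(2)] AE_space
proof eventually_elim
  fix \<omega> assume "emeasure (\<eta> \<omega>) B \<in> range of_nat" "\<omega> \<in> space P"
  moreover have "emeasure (\<eta> \<omega>) B = emeasure (count_space UNIV) (pts_in B \<omega>)" if "\<omega> \<in> space P"
    unfolding pts_in_def using X_space assms that
    by (subst eta_points[OF that], subst emeasure_points) auto
  ultimately show "finite (pts_in B \<omega>)"
    by (auto simp: emeasure_count_space split: if_splits)
qed

lemma measure_eta_pts_in:
  assumes "\<omega> \<in> space P" "B \<in> sets lam"
  shows "measure (\<eta> \<omega>) B = real (card (pts_in B \<omega>))"
proof -
  have "emeasure (\<eta> \<omega>) B = emeasure (count_space UNIV) (pts_in B \<omega>)"
    unfolding pts_in_def using X_space assms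
    by (subst eta_points[OF assms(1)], subst emeasure_points) auto
  then show ?thesis by (auto simp: measure_def emeasure_count_space enn2real_eq_posreal_iff
      ennreal_of_nat_eq_real_of_nat)
qed

text \<open>The three formulas read the same representation along three lists of points. The last
  one combines this with the rule that a new point occupies at most one coordinate.\<close>

lemma
  assumes w: "\<omega> \<in> space P" and fin: "finite (pts_in B \<omega>)" and J: "finite J"
    and g: "\<And>j. j \<in> J \<Longrightarrow> supported_in lam B c (g j)"
  shows factorial_functional_eta:
      "factorial_functional lam J g (\<eta> \<omega>) = tuple_sum (pts_in B \<omega>) J (\<lambda>j i. g j (X i \<omega>))"
    and factorial_functional_del:
      "factorial_functional lam J g (del i \<omega>) = tuple_sum (pts_in B \<omega> - {i}) J (\<lambda>j i. g j (X i \<omega>))"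
    and factorial_functional_add:
      "y \<in> space lam \<Longrightarrow> factorial_functional lam J g (add_point (\<eta> \<omega>) y)
        = factorial_functional lam J g (\<eta> \<omega>) + (\<Sum>j\<in>J. g j y * factorial_functional lam (J - {j}) g (\<eta> \<omega>))"
proof -
  have R: "factorial_functional lam K g (distr (count_space I) lam x) = tuple_sum {i \<in> I. x i \<in> B} K (\<lambda>j i. g j (x i))"
    if "x \<in> I \<rightarrow> space lam" "finite {i \<in> I. x i \<in> B}" "K \<subseteq> J" for I :: "nat set" and x K
  proof -
    have "finite K" using that J by (auto intro: finite_subset)
    moreover have "g j \<in> borel_measurable lam" if "j \<in> K" for j
      using g supported_inD(1) that \<open>K \<subseteq> J\<close> by blast
    ultimately have "represents_tuple_sum lam K g (factorial_functional lam K g)"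
      by (rule represents_factorial_functional)
    then show ?thesis
    proof (rule represents_tuple_sumD[OF _ that(1,2)])
      fix j y assume "j \<in> K" "y \<in> space lam" "y \<notin> B"
      then show "g j y = 0" using supported_inD(3)[OF g[of j]] that(3) by auto
    qed
  qed
  have eta: "factorial_functional lam K g (\<eta> \<omega>) = tuple_sum (pts_in B \<omega>) K (\<lambda>j i. g j (X i \<omega>))" if "K \<subseteq> J" for K
    using R[of "\<lambda>i. X i \<omega>" "pts \<omega>" K] that X_space w fin
    by (subst eta_points[OF w]) (auto simp: pts_in_def)
  show "factorial_functional lam J g (\<eta> \<omega>) = tuple_sum (pts_in B \<omega>) J (\<lambda>j i. g j (X i \<omega>))"
    by (rule eta) simp
  have e: "{k \<in> pts \<omega> - {i}. X k \<omega> \<in> B} = pts_in B \<omega> - {i}" by (auto simp: pts_in_def)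
  show "factorial_functional lam J g (del i \<omega>) = tuple_sum (pts_in B \<omega> - {i}) J (\<lambda>j i. g j (X i \<omega>))"
    using R[of "\<lambda>i. X i \<omega>" "pts \<omega> - {i}" J] X_space w fin
    unfolding del_def e by simp
  assume y: "y \<in> space lam"
  \<comment> \<open>The added point takes index 0 and the old points move up by one, so that the
    index sets do not collide even when infinitely many points are present.\<close>
  let ?x = "case_nat y (\<lambda>i. X i \<omega>)" and ?I = "insert 0 (Suc ` pts \<omega>)"
  have x: "?x \<in> ?I \<rightarrow> space lam" using y X_space w by auto
  have "add_point (\<eta> \<omega>) y = distr (count_space ?I) lam ?x"
  proof (rule measure_eqI)
    show "sets (add_point (\<eta> \<omega>) y) = sets (distr (count_space ?I) lam ?x)"
      using int_measuresD(1)[OF add_point_in_int_measures[OF eta_int[OF w]]] by simp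
    fix A assume "A \<in> sets (add_point (\<eta> \<omega>) y)"
    then have A: "A \<in> sets lam"
      using int_measuresD(1)[OF add_point_in_int_measures[OF eta_int[OF w]]] by simp
    have "(\<Sum>i. if i \<in> ?I then indicator A (?x i) else 0)
      = (\<Sum>i. if Suc i \<in> ?I then indicator A (?x (Suc i)) else 0) + (if 0 \<in> ?I then indicator A (?x 0) else (0::ennreal))"
      by (subst suminf_offset[of _ 1]) (auto cong: if_cong)
    also have "\<dots> = emeasure (\<eta> \<omega>) A + indicator A y"
      by (auto simp: emeasure_eta_sum[OF w A] intro!: suminf_cong)
    finally show "emeasure (add_point (\<eta> \<omega>) y) A = emeasure (distr (count_space ?I) lam ?x) A"
      by (simp add: emeasure_points_nat[OF x A] emeasure_add_point[OF eta_int[OF w] A])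
  qed
  moreover have I: "{i \<in> ?I. ?x i \<in> B} = (if y \<in> B then insert 0 (Suc ` pts_in B \<omega>) else Suc ` pts_in B \<omega>)"
    by (auto simp: pts_in_def)
  ultimately have 1: "factorial_functional lam J g (add_point (\<eta> \<omega>) y)
      = tuple_sum (if y \<in> B then insert 0 (Suc ` pts_in B \<omega>) else Suc ` pts_in B \<omega>) J (\<lambda>j i. g j (?x i))"
    using R[OF x, of J] fin by (simp split: if_splits)
  have 2: "tuple_sum (Suc ` pts_in B \<omega>) K (\<lambda>j i. g j (?x i)) = factorial_functional lam K g (\<eta> \<omega>)"
    if "K \<subseteq> J" for K
    using eta[OF that] by (subst tuple_sum_reindex) auto
  have g0: "g j y = 0" if "j \<in> J" "y \<notin> B" for j
    using supported_inD(3)[OF g[OF that(1)] y that(2)] .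
  show "factorial_functional lam J g (add_point (\<eta> \<omega>) y)
      = factorial_functional lam J g (\<eta> \<omega>) + (\<Sum>j\<in>J. g j y * factorial_functional lam (J - {j}) g (\<eta> \<omega>))"
  proof (cases "y \<in> B")
    case True
    have "tuple_sum (insert 0 (Suc ` pts_in B \<omega>)) J (\<lambda>j i. g j (?x i))
      = tuple_sum (Suc ` pts_in B \<omega>) J (\<lambda>j i. g j (?x i))
        + (\<Sum>j\<in>J. g j (?x 0) * tuple_sum (Suc ` pts_in B \<omega>) (J - {j}) (\<lambda>j i. g j (?x i)))"
      using fin J by (intro tuple_sum_insert_point) auto
    then show ?thesis using True by (simp add: 1 2)
  next
    case False
    then show ?thesis using g0 by (simp add: 1 2)
  qed
qed

text \<open>Pathwise preparation for the Mecke equation: the right-hand side is a sum over points of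
  a function of the remaining configuration and the position of the removed point.\<close>

lemma factorial_functional_insert:
  assumes w: "\<omega> \<in> space P" and fin: "finite (pts_in B \<omega>)" and J: "finite J" "j \<notin> J"
    and g: "\<And>k. k \<in> insert j J \<Longrightarrow> supported_in lam B c (g k)"
  shows "factorial_functional lam (insert j J) g (\<eta> \<omega>)
    = (\<Sum>i\<in>pts_in B \<omega>. g j (X i \<omega>) * factorial_functional lam J g (del i \<omega>))"
proof -
  have "factorial_functional lam J g (del i \<omega>) = tuple_sum (pts_in B \<omega> - {i}) J (\<lambda>j i. g j (X i \<omega>))" for i
    using factorial_functional_del[OF w fin J(1), of c g i] g by blast
  moreover have "factorial_functional lam (insert j J) g (\<eta> \<omega>) = tuple_sum (pts_in B \<omega>) (insert j J) (\<lambda>j i. g j (X i \<omega>))"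
    by (rule factorial_functional_eta[OF w fin]) (use J g in auto)
  ultimately show ?thesis using tuple_sum_insert[OF fin J] by simp
qed

text \<open>The rule D_y I(g) = sum over j of g_j(y) I(g without g_j). Each factorial term of the
  alternating sum obeys it by \<open>factorial_functional_add\<close>, and interchanging the sums
  over subsets and over their elements reassembles the integrals of lower order.\<close>

lemma wick_functional_add:
  assumes w: "\<omega> \<in> space P" and fin: "finite (pts_in B \<omega>)" and J: "finite J"
    and g: "\<And>j. j \<in> J \<Longrightarrow> supported_in lam B c (g j)" and y: "y \<in> space lam"
  shows "wick_functional lam J g (add_point (\<eta> \<omega>) y)
    = wick_functional lam J g (\<eta> \<omega>) + (\<Sum>j\<in>J. g j y * wick_functional lam (J - {j}) g (\<eta> \<omega>))"
proof -
  let ?c = "\<lambda>K. (-1) ^ (card J - card K) * (\<Prod>j\<in>J - K. \<integral>y. g j y \<partial>lam) :: real"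
  let ?f = "\<lambda>K. factorial_functional lam K g (\<eta> \<omega>)"
  have fK: "finite K" if "K \<in> Pow J" for K using that J by (auto intro: finite_subset)
  have ff: "factorial_functional lam K g (add_point (\<eta> \<omega>) y)
      = ?f K + (\<Sum>j\<in>K. g j y * ?f (K - {j}))" if "K \<in> Pow J" for K
    by (rule factorial_functional_add[OF w fin]) (use fK that g y in auto)
  have "(\<Sum>K\<in>Pow J. ?c K * (\<Sum>j\<in>K. g j y * ?f (K - {j})))
     = (\<Sum>K\<in>Pow J. \<Sum>j\<in>K. ?c K * (g j y * ?f (K - {j})))"
    by (simp add: sum_distrib_left)
  also have "\<dots> = (\<Sum>(K, j)\<in>(SIGMA K:Pow J. K). ?c K * (g j y * ?f (K - {j})))"
    using J fK by (intro sum.Sigma) auto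
  also have "\<dots> = (\<Sum>(j, K)\<in>(SIGMA j:J. Pow (J - {j})). g j y * ((-1) ^ (card (J - {j}) - card K) * ?f K * (\<Prod>j\<in>J - {j} - K. \<integral>y. g j y \<partial>lam)))"
  \<comment> \<open>A subset \<open>K\<close> containing \<open>j\<close> corresponds to
    \<open>K - {j}\<close> in \<open>J - {j}\<close>. Both cardinalities in the exponent of the sign
    drop by one and the complement stays the same, so the coefficients agree.\<close>
  proof (rule sum.reindex_bij_witness[of _ "\<lambda>(j, K). (insert j K, j)" "\<lambda>(K, j). (j, K - {j})"])
    fix p assume p: "p \<in> (SIGMA K:Pow J. K)"
    then obtain K j where K: "p = (K, j)" "K \<subseteq> J" "j \<in> K" by auto
    have "J - {j} - (K - {j}) = J - K" using K by auto
    moreover have "card (J - {j}) - card (K - {j}) = card J - card K"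
    proof -
      have "finite K" using K J by (auto intro: finite_subset)
      then show ?thesis using K J card_gt_0_iff[of K] by (auto simp: card_Diff_singleton)
    qed
    ultimately show "(case (case p of (K, j) \<Rightarrow> (j, K - {j})) of (j, K) \<Rightarrow> g j y * ((-1) ^ (card (J - {j}) - card K) * ?f K * (\<Prod>j\<in>J - {j} - K. \<integral>y. g j y \<partial>lam)))
      = (case p of (K, j) \<Rightarrow> ?c K * (g j y * ?f (K - {j})))"
      using K by (simp add: mult_ac)
  qed auto
  also have "\<dots> = (\<Sum>j\<in>J. \<Sum>K\<in>Pow (J - {j}). g j y * ((-1) ^ (card (J - {j}) - card K) * ?f K * (\<Prod>j\<in>J - {j} - K. \<integral>y. g j y \<partial>lam)))"
    using J by (intro sum.Sigma[symmetric]) auto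
  also have "\<dots> = (\<Sum>j\<in>J. g j y * wick_functional lam (J - {j}) g (\<eta> \<omega>))"
    by (simp add: wick_functional_def sum_distrib_left)
  finally have *: "(\<Sum>K\<in>Pow J. ?c K * (\<Sum>j\<in>K. g j y * ?f (K - {j})))
    = (\<Sum>j\<in>J. g j y * wick_functional lam (J - {j}) g (\<eta> \<omega>))" .
  have "wick_functional lam J g (add_point (\<eta> \<omega>) y)
     = (\<Sum>K\<in>Pow J. ?c K * ?f K + ?c K * (\<Sum>j\<in>K. g j y * ?f (K - {j})))"
    unfolding wick_functional_def
    by (intro sum.cong refl) (simp add: ff algebra_simps)
  also have "\<dots> = wick_functional lam J g (\<eta> \<omega>) + (\<Sum>j\<in>J. g j y * wick_functional lam (J - {j}) g (\<eta> \<omega>))"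
    unfolding sum.distrib * by (simp add: wick_functional_def mult_ac)
  finally show ?thesis .
qed

text \<open>The subsets with and without \<open>j\<close> are paired; they carry opposite signs.
  What remains for each \<open>K\<close> is a factorial term with one more point minus its
  compensator, the difference that integration by parts turns into D_y.\<close>

lemma wick_functional_insert:
  assumes J: "finite J" "j \<notin> J"
  shows "wick_functional lam (insert j J) g \<mu>
    = (\<Sum>K\<in>Pow J. (-1) ^ (card J - card K) *
        (factorial_functional lam (insert j K) g \<mu> - (\<integral>y. g j y \<partial>lam) * factorial_functional lam K g \<mu>)
        * (\<Prod>j\<in>J - K. \<integral>y. g j y \<partial>lam))"
proof -
  let ?t = "\<lambda>K. (-1) ^ (card (insert j J) - card K) * factorial_functional lam K g \<mu> * (\<Prod>j\<in>insert j J - K. \<integral>y. g j y \<partial>lam)"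
  have "wick_functional lam (insert j J) g \<mu> = (\<Sum>K\<in>Pow J. ?t K) + (\<Sum>K\<in>insert j ` Pow J. ?t K)"
    unfolding wick_functional_def Pow_insert using J by (intro sum.union_disjoint) auto
  also have "(\<Sum>K\<in>insert j ` Pow J. ?t K) = (\<Sum>K\<in>Pow J. ?t (insert j K))"
    using J by (intro sum.reindex[unfolded comp_def]) (auto simp: inj_on_def)
  also have "(\<Sum>K\<in>Pow J. ?t K) + (\<Sum>K\<in>Pow J. ?t (insert j K)) = (\<Sum>K\<in>Pow J. ?t K + ?t (insert j K))"
    by (rule sum.distrib[symmetric])
  also have "\<dots> = (\<Sum>K\<in>Pow J. (-1) ^ (card J - card K) *
        (factorial_functional lam (insert j K) g \<mu> - (\<integral>y. g j y \<partial>lam) * factorial_functional lam K g \<mu>)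
        * (\<Prod>j\<in>J - K. \<integral>y. g j y \<partial>lam))"
  proof (intro sum.cong refl)
    fix K assume K: "K \<in> Pow J"
    then have "finite K" "j \<notin> K" using J by (auto intro: finite_subset)
    have "card K \<le> card J" using K J by (auto intro: card_mono)
    then have 1: "card (insert j J) - card K = Suc (card J - card K)"
      "card (insert j J) - card (insert j K) = card J - card K"
      using J \<open>finite K\<close> \<open>j \<notin> K\<close> by auto
    have 2: "insert j J - insert j K = J - K" "insert j J - K = insert j (J - K)" using J \<open>j \<notin> K\<close> by auto
    have 3: "(\<Prod>j\<in>insert j (J - K). \<integral>y. g j y \<partial>lam) = (\<integral>y. g j y \<partial>lam) * (\<Prod>j\<in>J - K. \<integral>y. g j y \<partial>lam)"
      using J by simp
    show "?t K + ?t (insert j K) = (-1) ^ (card J - card K) *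
        (factorial_functional lam (insert j K) g \<mu> - (\<integral>y. g j y \<partial>lam) * factorial_functional lam K g \<mu>)
        * (\<Prod>j\<in>J - K. \<integral>y. g j y \<partial>lam)"
      unfolding 1 2 3 by (simp add: algebra_simps)
  qed
  finally show ?thesis .
qed

end

section \<open>Integration by parts for factorial measures\<close>

lemma power_le_fact_exp: "0 \<le> (x::real) \<Longrightarrow> x ^ k \<le> fact k * exp x"
proof -
  assume x: "0 \<le> x"
  have s: "(\<lambda>n. x ^ n /\<^sub>R fact n) sums exp x" by (rule exp_converges)
  have "(\<Sum>n\<in>{k}. x ^ n /\<^sub>R fact n) \<le> (\<Sum>n. x ^ n /\<^sub>R fact n)"
    using sums_summable[OF s] x by (intro sum_le_suminf) auto
  then have "x ^ k /\<^sub>R fact k \<le> exp x" using sums_unique[OF s] by simp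
  then show ?thesis by (simp add: field_simps)
qed

section \<open>Functionals with exponential moments\<close>

context poisson_points
begin

lemma measurable_count [measurable]:
  assumes "B \<in> sets lam"
  shows "(\<lambda>\<mu>. measure \<mu> B) \<in> borel_measurable N"
proof -
  have [measurable]: "(\<lambda>\<mu>. emeasure \<mu> B) \<in> borel_measurable N"
    by (rule measurable_emeasure_int_measure_space[OF assms])
  show ?thesis unfolding measure_def by measurable
qed

lemma measurable_diff_op [measurable]:
  assumes [measurable]: "H \<in> borel_measurable N"
  shows "(\<lambda>(\<mu>, y). diff_op y H \<mu>) \<in> borel_measurable (N \<Otimes>\<^sub>M lam)"
  unfolding diff_op_def case_prod_beta by measurable

lemma measurable_diff_op' [measurable]:
  assumes [measurable]: "H \<in> borel_measurable N" and "y \<in> space lam"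
  shows "diff_op y H \<in> borel_measurable N"
  using measurable_Pair2'[OF assms(2), of N] measurable_compose[OF _ measurable_diff_op[OF assms(1)], of "\<lambda>\<mu>. (\<mu>, y)" N]
  by (simp add: assms(2))

lemma AE_Q_iff:
  assumes "Measurable.pred N S"
  shows "(AE \<mu> in Q. S \<mu>) \<longleftrightarrow> (AE \<omega> in P. S (\<eta> \<omega>))"
  using assms by (intro AE_distr_iff) auto

text \<open>All exponents are required at once because the operations used later consume them:
  adding a point raises the exponent by 1, and a multiple integral of a product form costs a factor
  exp(mu(B)). A bound for one fixed \<open>c\<close> would not be stable.\<close>

definition exp_integrable :: "'a set \<Rightarrow> ('a measure \<Rightarrow> real) \<Rightarrow> bool" where
  "exp_integrable B H \<longleftrightarrow> H \<in> borel_measurable N \<and> (\<forall>c. integrable Q (\<lambda>\<mu>. H \<mu> * exp (c * measure \<mu> B)))"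

lemma exp_integrableD:
  assumes "exp_integrable B H"
  shows "H \<in> borel_measurable N" "integrable Q (\<lambda>\<mu>. H \<mu> * exp (c * measure \<mu> B))" "integrable Q H"
proof -
  show "H \<in> borel_measurable N" "integrable Q (\<lambda>\<mu>. H \<mu> * exp (c * measure \<mu> B))" for c
    using assms by (auto simp: exp_integrable_def)
  from this(2)[of 0] show "integrable Q H" by simp
qed

lemma exp_integrable_nn:
  assumes "B \<in> sets lam" "H \<in> borel_measurable N"
    and "\<And>c. 0 \<le> c \<Longrightarrow> (\<integral>\<^sup>+\<mu>. ennreal (\<bar>H \<mu>\<bar> * exp (c * measure \<mu> B)) \<partial>Q) < \<infinity>"
  shows "exp_integrable B H"
proof -
  note [measurable] = assms(1,2)
  have "integrable Q (\<lambda>\<mu>. H \<mu> * exp (c * measure \<mu> B))" for c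
  proof (rule integrableI_bounded)
    have "(\<integral>\<^sup>+\<mu>. ennreal (norm (H \<mu> * exp (c * measure \<mu> B))) \<partial>Q)
      \<le> (\<integral>\<^sup>+\<mu>. ennreal (\<bar>H \<mu>\<bar> * exp (\<bar>c\<bar> * measure \<mu> B)) \<partial>Q)"
      by (intro nn_integral_mono ennreal_leI) (auto simp: abs_mult intro!: mult_left_mono mult_right_mono)
    also have "\<dots> < \<infinity>" using assms(3)[of "\<bar>c\<bar>"] by simp
    finally show "(\<integral>\<^sup>+\<mu>. ennreal (norm (H \<mu> * exp (c * measure \<mu> B))) \<partial>Q) < \<infinity>" .
  qed measurable
  then show ?thesis using assms by (simp add: exp_integrable_def)
qed

lemma exp_integrable_bound:
  assumes B: "B \<in> sets lam" and H: "exp_integrable B H" and "G \<in> borel_measurable N"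
    and le: "AE \<mu> in Q. \<bar>G \<mu>\<bar> \<le> K * \<bar>H \<mu>\<bar> * exp (a * measure \<mu> B)"
  shows "exp_integrable B G"
  unfolding exp_integrable_def
proof (intro conjI allI)
  note [measurable] = B assms(3)
  show "integrable Q (\<lambda>\<mu>. G \<mu> * exp (c * measure \<mu> B))" for c
  proof (rule Bochner_Integration.integrable_bound)
    show "integrable Q (\<lambda>\<mu>. K * (H \<mu> * exp ((a + c) * measure \<mu> B)))"
      using exp_integrableD(2)[OF H] by (intro integrable_mult_right)
    show "AE \<mu> in Q. norm (G \<mu> * exp (c * measure \<mu> B)) \<le> norm (K * (H \<mu> * exp ((a + c) * measure \<mu> B)))"
      using le
    proof eventually_elim
      fix \<mu> assume "\<bar>G \<mu>\<bar> \<le> K * \<bar>H \<mu>\<bar> * exp (a * measure \<mu> B)"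
      then have "\<bar>G \<mu>\<bar> * exp (c * measure \<mu> B) \<le> K * \<bar>H \<mu>\<bar> * exp (a * measure \<mu> B) * exp (c * measure \<mu> B)"
        by (intro mult_right_mono) auto
      also have "\<dots> = K * \<bar>H \<mu>\<bar> * exp ((a + c) * measure \<mu> B)"
        by (simp add: distrib_right exp_add mult.assoc)
      also have "\<dots> \<le> \<bar>K\<bar> * \<bar>H \<mu>\<bar> * exp ((a + c) * measure \<mu> B)"
        by (intro mult_right_mono) auto
      finally show "norm (G \<mu> * exp (c * measure \<mu> B)) \<le> norm (K * (H \<mu> * exp ((a + c) * measure \<mu> B)))"
        by (simp add: abs_mult mult.assoc)
    qed
  qed measurable
qed (rule assms)

lemma exp_integrable_add:
  assumes "exp_integrable B G" "exp_integrable B H"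
  shows "exp_integrable B (\<lambda>\<mu>. G \<mu> + H \<mu>)"
  using assms by (auto simp: exp_integrable_def distrib_right)

context
  fixes B assumes B[measurable]: "B \<in> sets lam" and Bfin: "emeasure lam B < \<infinity>"
begin

abbreviation cnt :: "'a measure \<Rightarrow> real" where "cnt \<mu> \<equiv> measure \<mu> B"

text \<open>The exponential series computes the moment generating function of the Poisson law, exp(r
  (exp(c) - 1)) with r the intensity of \<open>B\<close>, which is finite for every
  \<open>c\<close>.\<close>

lemma exp_moment: "integrable Q (\<lambda>\<mu>. exp (c * cnt \<mu>))"
proof (rule integrableI_bounded)
  let ?r = "enn2real (emeasure lam B)"
  have "(\<integral>\<^sup>+\<mu>. ennreal (norm (exp (c * cnt \<mu>))) \<partial>Q) = (\<integral>\<^sup>+\<omega>. ennreal (exp (c * enn2real (emeasure (\<eta> \<omega>) B))) \<partial>P)"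
    by (subst nn_integral_distr) (auto simp: measure_def)
  also have "\<dots> = (\<Sum>k. ennreal (exp (c * enn2real (of_nat k))) * ennreal (poisson_weight ?r k))"
    by (rule poisson_nn_integral[OF poisson_emeasure[OF B] Bfin, of "\<lambda>z. ennreal (exp (c * enn2real z))"]) measurable
  also have "\<dots> = (\<Sum>k. ennreal (exp (- ?r) * ((?r * exp c) ^ k /\<^sub>R fact k)))"
  proof (rule suminf_cong)
    fix k :: nat
    have "exp (c * real k) = exp c ^ k" by (simp add: exp_of_nat_mult[symmetric] mult.commute)
    then have "exp (c * real k) * poisson_weight ?r k = exp (- ?r) * ((?r * exp c) ^ k /\<^sub>R fact k)"
      by (simp add: poisson_weight_def power_mult_distrib divide_inverse mult_ac)
    moreover have "enn2real (of_nat k) = real k" by (simp add: ennreal_of_nat_eq_real_of_nat)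
    ultimately show "ennreal (exp (c * enn2real (of_nat k))) * ennreal (poisson_weight ?r k)
        = ennreal (exp (- ?r) * ((?r * exp c) ^ k /\<^sub>R fact k))"
      by (simp only: ennreal_mult'[symmetric] exp_ge_zero)
  qed
  also have "\<dots> < \<infinity>"
  proof -
    have "(\<lambda>k. exp (- ?r) * ((?r * exp c) ^ k /\<^sub>R fact k)) sums (exp (- ?r) * exp (?r * exp c))"
      by (intro sums_mult exp_converges)
    then show ?thesis
      by (subst suminf_ennreal2) (auto simp: sums_iff)
  qed
  finally show "(\<integral>\<^sup>+\<mu>. ennreal (norm (exp (c * cnt \<mu>))) \<partial>Q) < \<infinity>" .
qed measurable

lemma exp_integrable_const: "exp_integrable B (\<lambda>_. c)"
  using exp_moment by (auto simp: exp_integrable_def)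

text \<open>The product of \<open>H\<close> and the exponential is dominated by the sum of their
  squares, and the square of the exponential is again an exponential moment.\<close>

lemma exp_integrable_L2:
  assumes "H \<in> L2 Q"
  shows "exp_integrable B H"
  unfolding exp_integrable_def
proof (intro conjI allI)
  have "H \<in> borel_measurable Q" and i: "integrable Q (\<lambda>\<mu>. (H \<mu>)\<^sup>2)"
    using assms unfolding L2_def by blast+
  then have [measurable]: "H \<in> borel_measurable N" by simp
  then show "H \<in> borel_measurable N" by simp
  fix c
  show "integrable Q (\<lambda>\<mu>. H \<mu> * exp (c * cnt \<mu>))"
  proof (rule Bochner_Integration.integrable_bound)
    show "integrable Q (\<lambda>\<mu>. (H \<mu>)\<^sup>2 + exp (2 * c * cnt \<mu>))"
      using i exp_moment[of "2 * c"] by simp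
    show "AE \<mu> in Q. norm (H \<mu> * exp (c * cnt \<mu>)) \<le> norm ((H \<mu>)\<^sup>2 + exp (2 * c * cnt \<mu>))"
    proof (rule AE_I2)
      fix \<mu>
      have "2 * (\<bar>H \<mu>\<bar> * exp (c * cnt \<mu>)) \<le> (H \<mu>)\<^sup>2 + (exp (c * cnt \<mu>))\<^sup>2"
        using sum_squares_bound[of "\<bar>H \<mu>\<bar>" "exp (c * cnt \<mu>)"] by simp
      moreover have "(exp (c * cnt \<mu>))\<^sup>2 = exp (2 * c * cnt \<mu>)"
        by (simp add: power2_eq_square exp_add[symmetric])
      moreover have "0 \<le> \<bar>H \<mu>\<bar> * exp (c * cnt \<mu>)" by simp
      ultimately have "\<bar>H \<mu>\<bar> * exp (c * cnt \<mu>) \<le> (H \<mu>)\<^sup>2 + exp (2 * c * cnt \<mu>)" by linarith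
      then show "norm (H \<mu> * exp (c * cnt \<mu>)) \<le> norm ((H \<mu>)\<^sup>2 + exp (2 * c * cnt \<mu>))"
        by (simp add: abs_mult)
    qed
  qed measurable
qed

text \<open>The Mecke equation turns the left-hand side into an expected sum over the points in
  \<open>B\<close>, where putting the removed point back gives H at the process itself. The sum has
  n terms, each at most |H| exp(c n) with n the count of \<open>B\<close>, and n is at most exp(n):
  hence the exponent c + 1.\<close>

lemma nn_integral_add_point:
  assumes [measurable]: "H \<in> borel_measurable N" and c: "0 \<le> c"
  shows "(\<integral>\<^sup>+p. indicator B (snd p) * ennreal (\<bar>H (add_point (fst p) (snd p))\<bar> * exp (c * cnt (fst p))) \<partial>QL)
    \<le> (\<integral>\<^sup>+\<mu>. ennreal (\<bar>H \<mu>\<bar> * exp ((c + 1) * cnt \<mu>)) \<partial>Q)"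
proof -
  have "(\<integral>\<^sup>+p. indicator B (snd p) * ennreal (\<bar>H (add_point (fst p) (snd p))\<bar> * exp (c * cnt (fst p))) \<partial>QL)
     = (\<integral>\<^sup>+\<omega>. (\<Sum>i. if i \<in> pts \<omega> then indicator B (X i \<omega>) *
          ennreal (\<bar>H (add_point (del i \<omega>) (X i \<omega>))\<bar> * exp (c * cnt (del i \<omega>))) else 0) \<partial>P)"
    by (subst mecke_nn_integral) (auto cong: if_cong)
  also have "\<dots> \<le> (\<integral>\<^sup>+\<omega>. ennreal (\<bar>H (\<eta> \<omega>)\<bar> * exp ((c + 1) * cnt (\<eta> \<omega>))) \<partial>P)"
  proof (rule nn_integral_mono_AE, use AE_finite_pts_in[OF B Bfin] AE_space in eventually_elim)
    fix \<omega> assume fin: "finite (pts_in B \<omega>)" and w: "\<omega> \<in> space P"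
    let ?n = "real (card (pts_in B \<omega>))"
    have n: "cnt (\<eta> \<omega>) = ?n" by (rule measure_eta_pts_in[OF w B])
    have "(\<Sum>i. if i \<in> pts \<omega> then indicator B (X i \<omega>) *
          ennreal (\<bar>H (add_point (del i \<omega>) (X i \<omega>))\<bar> * exp (c * cnt (del i \<omega>))) else 0)
       = (\<Sum>i\<in>pts_in B \<omega>. ennreal (\<bar>H (\<eta> \<omega>)\<bar> * exp (c * cnt (del i \<omega>))))"
      using fin add_point_del[OF w]
      by (subst suminf_finite[of "pts_in B \<omega>"]) (auto simp: pts_in_def intro!: sum.cong)
    also have "\<dots> \<le> (\<Sum>i\<in>pts_in B \<omega>. ennreal (\<bar>H (\<eta> \<omega>)\<bar> * exp (c * ?n)))"
    proof (intro sum_mono ennreal_leI mult_left_mono)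
      fix i assume "i \<in> pts_in B \<omega>"
      have "{k \<in> pts \<omega> - {i}. X k \<omega> \<in> B} = pts_in B \<omega> - {i}" by (auto simp: pts_in_def)
      then have "emeasure (del i \<omega>) B = emeasure (count_space UNIV) (pts_in B \<omega> - {i})"
        unfolding del_def using X_space w by (subst emeasure_points) auto
      then have "cnt (del i \<omega>) \<le> ?n"
        using fin by (simp add: measure_def emeasure_count_space ennreal_of_nat_eq_real_of_nat card_Diff1_le)
      then show "exp (c * cnt (del i \<omega>)) \<le> exp (c * ?n)" using c by (simp add: mult_left_mono)
    qed auto
    also have "\<dots> = ennreal (\<bar>H (\<eta> \<omega>)\<bar> * (?n * exp (c * ?n)))"
      by (simp add: ennreal_of_nat_eq_real_of_nat ennreal_mult'[symmetric] mult_ac)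
    also have "\<dots> \<le> ennreal (\<bar>H (\<eta> \<omega>)\<bar> * (exp ?n * exp (c * ?n)))"
      using power_le_fact_exp[of ?n 1] by (intro ennreal_leI mult_left_mono mult_right_mono) auto
    finally show "(\<Sum>i. if i \<in> pts \<omega> then indicator B (X i \<omega>) *
          ennreal (\<bar>H (add_point (del i \<omega>) (X i \<omega>))\<bar> * exp (c * cnt (del i \<omega>))) else 0)
       \<le> ennreal (\<bar>H (\<eta> \<omega>)\<bar> * exp ((c + 1) * cnt (\<eta> \<omega>)))"
      by (simp add: n distrib_right exp_add mult.commute)
  qed
  also have "\<dots> = (\<integral>\<^sup>+\<mu>. ennreal (\<bar>H \<mu>\<bar> * exp ((c + 1) * cnt \<mu>)) \<partial>Q)"
    by (subst nn_integral_distr) auto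
  finally show ?thesis .
qed

lemma nn_integral_no_point:
  assumes [measurable]: "H \<in> borel_measurable N"
  shows "(\<integral>\<^sup>+p. indicator B (snd p) * ennreal (\<bar>H (fst p)\<bar> * exp (c * cnt (fst p))) \<partial>QL)
    = emeasure lam B * (\<integral>\<^sup>+\<mu>. ennreal (\<bar>H \<mu>\<bar> * exp (c * cnt \<mu>)) \<partial>Q)"
proof -
  have "(\<integral>\<^sup>+p. indicator B (snd p) * ennreal (\<bar>H (fst p)\<bar> * exp (c * cnt (fst p))) \<partial>QL)
    = (\<integral>\<^sup>+\<mu>. \<integral>\<^sup>+y. ennreal (\<bar>H \<mu>\<bar> * exp (c * cnt \<mu>)) * indicator B y \<partial>lam \<partial>Q)"
    by (subst lam.nn_integral_fst[symmetric]) (auto simp: mult.commute)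
  also have "\<dots> = (\<integral>\<^sup>+\<mu>. ennreal (\<bar>H \<mu>\<bar> * exp (c * cnt \<mu>)) * emeasure lam B \<partial>Q)"
    by (simp add: nn_integral_cmult)
  also have "\<dots> = emeasure lam B * (\<integral>\<^sup>+\<mu>. ennreal (\<bar>H \<mu>\<bar> * exp (c * cnt \<mu>)) \<partial>Q)"
    by (subst nn_integral_multc) (auto simp: mult.commute)
  finally show ?thesis .
qed

lemma nn_integral_diff_op:
  assumes [measurable]: "H \<in> borel_measurable N" and c: "0 \<le> c"
  shows "(\<integral>\<^sup>+p. indicator B (snd p) * ennreal (\<bar>diff_op (snd p) H (fst p)\<bar> * exp (c * cnt (fst p))) \<partial>QL)
    \<le> (1 + emeasure lam B) * (\<integral>\<^sup>+\<mu>. ennreal (\<bar>H \<mu>\<bar> * exp ((c + 1) * cnt \<mu>)) \<partial>Q)"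
proof -
  let ?A = "\<integral>\<^sup>+\<mu>. ennreal (\<bar>H \<mu>\<bar> * exp ((c + 1) * cnt \<mu>)) \<partial>Q"
  have "(\<integral>\<^sup>+p. indicator B (snd p) * ennreal (\<bar>diff_op (snd p) H (fst p)\<bar> * exp (c * cnt (fst p))) \<partial>QL)
    \<le> (\<integral>\<^sup>+p. indicator B (snd p) * ennreal (\<bar>H (add_point (fst p) (snd p))\<bar> * exp (c * cnt (fst p)))
         + indicator B (snd p) * ennreal (\<bar>H (fst p)\<bar> * exp (c * cnt (fst p))) \<partial>QL)"
  proof (rule nn_integral_mono)
    fix p
    have "\<bar>diff_op (snd p) H (fst p)\<bar> * exp (c * cnt (fst p))
      \<le> (\<bar>H (add_point (fst p) (snd p))\<bar> + \<bar>H (fst p)\<bar>) * exp (c * cnt (fst p))"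
      unfolding diff_op_def by (intro mult_right_mono abs_triangle_ineq4) auto
    then have "ennreal (\<bar>diff_op (snd p) H (fst p)\<bar> * exp (c * cnt (fst p)))
      \<le> ennreal (\<bar>H (add_point (fst p) (snd p))\<bar> * exp (c * cnt (fst p))) + ennreal (\<bar>H (fst p)\<bar> * exp (c * cnt (fst p)))"
      by (simp add: ennreal_plus[symmetric] distrib_right ennreal_leI del: ennreal_plus)
    then show "indicator B (snd p) * ennreal (\<bar>diff_op (snd p) H (fst p)\<bar> * exp (c * cnt (fst p)))
      \<le> indicator B (snd p) * ennreal (\<bar>H (add_point (fst p) (snd p))\<bar> * exp (c * cnt (fst p)))
         + indicator B (snd p) * ennreal (\<bar>H (fst p)\<bar> * exp (c * cnt (fst p)))"
      unfolding distrib_left[symmetric] by (rule mult_left_mono) simp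
  qed
  also have "\<dots> = (\<integral>\<^sup>+p. indicator B (snd p) * ennreal (\<bar>H (add_point (fst p) (snd p))\<bar> * exp (c * cnt (fst p))) \<partial>QL)
         + (\<integral>\<^sup>+p. indicator B (snd p) * ennreal (\<bar>H (fst p)\<bar> * exp (c * cnt (fst p))) \<partial>QL)"
    by (rule nn_integral_add) measurable
  also have "\<dots> \<le> ?A + emeasure lam B * (\<integral>\<^sup>+\<mu>. ennreal (\<bar>H \<mu>\<bar> * exp (c * cnt \<mu>)) \<partial>Q)"
    by (intro add_mono nn_integral_add_point assms) (simp add: nn_integral_no_point)
  also have "\<dots> \<le> ?A + emeasure lam B * ?A"
    using c by (intro add_left_mono mult_left_mono nn_integral_mono ennreal_leI) (auto intro!: mult_right_mono)
  finally show ?thesis by (simp add: distrib_right)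
qed

lemma exp_integrable_finite:
  assumes "exp_integrable B H"
  shows "(\<integral>\<^sup>+\<mu>. ennreal (\<bar>H \<mu>\<bar> * exp (c * cnt \<mu>)) \<partial>Q) < \<infinity>"
  using exp_integrableD(2)[OF assms, of c] unfolding integrable_iff_bounded by (simp add: abs_mult)

text \<open>Fubini applied to \<open>nn_integral_diff_op\<close> gives a null set of exceptional y
  for each exponent. Natural exponents suffice, since they dominate the real ones, and countably
  many null sets can be united.\<close>

lemma AE_exp_integrable_diff_op:
  assumes H: "exp_integrable B H"
  shows "AE y in lam. y \<in> B \<longrightarrow> exp_integrable B (diff_op y H)"
proof -
  note [measurable] = exp_integrableD(1)[OF H]
  have "AE y in lam. \<forall>n::nat. (\<integral>\<^sup>+\<mu>. indicator B y * ennreal (\<bar>diff_op y H \<mu>\<bar> * exp (n * cnt \<mu>)) \<partial>Q) < \<infinity>"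
    unfolding AE_all_countable
  proof
    fix n :: nat
    have "(\<integral>\<^sup>+y. \<integral>\<^sup>+\<mu>. indicator B y * ennreal (\<bar>diff_op y H \<mu>\<bar> * exp (n * cnt \<mu>)) \<partial>Q \<partial>lam)
      = (\<integral>\<^sup>+p. indicator B (snd p) * ennreal (\<bar>diff_op (snd p) H (fst p)\<bar> * exp (n * cnt (fst p))) \<partial>QL)"
      by (subst QL.nn_integral_snd[symmetric]) auto
    also have "\<dots> \<le> (1 + emeasure lam B) * (\<integral>\<^sup>+\<mu>. ennreal (\<bar>H \<mu>\<bar> * exp ((n + 1) * cnt \<mu>)) \<partial>Q)"
      using nn_integral_diff_op[of H n] by (simp add: add.commute)
    also have "\<dots> < \<infinity>"
      using exp_integrable_finite[OF H, of "n + 1"] Bfin by (simp add: ennreal_mult_less_top)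
    finally have "(\<integral>\<^sup>+y. \<integral>\<^sup>+\<mu>. indicator B y * ennreal (\<bar>diff_op y H \<mu>\<bar> * exp (n * cnt \<mu>)) \<partial>Q \<partial>lam) \<noteq> \<infinity>" by simp
    then have "AE y in lam. (\<integral>\<^sup>+\<mu>. indicator B y * ennreal (\<bar>diff_op y H \<mu>\<bar> * exp (n * cnt \<mu>)) \<partial>Q) \<noteq> \<infinity>"
      by (rule nn_integral_PInf_AE[rotated]) measurable
    then show "AE y in lam. (\<integral>\<^sup>+\<mu>. indicator B y * ennreal (\<bar>diff_op y H \<mu>\<bar> * exp (n * cnt \<mu>)) \<partial>Q) < \<infinity>"
      by (simp add: less_top)
  qed
  then show ?thesis using AE_space
  proof eventually_elim
    fix y assume fin: "\<forall>n::nat. (\<integral>\<^sup>+\<mu>. indicator B y * ennreal (\<bar>diff_op y H \<mu>\<bar> * exp (n * cnt \<mu>)) \<partial>Q) < \<infinity>"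
      and y: "y \<in> space lam"
    show "y \<in> B \<longrightarrow> exp_integrable B (diff_op y H)"
    proof (intro impI exp_integrable_nn[OF B])
      show "diff_op y H \<in> borel_measurable N" by (rule measurable_diff_op'[OF _ y]) simp
      fix c :: real assume c: "0 \<le> c" and yB: "y \<in> B"
      obtain n :: nat where n: "c \<le> n" using real_arch_simple by blast
      have "(\<integral>\<^sup>+\<mu>. ennreal (\<bar>diff_op y H \<mu>\<bar> * exp (c * cnt \<mu>)) \<partial>Q) \<le> (\<integral>\<^sup>+\<mu>. ennreal (\<bar>diff_op y H \<mu>\<bar> * exp (n * cnt \<mu>)) \<partial>Q)"
        using n by (intro nn_integral_mono ennreal_leI mult_left_mono) (auto intro!: mult_right_mono)
      also have "\<dots> < \<infinity>" using spec[OF fin, of n] yB by simp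
      finally show "(\<integral>\<^sup>+\<mu>. ennreal (\<bar>diff_op y H \<mu>\<bar> * exp (c * cnt \<mu>)) \<partial>Q) < \<infinity>" .
    qed
  qed
qed

end

end

section \<open>Iterated differences and products of the intensity measure\<close>

lemma diff_iter_cong: "(\<And>i. i < n \<Longrightarrow> z i = z' i) \<Longrightarrow> diff_iter n z H = diff_iter n z' H"
proof (induction n arbitrary: z z')
  case (Suc n)
  have "diff_iter n (\<lambda>i. z (Suc i)) H = diff_iter n (\<lambda>i. z' (Suc i)) H"
    by (rule Suc.IH) (simp add: Suc.prems)
  then show ?case using Suc.prems[of 0] by simp
qed simp

text \<open>The defining recursion splits off the outermost operator, belonging to the first
  variable. Integration by parts produces D_y H inside, and the product measure is built up by its
  last variable; hence this second recursion.\<close>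

lemma diff_iter_last: "diff_iter (Suc n) z H = diff_iter n z (diff_op (z n) H)"
proof (induction n arbitrary: z)
  case (Suc n)
  have "diff_iter (Suc (Suc n)) z H = diff_op (z 0) (diff_iter (Suc n) (\<lambda>i. z (Suc i)) H)"
    by (rule diff_iter.simps(2))
  also have "\<dots> = diff_op (z 0) (diff_iter n (\<lambda>i. z (Suc i)) (diff_op (z (Suc n)) H))"
    by (simp only: Suc.IH)
  also have "\<dots> = diff_iter (Suc n) z (diff_op (z (Suc n)) H)"
    by (simp only: diff_iter.simps(2))
  finally show ?case .
qed simp

lemma diff_iter_upd: "diff_iter (Suc n) (z(n := y)) H = diff_iter n z (diff_op y H)"
  unfolding diff_iter_last fun_upd_same by (rule diff_iter_cong) simp

lemma measurable_diff_iter: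
  assumes [measurable]: "H \<in> borel_measurable (int_measure_space lam)"
  shows "(\<lambda>p. diff_iter n (fst p) H (snd p)) \<in> borel_measurable (pow_measure lam n \<Otimes>\<^sub>M int_measure_space lam)"
proof (induction n)
  case (Suc n)
  let ?S = "\<lambda>z. \<lambda>i\<in>{..<n}. z (Suc i)"
  have [measurable]: "?S \<in> measurable (pow_measure lam (Suc n)) (pow_measure lam n)"
    by (intro measurable_restrict measurable_component_singleton) auto
  have [measurable]: "(\<lambda>z. z 0) \<in> measurable (pow_measure lam (Suc n)) lam"
    by (rule measurable_component_singleton) simp
  have eq: "diff_iter n (\<lambda>i. z (Suc i)) H = diff_iter n (?S z) H" for z
    by (rule diff_iter_cong) simp
  have 1: "(\<lambda>p. (?S (fst p), add_point (snd p) (fst p 0)))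
      \<in> measurable (pow_measure lam (Suc n) \<Otimes>\<^sub>M int_measure_space lam) (pow_measure lam n \<Otimes>\<^sub>M int_measure_space lam)"
    and 2: "(\<lambda>p. (?S (fst p), snd p))
      \<in> measurable (pow_measure lam (Suc n) \<Otimes>\<^sub>M int_measure_space lam) (pow_measure lam n \<Otimes>\<^sub>M int_measure_space lam)"
    by measurable
  have "(\<lambda>p. diff_iter n (?S (fst p)) H (add_point (snd p) (fst p 0))) \<in> borel_measurable (pow_measure lam (Suc n) \<Otimes>\<^sub>M int_measure_space lam)"
    using measurable_compose[OF 1 Suc] by (simp only: fst_conv snd_conv)
  moreover have "(\<lambda>p. diff_iter n (?S (fst p)) H (snd p)) \<in> borel_measurable (pow_measure lam (Suc n) \<Otimes>\<^sub>M int_measure_space lam)"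
    using measurable_compose[OF 2 Suc] by (simp only: fst_conv snd_conv)
  ultimately show ?case by (simp add: diff_op_def eq)
qed simp

context poisson_points
begin

sublocale pow: product_sigma_finite "\<lambda>_::nat. lam" ..

lemma pow_insert:
  fixes J :: "nat set"
  assumes J: "finite J" "j \<notin> J"
  shows "distr (PiM J (\<lambda>_. lam) \<Otimes>\<^sub>M lam) (PiM (insert j J) (\<lambda>_. lam)) (\<lambda>p. (fst p)(j := snd p))
    = PiM (insert j J) (\<lambda>_. lam)"
proof (rule measure_eqI)
  have m: "(\<lambda>p. (fst p)(j := snd p)) \<in> measurable (PiM J (\<lambda>_. lam) \<Otimes>\<^sub>M lam) (PiM (insert j J) (\<lambda>_. lam))"
    by (intro measurable_fun_upd[where J=J]) auto
  fix A assume "A \<in> sets (distr (PiM J (\<lambda>_. lam) \<Otimes>\<^sub>M lam) (PiM (insert j J) (\<lambda>_. lam)) (\<lambda>p. (fst p)(j := snd p)))"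
  then have A[measurable]: "A \<in> sets (PiM (insert j J) (\<lambda>_. lam))" by simp
  have "emeasure (distr (PiM J (\<lambda>_. lam) \<Otimes>\<^sub>M lam) (PiM (insert j J) (\<lambda>_. lam)) (\<lambda>p. (fst p)(j := snd p))) A
     = (\<integral>\<^sup>+p. indicator A ((fst p)(j := snd p)) \<partial>(PiM J (\<lambda>_. lam) \<Otimes>\<^sub>M lam))"
    by (subst nn_integral_distr[OF m, symmetric]) auto
  also have "\<dots> = (\<integral>\<^sup>+z. \<integral>\<^sup>+y. indicator A (z(j := y)) \<partial>lam \<partial>PiM J (\<lambda>_. lam))"
    using measurable_compose[OF m borel_measurable_indicator[OF A]]
    by (subst lam.nn_integral_fst[symmetric]) auto
  also have "\<dots> = (\<integral>\<^sup>+z. indicator A z \<partial>PiM (insert j J) (\<lambda>_. lam))"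
    by (rule pow.product_nn_integral_insert[OF J, symmetric]) simp
  finally show "emeasure (distr (PiM J (\<lambda>_. lam) \<Otimes>\<^sub>M lam) (PiM (insert j J) (\<lambda>_. lam)) (\<lambda>p. (fst p)(j := snd p))) A
     = emeasure (PiM (insert j J) (\<lambda>_. lam)) A" by simp
qed simp

lemma integral_pow_insert:
  fixes J :: "nat set" and f :: "_ \<Rightarrow> real"
  assumes J: "finite J" "j \<notin> J" and f: "f \<in> borel_measurable (PiM (insert j J) (\<lambda>_. lam))"
  shows "(\<integral>z. f z \<partial>PiM (insert j J) (\<lambda>_. lam)) = (\<integral>p. f ((fst p)(j := snd p)) \<partial>(PiM J (\<lambda>_. lam) \<Otimes>\<^sub>M lam))"
    and "integrable (PiM (insert j J) (\<lambda>_. lam)) f \<longleftrightarrow> integrable (PiM J (\<lambda>_. lam) \<Otimes>\<^sub>M lam) (\<lambda>p. f ((fst p)(j := snd p)))"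
  using f by (subst (1) pow_insert[OF J, symmetric], simp add: integral_distr integrable_distr_eq)+

lemma nn_integral_pow_insert:
  fixes J :: "nat set"
  assumes J: "finite J" "j \<notin> J" and f: "f \<in> borel_measurable (PiM (insert j J) (\<lambda>_. lam))"
  shows "(\<integral>\<^sup>+z. f z \<partial>PiM (insert j J) (\<lambda>_. lam)) = (\<integral>\<^sup>+p. f ((fst p)(j := snd p)) \<partial>(PiM J (\<lambda>_. lam) \<Otimes>\<^sub>M lam))"
  using f by (subst (1) pow_insert[OF J, symmetric], simp add: nn_integral_distr)

lemma QL_integral_product:
  fixes F G :: "_ \<Rightarrow> real"
  assumes F: "integrable Q F" and G: "integrable lam G"
  shows "integrable QL (\<lambda>p. F (fst p) * G (snd p))"
    and "(\<integral>p. F (fst p) * G (snd p) \<partial>QL) = (\<integral>\<mu>. F \<mu> \<partial>Q) * (\<integral>y. G y \<partial>lam)"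
proof -
  have [measurable]: "F \<in> borel_measurable Q" "G \<in> borel_measurable lam" using F G by auto
  show i: "integrable QL (\<lambda>p. F (fst p) * G (snd p))"
  proof (rule QL.Fubini_integrable)
    show "integrable Q (\<lambda>\<mu>. \<integral>y. norm (F (fst (\<mu>, y)) * G (snd (\<mu>, y))) \<partial>lam)"
      using F by (simp add: abs_mult)
    show "AE \<mu> in Q. integrable lam (\<lambda>y. F (fst (\<mu>, y)) * G (snd (\<mu>, y)))"
      using G by simp
  qed measurable
  show "(\<integral>p. F (fst p) * G (snd p) \<partial>QL) = (\<integral>\<mu>. F \<mu> \<partial>Q) * (\<integral>y. G y \<partial>lam)"
    using QL.integral_fst'[OF i] by simp
qed

lemma measurable_point_integral:
  fixes h :: "'a measure \<times> 'a \<Rightarrow> real"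
  assumes h: "h \<in> borel_measurable (N \<Otimes>\<^sub>M lam)"
  shows "(\<lambda>\<omega>. \<integral>i. (if i \<in> pts \<omega> then h (del i \<omega>, X i \<omega>) else 0) \<partial>count_space UNIV) \<in> borel_measurable P"
proof -
  interpret C: sigma_finite_measure "count_space (UNIV :: nat set)"
    by (rule sigma_finite_measure_count_space)
  have [measurable]: "(\<lambda>p. h (del (snd p) (fst p), X (snd p) (fst p))) \<in> borel_measurable (P \<Otimes>\<^sub>M count_space UNIV)"
    by (rule measurable_compose[OF measurable_points h])
  have "(\<lambda>p. if snd p \<in> pts (fst p) then h (del (snd p) (fst p), X (snd p) (fst p)) else 0)
      \<in> borel_measurable (P \<Otimes>\<^sub>M count_space UNIV)"
    by measurable
  then show ?thesis
    by (intro C.borel_measurable_lebesgue_integral) (simp add: case_prod_beta)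
qed

lemma AE_QL_fst:
  assumes "AE \<mu> in Q. S \<mu>" and [measurable]: "Measurable.pred N S"
  shows "AE p in QL. S (fst p)"
proof (rule QL.AE_pair_measure)
  have "Measurable.pred QL (\<lambda>p. S (fst p))" by measurable
  then show "{p \<in> space QL. S (fst p)} \<in> sets QL" by (rule predE)
  show "AE \<mu> in Q. AE y in lam. S (fst (\<mu>, y))" using assms(1) by eventually_elim simp
qed

section \<open>Growth bounds and integration by parts\<close>

context
  fixes B assumes B[measurable]: "B \<in> sets lam" and Bfin: "emeasure lam B < \<infinity>"
begin

lemma factorial_functional_bound:
  assumes J: "finite J" and g: "\<And>j. j \<in> J \<Longrightarrow> supported_in lam B c (g j)" and c: "0 \<le> c"
  shows "AE \<mu> in Q. \<bar>factorial_functional lam J g \<mu>\<bar> \<le> c ^ card J * fact (card J) * exp (measure \<mu> B)"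
proof -
  have [measurable]: "factorial_functional lam J g \<in> borel_measurable N"
    using J g supported_inD(1) by (intro measurable_factorial_functional) blast+
  have "AE \<omega> in P. \<bar>factorial_functional lam J g (\<eta> \<omega>)\<bar> \<le> c ^ card J * fact (card J) * exp (measure (\<eta> \<omega>) B)"
    using AE_finite_pts_in[OF B Bfin] AE_space
  proof eventually_elim
    fix \<omega> assume fin: "finite (pts_in B \<omega>)" and w: "\<omega> \<in> space P"
    have b: "\<bar>g j (X i \<omega>)\<bar> \<le> c" if "j \<in> J" for i j
      using supported_inD(2)[OF g[OF that] X_space[OF w]] .
    have e: "factorial_functional lam J g (\<eta> \<omega>) = tuple_sum (pts_in B \<omega>) J (\<lambda>j i. g j (X i \<omega>))"
      by (rule factorial_functional_eta[OF w fin J]) (rule g)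
    have "\<bar>factorial_functional lam J g (\<eta> \<omega>)\<bar> \<le> (c * real (card (pts_in B \<omega>))) ^ card J"
      unfolding e by (intro tuple_sum_bound fin J c b)
    also have "\<dots> = c ^ card J * real (card (pts_in B \<omega>)) ^ card J" by (rule power_mult_distrib)
    also have "\<dots> \<le> c ^ card J * (fact (card J) * exp (real (card (pts_in B \<omega>))))"
      using c by (intro mult_left_mono power_le_fact_exp) auto
    finally show "\<bar>factorial_functional lam J g (\<eta> \<omega>)\<bar> \<le> c ^ card J * fact (card J) * exp (measure (\<eta> \<omega>) B)"
      by (simp add: measure_eta_pts_in[OF w B] mult.assoc)
  qed
  then show ?thesis by (subst AE_Q_iff) auto
qed

lemma wick_functional_bound:
  assumes J: "finite J" and g: "\<And>j. j \<in> J \<Longrightarrow> supported_in lam B c (g j)" and c: "0 \<le> c"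
  shows "\<exists>K\<ge>0. AE \<mu> in Q. \<bar>wick_functional lam J g \<mu>\<bar> \<le> K * exp (measure \<mu> B)"
proof -
  let ?k = "\<lambda>K. c ^ card K * fact (card K) * \<bar>\<Prod>j\<in>J - K. \<integral>y. g j y \<partial>lam\<bar>"
  have fb: "AE \<mu> in Q. \<bar>factorial_functional lam K g \<mu>\<bar> \<le> c ^ card K * fact (card K) * exp (measure \<mu> B)" if "K \<in> Pow J" for K
  proof (rule factorial_functional_bound)
    show "finite K" using that J by (auto intro: finite_subset)
    show "supported_in lam B c (g j)" if "j \<in> K" for j using that \<open>K \<in> Pow J\<close> g by auto
  qed (rule c)
  have "finite (Pow J)" using J by simp
  with fb have "AE \<mu> in Q. \<forall>K\<in>Pow J. \<bar>factorial_functional lam K g \<mu>\<bar> \<le> c ^ card K * fact (card K) * exp (measure \<mu> B)"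
    by (intro AE_finite_allI)
  then have "AE \<mu> in Q. \<bar>wick_functional lam J g \<mu>\<bar> \<le> (\<Sum>K\<in>Pow J. ?k K) * exp (measure \<mu> B)"
  proof eventually_elim
    fix \<mu> assume b: "\<forall>K\<in>Pow J. \<bar>factorial_functional lam K g \<mu>\<bar> \<le> c ^ card K * fact (card K) * exp (measure \<mu> B)"
    have "\<bar>wick_functional lam J g \<mu>\<bar> \<le> (\<Sum>K\<in>Pow J. \<bar>factorial_functional lam K g \<mu>\<bar> * \<bar>\<Prod>j\<in>J - K. \<integral>y. g j y \<partial>lam\<bar>)"
      unfolding wick_functional_def by (rule sum_abs[THEN order_trans]) (simp add: abs_mult power_abs)
    also have "\<dots> \<le> (\<Sum>K\<in>Pow J. (c ^ card K * fact (card K) * exp (measure \<mu> B)) * \<bar>\<Prod>j\<in>J - K. \<integral>y. g j y \<partial>lam\<bar>)"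
      using b by (intro sum_mono mult_right_mono) auto
    also have "\<dots> = (\<Sum>K\<in>Pow J. ?k K) * exp (measure \<mu> B)"
      unfolding sum_distrib_right by (intro sum.cong refl) (simp add: mult_ac)
    finally show "\<bar>wick_functional lam J g \<mu>\<bar> \<le> (\<Sum>K\<in>Pow J. ?k K) * exp (measure \<mu> B)" .
  qed
  moreover have "0 \<le> (\<Sum>K\<in>Pow J. ?k K)" using c by (intro sum_nonneg) auto
  ultimately show ?thesis by blast
qed

lemma exp_integrable_wick_mult:
  assumes J: "finite J" and g: "\<And>j. j \<in> J \<Longrightarrow> supported_in lam B c (g j)" and c: "0 \<le> c"
    and H: "exp_integrable B H"
  shows "exp_integrable B (\<lambda>\<mu>. wick_functional lam J g \<mu> * H \<mu>)"
proof -
  obtain K where K: "0 \<le> K" "AE \<mu> in Q. \<bar>wick_functional lam J g \<mu>\<bar> \<le> K * exp (measure \<mu> B)"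
    using wick_functional_bound[where g=g, OF J g c] by blast
  note [measurable] = exp_integrableD(1)[OF H]
  have [measurable]: "wick_functional lam J g \<in> borel_measurable N"
    using J g supported_inD(1) by (intro measurable_wick_functional) blast+
  have "AE \<mu> in Q. \<bar>wick_functional lam J g \<mu> * H \<mu>\<bar> \<le> K * \<bar>H \<mu>\<bar> * exp (1 * measure \<mu> B)"
    using K(2)
  proof eventually_elim
    fix \<mu> assume "\<bar>wick_functional lam J g \<mu>\<bar> \<le> K * exp (measure \<mu> B)"
    then have "\<bar>wick_functional lam J g \<mu>\<bar> * \<bar>H \<mu>\<bar> \<le> (K * exp (measure \<mu> B)) * \<bar>H \<mu>\<bar>"
      by (rule mult_right_mono) simp
    then show "\<bar>wick_functional lam J g \<mu> * H \<mu>\<bar> \<le> K * \<bar>H \<mu>\<bar> * exp (1 * measure \<mu> B)"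
      by (simp add: abs_mult mult_ac)
  qed
  then show ?thesis by (intro exp_integrable_bound[OF B H]) measurable
qed

lemma exp_integrable_factorial_mult:
  assumes J: "finite J" and g: "\<And>j. j \<in> J \<Longrightarrow> supported_in lam B c (g j)" and c: "0 \<le> c"
    and H: "exp_integrable B H"
  shows "exp_integrable B (\<lambda>\<mu>. factorial_functional lam J g \<mu> * H \<mu>)"
proof -
  note [measurable] = exp_integrableD(1)[OF H]
  have [measurable]: "factorial_functional lam J g \<in> borel_measurable N"
    using J g supported_inD(1) by (intro measurable_factorial_functional) blast+
  have "AE \<mu> in Q. \<bar>factorial_functional lam J g \<mu> * H \<mu>\<bar> \<le> (c ^ card J * fact (card J)) * \<bar>H \<mu>\<bar> * exp (1 * measure \<mu> B)"
  proof (rule AE_mp[OF factorial_functional_bound[OF J _ c]], rule g, assumption, intro AE_I2 impI)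
    fix \<mu> assume "\<bar>factorial_functional lam J g \<mu>\<bar> \<le> c ^ card J * fact (card J) * exp (measure \<mu> B)"
    then have "\<bar>factorial_functional lam J g \<mu>\<bar> * \<bar>H \<mu>\<bar> \<le> (c ^ card J * fact (card J) * exp (measure \<mu> B)) * \<bar>H \<mu>\<bar>"
      by (rule mult_right_mono) simp
    then show "\<bar>factorial_functional lam J g \<mu> * H \<mu>\<bar> \<le> (c ^ card J * fact (card J)) * \<bar>H \<mu>\<bar> * exp (1 * measure \<mu> B)"
      by (simp add: abs_mult mult_ac)
  qed
  then show ?thesis by (intro exp_integrable_bound[OF B H]) measurable
qed

lemma integrable_add_point:
  assumes H: "exp_integrable B H" and G: "G \<in> borel_measurable N"
    and K: "0 \<le> K" "AE \<mu> in Q. \<bar>G \<mu>\<bar> \<le> K * exp (measure \<mu> B)"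
    and h: "supported_in lam B c h" and c: "0 \<le> c"
  shows "integrable QL (\<lambda>p. h (snd p) * G (fst p) * H (add_point (fst p) (snd p)))"
proof (rule integrableI_bounded)
  have [measurable]: "G \<in> borel_measurable N" "H \<in> borel_measurable N" "h \<in> borel_measurable lam"
    using G exp_integrableD(1)[OF H] supported_inD(1)[OF h] by auto
  show "(\<lambda>p. h (snd p) * G (fst p) * H (add_point (fst p) (snd p))) \<in> borel_measurable QL"
    by measurable
  have "AE p in QL. \<bar>G (fst p)\<bar> \<le> K * exp (measure (fst p) B)"
    by (rule AE_QL_fst[OF K(2)]) measurable
  then have "AE p in QL. ennreal (norm (h (snd p) * G (fst p) * H (add_point (fst p) (snd p))))
     \<le> ennreal (c * K) * (indicator B (snd p) * ennreal (\<bar>H (add_point (fst p) (snd p))\<bar> * exp (1 * measure (fst p) B)))"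
    using AE_space
  proof eventually_elim
    fix p assume G: "\<bar>G (fst p)\<bar> \<le> K * exp (measure (fst p) B)" and "p \<in> space QL"
    then have y: "snd p \<in> space lam" by (auto simp: space_pair_measure)
    show "ennreal (norm (h (snd p) * G (fst p) * H (add_point (fst p) (snd p))))
     \<le> ennreal (c * K) * (indicator B (snd p) * ennreal (\<bar>H (add_point (fst p) (snd p))\<bar> * exp (1 * measure (fst p) B)))"
    proof (cases "snd p \<in> B")
      case True
      have "\<bar>h (snd p)\<bar> * \<bar>G (fst p)\<bar> * \<bar>H (add_point (fst p) (snd p))\<bar>
        \<le> c * (K * exp (measure (fst p) B)) * \<bar>H (add_point (fst p) (snd p))\<bar>"
        using supported_inD(2)[OF h y] G c by (intro mult_right_mono mult_mono) auto
      then show ?thesis using True c K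
        by (simp add: ennreal_mult'[symmetric] abs_mult mult_ac ennreal_leI)
    next
      case False
      then show ?thesis using supported_inD(3)[OF h y] by simp
    qed
  qed
  then have "(\<integral>\<^sup>+p. ennreal (norm (h (snd p) * G (fst p) * H (add_point (fst p) (snd p)))) \<partial>QL)
    \<le> (\<integral>\<^sup>+p. ennreal (c * K) * (indicator B (snd p) * ennreal (\<bar>H (add_point (fst p) (snd p))\<bar> * exp (1 * measure (fst p) B))) \<partial>QL)"
    by (rule nn_integral_mono_AE)
  also have "\<dots> = ennreal (c * K) * (\<integral>\<^sup>+p. indicator B (snd p) * ennreal (\<bar>H (add_point (fst p) (snd p))\<bar> * exp (1 * measure (fst p) B)) \<partial>QL)"
    by (rule nn_integral_cmult) measurable
  also have "\<dots> \<le> ennreal (c * K) * (\<integral>\<^sup>+\<mu>. ennreal (\<bar>H \<mu>\<bar> * exp ((1 + 1) * measure \<mu> B)) \<partial>Q)"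
    by (intro mult_left_mono nn_integral_add_point[OF B Bfin]) auto
  also have "\<dots> < \<infinity>"
    using exp_integrable_finite[OF B Bfin H, of "1 + 1"] by (simp add: ennreal_mult_less_top)
  finally show "(\<integral>\<^sup>+p. ennreal (norm (h (snd p) * G (fst p) * H (add_point (fst p) (snd p)))) \<partial>QL) < \<infinity>" .
qed

text \<open>At a point of the process the Mecke integrand contains
  H(\<open>add_point (del i \<omega>) (X i \<omega>)\<close>), which is H at the process and factors
  out of the sum over points; the remaining sum is \<open>factorial_functional_insert\<close>. The
  growth bound on factorial functionals supplies the integrability.\<close>

lemma factorial_by_parts:
  assumes J: "finite J" "j \<notin> J" and g: "\<And>k. k \<in> insert j J \<Longrightarrow> supported_in lam B c (g k)" and c: "0 \<le> c"
    and H: "exp_integrable B H"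
  shows "integrable QL (\<lambda>p. g j (snd p) * factorial_functional lam J g (fst p) * H (add_point (fst p) (snd p)))"
    and "(\<integral>\<mu>. factorial_functional lam (insert j J) g \<mu> * H \<mu> \<partial>Q)
      = (\<integral>p. g j (snd p) * factorial_functional lam J g (fst p) * H (add_point (fst p) (snd p)) \<partial>QL)"
proof -
  have gm: "g k \<in> borel_measurable lam" if "k \<in> insert j J" for k using g[OF that] by (rule supported_inD(1))
  then have [measurable]: "factorial_functional lam J g \<in> borel_measurable N"
      "factorial_functional lam (insert j J) g \<in> borel_measurable N" "H \<in> borel_measurable N"
    using J exp_integrableD(1)[OF H] by (auto intro!: measurable_factorial_functional)
  have gj: "supported_in lam B c (g j)" using g by auto
  show int: "integrable QL (\<lambda>p. g j (snd p) * factorial_functional lam J g (fst p) * H (add_point (fst p) (snd p)))"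
  proof (rule integrable_add_point[OF H _ _ _ gj c])
    show "AE \<mu> in Q. \<bar>factorial_functional lam J g \<mu>\<bar> \<le> (c ^ card J * fact (card J)) * exp (measure \<mu> B)"
      using g by (intro factorial_functional_bound J c) auto
  qed (use c in auto)
  have "(\<integral>p. g j (snd p) * factorial_functional lam J g (fst p) * H (add_point (fst p) (snd p)) \<partial>QL)
    = (\<integral>\<omega>. (\<integral>i. (if i \<in> pts \<omega> then g j (X i \<omega>) * factorial_functional lam J g (del i \<omega>) * H (add_point (del i \<omega>) (X i \<omega>)) else 0) \<partial>count_space UNIV) \<partial>P)"
    by (subst mecke_integral[OF int]) (simp cong: if_cong)
  also have "\<dots> = (\<integral>\<omega>. factorial_functional lam (insert j J) g (\<eta> \<omega>) * H (\<eta> \<omega>) \<partial>P)"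
  proof (rule integral_cong_AE)
    show "AE \<omega> in P. (\<integral>i. (if i \<in> pts \<omega> then g j (X i \<omega>) * factorial_functional lam J g (del i \<omega>) * H (add_point (del i \<omega>) (X i \<omega>)) else 0) \<partial>count_space UNIV)
       = factorial_functional lam (insert j J) g (\<eta> \<omega>) * H (\<eta> \<omega>)"
      using AE_finite_pts_in[OF B Bfin] AE_space
    proof eventually_elim
      fix \<omega> assume fin: "finite (pts_in B \<omega>)" and w: "\<omega> \<in> space P"
      let ?f = "\<lambda>i. if i \<in> pts \<omega> then g j (X i \<omega>) * factorial_functional lam J g (del i \<omega>) * H (add_point (del i \<omega>) (X i \<omega>)) else 0"
      have z: "?f i = 0" if "i \<notin> pts_in B \<omega>" for i
        using that supported_inD(3)[OF gj X_space[OF w, of i]] by (auto simp: pts_in_def)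
      then have sub: "{i. ?f i \<noteq> 0} \<subseteq> pts_in B \<omega>" by blast
      have "(\<integral>i. ?f i \<partial>count_space UNIV) = (\<Sum>i | i \<in> UNIV \<and> ?f i \<noteq> 0. ?f i)"
        using finite_subset[OF sub fin] by (intro lebesgue_integral_count_space_finite_support) simp
      also have "\<dots> = (\<Sum>i\<in>pts_in B \<omega>. ?f i)"
        using sub by (intro sum.mono_neutral_left fin) auto
      also have "\<dots> = (\<Sum>i\<in>pts_in B \<omega>. g j (X i \<omega>) * factorial_functional lam J g (del i \<omega>)) * H (\<eta> \<omega>)"
        unfolding sum_distrib_right
        by (intro sum.cong refl) (simp add: pts_in_def add_point_del[OF w])
      also have "(\<Sum>i\<in>pts_in B \<omega>. g j (X i \<omega>) * factorial_functional lam J g (del i \<omega>)) = factorial_functional lam (insert j J) g (\<eta> \<omega>)"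
        by (rule factorial_functional_insert[where g=g, OF w fin J g, symmetric])
      finally show "(\<integral>i. ?f i \<partial>count_space UNIV) = factorial_functional lam (insert j J) g (\<eta> \<omega>) * H (\<eta> \<omega>)" .
    qed
    have [measurable]: "g j \<in> borel_measurable lam" by (rule supported_inD(1)[OF gj])
    have "(\<lambda>p. g j (snd p) * factorial_functional lam J g (fst p) * H (add_point (fst p) (snd p))) \<in> borel_measurable (N \<Otimes>\<^sub>M lam)"
      by measurable
    from measurable_point_integral[OF this]
    show "(\<lambda>\<omega>. (\<integral>i. (if i \<in> pts \<omega> then g j (X i \<omega>) * factorial_functional lam J g (del i \<omega>) * H (add_point (del i \<omega>) (X i \<omega>)) else 0) \<partial>count_space UNIV)) \<in> borel_measurable P"
      by (simp cong: if_cong)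
    show "(\<lambda>\<omega>. factorial_functional lam (insert j J) g (\<eta> \<omega>) * H (\<eta> \<omega>)) \<in> borel_measurable P"
      by measurable
  qed
  also have "\<dots> = (\<integral>\<mu>. factorial_functional lam (insert j J) g \<mu> * H \<mu> \<partial>Q)"
    by (rule integral_distr[symmetric]) measurable
  finally show "(\<integral>\<mu>. factorial_functional lam (insert j J) g \<mu> * H \<mu> \<partial>Q)
      = (\<integral>p. g j (snd p) * factorial_functional lam J g (fst p) * H (add_point (fst p) (snd p)) \<partial>QL)" ..
qed

text \<open>Each bracket in \<open>wick_functional_insert\<close> is treated separately. The
  factorial term contributes H(mu + delta_y) and its compensator contributes H(mu) under the same
  integral over y, so that their difference is D_y H. This is the duality between raising the order
  of a multiple integral and the difference operator.\<close>

theorem wick_by_parts: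
  assumes J: "finite J" "j \<notin> J" and g: "\<And>k. k \<in> insert j J \<Longrightarrow> supported_in lam B c (g k)" and c: "0 \<le> c"
    and H: "exp_integrable B H"
  shows "integrable QL (\<lambda>p. g j (snd p) * wick_functional lam J g (fst p) * diff_op (snd p) H (fst p))"
    and "(\<integral>\<mu>. wick_functional lam (insert j J) g \<mu> * H \<mu> \<partial>Q)
      = (\<integral>p. g j (snd p) * wick_functional lam J g (fst p) * diff_op (snd p) H (fst p) \<partial>QL)"
proof -
  let ?s = "\<lambda>K. (-1) ^ (card J - card K) * (\<Prod>j\<in>J - K. \<integral>y. g j y \<partial>lam) :: real"
  let ?f = "\<lambda>K p. g j (snd p) * factorial_functional lam K g (fst p) * diff_op (snd p) H (fst p)"
  let ?G = "\<lambda>K \<mu>. (factorial_functional lam (insert j K) g \<mu> - (\<integral>y. g j y \<partial>lam) * factorial_functional lam K g \<mu>) * H \<mu>"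
  have gj: "supported_in lam B c (g j)" using g by auto
  have K: "integrable QL (?f K) \<and> integrable Q (?G K) \<and> (\<integral>\<mu>. ?G K \<mu> \<partial>Q) = (\<integral>p. ?f K p \<partial>QL)"
    if "K \<in> Pow J" for K
  proof -
    have fK: "finite K" "j \<notin> K" using that J by (auto intro: finite_subset)
    have gK: "\<And>k. k \<in> insert j K \<Longrightarrow> supported_in lam B c (g k)" using g that by auto
    note 1 = factorial_by_parts[where g=g, OF fK gK c H]
    have i1: "integrable Q (\<lambda>\<mu>. factorial_functional lam (insert j K) g \<mu> * H \<mu>)"
      using fK gK by (intro exp_integrableD(3)[of B] exp_integrable_factorial_mult[OF _ _ c H]) auto
    have i2: "integrable Q (\<lambda>\<mu>. factorial_functional lam K g \<mu> * H \<mu>)"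
      using fK gK by (intro exp_integrableD(3)[of B] exp_integrable_factorial_mult[OF _ _ c H]) auto
    note 2 = QL_integral_product[OF i2 supported_in_integrable[OF gj B Bfin]]
    have e: "?f K = (\<lambda>p. g j (snd p) * factorial_functional lam K g (fst p) * H (add_point (fst p) (snd p))
        - factorial_functional lam K g (fst p) * H (fst p) * g j (snd p))"
      by (simp add: fun_eq_iff diff_op_def algebra_simps)
    have e': "?G K = (\<lambda>\<mu>. factorial_functional lam (insert j K) g \<mu> * H \<mu> - (factorial_functional lam K g \<mu> * H \<mu>) * (\<integral>y. g j y \<partial>lam))"
      by (simp add: fun_eq_iff algebra_simps)
    have "integrable QL (?f K)" unfolding e using 1(1) 2(1) by (rule Bochner_Integration.integrable_diff)
    moreover have "integrable Q (?G K)" unfolding e' using i1 i2 by (intro Bochner_Integration.integrable_diff integrable_mult_left)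
    moreover have "(\<integral>\<mu>. ?G K \<mu> \<partial>Q) = (\<integral>p. ?f K p \<partial>QL)"
      unfolding e e' using 1 2 i1 i2 by simp
    ultimately show ?thesis by blast
  qed
  have e1: "(\<lambda>p. g j (snd p) * wick_functional lam J g (fst p) * diff_op (snd p) H (fst p)) = (\<lambda>p. \<Sum>K\<in>Pow J. ?s K * ?f K p)"
    unfolding wick_functional_def by (simp add: fun_eq_iff sum_distrib_left sum_distrib_right mult_ac)
  have e2: "wick_functional lam (insert j J) g \<mu> * H \<mu> = (\<Sum>K\<in>Pow J. ?s K * ?G K \<mu>)" for \<mu>
    unfolding wick_functional_insert[OF J] sum_distrib_right by (intro sum.cong refl) (simp add: mult_ac)
  show "integrable QL (\<lambda>p. g j (snd p) * wick_functional lam J g (fst p) * diff_op (snd p) H (fst p))"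
    unfolding e1 using K by (intro Bochner_Integration.integrable_sum integrable_mult_right) blast
  have "(\<integral>\<mu>. wick_functional lam (insert j J) g \<mu> * H \<mu> \<partial>Q) = (\<Sum>K\<in>Pow J. ?s K * (\<integral>\<mu>. ?G K \<mu> \<partial>Q))"
    unfolding e2 using K by (subst Bochner_Integration.integral_sum) auto
  also have "\<dots> = (\<Sum>K\<in>Pow J. ?s K * (\<integral>p. ?f K p \<partial>QL))"
    using K by (intro sum.cong refl) auto
  also have "\<dots> = (\<integral>p. g j (snd p) * wick_functional lam J g (fst p) * diff_op (snd p) H (fst p) \<partial>QL)"
    unfolding e1 using K by (subst Bochner_Integration.integral_sum) auto
  finally show "(\<integral>\<mu>. wick_functional lam (insert j J) g \<mu> * H \<mu> \<partial>Q)
      = (\<integral>p. g j (snd p) * wick_functional lam J g (fst p) * diff_op (snd p) H (fst p) \<partial>QL)" .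
qed

end

end

section \<open>The pairing of multiple integrals with expected differences\<close>

context poisson_points
begin

lemma QL_distr: "QL = distr (P \<Otimes>\<^sub>M lam) (N \<Otimes>\<^sub>M lam) (\<lambda>p. (\<eta> (fst p), snd p))"
proof -
  have "distr lam lam (\<lambda>y. y) = lam" by (rule distr_id)
  moreover have "sigma_finite_measure lam" ..
  ultimately show ?thesis
    using pair_measure_distr[of \<eta> P N "\<lambda>y. y" lam lam] by (simp add: case_prod_beta')
qed

lemma measurable_eta_pair [measurable]:
  "(\<lambda>p. (\<eta> (fst p), snd p)) \<in> measurable (P \<Otimes>\<^sub>M lam) (N \<Otimes>\<^sub>M lam)"
  by measurable

lemma sets_QL: "sets QL = sets (N \<Otimes>\<^sub>M lam)"
  by (intro sets_pair_measure_cong) auto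

lemma measurable_QL: "measurable QL K = measurable (N \<Otimes>\<^sub>M lam) K"
  by (rule measurable_cong_sets[OF sets_QL refl])

lemma AE_QL_iff:
  assumes "Measurable.pred (N \<Otimes>\<^sub>M lam) S"
  shows "(AE p in QL. S p) \<longleftrightarrow> (AE p in P \<Otimes>\<^sub>M lam. S (\<eta> (fst p), snd p))"
  unfolding QL_distr using assms by (intro AE_distr_iff) auto

lemma AE_QLI:
  assumes S: "Measurable.pred (N \<Otimes>\<^sub>M lam) S"
    and ae: "AE \<omega> in P. \<forall>y\<in>space lam. S (\<eta> \<omega>, y)"
  shows "AE p in QL. S p"
  unfolding AE_QL_iff[OF S]
proof (rule PL.AE_pair_measure)
  have "Measurable.pred (P \<Otimes>\<^sub>M lam) (\<lambda>p. S (\<eta> (fst p), snd p))"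
    by (rule measurable_compose[OF measurable_eta_pair S])
  then show "{p \<in> space (P \<Otimes>\<^sub>M lam). S (\<eta> (fst p), snd p)} \<in> sets (P \<Otimes>\<^sub>M lam)" by (rule predE)
  show "AE \<omega> in P. AE y in lam. S (\<eta> (fst (\<omega>, y)), snd (\<omega>, y))"
    using ae by eventually_elim (auto intro: AE_I2)
qed

lemma wick_functional_empty_AE: "AE \<mu> in Q. wick_functional lam {} g \<mu> = 1"
proof -
  have R: "represents_tuple_sum lam {} g (factorial_functional lam {} g)"
    by (rule represents_factorial_functional) auto
  have [measurable]: "factorial_functional lam {} g \<in> borel_measurable N"
    by (rule measurable_factorial_functional) auto
  have "factorial_functional lam {} g (\<eta> \<omega>) = 1" if w: "\<omega> \<in> space P" for \<omega>
    by (subst eta_points[OF w], subst represents_tuple_sumD[OF R, where B="{}"]) (use X_space[OF w] in auto)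
  then have "AE \<omega> in P. wick_functional lam {} g (\<eta> \<omega>) = 1" by simp
  then show ?thesis by (subst AE_Q_iff) auto
qed

lemma measurable_diff_iter_Q:
  assumes [measurable]: "H \<in> borel_measurable N"
  shows "(\<lambda>p. diff_iter n (fst p) H (snd p)) \<in> borel_measurable (pow_measure lam n \<Otimes>\<^sub>M Q)"
  using measurable_diff_iter[OF assms]
  by (subst measurable_cong_sets[OF sets_pair_measure_cong[OF refl sets_distr] refl])

lemma measurable_T:
  assumes "H \<in> borel_measurable N"
  shows "(\<lambda>z. \<integral>\<mu>. diff_iter n z H \<mu> \<partial>Q) \<in> borel_measurable (pow_measure lam n)"
  using measurable_diff_iter_Q[OF assms, of n]
  by (intro Q.borel_measurable_lebesgue_integral) (simp add: case_prod_beta)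

context
  fixes B assumes B[measurable]: "B \<in> sets lam" and Bfin: "emeasure lam B < \<infinity>"
begin

lemma measurable_nn_diff_iter:
  assumes "H \<in> borel_measurable N"
  shows "(\<lambda>z. \<integral>\<^sup>+\<mu>. ennreal (\<bar>diff_iter n z H \<mu>\<bar> * exp (c * measure \<mu> B)) \<partial>Q) \<in> borel_measurable (pow_measure lam n)"
proof -
  note [measurable] = measurable_diff_iter_Q[OF assms, of n]
  have "(\<lambda>p. ennreal (\<bar>diff_iter n (fst p) H (snd p)\<bar> * exp (c * measure (snd p) B))) \<in> borel_measurable (pow_measure lam n \<Otimes>\<^sub>M Q)"
    by measurable
  then show ?thesis by (intro Q.borel_measurable_nn_integral) (simp add: case_prod_beta)
qed

text \<open>Each difference costs a factor 1 + lam(B) and raises the exponent by one, by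
  \<open>nn_integral_diff_op\<close>. The case c = 0 yields integrability of the expected n-th
  difference over the cube with base \<open>B\<close>.\<close>

lemma nn_integral_diff_iter:
  assumes "H \<in> borel_measurable N" "0 \<le> c"
  shows "(\<integral>\<^sup>+z. (\<Prod>i<n. indicator B (z i)) * (\<integral>\<^sup>+\<mu>. ennreal (\<bar>diff_iter n z H \<mu>\<bar> * exp (c * measure \<mu> B)) \<partial>Q) \<partial>pow_measure lam n)
    \<le> (1 + emeasure lam B) ^ n * (\<integral>\<^sup>+\<mu>. ennreal (\<bar>H \<mu>\<bar> * exp ((c + n) * measure \<mu> B)) \<partial>Q)"
  using assms
proof (induction n arbitrary: H c)
  case 0
  then show ?case by (simp add: PiM_empty nn_integral_count_space_finite)
next
  case (Suc n)
  note [measurable] = \<open>H \<in> borel_measurable N\<close>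
  let ?I = "\<lambda>n z H. \<integral>\<^sup>+\<mu>. ennreal (\<bar>diff_iter n z H \<mu>\<bar> * exp (c * measure \<mu> B)) \<partial>Q"
  let ?f = "\<lambda>z. (\<Prod>i<Suc n. indicator B (z i)) * ?I (Suc n) z H"
  have [measurable]: "(\<lambda>z. ?I n z K) \<in> borel_measurable (pow_measure lam n)" if "K \<in> borel_measurable N" for n K
    by (rule measurable_nn_diff_iter[OF that])
  have [measurable]: "(\<lambda>z. z i) \<in> measurable (pow_measure lam k) lam" if "i < k" for i k
    using that by (intro measurable_component_singleton) auto
  have "(\<lambda>z. \<Prod>i<Suc n. indicator B (z i) :: ennreal) \<in> borel_measurable (pow_measure lam (Suc n))"
    by (intro borel_measurable_prod_ennreal) measurable
  then have fm: "?f \<in> borel_measurable (PiM (insert n {..<n}) (\<lambda>_. lam))"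
    using Suc.prems unfolding lessThan_Suc[symmetric] by measurable
  have "(\<integral>\<^sup>+z. ?f z \<partial>pow_measure lam (Suc n)) = (\<integral>\<^sup>+y. \<integral>\<^sup>+z. ?f (z(n := y)) \<partial>pow_measure lam n \<partial>lam)"
    using pow.product_nn_integral_insert_rev[OF _ _ fm] by (simp only: lessThan_Suc[symmetric]) simp
  also have "\<dots> \<le> (\<integral>\<^sup>+y. (1 + emeasure lam B) ^ n * (indicator B y * (\<integral>\<^sup>+\<mu>. ennreal (\<bar>diff_op y H \<mu>\<bar> * exp ((c + n) * measure \<mu> B)) \<partial>Q)) \<partial>lam)"
  proof (rule nn_integral_mono)
    fix y assume y: "y \<in> space lam"
    have d[measurable]: "diff_op y H \<in> borel_measurable N" by (rule measurable_diff_op'[OF _ y]) simp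
    have "?f (z(n := y)) = indicator B y * ((\<Prod>i<n. indicator B (z i)) * ?I n z (diff_op y H))" for z
      unfolding diff_iter_upd by (simp add: mult_ac)
    then have "(\<integral>\<^sup>+z. ?f (z(n := y)) \<partial>pow_measure lam n)
        = (\<integral>\<^sup>+z. indicator B y * ((\<Prod>i<n. indicator B (z i)) * ?I n z (diff_op y H)) \<partial>pow_measure lam n)"
      by simp
    also have "\<dots> = indicator B y * (\<integral>\<^sup>+z. (\<Prod>i<n. indicator B (z i)) * ?I n z (diff_op y H) \<partial>pow_measure lam n)"
      by (intro nn_integral_cmult borel_measurable_times borel_measurable_prod_ennreal) measurable
    also have "\<dots> \<le> indicator B y * ((1 + emeasure lam B) ^ n * (\<integral>\<^sup>+\<mu>. ennreal (\<bar>diff_op y H \<mu>\<bar> * exp ((c + n) * measure \<mu> B)) \<partial>Q))"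
      by (intro mult_left_mono Suc.IH Suc.prems d) simp
    finally show "(\<integral>\<^sup>+z. ?f (z(n := y)) \<partial>pow_measure lam n)
      \<le> (1 + emeasure lam B) ^ n * (indicator B y * (\<integral>\<^sup>+\<mu>. ennreal (\<bar>diff_op y H \<mu>\<bar> * exp ((c + n) * measure \<mu> B)) \<partial>Q))"
      by (simp add: mult_ac)
  qed
  also have "\<dots> = (1 + emeasure lam B) ^ n * (\<integral>\<^sup>+y. \<integral>\<^sup>+\<mu>. indicator B y * ennreal (\<bar>diff_op y H \<mu>\<bar> * exp ((c + n) * measure \<mu> B)) \<partial>Q \<partial>lam)"
  proof -
    have [measurable]: "(\<lambda>p. ennreal (\<bar>diff_op (fst p) H (snd p)\<bar> * exp ((c + n) * measure (snd p) B))) \<in> borel_measurable (lam \<Otimes>\<^sub>M Q)"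
      unfolding diff_op_def by measurable
    have "(\<lambda>y. \<integral>\<^sup>+\<mu>. ennreal (\<bar>diff_op y H \<mu>\<bar> * exp ((c + n) * measure \<mu> B)) \<partial>Q) \<in> borel_measurable lam"
      by (intro Q.borel_measurable_nn_integral) (simp add: case_prod_beta)
    then have "(\<integral>\<^sup>+y. (1 + emeasure lam B) ^ n * (indicator B y * (\<integral>\<^sup>+\<mu>. ennreal (\<bar>diff_op y H \<mu>\<bar> * exp ((c + n) * measure \<mu> B)) \<partial>Q)) \<partial>lam)
      = (1 + emeasure lam B) ^ n * (\<integral>\<^sup>+y. indicator B y * (\<integral>\<^sup>+\<mu>. ennreal (\<bar>diff_op y H \<mu>\<bar> * exp ((c + n) * measure \<mu> B)) \<partial>Q) \<partial>lam)"
      by (intro nn_integral_cmult) measurable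
    also have "\<dots> = (1 + emeasure lam B) ^ n * (\<integral>\<^sup>+y. \<integral>\<^sup>+\<mu>. indicator B y * ennreal (\<bar>diff_op y H \<mu>\<bar> * exp ((c + n) * measure \<mu> B)) \<partial>Q \<partial>lam)"
    proof (intro arg_cong2[where f="(*)"] refl nn_integral_cong)
      fix y assume y: "y \<in> space lam"
      note [measurable] = measurable_diff_op'[OF \<open>H \<in> borel_measurable N\<close> y]
      show "indicator B y * (\<integral>\<^sup>+\<mu>. ennreal (\<bar>diff_op y H \<mu>\<bar> * exp ((c + n) * measure \<mu> B)) \<partial>Q)
        = (\<integral>\<^sup>+\<mu>. indicator B y * ennreal (\<bar>diff_op y H \<mu>\<bar> * exp ((c + n) * measure \<mu> B)) \<partial>Q)"
        by (rule nn_integral_cmult[symmetric]) measurable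
    qed
    finally show ?thesis .
  qed
  also have "(\<integral>\<^sup>+y. \<integral>\<^sup>+\<mu>. indicator B y * ennreal (\<bar>diff_op y H \<mu>\<bar> * exp ((c + n) * measure \<mu> B)) \<partial>Q \<partial>lam)
     = (\<integral>\<^sup>+p. indicator B (snd p) * ennreal (\<bar>diff_op (snd p) H (fst p)\<bar> * exp ((c + n) * measure (fst p) B)) \<partial>QL)"
    by (subst QL.nn_integral_snd[symmetric]) auto
  also have "(1 + emeasure lam B) ^ n * \<dots>
     \<le> (1 + emeasure lam B) ^ n * ((1 + emeasure lam B) * (\<integral>\<^sup>+\<mu>. ennreal (\<bar>H \<mu>\<bar> * exp ((c + n + 1) * measure \<mu> B)) \<partial>Q))"
    using Suc.prems by (intro mult_left_mono nn_integral_diff_op[OF B Bfin]) auto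
  finally show ?case by (simp add: mult_ac add_ac)
qed

lemma abs_prod_supported:
  assumes g: "\<And>i. i < n \<Longrightarrow> supported_in lam B c (g i)" and z: "z \<in> space (pow_measure lam n)"
  shows "ennreal \<bar>\<Prod>i<n. g i (z i)\<bar> \<le> ennreal (c ^ n) * (\<Prod>i<n. indicator B (z i))"
proof (cases "\<forall>i<n. z i \<in> B")
  case True
  have zi: "z i \<in> space lam" if "i < n" for i using z that by (auto simp: space_PiM)
  have "\<bar>\<Prod>i<n. g i (z i)\<bar> = (\<Prod>i<n. \<bar>g i (z i)\<bar>)" by (rule abs_prod)
  also have "\<dots> \<le> (\<Prod>i<n. c)" using supported_inD(2)[OF g zi] by (intro prod_mono) auto
  finally show ?thesis using True by (simp add: ennreal_leI)
next
  case False
  then obtain i where i: "i < n" "z i \<notin> B" by auto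
  moreover have "z i \<in> space lam" using z i by (auto simp: space_PiM)
  ultimately have "g i (z i) = 0" using supported_inD(3)[OF g] by auto
  then have p: "(\<Prod>i<n. g i (z i)) = 0" using i by (intro prod_zero) auto
  show ?thesis unfolding p by simp
qed

text \<open>For fixed last variable y the induction hypothesis is applied to D_y H, which is again
  \<open>exp_integrable\<close> for almost every y in \<open>B\<close>; for y outside
  \<open>B\<close> the factor \<open>g n\<close> vanishes, so nothing has to be known there. Fubini
  puts the last variable back.\<close>

theorem wick_pairing:
  assumes g: "\<And>i. i < n \<Longrightarrow> supported_in lam B c (g i)" and c: "0 \<le> c" and H: "exp_integrable B H"
  shows "integrable (pow_measure lam n) (\<lambda>z. (\<integral>\<mu>. diff_iter n z H \<mu> \<partial>Q) * (\<Prod>i<n. g i (z i)))" (is ?int)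
    and "(\<integral>\<mu>. wick_functional lam {..<n} g \<mu> * H \<mu> \<partial>Q)
      = (\<integral>z. (\<integral>\<mu>. diff_iter n z H \<mu> \<partial>Q) * (\<Prod>i<n. g i (z i)) \<partial>pow_measure lam n)" (is ?eq)
proof -
  have int: "integrable (pow_measure lam n) (\<lambda>z. (\<integral>\<mu>. diff_iter n z H \<mu> \<partial>Q) * (\<Prod>i<n. g i (z i)))"
    if g: "\<And>i. i < n \<Longrightarrow> supported_in lam B c (g i)" and H: "exp_integrable B H" for n H
  proof (rule integrableI_bounded)
    note Hm = exp_integrableD(1)[OF H]
    note [measurable] = measurable_T[OF Hm, of n]
    have [measurable]: "(\<lambda>z. g i (z i)) \<in> borel_measurable (pow_measure lam n)" if "i < n" for i
    proof (rule measurable_compose[of "\<lambda>z. z i" _ lam "g i"])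
      show "(\<lambda>z. z i) \<in> measurable (pow_measure lam n) lam"
        using that by (intro measurable_component_singleton) simp
    qed (rule supported_inD(1)[OF g[OF that]])
    show "(\<lambda>z. (\<integral>\<mu>. diff_iter n z H \<mu> \<partial>Q) * (\<Prod>i<n. g i (z i))) \<in> borel_measurable (pow_measure lam n)"
      by (intro borel_measurable_times borel_measurable_prod) measurable
    let ?I = "\<lambda>z. \<integral>\<^sup>+\<mu>. ennreal (\<bar>diff_iter n z H \<mu>\<bar> * exp (0 * measure \<mu> B)) \<partial>Q"
    have "(\<integral>\<^sup>+z. ennreal (norm ((\<integral>\<mu>. diff_iter n z H \<mu> \<partial>Q) * (\<Prod>i<n. g i (z i)))) \<partial>pow_measure lam n)
      \<le> (\<integral>\<^sup>+z. ennreal (c ^ n) * ((\<Prod>i<n. indicator B (z i)) * ?I z) \<partial>pow_measure lam n)"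
    proof (rule nn_integral_mono)
      fix z assume z: "z \<in> space (pow_measure lam n)"
      \<comment> \<open>At tuples where the inner integral does not exist its value is 0 by
        convention, so the bound holds there as well.\<close>
      have 1: "ennreal \<bar>\<integral>\<mu>. diff_iter n z H \<mu> \<partial>Q\<bar> \<le> ?I z"
        using integral_norm_bound_ennreal[of Q "diff_iter n z H"]
        by (cases "integrable Q (diff_iter n z H)") (auto simp: not_integrable_integral_eq)
      have "ennreal (norm ((\<integral>\<mu>. diff_iter n z H \<mu> \<partial>Q) * (\<Prod>i<n. g i (z i))))
        = ennreal \<bar>\<integral>\<mu>. diff_iter n z H \<mu> \<partial>Q\<bar> * ennreal \<bar>\<Prod>i<n. g i (z i)\<bar>"
        by (simp add: ennreal_mult'[symmetric] abs_mult)
      also have "\<dots> \<le> ?I z * (ennreal (c ^ n) * (\<Prod>i<n. indicator B (z i)))"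
        by (intro mult_mono 1 abs_prod_supported g z) auto
      finally show "ennreal (norm ((\<integral>\<mu>. diff_iter n z H \<mu> \<partial>Q) * (\<Prod>i<n. g i (z i))))
        \<le> ennreal (c ^ n) * ((\<Prod>i<n. indicator B (z i)) * ?I z)" by (simp add: mult_ac)
    qed
    also have "\<dots> = ennreal (c ^ n) * (\<integral>\<^sup>+z. (\<Prod>i<n. indicator B (z i)) * ?I z \<partial>pow_measure lam n)"
    proof (rule nn_integral_cmult)
      have [measurable]: "(\<lambda>z. z i) \<in> measurable (pow_measure lam n) lam" if "i < n" for i
        using that by (intro measurable_component_singleton) auto
      have "(\<lambda>z. \<Prod>i<n. indicator B (z i) :: ennreal) \<in> borel_measurable (pow_measure lam n)"
        by (intro borel_measurable_prod_ennreal) measurable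
      with measurable_nn_diff_iter[OF Hm]
      show "(\<lambda>z. (\<Prod>i<n. indicator B (z i)) * ?I z) \<in> borel_measurable (pow_measure lam n)"
        by measurable
    qed
    also have "\<dots> \<le> ennreal (c ^ n) * ((1 + emeasure lam B) ^ n * (\<integral>\<^sup>+\<mu>. ennreal (\<bar>H \<mu>\<bar> * exp ((0 + real n) * measure \<mu> B)) \<partial>Q))"
      using nn_integral_diff_iter[OF Hm order_refl, of n] by (rule mult_left_mono) simp
    also have "\<dots> < \<infinity>"
      using exp_integrable_finite[OF B Bfin H, of "0 + real n"] Bfin
      by (simp add: ennreal_mult_less_top power_less_top_ennreal)
    finally show "(\<integral>\<^sup>+z. ennreal (norm ((\<integral>\<mu>. diff_iter n z H \<mu> \<partial>Q) * (\<Prod>i<n. g i (z i)))) \<partial>pow_measure lam n) < \<infinity>" .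
  qed
  show ?int using g H by (rule int)
  show ?eq using g H
  proof (induction n arbitrary: H)
    case 0
    have "(\<integral>\<mu>. wick_functional lam {} g \<mu> * H \<mu> \<partial>Q) = (\<integral>\<mu>. H \<mu> \<partial>Q)"
    proof (rule integral_cong_AE)
      show "AE \<mu> in Q. wick_functional lam {} g \<mu> * H \<mu> = H \<mu>"
        using wick_functional_empty_AE[of g] by eventually_elim simp
      have [measurable]: "H \<in> borel_measurable N" using exp_integrableD(1)[OF 0(2)] .
      have [measurable]: "wick_functional lam {} g \<in> borel_measurable N"
        by (rule measurable_wick_functional) auto
      show "(\<lambda>\<mu>. wick_functional lam {} g \<mu> * H \<mu>) \<in> borel_measurable Q" "H \<in> borel_measurable Q"
        by measurable
    qed
    then show ?case by (simp add: PiM_empty lebesgue_integral_count_space_finite)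
  next
    case (Suc n)
    interpret PN: sigma_finite_measure "pow_measure lam n" by (rule pow.sigma_finite) simp
    interpret PNL: pair_sigma_finite "pow_measure lam n" lam ..
    let ?F = "\<lambda>z. (\<integral>\<mu>. diff_iter (Suc n) z H \<mu> \<partial>Q) * (\<Prod>i<Suc n. g i (z i))"
    have gn: "supported_in lam B c (g n)" by (rule Suc.prems) simp
    note Hm = exp_integrableD(1)[OF Suc.prems(2)]
    have ins: "insert n {..<n} = {..<Suc n}" by (simp add: lessThan_Suc)
    note bp = wick_by_parts[where g=g and J="{..<n}" and j=n, OF B Bfin _ _ _ c Suc.prems(2), unfolded ins]
    have gs: "\<And>k. k \<in> {..<Suc n} \<Longrightarrow> supported_in lam B c (g k)" using Suc.prems by auto
    have iF: "integrable (PiM (insert n {..<n}) (\<lambda>_. lam)) ?F"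
      unfolding ins by (rule int[OF Suc.prems])
    have "(\<integral>\<mu>. wick_functional lam {..<Suc n} g \<mu> * H \<mu> \<partial>Q)
        = (\<integral>p. g n (snd p) * wick_functional lam {..<n} g (fst p) * diff_op (snd p) H (fst p) \<partial>QL)"
      by (rule bp(2)) (auto intro: gs)
    also have "\<dots> = (\<integral>y. \<integral>\<mu>. g n y * wick_functional lam {..<n} g \<mu> * diff_op y H \<mu> \<partial>Q \<partial>lam)"
    proof -
      have "integrable QL (\<lambda>p. g n (snd p) * wick_functional lam {..<n} g (fst p) * diff_op (snd p) H (fst p))"
        by (rule bp(1)) (auto intro: gs)
      then show ?thesis
        by (subst QL.integral_snd) (simp_all add: case_prod_beta')
    qed
    also have "\<dots> = (\<integral>y. \<integral>z. ?F (z(n := y)) \<partial>pow_measure lam n \<partial>lam)"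
    proof (rule integral_cong_AE)
      show "AE y in lam. (\<integral>\<mu>. g n y * wick_functional lam {..<n} g \<mu> * diff_op y H \<mu> \<partial>Q) = (\<integral>z. ?F (z(n := y)) \<partial>pow_measure lam n)"
        using AE_exp_integrable_diff_op[OF B Bfin Suc.prems(2)] AE_space
      proof eventually_elim
        fix y assume d: "y \<in> B \<longrightarrow> exp_integrable B (diff_op y H)" and y: "y \<in> space lam"
        have e: "?F (z(n := y)) = g n y * ((\<integral>\<mu>. diff_iter n z (diff_op y H) \<mu> \<partial>Q) * (\<Prod>i<n. g i (z i)))" for z
          unfolding diff_iter_upd by (simp add: mult_ac)
        show "(\<integral>\<mu>. g n y * wick_functional lam {..<n} g \<mu> * diff_op y H \<mu> \<partial>Q) = (\<integral>z. ?F (z(n := y)) \<partial>pow_measure lam n)"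
        proof (cases "y \<in> B")
          case True
          then have "(\<integral>\<mu>. wick_functional lam {..<n} g \<mu> * diff_op y H \<mu> \<partial>Q)
             = (\<integral>z. (\<integral>\<mu>. diff_iter n z (diff_op y H) \<mu> \<partial>Q) * (\<Prod>i<n. g i (z i)) \<partial>pow_measure lam n)"
            using d Suc.prems by (intro Suc.IH) auto
          then show ?thesis unfolding e by (simp add: mult.assoc)
        next
          case False
          then have "g n y = 0" using supported_inD(3)[OF gn y] by simp
          then show ?thesis unfolding e by simp
        qed
      qed
      have gm: "g k \<in> borel_measurable lam" if "k < Suc n" for k
        using supported_inD(1)[OF Suc.prems(1)[OF that]] .
      note [measurable] = gm[OF lessI] Hm
      have [measurable]: "wick_functional lam {..<n} g \<in> borel_measurable N"
        by (rule measurable_wick_functional) (auto intro: gm)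
      have "(\<lambda>p. g n (fst p) * wick_functional lam {..<n} g (snd p) * diff_op (fst p) H (snd p)) \<in> borel_measurable (lam \<Otimes>\<^sub>M Q)"
        unfolding diff_op_def by measurable
      then show "(\<lambda>y. \<integral>\<mu>. g n y * wick_functional lam {..<n} g \<mu> * diff_op y H \<mu> \<partial>Q) \<in> borel_measurable lam"
        by (intro Q.borel_measurable_lebesgue_integral) (simp add: case_prod_beta)
      have [measurable]: "?F \<in> borel_measurable (PiM (insert n {..<n}) (\<lambda>_. lam))" using iF by auto
      have "(\<lambda>p. (snd p)(n := fst p)) \<in> measurable (lam \<Otimes>\<^sub>M pow_measure lam n) (PiM (insert n {..<n}) (\<lambda>_. lam))"
        by (intro measurable_fun_upd[where J="{..<n}"]) auto
      from measurable_compose[OF this \<open>?F \<in> borel_measurable (PiM (insert n {..<n}) (\<lambda>_. lam))\<close>]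
      show "(\<lambda>y. \<integral>z. ?F (z(n := y)) \<partial>pow_measure lam n) \<in> borel_measurable lam"
        by (intro PN.borel_measurable_lebesgue_integral) (simp only: case_prod_unfold)
    qed
    also have "\<dots> = (\<integral>p. ?F ((fst p)(n := snd p)) \<partial>(pow_measure lam n \<Otimes>\<^sub>M lam))"
    proof -
      have "integrable (pow_measure lam n \<Otimes>\<^sub>M lam) (\<lambda>p. ?F ((fst p)(n := snd p)))"
        using iF by (subst integral_pow_insert(2)[of "{..<n}" n ?F, symmetric]) auto
      then have "integrable (pow_measure lam n \<Otimes>\<^sub>M lam) (case_prod (\<lambda>z y. ?F (z(n := y))))"
        by (simp only: case_prod_unfold)
      from PNL.integral_snd[OF this] show ?thesis by (simp only: case_prod_unfold)
    qed
    also have "\<dots> = (\<integral>z. ?F z \<partial>PiM (insert n {..<n}) (\<lambda>_. lam))"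
      by (rule integral_pow_insert(1)[symmetric]) (use iF in auto)
    finally show ?case unfolding ins .
  qed
qed

end

end

section \<open>Isometry and orthogonality\<close>

context poisson_points
begin

context
  fixes B assumes B[measurable]: "B \<in> sets lam" and Bfin: "emeasure lam B < \<infinity>"
begin

lemma measurable_wick_supported:
  assumes "finite J" "\<And>j. j \<in> J \<Longrightarrow> supported_in lam B c (g j)"
  shows "wick_functional lam J g \<in> borel_measurable N"
  using assms(1) supported_inD(1)[OF assms(2)] by (rule measurable_wick_functional)

lemma diff_op_wick_AE:
  assumes J: "finite J" and g: "\<And>j. j \<in> J \<Longrightarrow> supported_in lam B c (g j)"
  shows "AE p in QL. diff_op (snd p) (wick_functional lam J g) (fst p)
    = (\<Sum>j\<in>J. g j (snd p) * wick_functional lam (J - {j}) g (fst p))"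
proof (rule AE_QLI)
  have [measurable]: "wick_functional lam K g \<in> borel_measurable N" if "K \<subseteq> J" for K
    using that J g by (intro measurable_wick_supported) (auto intro: finite_subset)
  have "J - {j} \<subseteq> J" for j by auto
  moreover have [measurable]: "g j \<in> borel_measurable lam" if "j \<in> J" for j
    using supported_inD(1)[OF g[OF that]] .
  ultimately have 1: "(\<lambda>p. \<Sum>j\<in>J. g j (snd p) * wick_functional lam (J - {j}) g (fst p)) \<in> borel_measurable (N \<Otimes>\<^sub>M lam)"
    by measurable
  have 2: "(\<lambda>p. diff_op (snd p) (wick_functional lam J g) (fst p)) \<in> borel_measurable (N \<Otimes>\<^sub>M lam)"
    unfolding diff_op_def by measurable
  show "Measurable.pred (N \<Otimes>\<^sub>M lam) (\<lambda>p. diff_op (snd p) (wick_functional lam J g) (fst p)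
    = (\<Sum>j\<in>J. g j (snd p) * wick_functional lam (J - {j}) g (fst p)))"
    using 1 2 by measurable
  show "AE \<omega> in P. \<forall>y\<in>space lam. diff_op (snd (\<eta> \<omega>, y)) (wick_functional lam J g) (fst (\<eta> \<omega>, y))
    = (\<Sum>j\<in>J. g j (snd (\<eta> \<omega>, y)) * wick_functional lam (J - {j}) g (fst (\<eta> \<omega>, y)))"
    using AE_finite_pts_in[OF B Bfin] AE_space
  proof eventually_elim
    fix \<omega> assume fin: "finite (pts_in B \<omega>)" and w: "\<omega> \<in> space P"
    show "\<forall>y\<in>space lam. diff_op (snd (\<eta> \<omega>, y)) (wick_functional lam J g) (fst (\<eta> \<omega>, y))
      = (\<Sum>j\<in>J. g j (snd (\<eta> \<omega>, y)) * wick_functional lam (J - {j}) g (fst (\<eta> \<omega>, y)))"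
    proof
      fix y assume y: "y \<in> space lam"
      have "wick_functional lam J g (add_point (\<eta> \<omega>) y)
        = wick_functional lam J g (\<eta> \<omega>) + (\<Sum>j\<in>J. g j y * wick_functional lam (J - {j}) g (\<eta> \<omega>))"
        by (rule wick_functional_add[OF w fin J _ y]) (rule g)
      then show "diff_op (snd (\<eta> \<omega>, y)) (wick_functional lam J g) (fst (\<eta> \<omega>, y))
        = (\<Sum>j\<in>J. g j (snd (\<eta> \<omega>, y)) * wick_functional lam (J - {j}) g (fst (\<eta> \<omega>, y)))"
        by (simp add: diff_op_def)
    qed
  qed
qed

lemma exp_integrable_wick:
  assumes J: "finite J" and g: "\<And>j. j \<in> J \<Longrightarrow> supported_in lam B c (g j)" and c: "0 \<le> c"
  shows "exp_integrable B (wick_functional lam J g)"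
  using exp_integrable_wick_mult[OF B Bfin J _ c exp_integrable_const[OF B Bfin, of 1], of g] g by simp

lemma exp_integrable_sum:
  assumes "finite A" "\<And>a. a \<in> A \<Longrightarrow> exp_integrable B (F a)"
  shows "exp_integrable B (\<lambda>\<mu>. \<Sum>a\<in>A. k a * F a \<mu>)"
  using assms
proof (induction A rule: finite_induct)
  case empty
  then show ?case using exp_integrable_const[OF B Bfin, of 0] by simp
next
  case (insert a A)
  have "exp_integrable B (\<lambda>\<mu>. k a * F a \<mu>)"
    using insert.prems[of a] by (auto simp: exp_integrable_def mult.assoc)
  moreover have "exp_integrable B (\<lambda>\<mu>. \<Sum>a\<in>A. k a * F a \<mu>)" using insert by auto
  ultimately show ?case using insert.hyps by (simp add: exp_integrable_add)
qed

text \<open>Every integration by parts lowers both orders by one. Since the orders differ, one side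
  reaches order 0 first: either the other integral is then paired with a constant, whose difference
  is 0, or the sum over \<open>K\<close> is empty.\<close>

lemma wick_orthogonal:
  assumes J: "finite J" "\<And>j. j \<in> J \<Longrightarrow> supported_in lam B c (g j)"
    and K: "finite K" "\<And>j. j \<in> K \<Longrightarrow> supported_in lam B c (h j)"
    and c: "0 \<le> c" and ne: "card J \<noteq> card K"
  shows "(\<integral>\<mu>. wick_functional lam J g \<mu> * wick_functional lam K h \<mu> \<partial>Q) = 0"
  using J K ne
proof (induction J arbitrary: K rule: finite_induct)
  case empty
  then obtain k where k: "k \<in> K" by auto
  have [measurable]: "wick_functional lam {} g \<in> borel_measurable N" "wick_functional lam K h \<in> borel_measurable N"
    using empty by (auto intro!: measurable_wick_supported)
  have "(\<integral>\<mu>. wick_functional lam {} g \<mu> * wick_functional lam K h \<mu> \<partial>Q) = (\<integral>\<mu>. wick_functional lam K h \<mu> * 1 \<partial>Q)"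
  proof (rule integral_cong_AE)
    show "AE \<mu> in Q. wick_functional lam {} g \<mu> * wick_functional lam K h \<mu> = wick_functional lam K h \<mu> * 1"
      using wick_functional_empty_AE[of g] by eventually_elim simp
    show "(\<lambda>\<mu>. wick_functional lam {} g \<mu> * wick_functional lam K h \<mu>) \<in> borel_measurable Q"
      "(\<lambda>\<mu>. wick_functional lam K h \<mu> * 1) \<in> borel_measurable Q" by measurable
  qed
  also have "\<dots> = (\<integral>\<mu>. wick_functional lam (insert k (K - {k})) h \<mu> * 1 \<partial>Q)"
    using k by (simp add: insert_absorb)
  also have "\<dots> = (\<integral>p. h k (snd p) * wick_functional lam (K - {k}) h (fst p) * diff_op (snd p) (\<lambda>_. 1) (fst p) \<partial>QL)"
    by (rule wick_by_parts(2)[OF B Bfin _ _ _ c exp_integrable_const[OF B Bfin]]) (use empty k in auto)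
  also have "\<dots> = 0" by (simp add: diff_op_def)
  finally show ?case .
next
  case (insert j J)
  have gJ: "\<And>i. i \<in> J \<Longrightarrow> supported_in lam B c (g i)" and gj: "supported_in lam B c (g j)"
    using insert.prems by auto
  have eW: "exp_integrable B (wick_functional lam K h)"
    by (rule exp_integrable_wick[OF insert.prems(2) _ c]) (rule insert.prems)
  have [measurable]: "wick_functional lam J g \<in> borel_measurable N"
    by (rule measurable_wick_supported[OF insert.hyps(1)]) (rule gJ)
  have hm[measurable]: "h k \<in> borel_measurable lam" if "k \<in> K" for k
    using supported_inD(1)[OF insert.prems(3)[OF that]] .
  have wK[measurable]: "wick_functional lam L h \<in> borel_measurable N" if "L \<subseteq> K" for L
    using that insert.prems by (intro measurable_wick_supported) (auto intro: finite_subset)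
  have wKk[measurable]: "wick_functional lam (K - {k}) h \<in> borel_measurable N" for k by (rule wK) auto
  note [measurable] = supported_inD(1)[OF gj] exp_integrableD(1)[OF eW]
  let ?t = "\<lambda>k p. (wick_functional lam J g (fst p) * wick_functional lam (K - {k}) h (fst p)) * (g j (snd p) * h k (snd p))"
  have gh: "integrable lam (\<lambda>y. g j y * h k y)" if "k \<in> K" for k
  proof (rule supported_in_integrable[OF _ B Bfin, of "c * c"])
    show "supported_in lam B (c * c) (\<lambda>y. g j y * h k y)"
      using gj insert.prems(3)[OF that] c unfolding supported_in_def
      by (auto simp: abs_mult intro!: mult_mono)
  qed
  have iW: "integrable Q (\<lambda>\<mu>. wick_functional lam J g \<mu> * wick_functional lam (K - {k}) h \<mu>)" for k
    by (intro exp_integrableD(3)[of B] exp_integrable_wick_mult[OF B Bfin _ _ c] exp_integrable_wick[OF _ _ c])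
       (use insert gJ in auto)
  note tt = QL_integral_product[OF iW gh]
  have "(\<integral>\<mu>. wick_functional lam (insert j J) g \<mu> * wick_functional lam K h \<mu> \<partial>Q)
    = (\<integral>p. g j (snd p) * wick_functional lam J g (fst p) * diff_op (snd p) (wick_functional lam K h) (fst p) \<partial>QL)"
    by (rule wick_by_parts(2)[OF B Bfin insert.hyps _ c eW]) (rule insert.prems)
  also have "\<dots> = (\<integral>p. (\<Sum>k\<in>K. ?t k p) \<partial>QL)"
  proof (rule integral_cong_AE)
    have "AE p in QL. diff_op (snd p) (wick_functional lam K h) (fst p)
        = (\<Sum>k\<in>K. h k (snd p) * wick_functional lam (K - {k}) h (fst p))"
      by (rule diff_op_wick_AE[OF insert.prems(2)]) (rule insert.prems)
    then show "AE p in QL. g j (snd p) * wick_functional lam J g (fst p) * diff_op (snd p) (wick_functional lam K h) (fst p)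
       = (\<Sum>k\<in>K. ?t k p)"
      by eventually_elim (simp add: sum_distrib_left mult_ac)
    show "(\<lambda>p. g j (snd p) * wick_functional lam J g (fst p) * diff_op (snd p) (wick_functional lam K h) (fst p)) \<in> borel_measurable QL"
      unfolding diff_op_def by measurable
    show "(\<lambda>p. \<Sum>k\<in>K. ?t k p) \<in> borel_measurable QL"
      by measurable
  qed
  also have "\<dots> = (\<Sum>k\<in>K. \<integral>p. ?t k p \<partial>QL)"
    using tt(1) by (intro Bochner_Integration.integral_sum) auto
  also have "\<dots> = (\<Sum>k\<in>K. 0)"
  proof (intro sum.cong refl)
    fix k assume k: "k \<in> K"
    have "card (K - {k}) = card K - 1" "0 < card K" using k insert.prems by (auto simp: card_gt_0_iff)
    then have "(\<integral>\<mu>. wick_functional lam J g \<mu> * wick_functional lam (K - {k}) h \<mu> \<partial>Q) = 0"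
      using insert.prems insert.hyps by (intro insert.IH) auto
    then show "(\<integral>p. ?t k p \<partial>QL) = 0" using tt(2)[OF k] by simp
  qed
  finally show ?case by simp
qed

text \<open>For fixed y the last factors are numbers and can be merged into the coefficients, so the
  bound in the remaining variables applies and may be integrated over y. This is why
  \<open>bound\<close> is demanded for arbitrary coefficients.\<close>

lemma wick_slice_bound:
  assumes J: "finite J" "l \<notin> J" and A: "finite A"
    and g: "\<And>a j. a \<in> A \<Longrightarrow> j \<in> insert l J \<Longrightarrow> supported_in lam B c (g a j)"
    and bound: "\<And>k. (\<integral>\<^sup>+\<mu>. ennreal ((\<Sum>a\<in>A. k a * wick_functional lam J (g a) \<mu>)\<^sup>2) \<partial>Q)
      \<le> ennreal (fact (card J)) * (\<integral>\<^sup>+z. ennreal ((\<Sum>a\<in>A. k a * (\<Prod>j\<in>J. g a j (z j)))\<^sup>2) \<partial>PiM J (\<lambda>_. lam))"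
  shows "(\<integral>\<^sup>+p. ennreal ((\<Sum>a\<in>A. k a * g a l (snd p) * wick_functional lam J (g a) (fst p))\<^sup>2) \<partial>QL)
      \<le> ennreal (fact (card J)) * (\<integral>\<^sup>+z. ennreal ((\<Sum>a\<in>A. k a * (\<Prod>j\<in>insert l J. g a j (z j)))\<^sup>2) \<partial>PiM (insert l J) (\<lambda>_. lam))"
proof -
  interpret PJ: sigma_finite_measure "PiM J (\<lambda>_. lam)" by (rule pow.sigma_finite) (rule J)
  interpret PJL: pair_sigma_finite "PiM J (\<lambda>_. lam)" lam ..
  have gm[measurable]: "g a j \<in> borel_measurable lam" if "a \<in> A" "j \<in> insert l J" for a j
    using supported_inD(1)[OF g[OF that]] .
  have [measurable]: "wick_functional lam J (g a) \<in> borel_measurable N" if "a \<in> A" for a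
    by (rule measurable_wick_supported[OF J(1)]) (use g that in auto)
  have [measurable]: "g a l \<in> borel_measurable lam" if "a \<in> A" for a using gm[OF that] by auto
  have pm: "(\<lambda>z. \<Prod>j\<in>K. g a j (z j)) \<in> borel_measurable (PiM K (\<lambda>_. lam))" if "a \<in> A" "K \<subseteq> insert l J" for a K
  proof (rule borel_measurable_prod)
    fix j assume "j \<in> K"
    then show "(\<lambda>z. g a j (z j)) \<in> borel_measurable (PiM K (\<lambda>_. lam))"
      using that by (intro measurable_compose[OF measurable_component_singleton[of j K "\<lambda>_. lam"] gm]) auto
  qed
  have pmJ[measurable]: "(\<lambda>z. \<Prod>j\<in>J. g a j (z j)) \<in> borel_measurable (PiM J (\<lambda>_. lam))" if "a \<in> A" for a
    by (rule pm[OF that]) auto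
  have pml[measurable]: "(\<lambda>z. \<Prod>j\<in>insert l J. g a j (z j)) \<in> borel_measurable (PiM (insert l J) (\<lambda>_. lam))" if "a \<in> A" for a
    by (rule pm[OF that]) auto
  have "(\<integral>\<^sup>+p. ennreal ((\<Sum>a\<in>A. k a * g a l (snd p) * wick_functional lam J (g a) (fst p))\<^sup>2) \<partial>QL)
    = (\<integral>\<^sup>+y. \<integral>\<^sup>+\<mu>. ennreal ((\<Sum>a\<in>A. (k a * g a l y) * wick_functional lam J (g a) \<mu>)\<^sup>2) \<partial>Q \<partial>lam)"
    by (subst QL.nn_integral_snd[symmetric]) simp_all
  also have "\<dots> \<le> (\<integral>\<^sup>+y. ennreal (fact (card J)) * (\<integral>\<^sup>+z. ennreal ((\<Sum>a\<in>A. (k a * g a l y) * (\<Prod>j\<in>J. g a j (z j)))\<^sup>2) \<partial>PiM J (\<lambda>_. lam)) \<partial>lam)"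
    by (rule nn_integral_mono) (rule bound)
  also have "\<dots> = ennreal (fact (card J)) * (\<integral>\<^sup>+y. \<integral>\<^sup>+z. ennreal ((\<Sum>a\<in>A. (k a * g a l y) * (\<Prod>j\<in>J. g a j (z j)))\<^sup>2) \<partial>PiM J (\<lambda>_. lam) \<partial>lam)"
    by (rule nn_integral_cmult) measurable
  also have "(\<integral>\<^sup>+y. \<integral>\<^sup>+z. ennreal ((\<Sum>a\<in>A. (k a * g a l y) * (\<Prod>j\<in>J. g a j (z j)))\<^sup>2) \<partial>PiM J (\<lambda>_. lam) \<partial>lam)
    = (\<integral>\<^sup>+p. ennreal ((\<Sum>a\<in>A. (k a * g a l (snd p)) * (\<Prod>j\<in>J. g a j (fst p j)))\<^sup>2) \<partial>(PiM J (\<lambda>_. lam) \<Otimes>\<^sub>M lam))"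
  proof -
    have "(\<lambda>p. ennreal ((\<Sum>a\<in>A. (k a * g a l (snd p)) * (\<Prod>j\<in>J. g a j (fst p j)))\<^sup>2)) \<in> borel_measurable (PiM J (\<lambda>_. lam) \<Otimes>\<^sub>M lam)"
      using measurable_compose[OF measurable_fst pmJ] by measurable
    from PJL.nn_integral_snd[OF this] show ?thesis by simp
  qed
  also have "\<dots> = (\<integral>\<^sup>+p. ennreal ((\<Sum>a\<in>A. k a * (\<Prod>j\<in>insert l J. g a j (((fst p)(l := snd p)) j)))\<^sup>2) \<partial>(PiM J (\<lambda>_. lam) \<Otimes>\<^sub>M lam))"
  proof (rule nn_integral_cong)
    fix p
    have "(\<Prod>j\<in>insert l J. g a j (((fst p)(l := snd p)) j)) = g a l (snd p) * (\<Prod>j\<in>J. g a j (fst p j))" for a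
    proof -
      have "(\<Prod>j\<in>J. g a j (((fst p)(l := snd p)) j)) = (\<Prod>j\<in>J. g a j (fst p j))"
        using J by (intro prod.cong) auto
      then show ?thesis using J by simp
    qed
    then show "ennreal ((\<Sum>a\<in>A. (k a * g a l (snd p)) * (\<Prod>j\<in>J. g a j (fst p j)))\<^sup>2)
       = ennreal ((\<Sum>a\<in>A. k a * (\<Prod>j\<in>insert l J. g a j (((fst p)(l := snd p)) j)))\<^sup>2)"
      by (simp only: mult.assoc)
  qed
  also have "\<dots> = (\<integral>\<^sup>+z. ennreal ((\<Sum>a\<in>A. k a * (\<Prod>j\<in>insert l J. g a j (z j)))\<^sup>2) \<partial>PiM (insert l J) (\<lambda>_. lam))"
    by (rule nn_integral_pow_insert[OF J, symmetric]) measurable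
  finally show ?thesis .
qed

text \<open>The upper half of the isometry, with the unsymmetrized norm on the right. Integration by
  parts in one coordinate j writes E F^2 as a sum over l of the integrals of U_j U_l, where U_l
  integrates out all variables but l. Each is at most the mean of the two squared norms, and these
  are bounded by \<open>wick_slice_bound\<close>; the number of terms, \<open>card J\<close>,
  completes the factorial. The induction is over the cardinality because every coordinate l must be
  removable, not just one chosen in advance.\<close>

theorem wick_L2_bound:
  assumes J: "finite J" and A: "finite A"
    and g: "\<And>a j. a \<in> A \<Longrightarrow> j \<in> J \<Longrightarrow> supported_in lam B c (g a j)" and c: "0 \<le> c"
  shows "(\<integral>\<^sup>+\<mu>. ennreal ((\<Sum>a\<in>A. k a * wick_functional lam J (g a) \<mu>)\<^sup>2) \<partial>Q)
    \<le> ennreal (fact (card J)) * (\<integral>\<^sup>+z. ennreal ((\<Sum>a\<in>A. k a * (\<Prod>j\<in>J. g a j (z j)))\<^sup>2) \<partial>PiM J (\<lambda>_. lam))"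
  using J g
proof (induction "card J" arbitrary: J k)
  case 0
  then have [simp]: "J = {}" by simp
  have "AE \<mu> in Q. \<forall>a\<in>A. wick_functional lam {} (g a) \<mu> = 1"
    using A wick_functional_empty_AE by (intro AE_finite_allI) auto
  then have "AE \<mu> in Q. ennreal ((\<Sum>a\<in>A. k a * wick_functional lam {} (g a) \<mu>)\<^sup>2) = ennreal ((\<Sum>a\<in>A. k a)\<^sup>2)"
    by eventually_elim simp
  then have "(\<integral>\<^sup>+\<mu>. ennreal ((\<Sum>a\<in>A. k a * wick_functional lam {} (g a) \<mu>)\<^sup>2) \<partial>Q) = (\<integral>\<^sup>+\<mu>. ennreal ((\<Sum>a\<in>A. k a)\<^sup>2) \<partial>Q)"
    by (rule nn_integral_cong_AE)
  moreover have "emeasure Q (space N) = 1" using Q.emeasure_space_1 by simp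
  ultimately show ?case by (simp add: PiM_empty nn_integral_count_space_finite del: wick_functional_empty)
next
  case (Suc n)
  note gJ = Suc.prems(2)
  let ?F = "\<lambda>\<mu>. \<Sum>a\<in>A. k a * wick_functional lam J (g a) \<mu>"
  let ?U = "\<lambda>l p. \<Sum>a\<in>A. k a * g a l (snd p) * wick_functional lam (J - {l}) (g a) (fst p)"
  let ?S = "\<integral>\<^sup>+z. ennreal ((\<Sum>a\<in>A. k a * (\<Prod>j\<in>J. g a j (z j)))\<^sup>2) \<partial>PiM J (\<lambda>_. lam)"
  obtain j where j: "j \<in> J" using Suc.hyps(2) by (metis card.empty equals0I nat.distinct(1))
  have cJ: "card (J - {l}) = n" if "l \<in> J" for l using that Suc.hyps(2) Suc.prems(1) by simp
  have Ub: "(\<integral>\<^sup>+p. ennreal ((?U l p)\<^sup>2) \<partial>QL) \<le> ennreal (fact n) * ?S" if l: "l \<in> J" for l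
  proof -
    have "(\<integral>\<^sup>+p. ennreal ((?U l p)\<^sup>2) \<partial>QL)
      \<le> ennreal (fact (card (J - {l}))) * (\<integral>\<^sup>+z. ennreal ((\<Sum>a\<in>A. k a * (\<Prod>j\<in>insert l (J - {l}). g a j (z j)))\<^sup>2) \<partial>PiM (insert l (J - {l})) (\<lambda>_. lam))"
    proof (rule wick_slice_bound)
      show "(\<integral>\<^sup>+\<mu>. ennreal ((\<Sum>a\<in>A. k a * wick_functional lam (J - {l}) (g a) \<mu>)\<^sup>2) \<partial>Q)
        \<le> ennreal (fact (card (J - {l}))) * (\<integral>\<^sup>+z. ennreal ((\<Sum>a\<in>A. k a * (\<Prod>j\<in>J - {l}. g a j (z j)))\<^sup>2) \<partial>PiM (J - {l}) (\<lambda>_. lam))" for k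
        using Suc.prems cJ[OF l] by (intro Suc.hyps(1)) auto
    qed (use Suc.prems A l in auto)
    then show ?thesis using l cJ[OF l] by (simp add: insert_absorb)
  qed
  have gm[measurable]: "g a l \<in> borel_measurable lam" if "a \<in> A" "l \<in> J" for a l
    using supported_inD(1)[OF gJ[OF that]] .
  have Wm[measurable]: "wick_functional lam K (g a) \<in> borel_measurable N" if "a \<in> A" "K \<subseteq> J" for a K
    using that Suc.prems by (intro measurable_wick_supported) (auto intro: finite_subset)
  have [measurable]: "wick_functional lam J (g a) \<in> borel_measurable N"
    "wick_functional lam (J - {l}) (g a) \<in> borel_measurable N" if "a \<in> A" for a l
    using that by (auto intro!: Wm)
  have Um[measurable]: "?U l \<in> borel_measurable (N \<Otimes>\<^sub>M lam)" if "l \<in> J" for l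
    using that by measurable
  have eW: "exp_integrable B (wick_functional lam J (g a))" if "a \<in> A" for a
    by (rule exp_integrable_wick[OF Suc.prems(1) _ c]) (use gJ that in auto)
  have eF: "exp_integrable B ?F" using A eW by (intro exp_integrable_sum)
  note [measurable] = exp_integrableD(1)[OF eF]
  have gja: "\<And>i. i \<in> insert j (J - {j}) \<Longrightarrow> supported_in lam B c (g a i)" if "a \<in> A" for a
    using gJ that j by auto
  have iWF: "integrable Q (\<lambda>\<mu>. wick_functional lam J (g a) \<mu> * ?F \<mu>)" if "a \<in> A" for a
    by (intro exp_integrableD(3)[of B] exp_integrable_wick_mult[OF B Bfin Suc.prems(1) _ c eF]) (use gJ that in auto)
  have F2: "(?F \<mu>)\<^sup>2 = (\<Sum>a\<in>A. k a * (wick_functional lam J (g a) \<mu> * ?F \<mu>))" for \<mu>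
    by (simp add: power2_eq_square sum_distrib_right mult.assoc)
  have iF2: "integrable Q (\<lambda>\<mu>. (?F \<mu>)\<^sup>2)"
    unfolding F2 using iWF by (intro Bochner_Integration.integrable_sum integrable_mult_right)
  have fJ: "finite (J - {j})" "j \<notin> J - {j}" "insert j (J - {j}) = J" using Suc.prems j by auto
  have bp: "integrable QL (\<lambda>p. g a j (snd p) * wick_functional lam (J - {j}) (g a) (fst p) * diff_op (snd p) ?F (fst p))
     \<and> (\<integral>\<mu>. wick_functional lam J (g a) \<mu> * ?F \<mu> \<partial>Q)
      = (\<integral>p. g a j (snd p) * wick_functional lam (J - {j}) (g a) (fst p) * diff_op (snd p) ?F (fst p) \<partial>QL)" if "a \<in> A" for a
    using wick_by_parts[where g="g a", OF B Bfin fJ(1,2) _ c eF] gja[OF that] unfolding fJ(3) by blast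
  have DF: "AE p in QL. diff_op (snd p) ?F (fst p) = (\<Sum>l\<in>J. ?U l p)"
  proof -
    have "AE p in QL. \<forall>a\<in>A. diff_op (snd p) (wick_functional lam J (g a)) (fst p)
      = (\<Sum>l\<in>J. g a l (snd p) * wick_functional lam (J - {l}) (g a) (fst p))"
      using A Suc.prems by (intro AE_finite_allI diff_op_wick_AE) auto
    then show ?thesis
    proof eventually_elim
      fix p assume d: "\<forall>a\<in>A. diff_op (snd p) (wick_functional lam J (g a)) (fst p)
        = (\<Sum>l\<in>J. g a l (snd p) * wick_functional lam (J - {l}) (g a) (fst p))"
      have "diff_op (snd p) ?F (fst p) = (\<Sum>a\<in>A. k a * diff_op (snd p) (wick_functional lam J (g a)) (fst p))"
        by (simp add: diff_op_def sum_subtractf right_diff_distrib)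
      also have "\<dots> = (\<Sum>a\<in>A. \<Sum>l\<in>J. k a * g a l (snd p) * wick_functional lam (J - {l}) (g a) (fst p))"
        using d by (intro sum.cong refl) (simp add: sum_distrib_left mult.assoc)
      also have "\<dots> = (\<Sum>l\<in>J. ?U l p)" by (rule sum.swap)
      finally show "diff_op (snd p) ?F (fst p) = (\<Sum>l\<in>J. ?U l p)" .
    qed
  qed
  \<comment> \<open>Only the coordinate \<open>j\<close> is split off in one of the two copies of F;
    the other copy is differentiated, which yields all the \<open>?U l\<close>.\<close>
  have 1: "(\<integral>\<mu>. (?F \<mu>)\<^sup>2 \<partial>Q) = (\<integral>p. ?U j p * (\<Sum>l\<in>J. ?U l p) \<partial>QL)"
  proof -
    have "(\<integral>\<mu>. (?F \<mu>)\<^sup>2 \<partial>Q) = (\<Sum>a\<in>A. k a * (\<integral>\<mu>. wick_functional lam J (g a) \<mu> * ?F \<mu> \<partial>Q))"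
      unfolding F2 using iWF by (subst Bochner_Integration.integral_sum) auto
    also have "\<dots> = (\<Sum>a\<in>A. k a * (\<integral>p. g a j (snd p) * wick_functional lam (J - {j}) (g a) (fst p) * diff_op (snd p) ?F (fst p) \<partial>QL))"
      using bp by (intro sum.cong refl) simp
    also have "\<dots> = (\<integral>p. (\<Sum>a\<in>A. k a * (g a j (snd p) * wick_functional lam (J - {j}) (g a) (fst p) * diff_op (snd p) ?F (fst p))) \<partial>QL)"
      using bp by (subst Bochner_Integration.integral_sum) auto
    also have "\<dots> = (\<integral>p. ?U j p * diff_op (snd p) ?F (fst p) \<partial>QL)"
      by (simp add: sum_distrib_right mult.assoc)
    also have "\<dots> = (\<integral>p. ?U j p * (\<Sum>l\<in>J. ?U l p) \<partial>QL)"
    proof (rule integral_cong_AE)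
      show "AE p in QL. ?U j p * diff_op (snd p) ?F (fst p) = ?U j p * (\<Sum>l\<in>J. ?U l p)"
        using DF by eventually_elim simp
      have [measurable]: "(\<lambda>p. diff_op (snd p) ?F (fst p)) \<in> borel_measurable (N \<Otimes>\<^sub>M lam)"
        unfolding diff_op_def by measurable
      show "(\<lambda>p. ?U j p * diff_op (snd p) ?F (fst p)) \<in> borel_measurable QL"
        "(\<lambda>p. ?U j p * (\<Sum>l\<in>J. ?U l p)) \<in> borel_measurable QL"
        unfolding measurable_QL using Um j by (intro borel_measurable_times borel_measurable_sum; simp)+
    qed
    finally show ?thesis .
  qed
  show ?case
  \<comment> \<open>For infinite norm the claim is trivial; a finite norm allows a passage to real
    integrals, where the products \<open>?U j p * ?U l p\<close> of arbitrary sign make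
    sense.\<close>
  proof (cases "?S = \<infinity>")
    case True
    then show ?thesis by (simp add: ennreal_mult_top)
  next
    case False
    obtain s where S: "?S = ennreal s" "0 \<le> s"
      using False by (cases ?S rule: ennreal_cases) auto
    have iU: "integrable QL (\<lambda>p. (?U l p)\<^sup>2)" if "l \<in> J" for l
    proof (rule integrableI_nonneg)
      show "(\<lambda>p. (?U l p)\<^sup>2) \<in> borel_measurable QL"
        unfolding measurable_QL using Um[OF that] by measurable
      show "(\<integral>\<^sup>+p. ennreal ((?U l p)\<^sup>2) \<partial>QL) < \<infinity>"
        using Ub[OF that] by (rule le_less_trans) (simp add: S ennreal_mult'[symmetric])
    qed auto
    have bU: "(\<integral>p. (?U l p)\<^sup>2 \<partial>QL) \<le> fact n * s" if "l \<in> J" for l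
    proof -
      have "ennreal (\<integral>p. (?U l p)\<^sup>2 \<partial>QL) \<le> ennreal (fact n * s)"
        using Ub[OF that] nn_integral_eq_integral[OF iU[OF that]] S by (simp add: ennreal_mult')
      then show ?thesis using S by (simp add: ennreal_le_iff)
    qed
    have ab: "\<bar>x * y\<bar> \<le> (x\<^sup>2 + y\<^sup>2) / 2" for x y :: real
      using sum_squares_bound[of "\<bar>x\<bar>" "\<bar>y\<bar>"] by (simp add: abs_mult)
    have iUU: "integrable QL (\<lambda>p. ?U j p * ?U l p)" if "l \<in> J" for l
    proof (rule Bochner_Integration.integrable_bound)
      show "integrable QL (\<lambda>p. ((?U j p)\<^sup>2 + (?U l p)\<^sup>2) / 2)"
        using iU[OF j] iU[OF that] by simp
      show "(\<lambda>p. ?U j p * ?U l p) \<in> borel_measurable QL"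
        unfolding measurable_QL using Um[OF j] Um[OF that] by (rule borel_measurable_times)
      show "AE p in QL. norm (?U j p * ?U l p) \<le> norm (((?U j p)\<^sup>2 + (?U l p)\<^sup>2) / 2)"
        using ab by (intro AE_I2) simp
    qed
    have bUU: "(\<integral>p. ?U j p * ?U l p \<partial>QL) \<le> fact n * s" if "l \<in> J" for l
    proof -
      have "(\<integral>p. ?U j p * ?U l p \<partial>QL) \<le> (\<integral>p. ((?U j p)\<^sup>2 + (?U l p)\<^sup>2) / 2 \<partial>QL)"
      proof (rule integral_mono)
        show "?U j p * ?U l p \<le> ((?U j p)\<^sup>2 + (?U l p)\<^sup>2) / 2" for p
          using ab by (rule abs_le_D1)
      qed (use iUU[OF that] iU[OF j] iU[OF that] in simp_all)
      also have "\<dots> = ((\<integral>p. (?U j p)\<^sup>2 \<partial>QL) + (\<integral>p. (?U l p)\<^sup>2 \<partial>QL)) / 2"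
        using iU[OF j] iU[OF that] by simp
      also have "\<dots> \<le> fact n * s" using bU[OF j] bU[OF that] by simp
      finally show ?thesis .
    qed
    have e: "?U j p * (\<Sum>l\<in>J. ?U l p) = (\<Sum>l\<in>J. ?U j p * ?U l p)" for p
      by (rule sum_distrib_left)
    have "(\<integral>\<mu>. (?F \<mu>)\<^sup>2 \<partial>Q) = (\<Sum>l\<in>J. \<integral>p. ?U j p * ?U l p \<partial>QL)"
      unfolding 1 e using iUU by (intro Bochner_Integration.integral_sum)
    also have "\<dots> \<le> (\<Sum>l\<in>J. fact n * s)" using bUU by (intro sum_mono)
    also have "\<dots> = fact (card J) * s" using Suc.hyps(2)[symmetric] by (simp add: mult_ac)
    finally have "ennreal (\<integral>\<mu>. (?F \<mu>)\<^sup>2 \<partial>Q) \<le> ennreal (fact (card J) * s)" by (rule ennreal_leI)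
    then show ?thesis
      using nn_integral_eq_integral[OF iF2] S by (simp add: ennreal_mult')
  qed
qed

end

end

section \<open>Convergence in mean square\<close>

text \<open>The squared norm takes values in \<open>ennreal\<close>, so estimates can be stated
  before square integrability is known, and often serve to prove it.\<close>

definition sqn :: "'a measure \<Rightarrow> ('a \<Rightarrow> real) \<Rightarrow> ennreal" where
  "sqn M h = (\<integral>\<^sup>+x. ennreal ((h x)\<^sup>2) \<partial>M)"

lemma L2_iff: "h \<in> L2 M \<longleftrightarrow> h \<in> borel_measurable M \<and> sqn M h < \<infinity>"
  by (auto simp: L2_def sqn_def integrable_iff_bounded)

lemma L2_measurable: "h \<in> L2 M \<Longrightarrow> h \<in> borel_measurable M"
  by (simp add: L2_def)

lemma L2_tendsto_iff:
  "L2_tendsto M h l \<longleftrightarrow> (\<forall>k. h k \<in> L2 M) \<and> l \<in> L2 M \<and> (\<lambda>k. sqn M (\<lambda>x. h k x - l x)) \<longlonglongrightarrow> 0"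
  by (simp add: L2_tendsto_def sqn_def)

lemma sqn_cong_AE: "AE x in M. f x = g x \<Longrightarrow> sqn M f = sqn M g"
  unfolding sqn_def by (intro nn_integral_cong_AE) (auto elim: eventually_mono)

text \<open>A substitute for Minkowski's inequality, from (a + b)^2 being at most 2 a^2 + 2 b^2. Its
  factor 2 is the origin of the thresholds e / 4 below and of the factor 4 in
  \<open>slice_limit_norm\<close>.\<close>

lemma sqn_add_le:
  assumes [measurable]: "f \<in> borel_measurable M" "g \<in> borel_measurable M"
  shows "sqn M (\<lambda>x. f x + g x) \<le> 2 * sqn M f + 2 * sqn M g"
proof -
  have "(a + b)\<^sup>2 \<le> 2 * a\<^sup>2 + 2 * b\<^sup>2" for a b :: real
    using sum_squares_bound[of a b] by (simp add: power2_sum)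
  then have "sqn M (\<lambda>x. f x + g x) \<le> (\<integral>\<^sup>+x. 2 * ennreal ((f x)\<^sup>2) + 2 * ennreal ((g x)\<^sup>2) \<partial>M)"
    unfolding sqn_def
    by (intro nn_integral_mono) (simp add: ennreal_mult'[symmetric] ennreal_plus[symmetric] ennreal_leI
        flip: ennreal_numeral del: ennreal_plus)
  also have "\<dots> = 2 * sqn M f + 2 * sqn M g"
    unfolding sqn_def by (simp add: nn_integral_add nn_integral_cmult)
  finally show ?thesis .
qed

lemma sqn_minus_commute: "sqn M (\<lambda>x. f x - g x) = sqn M (\<lambda>x. g x - f x)"
  by (simp add: sqn_def power2_commute)

lemma sqn_diff_le:
  assumes "f \<in> borel_measurable M" "g \<in> borel_measurable M" "h \<in> borel_measurable M"
  shows "sqn M (\<lambda>x. f x - h x) \<le> 2 * sqn M (\<lambda>x. f x - g x) + 2 * sqn M (\<lambda>x. g x - h x)"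
  using sqn_add_le[of "\<lambda>x. f x - g x" M "\<lambda>x. g x - h x"] assms by simp

lemma sqn_cmult: "f \<in> borel_measurable M \<Longrightarrow> sqn M (\<lambda>x. c * f x) = ennreal (c\<^sup>2) * sqn M f"
  unfolding sqn_def by (simp add: power_mult_distrib ennreal_mult' nn_integral_cmult)

lemma sqn_eq_0_iff: "f \<in> borel_measurable M \<Longrightarrow> sqn M f = 0 \<longleftrightarrow> (AE x in M. f x = 0)"
  unfolding sqn_def by (subst nn_integral_0_iff_AE) auto

lemma L2_add: "f \<in> L2 M \<Longrightarrow> g \<in> L2 M \<Longrightarrow> (\<lambda>x. f x + g x) \<in> L2 M"
  unfolding L2_iff using le_less_trans[OF sqn_add_le, of f M g "\<infinity>"]
  by (auto simp: ennreal_mult_less_top)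

lemma L2_cmult: "f \<in> L2 M \<Longrightarrow> (\<lambda>x. c * f x) \<in> L2 M"
  unfolding L2_iff by (auto simp: sqn_cmult ennreal_mult_less_top)

lemma L2_diff: "f \<in> L2 M \<Longrightarrow> g \<in> L2 M \<Longrightarrow> (\<lambda>x. f x - g x) \<in> L2 M"
  using L2_add[of f M "\<lambda>x. (-1) * g x"] L2_cmult[of g M "-1"] by simp

lemma L2_zero: "(\<lambda>_. 0) \<in> L2 M"
  by (simp add: L2_iff sqn_def)

lemma L2_sum: "(\<And>i. i \<in> A \<Longrightarrow> f i \<in> L2 M) \<Longrightarrow> (\<lambda>x. \<Sum>i\<in>A. f i x) \<in> L2 M"
  by (induction A rule: infinite_finite_induct) (auto simp: L2_zero L2_add)

lemma L2_mult_integrable: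
  assumes f: "f \<in> L2 M" and g: "g \<in> L2 M"
  shows "integrable M (\<lambda>x. f x * g x)"
proof (rule Bochner_Integration.integrable_bound)
  show "integrable M (\<lambda>x. (f x)\<^sup>2 + (g x)\<^sup>2)" using f g by (simp add: L2_def)
  show "(\<lambda>x. f x * g x) \<in> borel_measurable M"
    by (intro borel_measurable_times L2_measurable f g)
  have "\<bar>a * b\<bar> \<le> a\<^sup>2 + b\<^sup>2" for a b :: real
  proof -
    have "2 * (\<bar>a\<bar> * \<bar>b\<bar>) \<le> a\<^sup>2 + b\<^sup>2"
      using sum_squares_bound[of "\<bar>a\<bar>" "\<bar>b\<bar>"] by (simp add: mult.assoc)
    moreover have "0 \<le> \<bar>a\<bar> * \<bar>b\<bar>" by simp
    ultimately show ?thesis unfolding abs_mult by linarith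
  qed
  then show "AE x in M. norm (f x * g x) \<le> norm ((f x)\<^sup>2 + (g x)\<^sup>2)" by (intro AE_I2) simp
qed

lemma L2_inner_bound:
  assumes f: "f \<in> L2 M" and g: "g \<in> L2 M"
  shows "ennreal ((\<integral>x. f x * g x \<partial>M)\<^sup>2) \<le> sqn M f * sqn M g"
proof -
  have [measurable]: "f \<in> borel_measurable M" "g \<in> borel_measurable M"
    using f g by (auto simp: L2_def)
  have "ennreal \<bar>\<integral>x. f x * g x \<partial>M\<bar> \<le> (\<integral>\<^sup>+x. ennreal \<bar>f x\<bar> * ennreal \<bar>g x\<bar> \<partial>M)"
    using integral_norm_bound_ennreal[OF L2_mult_integrable[OF f g]] by (simp add: abs_mult ennreal_mult')
  then have "(ennreal \<bar>\<integral>x. f x * g x \<partial>M\<bar>)\<^sup>2 \<le> (\<integral>\<^sup>+x. ennreal \<bar>f x\<bar> * ennreal \<bar>g x\<bar> \<partial>M)\<^sup>2"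
    by (rule power_mono) simp
  also have "\<dots> \<le> (\<integral>\<^sup>+x. (ennreal \<bar>f x\<bar>)\<^sup>2 \<partial>M) * (\<integral>\<^sup>+x. (ennreal \<bar>g x\<bar>)\<^sup>2 \<partial>M)"
    by (rule Cauchy_Schwarz_nn_integral) measurable
  finally show ?thesis by (simp add: sqn_def ennreal_power)
qed

lemma ennreal_tendsto_0_bound:
  fixes a b :: "nat \<Rightarrow> ennreal"
  assumes "b \<longlonglongrightarrow> 0" "c < \<infinity>" "\<And>k. a k \<le> c * b k"
  shows "a \<longlonglongrightarrow> 0"
proof (rule tendsto_sandwich[of "\<lambda>_. 0"])
  have "(\<lambda>k. c * b k) \<longlonglongrightarrow> c * 0" using assms by (intro ennreal_tendsto_cmult) auto
  then show "(\<lambda>k. c * b k) \<longlonglongrightarrow> 0" by simp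
qed (use assms in auto)

lemma L2_tendsto_inner:
  assumes h: "L2_tendsto M h l" and g: "g \<in> L2 M"
  shows "(\<lambda>k. \<integral>x. h k x * g x \<partial>M) \<longlonglongrightarrow> (\<integral>x. l x * g x \<partial>M)"
proof -
  have hk: "h k \<in> L2 M" and l: "l \<in> L2 M" for k using h by (auto simp: L2_tendsto_iff)
  let ?d = "\<lambda>k. (\<integral>x. h k x * g x \<partial>M) - (\<integral>x. l x * g x \<partial>M)"
  have "(\<lambda>k. ennreal ((?d k)\<^sup>2)) \<longlonglongrightarrow> 0"
  proof (rule ennreal_tendsto_0_bound)
    show "(\<lambda>k. sqn M (\<lambda>x. h k x - l x)) \<longlonglongrightarrow> 0" using h by (simp add: L2_tendsto_iff)
    show "sqn M g < \<infinity>" using g by (simp add: L2_iff)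
    fix k
    have "?d k = (\<integral>x. (h k x - l x) * g x \<partial>M)"
      using L2_mult_integrable[OF hk g] L2_mult_integrable[OF l g] by (simp add: left_diff_distrib)
    then show "ennreal ((?d k)\<^sup>2) \<le> sqn M g * sqn M (\<lambda>x. h k x - l x)"
      using L2_inner_bound[OF L2_diff[OF hk l] g] by (simp add: mult.commute)
  qed
  then have "(\<lambda>k. (?d k)\<^sup>2) \<longlonglongrightarrow> 0"
    by (subst (asm) tendsto_ennreal_iff[of _ _ 0, simplified]) auto
  then have "(\<lambda>k. sqrt ((?d k)\<^sup>2)) \<longlonglongrightarrow> sqrt 0" by (rule tendsto_real_sqrt)
  then have "?d \<longlonglongrightarrow> 0" by (simp add: tendsto_rabs_zero_iff)
  then show ?thesis by (rule LIM_zero_cancel)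
qed

lemma L2_tendsto_unique:
  assumes h: "L2_tendsto M h l" and h': "L2_tendsto M h l'"
  shows "AE x in M. l x = l' x"
proof -
  have [measurable]: "h k \<in> borel_measurable M" "l \<in> borel_measurable M" "l' \<in> borel_measurable M" for k
    using h h' by (auto simp: L2_tendsto_def L2_def)
  have "(\<lambda>k. 2 * sqn M (\<lambda>x. h k x - l x) + 2 * sqn M (\<lambda>x. h k x - l' x)) \<longlonglongrightarrow> 2 * 0 + 2 * 0"
    using h h' by (intro tendsto_add ennreal_tendsto_cmult) (auto simp: L2_tendsto_iff)
  then have "sqn M (\<lambda>x. l x - l' x) \<le> 2 * 0 + 2 * 0"
    by (rule tendsto_lowerbound)
       (auto intro!: always_eventually simp: sqn_minus_commute[of M l] intro: sqn_diff_le[of l M "h _" l', unfolded sqn_minus_commute[of M l]])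
  then have "sqn M (\<lambda>x. l x - l' x) = 0" by simp
  then show ?thesis by (subst (asm) sqn_eq_0_iff) auto
qed

lemma L2_tendsto_cong_AE:
  assumes "L2_tendsto M h l" "\<And>k. h' k \<in> borel_measurable M" "\<And>k. AE x in M. h k x = h' k x"
    and "l' \<in> borel_measurable M" "AE x in M. l x = l' x"
  shows "L2_tendsto M h' l'"
proof -
  have "sqn M (h' k) = sqn M (h k)" for k using assms(3)[of k] by (intro sqn_cong_AE) (auto elim: eventually_mono)
  moreover have "sqn M l' = sqn M l" using assms(5) by (intro sqn_cong_AE) (auto elim: eventually_mono)
  moreover have "sqn M (\<lambda>x. h' k x - l' x) = sqn M (\<lambda>x. h k x - l x)" for k
    by (rule sqn_cong_AE, use assms(3)[of k] assms(5) in eventually_elim) simp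
  ultimately show ?thesis using assms by (simp add: L2_tendsto_iff L2_iff)
qed

lemma L2_tendsto_diff:
  assumes "L2_tendsto M h l" "L2_tendsto M h' l'"
  shows "L2_tendsto M (\<lambda>k x. h k x - h' k x) (\<lambda>x. l x - l' x)"
  unfolding L2_tendsto_iff
proof (intro conjI allI)
  have L: "h k \<in> L2 M" "l \<in> L2 M" "h' k \<in> L2 M" "l' \<in> L2 M" for k using assms by (auto simp: L2_tendsto_iff)
  then show "(\<lambda>x. h k x - h' k x) \<in> L2 M" "(\<lambda>x. l x - l' x) \<in> L2 M" for k by (auto intro: L2_diff)
  have "(\<lambda>k. 2 * sqn M (\<lambda>x. h k x - l x) + 2 * sqn M (\<lambda>x. h' k x - l' x)) \<longlonglongrightarrow> 2 * 0 + 2 * 0"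
    using assms by (intro tendsto_add ennreal_tendsto_cmult) (auto simp: L2_tendsto_iff)
  then have t: "(\<lambda>k. 2 * sqn M (\<lambda>x. h k x - l x) + 2 * sqn M (\<lambda>x. h' k x - l' x)) \<longlonglongrightarrow> 0" by simp
  have "sqn M (\<lambda>x. h k x - h' k x - (l x - l' x)) \<le> 2 * sqn M (\<lambda>x. h k x - l x) + 2 * sqn M (\<lambda>x. h' k x - l' x)" for k
    using sqn_add_le[of "\<lambda>x. h k x - l x" M "\<lambda>x. l' x - h' k x"] L2_measurable[OF L(1)[of k]] L2_measurable[OF L(2)]
      L2_measurable[OF L(3)[of k]] L2_measurable[OF L(4)]
    by (simp add: sqn_minus_commute[of M l'] algebra_simps)
  then show "(\<lambda>k. sqn M (\<lambda>x. h k x - h' k x - (l x - l' x))) \<longlonglongrightarrow> 0"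
    by (intro tendsto_sandwich[OF _ _ tendsto_const t]) auto
qed

lemma tendsto_ennreal_0I:
  fixes a :: "nat \<Rightarrow> ennreal"
  assumes "\<And>e. 0 < e \<Longrightarrow> eventually (\<lambda>k. a k \<le> ennreal e) sequentially"
  shows "a \<longlonglongrightarrow> 0"
proof (rule order_tendstoI)
  fix y :: ennreal assume "0 < y"
  then obtain z where z: "0 < z" "z < y" using dense by blast
  then have "z < top" using top.not_eq_extremum by fastforce
  then obtain e where e: "z = ennreal e" "0 \<le> e" by (cases z rule: ennreal_cases) auto
  then have "0 < e" using z by (simp add: ennreal_less_zero_iff)
  from assms[OF this] show "eventually (\<lambda>k. a k < y) sequentially"
    by eventually_elim (use z e in auto)
qed simp

text \<open>The Riesz-Fischer argument: a rapidly convergent subsequence has summable increments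
  almost everywhere and thus a pointwise limit, and Fatou's lemma shows that the full sequence
  converges to it in mean square.\<close>

lemma L2_complete:
  assumes h: "\<And>k. h k \<in> L2 M"
    and cauchy: "\<And>e. 0 < e \<Longrightarrow> \<exists>K. \<forall>m\<ge>K. \<forall>n\<ge>K. sqn M (\<lambda>x. h m x - h n x) \<le> ennreal e"
  shows "\<exists>l. L2_tendsto M h l"
proof -
  have [measurable]: "h k \<in> borel_measurable M" for k using h by (rule L2_measurable)
  \<comment> \<open>The rate 4^-j leaves room for the weight 2^j below: the weighted squared
    increments still have integrals of at most 2^-j.\<close>
  have "\<exists>K. \<forall>m\<ge>K. \<forall>n\<ge>K. sqn M (\<lambda>x. h m x - h n x) \<le> ennreal ((1 / 4) ^ j)" for j :: nat
    by (rule cauchy) simp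
  then obtain K where K: "sqn M (\<lambda>x. h m x - h n x) \<le> ennreal ((1 / 4) ^ j)" if "m \<ge> K j" "n \<ge> K j" for j :: nat and m n
    by metis
  \<comment> \<open>The maximum makes both \<open>r j\<close> and \<open>r (Suc j)\<close>
    admissible for the bound of index \<open>j\<close>; the summand \<open>j\<close> forces
    \<open>r\<close> to infinity, which the Fatou argument uses.\<close>
  define r where "r j = Max (K ` {..j}) + j" for j
  have r: "K i \<le> r j" if "i \<le> j" for i j
    unfolding r_def using that by (intro trans_le_add1 Max_ge) auto
  let ?d = "\<lambda>j x. h (r (Suc j)) x - h (r j) x"
  have "(\<integral>\<^sup>+x. (\<Sum>j. ennreal (2 ^ j * (?d j x)\<^sup>2)) \<partial>M) = (\<Sum>j. \<integral>\<^sup>+x. ennreal (2 ^ j * (?d j x)\<^sup>2) \<partial>M)"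
    by (rule nn_integral_suminf) measurable
  also have "\<dots> \<le> (\<Sum>j. ennreal ((1 / 2) ^ j))"
  proof (intro suminf_le)
    fix j :: nat
    have "(\<integral>\<^sup>+x. ennreal (2 ^ j * (?d j x)\<^sup>2) \<partial>M) = ennreal (2 ^ j) * sqn M (?d j)"
      by (simp add: sqn_def ennreal_mult' nn_integral_cmult)
    also have "\<dots> \<le> ennreal (2 ^ j) * ennreal ((1 / 4) ^ j)"
      by (intro mult_left_mono K r) auto
    also have "\<dots> = ennreal ((1 / 2) ^ j)"
      by (simp add: ennreal_mult'[symmetric] power_mult_distrib[symmetric])
    finally show "(\<integral>\<^sup>+x. ennreal (2 ^ j * (?d j x)\<^sup>2) \<partial>M) \<le> ennreal ((1 / 2) ^ j)" .
  qed auto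
  also have "\<dots> < \<infinity>" by (subst suminf_ennreal2) auto
  finally have "(\<integral>\<^sup>+x. (\<Sum>j. ennreal (2 ^ j * (?d j x)\<^sup>2)) \<partial>M) \<noteq> \<infinity>" by simp
  then have "AE x in M. (\<Sum>j. ennreal (2 ^ j * (?d j x)\<^sup>2)) \<noteq> \<infinity>"
    by (intro nn_integral_PInf_AE) auto
  then have conv: "AE x in M. convergent (\<lambda>j. h (r j) x)"
  proof eventually_elim
    fix x assume "(\<Sum>j. ennreal (2 ^ j * (?d j x)\<^sup>2)) \<noteq> \<infinity>"
    then have s: "summable (\<lambda>j. 2 ^ j * (?d j x)\<^sup>2)"
      by (intro summable_suminf_not_top) auto
    have t: "summable (\<lambda>j. (1 / 2) ^ j + 2 ^ j * (?d j x)\<^sup>2)"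
      using s by (intro summable_add) auto
    have "summable (\<lambda>j. ?d j x)"
    proof (rule summable_comparison_test'[of "\<lambda>j. (1 / 2) ^ j + 2 ^ j * (?d j x)\<^sup>2" 0])
      show "summable (\<lambda>j. (1 / 2) ^ j + 2 ^ j * (?d j x)\<^sup>2)" by (rule t)
      fix j :: nat
      \<comment> \<open>Obtained from (b |a| - 1)^2 being nonnegative. With b = 2^j it converts
        summability of the weighted squares into absolute summability of the increments.\<close>
      have *: "\<bar>a\<bar> \<le> 1 / b + b * a\<^sup>2" if "0 < b" for a b :: real
      proof -
        have "0 \<le> (b * \<bar>a\<bar> - 1)\<^sup>2" by simp
        then have "2 * (b * \<bar>a\<bar>) \<le> 1 + b * (b * a\<^sup>2)"
          by (simp add: power2_diff power_mult_distrib) (simp add: power2_eq_square mult_ac)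
        then have "b * \<bar>a\<bar> \<le> 1 + b * (b * a\<^sup>2)" using that by (smt (verit) mult_nonneg_nonneg abs_ge_zero)
        then show ?thesis using that by (simp add: field_simps)
      qed
      show "norm (?d j x) \<le> (1 / 2) ^ j + 2 ^ j * (?d j x)\<^sup>2"
        using *[of "2 ^ j" "?d j x"] by (simp add: power_one_over)
    qed
    then have "convergent (\<lambda>n. \<Sum>j<n. ?d j x)" by (simp add: summable_iff_convergent)
    moreover have "(\<Sum>j<n. ?d j x) = h (r n) x - h (r 0) x" for n by (rule sum_lessThan_telescope)
    ultimately have "convergent (\<lambda>n. h (r n) x - h (r 0) x)" by simp
    then have "convergent (\<lambda>n. (h (r n) x - h (r 0) x) + h (r 0) x)"
      by (intro convergent_add convergent_const)
    then show "convergent (\<lambda>j. h (r j) x)" by simp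
  qed
  define l where "l x = lim (\<lambda>j. h (r j) x)" for x
  have [measurable]: "l \<in> borel_measurable M" unfolding l_def[abs_def] by measurable
  have lim: "AE x in M. (\<lambda>j. h (r j) x) \<longlonglongrightarrow> l x"
    using conv unfolding l_def by eventually_elim (simp add: convergent_LIMSEQ_iff)
  have bound: "\<exists>K. \<forall>m\<ge>K. sqn M (\<lambda>x. h m x - l x) \<le> ennreal e" if e: "0 < e" for e
  proof -
    obtain L where L: "\<forall>m\<ge>L. \<forall>n\<ge>L. sqn M (\<lambda>x. h m x - h n x) \<le> ennreal e"
      using cauchy[OF e] by blast
    have "sqn M (\<lambda>x. h m x - l x) \<le> ennreal e" if m: "m \<ge> L" for m
    proof -
      \<comment> \<open>Fatou's lemma transfers the Cauchy bound to the limit along the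
        subsequence.\<close>
      have "sqn M (\<lambda>x. h m x - l x) = (\<integral>\<^sup>+x. liminf (\<lambda>j. ennreal ((h m x - h (r j) x)\<^sup>2)) \<partial>M)"
        unfolding sqn_def
      proof (rule nn_integral_cong_AE, use lim in eventually_elim)
        fix x assume "(\<lambda>j. h (r j) x) \<longlonglongrightarrow> l x"
        then have "(\<lambda>j. ennreal ((h m x - h (r j) x)\<^sup>2)) \<longlonglongrightarrow> ennreal ((h m x - l x)\<^sup>2)"
          by (intro tendsto_ennrealI tendsto_intros)
        then show "ennreal ((h m x - l x)\<^sup>2) = liminf (\<lambda>j. ennreal ((h m x - h (r j) x)\<^sup>2))"
          by (rule lim_imp_Liminf[OF trivial_limit_sequentially, symmetric])
      qed
      also have "\<dots> \<le> liminf (\<lambda>j. sqn M (\<lambda>x. h m x - h (r j) x))"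
        unfolding sqn_def by (rule nn_integral_liminf) measurable
      also have "\<dots> \<le> ennreal e"
      proof -
        have "sqn M (\<lambda>x. h m x - h (r j) x) \<le> ennreal e" if "j \<ge> L" for j
          using L m that by (simp add: r_def)
        then have "eventually (\<lambda>j. sqn M (\<lambda>x. h m x - h (r j) x) \<le> ennreal e) sequentially"
          by (auto simp: eventually_sequentially)
        then have "liminf (\<lambda>j. sqn M (\<lambda>x. h m x - h (r j) x)) \<le> liminf (\<lambda>j. ennreal e)"
          by (rule Liminf_mono)
        then show ?thesis by (simp add: Liminf_const)
      qed
      finally show ?thesis .
    qed
    then show ?thesis by blast
  qed
  have "L2_tendsto M h l"
    unfolding L2_tendsto_iff
  proof (intro conjI allI h)
    obtain m where m: "sqn M (\<lambda>x. h m x - l x) \<le> ennreal 1" using bound[of 1] by auto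
    have "sqn M (\<lambda>x. h m x - l x) < \<infinity>" using m by (rule le_less_trans) simp
    then have "(\<lambda>x. h m x - l x) \<in> L2 M" by (simp add: L2_iff)
    then show "l \<in> L2 M" using L2_diff[OF h[of m]] by force
    show "(\<lambda>k. sqn M (\<lambda>x. h k x - l x)) \<longlonglongrightarrow> 0"
    proof (rule tendsto_ennreal_0I)
      fix e :: real assume "0 < e"
      then obtain K where "\<forall>m\<ge>K. sqn M (\<lambda>x. h m x - l x) \<le> ennreal e" using bound by blast
      then show "eventually (\<lambda>k. sqn M (\<lambda>x. h k x - l x) \<le> ennreal e) sequentially"
        by (auto simp: eventually_sequentially)
    qed
  qed
  then show ?thesis by blast
qed

section \<open>Density of functions of sum-product form\<close>

lemma sum_product_append: "sum_product n (gs @ hs) y = sum_product n gs y + sum_product n hs y"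
  by (simp add: sum_product_def)

lemma sum_product_Nil [simp]: "sum_product n [] y = 0"
  by (simp add: sum_product_def)

definition admissible_tuples :: "'a measure \<Rightarrow> nat \<Rightarrow> (nat \<Rightarrow> 'a \<Rightarrow> real) list \<Rightarrow> bool" where
  "admissible_tuples lam n gs \<longleftrightarrow> (\<forall>h\<in>set gs. \<forall>i<n. admissible_factor lam (h i))"

text \<open>Lists of factor tuples carry no coefficients, so a scalar is absorbed into the first
  factor. This presupposes at least one variable, hence the assumptions \<open>0 < n\<close> in what
  follows.\<close>

definition scale_first :: "real \<Rightarrow> (nat \<Rightarrow> 'a \<Rightarrow> real) \<Rightarrow> nat \<Rightarrow> 'a \<Rightarrow> real" where
  "scale_first c h = h(0 := \<lambda>y. c * h 0 y)"

lemma prod_scale_first: "0 < n \<Longrightarrow> (\<Prod>i<n. scale_first c h i (y i)) = c * (\<Prod>i<n. h i (y i))"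
proof -
  assume n: "0 < n"
  have "(\<Prod>i<n. scale_first c h i (y i)) = (\<Prod>i\<in>{..<n}. (if i = 0 then c else 1) * h i (y i))"
    by (intro prod.cong) (auto simp: scale_first_def)
  also have "\<dots> = c * (\<Prod>i<n. h i (y i))"
    using n by (simp add: prod.distrib)
  finally show ?thesis .
qed

lemma sum_product_scale: "0 < n \<Longrightarrow> sum_product n (map (scale_first c) gs) y = c * sum_product n gs y"
  by (induction gs) (simp_all add: sum_product_def prod_scale_first distrib_left)

lemma admissible_factor_scale:
  "admissible_factor lam h \<Longrightarrow> admissible_factor lam (\<lambda>y. c * h y)"
  unfolding admissible_factor_def
proof (elim conjE exE bexE, intro conjI)
  fix b B assume h: "h \<in> borel_measurable lam" "\<forall>y\<in>space lam. \<bar>h y\<bar> \<le> b"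
    and B: "B \<in> sets lam" "emeasure lam B < \<infinity>" "\<forall>y\<in>space lam - B. h y = 0"
  show "(\<lambda>y. c * h y) \<in> borel_measurable lam" using h by measurable
  have "\<forall>y\<in>space lam. \<bar>c * h y\<bar> \<le> \<bar>c\<bar> * b" using h by (auto simp: abs_mult intro: mult_left_mono)
  then show "\<exists>b. \<forall>y\<in>space lam. \<bar>c * h y\<bar> \<le> b" by blast
  show "\<exists>B\<in>sets lam. emeasure lam B < \<infinity> \<and> (\<forall>y\<in>space lam - B. c * h y = 0)" using B by auto
qed

lemma admissible_scale_first:
  "\<forall>i<n. admissible_factor lam (h i) \<Longrightarrow> \<forall>i<n. admissible_factor lam (scale_first c h i)"
  by (auto simp: scale_first_def admissible_factor_scale)

lemma admissible_tuples_simps: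
  "admissible_tuples lam n []"
  "admissible_tuples lam n (gs @ hs) \<longleftrightarrow> admissible_tuples lam n gs \<and> admissible_tuples lam n hs"
  "admissible_tuples lam n gs \<Longrightarrow> admissible_tuples lam n (map (scale_first c) gs)"
proof -
  show "admissible_tuples lam n []"
    "admissible_tuples lam n (gs @ hs) \<longleftrightarrow> admissible_tuples lam n gs \<and> admissible_tuples lam n hs"
    by (auto simp: admissible_tuples_def)
  assume "admissible_tuples lam n gs"
  then show "admissible_tuples lam n (map (scale_first c) gs)"
    unfolding admissible_tuples_def using admissible_scale_first[of n lam _ c] by auto
qed

lemma measurable_sum_product:
  assumes "admissible_tuples lam n gs"
  shows "sum_product n gs \<in> borel_measurable (pow_measure lam n)"
  using assms
proof (induction gs)
  case (Cons g gs)
  have "(\<lambda>z. g i (z i)) \<in> borel_measurable (pow_measure lam n)" if "i < n" for i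
  proof (rule measurable_compose[of "\<lambda>z. z i" _ lam "g i"])
    show "(\<lambda>z. z i) \<in> measurable (pow_measure lam n) lam"
      using that by (intro measurable_component_singleton) simp
    show "g i \<in> borel_measurable lam"
      using Cons.prems that by (auto simp: admissible_tuples_def admissible_factor_def)
  qed
  then have "(\<lambda>z. \<Prod>i<n. g i (z i)) \<in> borel_measurable (pow_measure lam n)"
    by (intro borel_measurable_prod) auto
  moreover have "sum_product n gs \<in> borel_measurable (pow_measure lam n)"
    using Cons by (auto simp: admissible_tuples_def)
  ultimately show ?case unfolding sum_product_def[abs_def] by simp
qed (simp add: sum_product_def[abs_def])

text \<open>Closeness to functions of sum-product form, phrased by an error bound so that each
  closure property can be proved separately before a sequence is extracted at the end.\<close>

definition approximable :: "'a measure \<Rightarrow> nat \<Rightarrow> ((nat \<Rightarrow> 'a) \<Rightarrow> real) \<Rightarrow> bool" where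
  "approximable lam n g \<longleftrightarrow> g \<in> borel_measurable (pow_measure lam n) \<and>
     (\<forall>e>0. \<exists>gs. admissible_tuples lam n gs \<and> sqn (pow_measure lam n) (\<lambda>z. sum_product n gs z - g z) \<le> ennreal e)"

lemma approximable_limit:
  assumes g: "g \<in> borel_measurable (pow_measure lam n)"
    and h: "\<And>k. approximable lam n (h k)"
    and lim: "(\<lambda>k. sqn (pow_measure lam n) (\<lambda>z. h k z - g z)) \<longlonglongrightarrow> 0"
  shows "approximable lam n g"
  unfolding approximable_def
proof (intro conjI g allI impI)
  fix e :: real assume e: "0 < e"
  then have "eventually (\<lambda>k. sqn (pow_measure lam n) (\<lambda>z. h k z - g z) < ennreal (e / 4)) sequentially"
    using lim by (intro order_tendstoD) auto
  then obtain k where k: "sqn (pow_measure lam n) (\<lambda>z. h k z - g z) < ennreal (e / 4)"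
    by (auto simp: eventually_sequentially)
  obtain gs where gs: "admissible_tuples lam n gs"
      "sqn (pow_measure lam n) (\<lambda>z. sum_product n gs z - h k z) \<le> ennreal (e / 4)"
    using h[of k] e unfolding approximable_def by (metis zero_less_divide_iff zero_less_numeral)
  have hm: "h k \<in> borel_measurable (pow_measure lam n)" using h[of k] by (simp add: approximable_def)
  have "sqn (pow_measure lam n) (\<lambda>z. sum_product n gs z - g z)
     \<le> 2 * sqn (pow_measure lam n) (\<lambda>z. sum_product n gs z - h k z) + 2 * sqn (pow_measure lam n) (\<lambda>z. h k z - g z)"
    by (rule sqn_diff_le[OF measurable_sum_product[OF gs(1)] hm g])
  also have "\<dots> \<le> 2 * ennreal (e / 4) + 2 * ennreal (e / 4)"
    using gs(2) k by (intro add_mono mult_left_mono) auto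
  also have "\<dots> = ennreal e"
    using e by (simp add: ennreal_mult'[symmetric] ennreal_plus[symmetric] flip: ennreal_numeral del: ennreal_plus)
  finally show "\<exists>gs. admissible_tuples lam n gs \<and> sqn (pow_measure lam n) (\<lambda>z. sum_product n gs z - g z) \<le> ennreal e"
    using gs(1) by blast
qed

lemma approximable_dominated:
  assumes g: "g \<in> borel_measurable (pow_measure lam n)"
    and h: "\<And>k. approximable lam n (h k)"
    and lim: "\<And>z. z \<in> space (pow_measure lam n) \<Longrightarrow> (\<lambda>k. h k z) \<longlonglongrightarrow> g z"
    and w: "w \<in> L2 (pow_measure lam n)"
    and le: "\<And>k z. z \<in> space (pow_measure lam n) \<Longrightarrow> \<bar>h k z\<bar> \<le> \<bar>w z\<bar>"
  shows "approximable lam n g"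
proof (rule approximable_limit[OF g h])
  let ?M = "pow_measure lam n"
  have [measurable]: "h k \<in> borel_measurable ?M" for k using h[of k] by (simp add: approximable_def)
  note [measurable] = g L2_measurable[OF w]
  have gl: "\<bar>g z\<bar> \<le> \<bar>w z\<bar>" if "z \<in> space ?M" for z
  proof (rule tendsto_upperbound[OF tendsto_rabs[OF lim[OF that]]])
    show "eventually (\<lambda>k. \<bar>h k z\<bar> \<le> \<bar>w z\<bar>) sequentially" using le[OF that] by simp
  qed simp
  have "(\<lambda>k. \<integral>\<^sup>+z. ennreal ((h k z - g z)\<^sup>2) \<partial>?M) \<longlonglongrightarrow> (\<integral>\<^sup>+z. ennreal 0 \<partial>?M)"
  proof (rule nn_integral_dominated_convergence[where w="\<lambda>z. 4 * ennreal ((w z)\<^sup>2)"])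
    show "AE z in ?M. ennreal ((h k z - g z)\<^sup>2) \<le> 4 * ennreal ((w z)\<^sup>2)" for k
    proof (rule AE_I2)
      fix z assume z: "z \<in> space ?M"
      have "\<bar>h k z - g z\<bar> \<le> 2 * \<bar>w z\<bar>" using le[OF z, of k] gl[OF z] by linarith
      then have "\<bar>h k z - g z\<bar>\<^sup>2 \<le> (2 * \<bar>w z\<bar>)\<^sup>2" by (rule power_mono) simp
      then show "ennreal ((h k z - g z)\<^sup>2) \<le> 4 * ennreal ((w z)\<^sup>2)"
        by (simp add: power_mult_distrib ennreal_mult'[symmetric] ennreal_leI flip: ennreal_numeral)
    qed
    show "(\<integral>\<^sup>+z. 4 * ennreal ((w z)\<^sup>2) \<partial>?M) < \<infinity>"
      using w by (simp add: nn_integral_cmult L2_iff sqn_def ennreal_mult_less_top)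
    show "AE z in ?M. (\<lambda>k. ennreal ((h k z - g z)\<^sup>2)) \<longlonglongrightarrow> ennreal 0"
    proof (rule AE_I2)
      fix z assume "z \<in> space ?M"
      then have "(\<lambda>k. (h k z - g z)\<^sup>2) \<longlonglongrightarrow> (g z - g z)\<^sup>2" using lim by (intro tendsto_intros)
      then show "(\<lambda>k. ennreal ((h k z - g z)\<^sup>2)) \<longlonglongrightarrow> ennreal 0" by (intro tendsto_ennrealI) simp
    qed
  qed measurable
  then show "(\<lambda>k. sqn ?M (\<lambda>z. h k z - g z)) \<longlonglongrightarrow> 0" by (simp add: sqn_def)
qed

lemma approximable_exact:
  assumes "admissible_tuples lam n gs" "g \<in> borel_measurable (pow_measure lam n)"
    and "\<And>z. z \<in> space (pow_measure lam n) \<Longrightarrow> sum_product n gs z = g z"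
  shows "approximable lam n g"
proof -
  have "sqn (pow_measure lam n) (\<lambda>z. sum_product n gs z - g z) = sqn (pow_measure lam n) (\<lambda>_. 0)"
    using assms(3) by (intro sqn_cong_AE AE_I2) simp
  then show ?thesis using assms(1,2) unfolding approximable_def by (auto simp: sqn_def)
qed

lemma approximable_scale:
  assumes n: "0 < n" and g: "approximable lam n g"
  shows "approximable lam n (\<lambda>z. c * g z)"
  unfolding approximable_def
proof (intro conjI allI impI)
  have gm[measurable]: "g \<in> borel_measurable (pow_measure lam n)" using g by (simp add: approximable_def)
  then show "(\<lambda>z. c * g z) \<in> borel_measurable (pow_measure lam n)" by measurable
  fix e :: real assume e: "0 < e"
  \<comment> \<open>Dividing by 1 + c^2 instead of c^2 spares a separate treatment of
    \<open>c = 0\<close>.\<close>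
  define d where "d = e / (1 + c\<^sup>2)"
  have pos: "0 < 1 + c\<^sup>2" by (rule add_pos_nonneg) auto
  then have d: "0 < d" using e by (simp add: d_def)
  then obtain gs where gs: "admissible_tuples lam n gs"
      "sqn (pow_measure lam n) (\<lambda>z. sum_product n gs z - g z) \<le> ennreal d"
    using g unfolding approximable_def by blast
  have "sqn (pow_measure lam n) (\<lambda>z. sum_product n (map (scale_first c) gs) z - c * g z)
     = sqn (pow_measure lam n) (\<lambda>z. c * (sum_product n gs z - g z))"
    using n by (simp add: sum_product_scale right_diff_distrib)
  also have "\<dots> = ennreal (c\<^sup>2) * sqn (pow_measure lam n) (\<lambda>z. sum_product n gs z - g z)"
    by (intro sqn_cmult borel_measurable_diff measurable_sum_product gs(1) gm)
  also have "\<dots> \<le> ennreal (c\<^sup>2) * ennreal d" using gs(2) by (rule mult_left_mono) simp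
  also have "\<dots> = ennreal (c\<^sup>2 * d)" by (simp add: ennreal_mult')
  also have "\<dots> \<le> ennreal ((1 + c\<^sup>2) * d)" using d by (intro ennreal_leI mult_right_mono) auto
  also have "(1 + c\<^sup>2) * d = e" using pos by (simp add: d_def)
  finally show "\<exists>gs. admissible_tuples lam n gs \<and> sqn (pow_measure lam n) (\<lambda>z. sum_product n gs z - c * g z) \<le> ennreal e"
    using admissible_tuples_simps(3)[OF gs(1)] by blast
qed

lemma approximable_add:
  assumes g: "approximable lam n g" and h: "approximable lam n h"
  shows "approximable lam n (\<lambda>z. g z + h z)"
  unfolding approximable_def
proof (intro conjI allI impI)
  have [measurable]: "g \<in> borel_measurable (pow_measure lam n)" "h \<in> borel_measurable (pow_measure lam n)"
    using g h by (auto simp: approximable_def)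
  then show "(\<lambda>z. g z + h z) \<in> borel_measurable (pow_measure lam n)" by measurable
  fix e :: real assume e: "0 < e"
  then have e4: "0 < e / 4" by simp
  obtain gs where gs: "admissible_tuples lam n gs"
      "sqn (pow_measure lam n) (\<lambda>z. sum_product n gs z - g z) \<le> ennreal (e / 4)"
    using g e4 unfolding approximable_def by blast
  obtain hs where hs: "admissible_tuples lam n hs"
      "sqn (pow_measure lam n) (\<lambda>z. sum_product n hs z - h z) \<le> ennreal (e / 4)"
    using h e4 unfolding approximable_def by blast
  note [measurable] = measurable_sum_product[OF gs(1)] measurable_sum_product[OF hs(1)]
  have "sqn (pow_measure lam n) (\<lambda>z. sum_product n (gs @ hs) z - (g z + h z))
     = sqn (pow_measure lam n) (\<lambda>z. (sum_product n gs z - g z) + (sum_product n hs z - h z))"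
    by (simp add: sum_product_append algebra_simps)
  also have "\<dots> \<le> 2 * sqn (pow_measure lam n) (\<lambda>z. sum_product n gs z - g z) + 2 * sqn (pow_measure lam n) (\<lambda>z. sum_product n hs z - h z)"
    by (intro sqn_add_le) measurable
  also have "\<dots> \<le> 2 * ennreal (e / 4) + 2 * ennreal (e / 4)"
    using gs(2) hs(2) by (intro add_mono mult_left_mono) auto
  also have "\<dots> = ennreal e"
    using e by (simp add: ennreal_mult'[symmetric] ennreal_plus[symmetric] flip: ennreal_numeral del: ennreal_plus)
  finally show "\<exists>gs. admissible_tuples lam n gs \<and> sqn (pow_measure lam n) (\<lambda>z. sum_product n gs z - (g z + h z)) \<le> ennreal e"
    using gs(1) hs(1) by (intro exI[of _ "gs @ hs"]) (simp add: admissible_tuples_simps)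
qed

lemma approximable_diff:
  "0 < n \<Longrightarrow> approximable lam n g \<Longrightarrow> approximable lam n h \<Longrightarrow> approximable lam n (\<lambda>z. g z - h z)"
  using approximable_add[of lam n g "\<lambda>z. (-1) * h z"] approximable_scale[of n lam h "-1"] by simp

context sigma_finite_measure
begin

lemma cube_in_sets: "B \<in> sets M \<Longrightarrow> (\<Pi>\<^sub>E i\<in>{..<n}. B) \<in> sets (pow_measure M n)"
  by (intro sets_PiM_I_finite) auto

lemma emeasure_cube:
  assumes "B \<in> sets M" "emeasure M B < \<infinity>"
  shows "emeasure (pow_measure M n) (\<Pi>\<^sub>E i\<in>{..<n}. B) < \<infinity>"
proof -
  interpret product_sigma_finite "\<lambda>_::nat. M" ..
  have "emeasure (pow_measure M n) (\<Pi>\<^sub>E i\<in>{..<n}. B) = (\<Prod>i<n. emeasure M B)"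
    using assms by (intro emeasure_PiM) auto
  then show ?thesis using assms(2) by (simp add: power_less_top_ennreal)
qed

lemma indicator_L2:
  "S \<in> sets N \<Longrightarrow> emeasure N S < \<infinity> \<Longrightarrow> (indicator S :: _ \<Rightarrow> real) \<in> L2 N"
proof -
  assume S: "S \<in> sets N" "emeasure N S < \<infinity>"
  have "sqn N (indicator S) = (\<integral>\<^sup>+x. indicator S x \<partial>N)"
    unfolding sqn_def by (intro nn_integral_cong) (simp add: indicator_def)
  then show "(indicator S :: _ \<Rightarrow> real) \<in> L2 N" using S by (simp add: L2_iff)
qed

text \<open>A Dynkin class argument inside a cube of finite measure, to which everything is cut down
  so that indicators are square integrable and complements stay in the class. Measurable rectangles
  are products of indicators and need no approximation; disjoint unions follow by dominated
  convergence with the indicator of the cube as majorant.\<close>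

lemma approximable_indicator:
  assumes n: "0 < n" and B: "B \<in> sets M" "emeasure M B < \<infinity>" and S: "S \<in> sets (pow_measure M n)"
  shows "approximable M n (indicator (S \<inter> (\<Pi>\<^sub>E i\<in>{..<n}. B)))"
proof -
  let ?C = "\<Pi>\<^sub>E i\<in>{..<n}. B"
  note C = cube_in_sets[OF B(1), of n]
  have gen: "sets (pow_measure M n) = sigma_sets (\<Pi>\<^sub>E i\<in>{..<n}. space M) {Pi\<^sub>E {..<n} A | A. A \<in> {..<n} \<rightarrow> sets M}"
    by (subst sets_PiM) (simp add: prod_algebra_eq_finite)
  have rect: "approximable M n (indicator (Pi\<^sub>E {..<n} A \<inter> ?C))" if A: "A \<in> {..<n} \<rightarrow> sets M" for A
  proof (rule approximable_exact[of M n "[\<lambda>i. indicator (A i \<inter> B)]"])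
    have "admissible_factor M (indicator (A i \<inter> B))" if "i < n" for i
    proof -
      have "A i \<inter> B \<in> sets M" "emeasure M (A i \<inter> B) < \<infinity>"
        using A B that emeasure_mono[of "A i \<inter> B" B M] by (auto intro: le_less_trans)
      then show ?thesis
        unfolding admissible_factor_def
        by (intro conjI exI[of _ 1] bexI[of _ "A i \<inter> B"]) (auto simp: indicator_def)
    qed
    then show "admissible_tuples M n [\<lambda>i. indicator (A i \<inter> B)]" by (simp add: admissible_tuples_def)
    have "Pi\<^sub>E {..<n} A \<in> sets (pow_measure M n)" using A by (intro sets_PiM_I_finite) auto
    then show "indicator (Pi\<^sub>E {..<n} A \<inter> ?C) \<in> borel_measurable (pow_measure M n)" using C by simp
    fix z assume z: "z \<in> space (pow_measure M n)"
    show "sum_product n [\<lambda>i. indicator (A i \<inter> B)] z = indicator (Pi\<^sub>E {..<n} A \<inter> ?C) z"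
    proof (cases "\<forall>i<n. z i \<in> A i \<inter> B")
      case True
      then have "z \<in> Pi\<^sub>E {..<n} A \<inter> ?C" using z by (auto simp: space_PiM PiE_iff)
      then show ?thesis using True by (simp add: sum_product_def)
    next
      case False
      then obtain i where i: "i < n" "z i \<notin> A i \<inter> B" by auto
      then have "(\<Prod>i<n. indicator (A i \<inter> B) (z i)) = (0::real)"
        by (intro prod_zero bexI[of _ i]) (auto simp: indicator_def)
      moreover have "z \<notin> Pi\<^sub>E {..<n} A \<inter> ?C" using i by auto
      ultimately show ?thesis by (simp add: sum_product_def)
    qed
  qed
  have istab: "Int_stable {Pi\<^sub>E {..<n} A | A. A \<in> {..<n} \<rightarrow> sets M}"
    proof (rule Int_stableI)
      fix a b assume "a \<in> {Pi\<^sub>E {..<n} A | A. A \<in> {..<n} \<rightarrow> sets M}" "b \<in> {Pi\<^sub>E {..<n} A | A. A \<in> {..<n} \<rightarrow> sets M}"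
      then obtain A A' where "a = Pi\<^sub>E {..<n} A" "b = Pi\<^sub>E {..<n} A'" "A \<in> {..<n} \<rightarrow> sets M" "A' \<in> {..<n} \<rightarrow> sets M" by blast
      then show "a \<inter> b \<in> {Pi\<^sub>E {..<n} A | A. A \<in> {..<n} \<rightarrow> sets M}"
        by (intro CollectI exI[of _ "\<lambda>i. A i \<inter> A' i"]) (auto simp: PiE_Int)
    qed
  have sub: "{Pi\<^sub>E {..<n} A | A. A \<in> {..<n} \<rightarrow> sets M} \<subseteq> Pow (\<Pi>\<^sub>E i\<in>{..<n}. space M)"
    proof -
      have "Pi\<^sub>E {..<n} A \<subseteq> (\<Pi>\<^sub>E i\<in>{..<n}. space M)" if A: "A \<in> {..<n} \<rightarrow> sets M" for A
      proof (rule PiE_mono)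
        fix i assume "i \<in> {..<n}"
        then have "A i \<in> sets M" using A by blast
        then show "A i \<subseteq> space M" by (rule sets.sets_into_space)
      qed
      then show ?thesis by blast
    qed
  show ?thesis
    using istab sub S[unfolded gen]
  proof (induction rule: sigma_sets_induct_disjoint)
    case (basic A)
    then show ?case using rect by auto
  next
    case empty
    then show ?case by (intro approximable_exact[of M n "[]"]) (auto simp: admissible_tuples_simps)
  next
    case (compl A)
    have "approximable M n (\<lambda>z. indicator ((\<Pi>\<^sub>E i\<in>{..<n}. space M) \<inter> ?C) z - indicator (A \<inter> ?C) z)"
      using rect[of "\<lambda>_. space M"] by (intro approximable_diff n compl.IH) auto
    moreover have "(\<lambda>z. indicator ((\<Pi>\<^sub>E i\<in>{..<n}. space M) \<inter> ?C) z - indicator (A \<inter> ?C) z)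
        = (indicator (((\<Pi>\<^sub>E i\<in>{..<n}. space M) - A) \<inter> ?C) :: _ \<Rightarrow> real)"
    proof
      fix z
      have "A \<subseteq> (\<Pi>\<^sub>E i\<in>{..<n}. space M)"
        using sets.sets_into_space[of A "pow_measure M n"] compl.hyps unfolding gen by (simp add: space_PiM)
      then show "indicator ((\<Pi>\<^sub>E i\<in>{..<n}. space M) \<inter> ?C) z - indicator (A \<inter> ?C) z
        = (indicator (((\<Pi>\<^sub>E i\<in>{..<n}. space M) - A) \<inter> ?C) z :: real)"
        by (auto simp: indicator_def)
    qed
    ultimately show ?case by simp
  next
    case (union A)
    have Am: "A i \<in> sets (pow_measure M n)" for i using union.hyps unfolding gen by auto
    have part: "approximable M n (\<lambda>z. \<Sum>i<k. indicator (A i \<inter> ?C) z)" for k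
    proof (induction k)
      case 0
      then show ?case by (intro approximable_exact[of M n "[]"]) (auto simp: admissible_tuples_simps)
    next
      case (Suc k)
      then show ?case using approximable_add[OF Suc union.IH[of k]] by simp
    qed
    have eq: "(\<Sum>i<k. indicator (A i \<inter> ?C) z) = (indicator ((\<Union>i<k. A i) \<inter> ?C) z :: real)" for k z
    proof -
      have "(indicator (\<Union>i<k. A i \<inter> ?C) z :: real) = (\<Sum>i<k. indicator (A i \<inter> ?C) z)"
        using union.hyps(1) by (intro indicator_UN_disjoint) (auto simp: disjoint_family_on_def)
      moreover have "(\<Union>i<k. A i \<inter> ?C) = (\<Union>i<k. A i) \<inter> ?C" by auto
      ultimately show ?thesis by simp
    qed
    show ?case
    proof (rule approximable_dominated[where w="indicator ?C", OF _ part])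
      show "indicator (\<Union> (range A) \<inter> ?C) \<in> borel_measurable (pow_measure M n)" using Am C by auto
      show "indicator ?C \<in> L2 (pow_measure M n)" using C emeasure_cube[OF B] by (intro indicator_L2)
      show "\<bar>\<Sum>i<k. indicator (A i \<inter> ?C) z\<bar> \<le> \<bar>indicator ?C z :: real\<bar>" for k z
        unfolding eq by (auto simp: indicator_def)
      fix z
      show "(\<lambda>k. \<Sum>i<k. indicator (A i \<inter> ?C) z) \<longlonglongrightarrow> (indicator (\<Union> (range A) \<inter> ?C) z :: real)"
      proof (cases "\<exists>i. z \<in> A i \<inter> ?C")
        case True
        then obtain i where i: "z \<in> A i" "z \<in> ?C" by auto
        have "eventually (\<lambda>k. (\<Sum>i<k. indicator (A i \<inter> ?C) z) = (indicator (\<Union> (range A) \<inter> ?C) z :: real)) sequentially"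
          unfolding eq eventually_sequentially using i by (intro exI[of _ "Suc i"]) (auto simp: indicator_def)
        then show ?thesis by (rule tendsto_eventually)
      next
        case False
        then show ?thesis unfolding eq by (intro tendsto_eventually always_eventually) (auto simp: indicator_def)
      qed
    qed
  qed
qed

lemma approximable_nonneg_cube:
  assumes n: "0 < n" and B: "B \<in> sets M" "emeasure M B < \<infinity>"
    and u: "u \<in> borel_measurable (pow_measure M n)" "\<And>z. 0 \<le> u z"
    and L2: "(\<lambda>z. u z * indicator (\<Pi>\<^sub>E i\<in>{..<n}. B) z) \<in> L2 (pow_measure M n)"
  shows "approximable M n (\<lambda>z. u z * indicator (\<Pi>\<^sub>E i\<in>{..<n}. B) z)"
  using u L2
proof (induction rule: borel_measurable_induct_real)
  let ?C = "\<Pi>\<^sub>E i\<in>{..<n}. B"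
  note [measurable] = cube_in_sets[OF B(1), of n]
  \<comment> \<open>The induction carries square integrability as a premise, and a part that is
    dominated by the whole inherits it.\<close>
  have bd: "(\<lambda>z. v z * indicator ?C z) \<in> L2 (pow_measure M n)"
    if "(\<lambda>z. u z * indicator ?C z) \<in> L2 (pow_measure M n)" and v[measurable]: "v \<in> borel_measurable (pow_measure M n)"
      and le: "\<And>z. z \<in> space (pow_measure M n) \<Longrightarrow> \<bar>v z\<bar> \<le> u z" for u v
  proof -
    have "sqn (pow_measure M n) (\<lambda>z. v z * indicator ?C z) \<le> sqn (pow_measure M n) (\<lambda>z. u z * indicator ?C z)"
      unfolding sqn_def
    proof (intro nn_integral_mono ennreal_leI)
      fix z assume z: "z \<in> space (pow_measure M n)"
      have "\<bar>v z * indicator ?C z\<bar> \<le> \<bar>u z * indicator ?C z\<bar>"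
        using le[OF z] by (auto simp: indicator_def)
      then show "(v z * indicator ?C z)\<^sup>2 \<le> (u z * indicator ?C z)\<^sup>2" by (simp add: abs_le_square_iff)
    qed
    then show ?thesis using that(1) by (auto simp: L2_iff intro: le_less_trans)
  qed
  {
    case (set A)
    have "(\<lambda>z. indicator A z * indicator ?C z) = (indicator (A \<inter> ?C) :: _ \<Rightarrow> real)"
      by (auto simp: indicator_def fun_eq_iff)
    then show ?case using approximable_indicator[OF n B set(1)] by simp
  next
    case (mult u c)
    show ?case
    proof (cases "c = 0")
      case True
      then show ?thesis by (intro approximable_exact[of M n "[]"]) (auto simp: admissible_tuples_simps)
    next
      case False
      have "(\<lambda>z. inverse c * (c * u z * indicator ?C z)) \<in> L2 (pow_measure M n)"
        using mult.prems by (rule L2_cmult)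
      moreover have "(\<lambda>z. inverse c * (c * u z * indicator ?C z)) = (\<lambda>z. u z * indicator ?C z)"
        using False by (simp add: fun_eq_iff field_simps)
      ultimately have "approximable M n (\<lambda>z. u z * indicator ?C z)" by (intro mult.IH) (simp only:)
      then have "approximable M n (\<lambda>z. c * (u z * indicator ?C z))" by (rule approximable_scale[OF n])
      then show ?thesis by (simp add: mult.assoc)
    qed
  next
    case (add u v)
    have "approximable M n (\<lambda>z. u z * indicator ?C z)" "approximable M n (\<lambda>z. v z * indicator ?C z)"
      using add by (intro add.IH bd[OF add.prems]; simp)+
    from approximable_add[OF this(2,1)] show ?case by (simp add: distrib_right)
  next
    case (seq U)
    have le: "U k z \<le> u z" if "z \<in> space (pow_measure M n)" for k z
      using seq.hyps(3) seq.hyps(4)[OF that] by (intro incseq_le) (auto simp: incseq_def le_fun_def)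
    have "approximable M n (\<lambda>z. U k z * indicator ?C z)" for k
      using le seq.hyps(2) by (intro seq.IH bd[OF seq.prems] seq.hyps(1)) auto
    then show ?case
    proof (rule approximable_dominated[rotated])
      show "(\<lambda>z. u z * indicator ?C z) \<in> borel_measurable (pow_measure M n)" using seq.prems by (rule L2_measurable)
      show "(\<lambda>z. u z * indicator ?C z) \<in> L2 (pow_measure M n)" by (rule seq.prems)
      fix z assume z: "z \<in> space (pow_measure M n)"
      show "(\<lambda>k. U k z * indicator ?C z) \<longlonglongrightarrow> u z * indicator ?C z"
        using seq.hyps(4)[OF z] by (intro tendsto_intros)
      show "\<bar>U k z * indicator ?C z\<bar> \<le> \<bar>u z * indicator ?C z\<bar>" for k
        using le[OF z, of k] seq.hyps(2)[of k z] by (auto simp: indicator_def)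
    qed
  }
qed

text \<open>Truncation to cubes over an increasing exhaustion by sets of finite measure. Every tuple
  has finitely many coordinates, so it eventually lies in the cube, and the function itself is the
  majorant.\<close>

lemma approximable_nonneg:
  assumes n: "0 < n" and u: "u \<in> L2 (pow_measure M n)" "\<And>z. 0 \<le> u z"
  shows "approximable M n u"
proof -
  obtain A :: "nat \<Rightarrow> 'a set" where A: "range A \<subseteq> sets M" "(\<Union>i. A i) = space M" "\<And>i. emeasure M (A i) \<noteq> \<infinity>" "incseq A"
    using sigma_finite_incseq by blast
  let ?C = "\<lambda>k. \<Pi>\<^sub>E i\<in>{..<n}. A k"
  have Ak: "A k \<in> sets M" "emeasure M (A k) < \<infinity>" for k using A(1) A(3)[of k] by (auto simp: less_top)
  note [measurable] = L2_measurable[OF u(1)] cube_in_sets[OF Ak(1), of n]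
  have le: "\<bar>u z * indicator (?C k) z\<bar> \<le> \<bar>u z\<bar>" for z k by (auto simp: indicator_def)
  show ?thesis
  proof (rule approximable_dominated[OF _ _ _ u(1) le])
    show "approximable M n (\<lambda>z. u z * indicator (?C k) z)" for k
    proof (rule approximable_nonneg_cube[OF n Ak])
      have "sqn (pow_measure M n) (\<lambda>z. u z * indicator (?C k) z) \<le> sqn (pow_measure M n) u"
        unfolding sqn_def using le[of _ k] by (intro nn_integral_mono ennreal_leI) (simp add: abs_le_square_iff)
      then show "(\<lambda>z. u z * indicator (?C k) z) \<in> L2 (pow_measure M n)"
        using u(1) by (auto simp: L2_iff intro: le_less_trans)
    qed (use u in \<open>auto simp: L2_measurable\<close>)
    fix z assume z: "z \<in> space (pow_measure M n)"
    have "\<exists>k. \<forall>i<n. z i \<in> A k"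
    proof -
      have "\<exists>k. z i \<in> A k" if "i < n" for i
      proof -
        have "z i \<in> space M" using z that by (auto simp: space_PiM)
        then show ?thesis using A(2) by auto
      qed
      then obtain k where k: "z i \<in> A (k i)" if "i < n" for i by metis
      have "z i \<in> A (Max (k ` {..<n}))" if "i < n" for i
      proof -
        have "k i \<le> Max (k ` {..<n})" using that by (intro Max_ge) auto
        then show ?thesis using k[OF that] A(4) by (auto simp: incseq_def)
      qed
      then show ?thesis by blast
    qed
    then obtain k where k: "\<forall>i<n. z i \<in> A k" by blast
    have zC: "z \<in> ?C m" if "k \<le> m" for m
      using k z incseqD[OF A(4) that] by (auto simp: PiE_iff space_PiM)
    then have "eventually (\<lambda>k. u z * indicator (?C k) z = u z) sequentially"
      unfolding eventually_sequentially
      by (intro exI[of _ k] allI impI) (simp only: indicator_simps(1)[OF zC] mult_1_right)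
    then show "(\<lambda>k. u z * indicator (?C k) z) \<longlonglongrightarrow> u z" by (rule tendsto_eventually)
  qed measurable
qed

theorem sum_product_dense:
  assumes n: "0 < n" and g: "g \<in> L2 (pow_measure M n)"
  shows "\<exists>gs. (\<forall>k. admissible_tuples M n (gs k)) \<and>
    L2_tendsto (pow_measure M n) (\<lambda>k. sum_product n (gs k)) g"
proof -
  let ?M = "pow_measure M n"
  note [measurable] = L2_measurable[OF g]
  have part: "(\<lambda>z. max 0 (h z)) \<in> L2 ?M" if "h \<in> L2 ?M" for h
  proof -
    note [measurable] = L2_measurable[OF that]
    have "sqn ?M (\<lambda>z. max 0 (h z)) \<le> sqn ?M h"
      unfolding sqn_def by (intro nn_integral_mono ennreal_leI) (auto simp: max_def)
    then show ?thesis using that by (auto simp: L2_iff intro: le_less_trans)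
  qed
  have "(\<lambda>z. - g z) \<in> L2 ?M" using L2_cmult[OF g, of "-1"] by simp
  then have "approximable M n (\<lambda>z. max 0 (g z) - max 0 (- g z))"
    using part g by (intro approximable_diff approximable_nonneg n) auto
  moreover have "(\<lambda>z. max 0 (g z) - max 0 (- g z)) = g" by (auto simp: max_def)
  ultimately have ap: "approximable M n g" by simp
  have "\<exists>gs. admissible_tuples M n gs \<and> sqn ?M (\<lambda>z. sum_product n gs z - g z) \<le> ennreal (1 / real (Suc k))" for k
    using ap unfolding approximable_def by simp
  then obtain gs where gs: "\<And>k. admissible_tuples M n (gs k)"
      "\<And>k. sqn ?M (\<lambda>z. sum_product n (gs k) z - g z) \<le> ennreal (1 / real (Suc k))"
    by metis
  have "L2_tendsto ?M (\<lambda>k. sum_product n (gs k)) g"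
    unfolding L2_tendsto_iff
  proof (intro conjI allI g)
    fix k
    note [measurable] = measurable_sum_product[OF gs(1)[of k]]
    have "(\<lambda>z. sum_product n (gs k) z - g z) \<in> L2 ?M"
      using le_less_trans[OF gs(2)[of k], of \<infinity>] by (simp add: L2_iff)
    then show "sum_product n (gs k) \<in> L2 ?M" using L2_add[OF _ g] by fastforce
  next
    have "(\<lambda>k. ennreal (1 / real (Suc k))) \<longlonglongrightarrow> ennreal 0"
      by (intro tendsto_ennrealI LIMSEQ_Suc lim_1_over_n)
    then have t: "(\<lambda>k. ennreal (1 / real (Suc k))) \<longlonglongrightarrow> 0" by (simp only: ennreal_0)
    show "(\<lambda>k. sqn ?M (\<lambda>z. sum_product n (gs k) z - g z)) \<longlonglongrightarrow> 0"
      by (rule tendsto_sandwich[OF _ _ tendsto_const t]; intro always_eventually allI)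
         (simp, rule gs(2))
  qed
  then show ?thesis using gs(1) by blast
qed

end

section \<open>Multiple integrals and their slices\<close>

text \<open>Coordinate 0 belongs to exactly one of \<open>J\<close> and its complement, so every
  term of the alternating sum picks up the scalar exactly once.\<close>

lemma wiener_ito_prod_scale:
  assumes n: "0 < n"
  shows "wiener_ito_prod lam \<eta> X n (scale_first c h) \<omega> = c * wiener_ito_prod lam \<eta> X n h \<omega>"
proof -
  have p: "(\<Prod>j\<in>J. scale_first c h j (y j)) = (if 0 \<in> J then c else 1) * (\<Prod>j\<in>J. h j (y j))" if "finite J" for J y
  proof -
    have "(\<Prod>j\<in>J. scale_first c h j (y j)) = (\<Prod>j\<in>J. (if j = 0 then c else 1) * h j (y j))"
      by (intro prod.cong) (auto simp: scale_first_def)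
    also have "\<dots> = (if 0 \<in> J then c else 1) * (\<Prod>j\<in>J. h j (y j))"
      using that by (simp add: prod.distrib)
    finally show ?thesis .
  qed
  show ?thesis
    unfolding wiener_ito_prod_def sum_distrib_left
  proof (intro sum.cong refl)
    fix J assume J: "J \<in> Pow {..<n}"
    then have fJ: "finite J" by (auto intro: finite_subset)
    show "(- 1) ^ (n - card J) * (\<integral>y. (\<Prod>j\<in>J. scale_first c h j (y j)) \<partial>factorial_measure lam (point_index (\<eta> \<omega>)) (\<lambda>i. X i \<omega>) J)
        * (\<integral>y. (\<Prod>j\<in>{..<n} - J. scale_first c h j (y j)) \<partial>PiM ({..<n} - J) (\<lambda>_. lam))
      = c * ((- 1) ^ (n - card J) * (\<integral>y. (\<Prod>j\<in>J. h j (y j)) \<partial>factorial_measure lam (point_index (\<eta> \<omega>)) (\<lambda>i. X i \<omega>) J)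
        * (\<integral>y. (\<Prod>j\<in>{..<n} - J. h j (y j)) \<partial>PiM ({..<n} - J) (\<lambda>_. lam)))"
      using n by (cases "0 \<in> J") (simp_all add: p[OF fJ] p)
  qed
qed

definition wick_list :: "'a measure \<Rightarrow> nat \<Rightarrow> (nat \<Rightarrow> 'a \<Rightarrow> real) list \<Rightarrow> 'a measure \<Rightarrow> real" where
  "wick_list lam n gs \<mu> = (\<Sum>g\<leftarrow>gs. wick_functional lam {..<n} g \<mu>)"

text \<open>For a function of n + 1 variables in sum-product form this is the integral of order n of
  its section at the last variable, jointly in the configuration and that variable. The last factors
  appear as plain numbers.\<close>

definition wick_slice :: "'a measure \<Rightarrow> nat \<Rightarrow> (nat \<Rightarrow> 'a \<Rightarrow> real) list \<Rightarrow> 'a measure \<times> 'a \<Rightarrow> real" where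
  "wick_slice lam n gs p = (\<Sum>g\<leftarrow>gs. g n (snd p) * wick_functional lam {..<n} g (fst p))"

lemma wick_list_Nil [simp]: "wick_list lam n [] \<mu> = 0"
  by (simp add: wick_list_def)

lemma wick_slice_Nil [simp]: "wick_slice lam n [] p = 0"
  by (simp add: wick_slice_def)

lemma sum_list_nth: "(\<Sum>g\<leftarrow>gs. F g) = (\<Sum>i<length gs. F (gs ! i))" for F :: "_ \<Rightarrow> real"
  by (simp add: sum_list_sum_nth atLeast0LessThan)

lemma admissible_tuples_support:
  assumes "admissible_tuples lam n gs"
  shows "\<exists>B c. B \<in> sets lam \<and> emeasure lam B < \<infinity> \<and> 0 \<le> c \<and> (\<forall>g\<in>set gs. \<forall>j<n. supported_in lam B c (g j))"
proof -
  have "\<exists>B c. B \<in> sets lam \<and> emeasure lam B < \<infinity> \<and> 0 \<le> c \<and>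
      (\<forall>p\<in>set gs \<times> {..<n}. supported_in lam B c ((\<lambda>(g, j). g j) p))"
    using assms by (intro common_support) (auto simp: admissible_tuples_def)
  then show ?thesis by fastforce
qed

lemma admissible_tuples_Suc: "admissible_tuples lam (Suc n) gs \<Longrightarrow> admissible_tuples lam n gs"
  by (auto simp: admissible_tuples_def)

lemma admissible_tuples_measurable:
  "admissible_tuples lam n gs \<Longrightarrow> g \<in> set gs \<Longrightarrow> j < n \<Longrightarrow> g j \<in> borel_measurable lam"
  by (auto simp: admissible_tuples_def admissible_factor_def)

section \<open>Norm bounds for integrals of sum-product forms\<close>

context poisson_points
begin

lemma measurable_wick_tuple:
  "admissible_tuples lam n gs \<Longrightarrow> g \<in> set gs \<Longrightarrow> wick_functional lam {..<n} g \<in> borel_measurable N"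
  by (intro measurable_wick_functional admissible_tuples_measurable) auto

lemma measurable_wick_list [measurable]:
  "admissible_tuples lam n gs \<Longrightarrow> wick_list lam n gs \<in> borel_measurable N"
  unfolding wick_list_def[abs_def] sum_list_nth
  by (intro borel_measurable_sum measurable_wick_tuple[of n gs]) auto

lemma measurable_wick_slice [measurable]:
  assumes "admissible_tuples lam (Suc n) gs"
  shows "wick_slice lam n gs \<in> borel_measurable (N \<Otimes>\<^sub>M lam)"
  unfolding wick_slice_def[abs_def] sum_list_nth
proof (rule borel_measurable_sum)
  fix i assume "i \<in> {..<length gs}"
  then have g: "gs ! i \<in> set gs" by auto
  note [measurable] = admissible_tuples_measurable[OF assms g lessI]
    measurable_wick_tuple[OF admissible_tuples_Suc[OF assms] g]
  show "(\<lambda>p. (gs ! i) n (snd p) * wick_functional lam {..<n} (gs ! i) (fst p)) \<in> borel_measurable (N \<Otimes>\<^sub>M lam)"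
    by measurable
qed

text \<open>The difference of two lists becomes one linear combination with coefficients 1 and -1,
  the format in which the norm bounds are available.\<close>

lemma signed_list_sum:
  fixes F :: "_ \<Rightarrow> real"
  defines "xs \<equiv> \<lambda>gs hs. map (Pair 1) gs @ map (Pair (-1 :: real)) hs"
  shows "(\<Sum>a<length (xs gs hs). fst (xs gs hs ! a) * F (snd (xs gs hs ! a))) = (\<Sum>g\<leftarrow>gs. F g) - (\<Sum>g\<leftarrow>hs. F g)"
proof -
  have "(\<Sum>a<length (xs gs hs). fst (xs gs hs ! a) * F (snd (xs gs hs ! a))) = (\<Sum>x\<leftarrow>xs gs hs. fst x * F (snd x))"
    by (rule sum_list_nth[symmetric])
  also have "\<dots> = (\<Sum>g\<leftarrow>gs. F g) - (\<Sum>g\<leftarrow>hs. F g)"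
  proof -
    have "(\<Sum>g\<leftarrow>hs. - F g) = - (\<Sum>g\<leftarrow>hs. F g)" by (induction hs) auto
    then show ?thesis by (simp add: xs_def comp_def)
  qed
  finally show ?thesis .
qed

lemma
  assumes gs: "admissible_tuples lam n gs" and hs: "admissible_tuples lam n hs"
  shows wick_list_bound: "sqn Q (\<lambda>\<mu>. wick_list lam n gs \<mu> - wick_list lam n hs \<mu>)
      \<le> ennreal (fact n) * sqn (pow_measure lam n) (\<lambda>z. sum_product n gs z - sum_product n hs z)"
proof -
  let ?xs = "map (Pair 1) gs @ map (Pair (-1 :: real)) hs"
  have "admissible_tuples lam n (gs @ hs)" using gs hs by (simp add: admissible_tuples_simps)
  then obtain B c where B: "B \<in> sets lam" "emeasure lam B < \<infinity>" "0 \<le> c"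
      and s: "\<forall>g\<in>set (gs @ hs). \<forall>j<n. supported_in lam B c (g j)"
    using admissible_tuples_support by blast
  have "snd ` set ?xs = set (gs @ hs)" by (simp add: image_Un image_image)
  then have s': "supported_in lam B c (snd (?xs ! a) j)" if "a < length ?xs" "j < n" for a j
    using s that nth_mem[OF that(1)] by blast
  have "(\<integral>\<^sup>+\<mu>. ennreal ((\<Sum>a\<in>{..<length ?xs}. fst (?xs ! a) * wick_functional lam {..<n} (snd (?xs ! a)) \<mu>)\<^sup>2) \<partial>Q)
    \<le> ennreal (fact (card {..<n})) * (\<integral>\<^sup>+z. ennreal ((\<Sum>a\<in>{..<length ?xs}. fst (?xs ! a) * (\<Prod>j\<in>{..<n}. snd (?xs ! a) j (z j)))\<^sup>2) \<partial>pow_measure lam n)"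
    by (rule wick_L2_bound[OF B(1,2) _ _ _ B(3)]) (use s' in auto)
  then show ?thesis
    using signed_list_sum[where F="\<lambda>g. wick_functional lam {..<n} g _" and gs=gs and hs=hs]
      signed_list_sum[where F="\<lambda>g. \<Prod>j<n. g j (_ j)" and gs=gs and hs=hs]
    by (simp add: sqn_def wick_list_def sum_product_def)
qed

lemma wick_slice_list_bound:
  assumes gs: "admissible_tuples lam (Suc n) gs" and hs: "admissible_tuples lam (Suc n) hs"
  shows "sqn QL (\<lambda>p. wick_slice lam n gs p - wick_slice lam n hs p)
      \<le> ennreal (fact n) * sqn (pow_measure lam (Suc n)) (\<lambda>z. sum_product (Suc n) gs z - sum_product (Suc n) hs z)"
proof -
  let ?xs = "map (Pair 1) gs @ map (Pair (-1 :: real)) hs"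
  have "admissible_tuples lam (Suc n) (gs @ hs)" using gs hs by (simp add: admissible_tuples_simps)
  then obtain B c where B: "B \<in> sets lam" "emeasure lam B < \<infinity>" "0 \<le> c"
      and s: "\<forall>g\<in>set (gs @ hs). \<forall>j<Suc n. supported_in lam B c (g j)"
    using admissible_tuples_support by blast
  have "snd ` set ?xs = set (gs @ hs)" by (simp add: image_Un image_image)
  then have s': "supported_in lam B c (snd (?xs ! a) j)" if "a < length ?xs" "j < Suc n" for a j
    using s that nth_mem[OF that(1)] by blast
  have ins: "insert n {..<n} = {..<Suc n}" by (simp add: lessThan_Suc)
  have "(\<integral>\<^sup>+p. ennreal ((\<Sum>a\<in>{..<length ?xs}. fst (?xs ! a) * snd (?xs ! a) n (snd p) * wick_functional lam {..<n} (snd (?xs ! a)) (fst p))\<^sup>2) \<partial>QL)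
    \<le> ennreal (fact (card {..<n})) * (\<integral>\<^sup>+z. ennreal ((\<Sum>a\<in>{..<length ?xs}. fst (?xs ! a) * (\<Prod>j\<in>insert n {..<n}. snd (?xs ! a) j (z j)))\<^sup>2) \<partial>PiM (insert n {..<n}) (\<lambda>_. lam))"
  proof (rule wick_slice_bound[OF B(1,2)])
    show "(\<integral>\<^sup>+\<mu>. ennreal ((\<Sum>a\<in>{..<length ?xs}. k a * wick_functional lam {..<n} (snd (?xs ! a)) \<mu>)\<^sup>2) \<partial>Q)
    \<le> ennreal (fact (card {..<n})) * (\<integral>\<^sup>+z. ennreal ((\<Sum>a\<in>{..<length ?xs}. k a * (\<Prod>j\<in>{..<n}. snd (?xs ! a) j (z j)))\<^sup>2) \<partial>pow_measure lam n)" for k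
      by (rule wick_L2_bound[OF B(1,2) _ _ _ B(3)]) (use s' in auto)
  qed (use s' in auto)
  then show ?thesis
    using signed_list_sum[where F="\<lambda>g. g n _ * wick_functional lam {..<n} g _" and gs=gs and hs=hs]
      signed_list_sum[where F="\<lambda>g. \<Prod>j<Suc n. g j (_ j)" and gs=gs and hs=hs]
    unfolding ins by (simp add: sqn_def wick_slice_def sum_product_def mult.assoc)
qed

lemma sqn_P: "h \<in> borel_measurable N \<Longrightarrow> sqn P (\<lambda>\<omega>. h (\<eta> \<omega>)) = sqn Q h"
  unfolding sqn_def by (subst nn_integral_distr) auto

lemma sqn_PL: "h \<in> borel_measurable (N \<Otimes>\<^sub>M lam) \<Longrightarrow> sqn (P \<Otimes>\<^sub>M lam) (\<lambda>p. h (\<eta> (fst p), snd p)) = sqn QL h"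
  unfolding sqn_def QL_distr by (subst nn_integral_distr) auto

lemma L2_PL: "h \<in> L2 QL \<Longrightarrow> (\<lambda>p. h (\<eta> (fst p), snd p)) \<in> L2 (P \<Otimes>\<^sub>M lam)"
  using sqn_PL[of h] measurable_compose[OF measurable_eta_pair, of h borel] by (simp add: L2_iff measurable_QL)

lemma L2_tendsto_PL:
  assumes "L2_tendsto QL h l"
  shows "L2_tendsto (P \<Otimes>\<^sub>M lam) (\<lambda>k p. h k (\<eta> (fst p), snd p)) (\<lambda>p. l (\<eta> (fst p), snd p))"
proof -
  have "(\<lambda>p. h k p - l p) \<in> borel_measurable (N \<Otimes>\<^sub>M lam)" for k
    using assms L2_diff[of "h k" _ l] L2_measurable unfolding L2_tendsto_iff measurable_QL[symmetric] by blast
  from sqn_PL[OF this] assms show ?thesis by (auto simp: L2_tendsto_iff L2_PL)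
qed

lemma sum_product_L2:
  assumes "admissible_tuples lam n gs"
  shows "sum_product n gs \<in> L2 (pow_measure lam n)"
proof -
  obtain B c where B: "B \<in> sets lam" "emeasure lam B < \<infinity>" "0 \<le> c"
      and s: "\<forall>g\<in>set gs. \<forall>j<n. supported_in lam B c (g j)"
    using admissible_tuples_support[OF assms] by blast
  have prod: "(\<lambda>z. \<Prod>i<n. g i (z i)) \<in> L2 (pow_measure lam n)" if g: "g \<in> set gs" for g
  proof -
    have "integrable (pow_measure lam n) (\<lambda>z. \<Prod>i<n. (g i (z i))\<^sup>2)"
    proof (intro pow.product_integrable_prod)
      fix i assume "i \<in> {..<n}"
      then have si: "supported_in lam B c (g i)" using s g by simp
      note [measurable] = supported_inD(1)[OF si]
      have "\<bar>(g i y)\<^sup>2\<bar> \<le> c\<^sup>2" if "y \<in> space lam" for y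
        using power_mono[OF supported_inD(2)[OF si that], of 2] by simp
      moreover have "(g i y)\<^sup>2 = 0" if "y \<in> space lam" "y \<notin> B" for y
        using supported_inD(3)[OF si that] by simp
      ultimately have "supported_in lam B (c\<^sup>2) (\<lambda>y. (g i y)\<^sup>2)"
        unfolding supported_in_def by simp
      then show "integrable lam (\<lambda>y. (g i y)\<^sup>2)" using B(1,2) by (rule supported_in_integrable)
    qed simp
    moreover have "sum_product n [g] \<in> borel_measurable (pow_measure lam n)"
      using assms g by (intro measurable_sum_product) (auto simp: admissible_tuples_def)
    ultimately show ?thesis by (simp add: L2_def sum_product_def[abs_def] prod_power_distrib)
  qed
  have "(\<lambda>z. \<Sum>i<length gs. \<Prod>j<n. (gs ! i) j (z j)) \<in> L2 (pow_measure lam n)"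
    by (intro L2_sum prod) auto
  then show ?thesis by (simp add: sum_product_def[abs_def] sum_list_nth)
qed

lemma wick_list_L2:
  assumes gs: "admissible_tuples lam n gs"
  shows "wick_list lam n gs \<in> L2 Q"
proof -
  have "sqn Q (wick_list lam n gs) \<le> ennreal (fact n) * sqn (pow_measure lam n) (sum_product n gs)"
    using wick_list_bound[OF gs admissible_tuples_simps(1)] by simp
  also have "\<dots> < \<infinity>" using sum_product_L2[OF gs] by (simp add: L2_iff ennreal_mult_less_top)
  finally show ?thesis using measurable_wick_list[OF gs] by (simp add: L2_iff)
qed

lemma wick_slice_L2:
  assumes gs: "admissible_tuples lam (Suc n) gs"
  shows "wick_slice lam n gs \<in> L2 QL"
proof -
  have "sqn QL (wick_slice lam n gs) \<le> ennreal (fact n) * sqn (pow_measure lam (Suc n)) (sum_product (Suc n) gs)"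
    using wick_slice_list_bound[OF gs admissible_tuples_simps(1)] by simp
  also have "\<dots> < \<infinity>" using sum_product_L2[OF gs] by (simp add: L2_iff ennreal_mult_less_top)
  finally show ?thesis using measurable_wick_slice[OF gs] by (simp add: L2_iff measurable_QL)
qed

text \<open>The process may have infinitely many points, so the tuples form an infinite set; but a
  nonzero product forces every entry into \<open>pts_in B \<omega>\<close>, which leaves the finite
  sum that the functional represents.\<close>

lemma integral_factorial_measure:
  assumes w: "\<omega> \<in> space P" and fin: "finite (pts_in B \<omega>)" and J: "finite J"
    and g: "\<And>j. j \<in> J \<Longrightarrow> supported_in lam B c (g j)"
  shows "(\<integral>y. (\<Prod>j\<in>J. g j (y j)) \<partial>factorial_measure lam (pts \<omega>) (\<lambda>i. X i \<omega>) J) = factorial_functional lam J g (\<eta> \<omega>)"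
proof -
  let ?A = "\<lambda>I. {t \<in> J \<rightarrow>\<^sub>E I. inj_on t J}"
  let ?f = "\<lambda>t. \<Prod>j\<in>J. g j (X (t j) \<omega>)"
  have m: "(\<lambda>t. \<lambda>j\<in>J. X (t j) \<omega>) \<in> measurable (count_space (?A (pts \<omega>))) (PiM J (\<lambda>_. lam))"
    using X_space[OF w] by (auto simp: space_PiM PiE_iff)
  have "(\<lambda>y. g j (y j)) \<in> borel_measurable (PiM J (\<lambda>_. lam))" if "j \<in> J" for j
    by (rule measurable_compose[OF measurable_component_singleton[OF that] supported_inD(1)[OF g[OF that]]])
  then have gm: "(\<lambda>y. \<Prod>j\<in>J. g j (y j)) \<in> borel_measurable (PiM J (\<lambda>_. lam))"
    by (rule borel_measurable_prod)
  have "(\<integral>y. (\<Prod>j\<in>J. g j (y j)) \<partial>factorial_measure lam (pts \<omega>) (\<lambda>i. X i \<omega>) J) = (\<integral>t. ?f t \<partial>count_space (?A (pts \<omega>)))"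
    unfolding factorial_measure_def by (subst integral_distr[OF m gm]) simp
  also have "\<dots> = (\<Sum>t | t \<in> ?A (pts \<omega>) \<and> ?f t \<noteq> 0. ?f t)"
  proof (rule lebesgue_integral_count_space_finite_support)
    have "{t \<in> ?A (pts \<omega>). ?f t \<noteq> 0} \<subseteq> ?A (pts_in B \<omega>)"
    proof
      fix t assume t: "t \<in> {t \<in> ?A (pts \<omega>). ?f t \<noteq> 0}"
      have "t j \<in> pts_in B \<omega>" if j: "j \<in> J" for j
      proof -
        have "g j (X (t j) \<omega>) \<noteq> 0" using t j J by auto
        then have "X (t j) \<omega> \<in> B" using supported_inD(3)[OF g[OF j] X_space[OF w]] by blast
        then show ?thesis using t j by (auto simp: pts_in_def)
      qed
      then show "t \<in> ?A (pts_in B \<omega>)" using t by (auto simp: PiE_iff)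
    qed
    then show "finite {t \<in> ?A (pts \<omega>). ?f t \<noteq> 0}"
      using finite_inj_tuples[OF fin J] by (rule finite_subset)
  qed
  also have "\<dots> = (\<Sum>t\<in>?A (pts_in B \<omega>). ?f t)"
  proof (rule sum.mono_neutral_left[OF finite_inj_tuples[OF fin J]])
    show "{t \<in> ?A (pts \<omega>). ?f t \<noteq> 0} \<subseteq> ?A (pts_in B \<omega>)"
    proof
      fix t assume t: "t \<in> {t \<in> ?A (pts \<omega>). ?f t \<noteq> 0}"
      have "t j \<in> pts_in B \<omega>" if j: "j \<in> J" for j
      proof -
        have "g j (X (t j) \<omega>) \<noteq> 0" using t j J by auto
        then have "X (t j) \<omega> \<in> B" using supported_inD(3)[OF g[OF j] X_space[OF w]] by blast
        then show ?thesis using t j by (auto simp: pts_in_def)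
      qed
      then show "t \<in> ?A (pts_in B \<omega>)" using t by (auto simp: PiE_iff)
    qed
    have "?A (pts_in B \<omega>) \<subseteq> ?A (pts \<omega>)" by (auto simp: pts_in_def PiE_iff)
    then show "\<forall>t\<in>?A (pts_in B \<omega>) - {t \<in> ?A (pts \<omega>). ?f t \<noteq> 0}. ?f t = 0" by blast
  qed
  also have "\<dots> = factorial_functional lam J g (\<eta> \<omega>)"
    by (subst factorial_functional_eta[OF w fin J, of c]) (use g in \<open>auto simp: tuple_sum_def\<close>)
  finally show ?thesis .
qed

lemma wiener_ito_prod_AE:
  assumes g: "\<And>i. i < n \<Longrightarrow> admissible_factor lam (g i)"
  shows "AE \<omega> in P. wiener_ito_prod lam \<eta> X n g \<omega> = wick_functional lam {..<n} g (\<eta> \<omega>)"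
proof -
  obtain B c where B: "B \<in> sets lam" "emeasure lam B < \<infinity>" "0 \<le> c" and s: "\<forall>i\<in>{..<n}. supported_in lam B c (g i)"
    using common_support[of "{..<n}" lam g] g by auto
  show ?thesis
    using AE_finite_pts_in[OF B(1,2)] AE_space
  proof eventually_elim
    fix \<omega> assume fin: "finite (pts_in B \<omega>)" and w: "\<omega> \<in> space P"
    show "wiener_ito_prod lam \<eta> X n g \<omega> = wick_functional lam {..<n} g (\<eta> \<omega>)"
      unfolding wiener_ito_prod_def wick_functional_def
    proof (intro sum.cong refl arg_cong2[where f="(*)"])
      fix J assume J: "J \<in> Pow {..<n}"
      show "(- 1) ^ (n - card J) = (- 1 :: real) ^ (card {..<n} - card J)" by simp
      show "(\<integral>y. (\<Prod>j\<in>J. g j (y j)) \<partial>factorial_measure lam (pts \<omega>) (\<lambda>i. X i \<omega>) J) = factorial_functional lam J g (\<eta> \<omega>)"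
        by (rule integral_factorial_measure[OF w fin]) (use J s in \<open>auto intro: finite_subset\<close>)
      show "(\<integral>y. (\<Prod>j\<in>{..<n} - J. g j (y j)) \<partial>PiM ({..<n} - J) (\<lambda>_. lam)) = (\<Prod>j\<in>{..<n} - J. \<integral>y. g j y \<partial>lam)"
        using s B by (intro pow.product_integral_prod supported_in_integrable[of lam B c]) auto
    qed
  qed
qed

text \<open>Convergence in L2 requires honest measurability, and almost sure agreement with a
  measurable functional does not give it, since \<open>P\<close> need not be complete. The integral
  is therefore rewritten over the fixed countable set of all index tuples, with the random
  constraint moved into an indicator.\<close>

lemma measurable_wiener_ito_prod:
  assumes g: "\<And>i. i < n \<Longrightarrow> g i \<in> borel_measurable lam"
  shows "wiener_ito_prod lam \<eta> X n g \<in> borel_measurable P"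
  unfolding wiener_ito_prod_def[abs_def]
proof (intro borel_measurable_sum borel_measurable_times borel_measurable_const)
  fix J assume J: "J \<in> Pow {..<n}"
  then have fJ: "finite J" by (auto intro: finite_subset)
  let ?T = "J \<rightarrow>\<^sub>E (UNIV :: nat set)"
  let ?A = "\<lambda>\<omega>. {t \<in> J \<rightarrow>\<^sub>E pts \<omega>. inj_on t J}"
  let ?f = "\<lambda>\<omega> t. \<Prod>j\<in>J. g j (X (t j) \<omega>)"
  have cT: "countable ?T" using fJ by (intro countable_PiE) auto
  interpret T: sigma_finite_measure "count_space ?T"
    using cT by (rule sigma_finite_measure_count_space_countable)
  have gm: "g j \<in> borel_measurable lam" if "j \<in> J" for j using g that J by auto
  have eq: "(\<integral>y. (\<Prod>j\<in>J. g j (y j)) \<partial>factorial_measure lam (pts \<omega>) (\<lambda>i. X i \<omega>) J)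
     = (\<integral>t. indicator (?A \<omega>) t * ?f \<omega> t \<partial>count_space ?T)" if w: "\<omega> \<in> space P" for \<omega>
  proof -
    have m: "(\<lambda>t. \<lambda>j\<in>J. X (t j) \<omega>) \<in> measurable (count_space (?A \<omega>)) (PiM J (\<lambda>_. lam))"
      using X_space[OF w] by (auto simp: space_PiM PiE_iff)
    have "(\<lambda>y. g j (y j)) \<in> borel_measurable (PiM J (\<lambda>_. lam))" if "j \<in> J" for j
      by (rule measurable_compose[OF measurable_component_singleton[OF that] gm[OF that]])
    then have gm': "(\<lambda>y. \<Prod>j\<in>J. g j (y j)) \<in> borel_measurable (PiM J (\<lambda>_. lam))"
      by (rule borel_measurable_prod)
    have "(\<integral>y. (\<Prod>j\<in>J. g j (y j)) \<partial>factorial_measure lam (pts \<omega>) (\<lambda>i. X i \<omega>) J) = (\<integral>t. ?f \<omega> t \<partial>count_space (?A \<omega>))"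
      unfolding factorial_measure_def by (subst integral_distr[OF m gm']) simp
    also have "count_space (?A \<omega>) = restrict_space (count_space ?T) (?A \<omega>)"
    proof -
      have "?A \<omega> \<inter> ?T = ?A \<omega>" by (auto simp: PiE_iff extensional_def)
      then show ?thesis by (simp only: restrict_count_space)
    qed
    also have "(\<integral>t. ?f \<omega> t \<partial>restrict_space (count_space ?T) (?A \<omega>)) = (\<integral>t. indicator (?A \<omega>) t *\<^sub>R ?f \<omega> t \<partial>count_space ?T)"
      by (rule integral_restrict_space) simp
    finally show ?thesis by simp
  qed
  have "(\<lambda>p. indicator (?A (fst p)) (snd p) * ?f (fst p) (snd p)) \<in> borel_measurable (P \<Otimes>\<^sub>M count_space ?T)"
  proof (rule measurable_compose_countable'[where f="\<lambda>t p. indicator (?A (fst p)) t * ?f (fst p) t" and g=snd and I="?T"])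
    fix t assume t: "t \<in> ?T"
    have 1: "Measurable.pred P (\<lambda>\<omega>. \<forall>j\<in>J. t j \<in> pts \<omega>)" using fJ by measurable
    have "(\<lambda>\<omega>. if (\<forall>j\<in>J. t j \<in> pts \<omega>) \<and> inj_on t J then 1 else 0 :: real) \<in> borel_measurable P"
      using 1 by measurable
    moreover have "(if (\<forall>j\<in>J. t j \<in> pts \<omega>) \<and> inj_on t J then 1 else 0 :: real) = indicator (?A \<omega>) t" for \<omega>
      using t by (auto simp: indicator_def PiE_iff)
    ultimately have "(\<lambda>\<omega>. indicator (?A \<omega>) t :: real) \<in> borel_measurable P" by simp
    moreover have "(\<lambda>\<omega>. ?f \<omega> t) \<in> borel_measurable P"
      by (intro borel_measurable_prod measurable_compose[OF measurable_X gm])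
    ultimately have "(\<lambda>\<omega>. indicator (?A \<omega>) t * ?f \<omega> t) \<in> borel_measurable P" by (rule borel_measurable_times)
    from measurable_compose[OF measurable_fst this]
    show "(\<lambda>p. indicator (?A (fst p)) t * ?f (fst p) t) \<in> borel_measurable (P \<Otimes>\<^sub>M count_space ?T)" .
  qed (use cT in auto)
  then have "(\<lambda>\<omega>. \<integral>t. indicator (?A \<omega>) t * ?f \<omega> t \<partial>count_space ?T) \<in> borel_measurable P"
    by (intro T.borel_measurable_lebesgue_integral) (simp add: case_prod_unfold)
  then show "(\<lambda>\<omega>. \<integral>y. (\<Prod>j\<in>J. g j (y j)) \<partial>factorial_measure lam (pts \<omega>) (\<lambda>i. X i \<omega>) J) \<in> borel_measurable P"
    by (simp add: eq cong: measurable_cong)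
qed

lemma wiener_ito_sum_product_AE:
  assumes "admissible_tuples lam n gs"
  shows "AE \<omega> in P. wiener_ito_sum_product lam \<eta> X n gs \<omega> = wick_list lam n gs (\<eta> \<omega>)"
proof -
  have "AE \<omega> in P. \<forall>g\<in>set gs. wiener_ito_prod lam \<eta> X n g \<omega> = wick_functional lam {..<n} g (\<eta> \<omega>)"
    using assms by (intro AE_finite_allI wiener_ito_prod_AE) (auto simp: admissible_tuples_def)
  then show ?thesis
    by eventually_elim (auto simp: wiener_ito_sum_product_def wick_list_def intro!: arg_cong[where f=sum_list] map_cong)
qed

lemma measurable_wiener_ito_sum_product:
  assumes "admissible_tuples lam n gs"
  shows "wiener_ito_sum_product lam \<eta> X n gs \<in> borel_measurable P"
  unfolding wiener_ito_sum_product_def[abs_def] sum_list_nth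
  by (intro borel_measurable_sum measurable_wiener_ito_prod admissible_tuples_measurable[OF assms]) auto

lemma wiener_ito_sum_product_bound:
  assumes gs: "admissible_tuples lam n gs" and hs: "admissible_tuples lam n hs"
  shows "sqn P (\<lambda>\<omega>. wiener_ito_sum_product lam \<eta> X n gs \<omega> - wiener_ito_sum_product lam \<eta> X n hs \<omega>)
    \<le> ennreal (fact n) * sqn (pow_measure lam n) (\<lambda>z. sum_product n gs z - sum_product n hs z)"
proof -
  have "sqn P (\<lambda>\<omega>. wiener_ito_sum_product lam \<eta> X n gs \<omega> - wiener_ito_sum_product lam \<eta> X n hs \<omega>)
     = sqn P (\<lambda>\<omega>. wick_list lam n gs (\<eta> \<omega>) - wick_list lam n hs (\<eta> \<omega>))"
    by (rule sqn_cong_AE, use wiener_ito_sum_product_AE[OF gs] wiener_ito_sum_product_AE[OF hs] in eventually_elim) simp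
  also have "\<dots> = sqn Q (\<lambda>\<mu>. wick_list lam n gs \<mu> - wick_list lam n hs \<mu>)"
    using gs hs by (intro sqn_P) measurable
  also note wick_list_bound[OF gs hs]
  finally show ?thesis .
qed

text \<open>Two approximating sequences of the same kernel differ by sum-product forms tending to 0,
  and the norm bound carries this over to their integrals.\<close>

lemma is_wiener_ito_unique:
  assumes F: "is_wiener_ito P lam \<eta> X n g F" and F': "is_wiener_ito P lam \<eta> X n g F'"
  shows "AE \<omega> in P. F \<omega> = F' \<omega>"
proof -
  obtain gs where gs: "\<And>k. admissible_tuples lam n (gs k)"
      "L2_tendsto (pow_measure lam n) (\<lambda>k. sum_product n (gs k)) g"
      "L2_tendsto P (\<lambda>k. wiener_ito_sum_product lam \<eta> X n (gs k)) F"
    using F unfolding is_wiener_ito_def admissible_tuples_def by blast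
  obtain hs where hs: "\<And>k. admissible_tuples lam n (hs k)"
      "L2_tendsto (pow_measure lam n) (\<lambda>k. sum_product n (hs k)) g"
      "L2_tendsto P (\<lambda>k. wiener_ito_sum_product lam \<eta> X n (hs k)) F'"
    using F' unfolding is_wiener_ito_def admissible_tuples_def by blast
  let ?D = "\<lambda>k \<omega>. wiener_ito_sum_product lam \<eta> X n (gs k) \<omega> - wiener_ito_sum_product lam \<eta> X n (hs k) \<omega>"
  have 1: "L2_tendsto P ?D (\<lambda>\<omega>. F \<omega> - F' \<omega>)" by (rule L2_tendsto_diff[OF gs(3) hs(3)])
  have 2: "L2_tendsto (pow_measure lam n) (\<lambda>k z. sum_product n (gs k) z - sum_product n (hs k) z) (\<lambda>z. g z - g z)"
    by (rule L2_tendsto_diff[OF gs(2) hs(2)])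
  have "L2_tendsto P ?D (\<lambda>_. 0)"
    unfolding L2_tendsto_iff
  proof (intro conjI allI L2_zero)
    show "?D k \<in> L2 P" for k using 1 by (simp add: L2_tendsto_iff)
    show "(\<lambda>k. sqn P (\<lambda>\<omega>. ?D k \<omega> - 0)) \<longlonglongrightarrow> 0"
    proof (rule ennreal_tendsto_0_bound)
      show "(\<lambda>k. sqn (pow_measure lam n) (\<lambda>z. sum_product n (gs k) z - sum_product n (hs k) z)) \<longlonglongrightarrow> 0"
        using 2 by (simp add: L2_tendsto_iff)
      show "ennreal (fact n) < \<infinity>" by simp
      show "sqn P (\<lambda>\<omega>. ?D k \<omega> - 0) \<le> ennreal (fact n) * sqn (pow_measure lam n) (\<lambda>z. sum_product n (gs k) z - sum_product n (hs k) z)" for k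
        using wiener_ito_sum_product_bound[OF gs(1)[of k] hs(1)[of k]] by simp
    qed
  qed
  from L2_tendsto_unique[OF 1 this] show ?thesis by eventually_elim simp
qed

text \<open>A jointly measurable version of the sections I_n(g_y), obtained at once as a limit in L2
  of the product space instead of choosing a version for each y separately.\<close>

definition is_slice_limit :: "nat \<Rightarrow> ((nat \<Rightarrow> 'a) \<Rightarrow> real) \<Rightarrow> ('a measure \<times> 'a \<Rightarrow> real) \<Rightarrow> bool" where
  "is_slice_limit n g G \<longleftrightarrow> (\<exists>gs. (\<forall>k. admissible_tuples lam (Suc n) (gs k)) \<and>
     L2_tendsto (pow_measure lam (Suc n)) (\<lambda>k. sum_product (Suc n) (gs k)) g \<and>
     L2_tendsto QL (\<lambda>k. wick_slice lam n (gs k)) G)"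

lemma L2_tendsto_Cauchy:
  assumes h: "L2_tendsto M h l" and e: "0 < (e :: real)"
  shows "\<exists>K. \<forall>m\<ge>K. \<forall>n\<ge>K. sqn M (\<lambda>x. h m x - h n x) \<le> ennreal e"
proof -
  have [measurable]: "h k \<in> borel_measurable M" "l \<in> borel_measurable M" for k
    using h by (auto simp: L2_tendsto_def L2_def)
  have "eventually (\<lambda>k. sqn M (\<lambda>x. h k x - l x) < ennreal (e / 4)) sequentially"
    using h e by (intro order_tendstoD) (auto simp: L2_tendsto_iff)
  then obtain K where K: "sqn M (\<lambda>x. h k x - l x) \<le> ennreal (e / 4)" if "k \<ge> K" for k
    by (auto simp: eventually_sequentially intro: less_imp_le)
  have "sqn M (\<lambda>x. h m x - h n x) \<le> ennreal e" if "m \<ge> K" "n \<ge> K" for m n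
  proof -
    have "sqn M (\<lambda>x. h m x - h n x) \<le> 2 * sqn M (\<lambda>x. h m x - l x) + 2 * sqn M (\<lambda>x. l x - h n x)"
      by (rule sqn_diff_le) measurable
    also have "\<dots> \<le> 2 * ennreal (e / 4) + 2 * ennreal (e / 4)"
      unfolding sqn_minus_commute[of M l] using K that by (intro add_mono mult_left_mono) auto
    also have "\<dots> = ennreal e"
      using e by (simp add: ennreal_mult'[symmetric] ennreal_plus[symmetric] flip: ennreal_numeral del: ennreal_plus)
    finally show ?thesis .
  qed
  then show ?thesis by blast
qed

text \<open>Density supplies sum-product approximations of \<open>g\<close>,
  \<open>wick_slice_list_bound\<close> makes their slices Cauchy, and completeness yields the
  limit.\<close>

lemma slice_limit_exists:
  assumes g: "g \<in> L2 (pow_measure lam (Suc n))"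
  shows "\<exists>G. is_slice_limit n g G"
proof -
  obtain gs where gs: "\<And>k. admissible_tuples lam (Suc n) (gs k)"
      "L2_tendsto (pow_measure lam (Suc n)) (\<lambda>k. sum_product (Suc n) (gs k)) g"
    using lam.sum_product_dense[OF _ g] by auto
  have "\<exists>G. L2_tendsto QL (\<lambda>k. wick_slice lam n (gs k)) G"
  proof (rule L2_complete)
    show "wick_slice lam n (gs k) \<in> L2 QL" for k by (rule wick_slice_L2[OF gs(1)])
    fix e :: real assume "0 < e"
    then have "0 < e / fact n" by simp
    from L2_tendsto_Cauchy[OF gs(2) this] obtain K where
      K: "\<forall>m\<ge>K. \<forall>l\<ge>K. sqn (pow_measure lam (Suc n)) (\<lambda>z. sum_product (Suc n) (gs m) z - sum_product (Suc n) (gs l) z) \<le> ennreal (e / fact n)"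
      by blast
    have "sqn QL (\<lambda>p. wick_slice lam n (gs m) p - wick_slice lam n (gs l) p) \<le> ennreal e" if "m \<ge> K" "l \<ge> K" for m l
    proof -
      have "sqn QL (\<lambda>p. wick_slice lam n (gs m) p - wick_slice lam n (gs l) p)
        \<le> ennreal (fact n) * sqn (pow_measure lam (Suc n)) (\<lambda>z. sum_product (Suc n) (gs m) z - sum_product (Suc n) (gs l) z)"
        by (rule wick_slice_list_bound[OF gs(1) gs(1)])
      also have "\<dots> \<le> ennreal (fact n) * ennreal (e / fact n)" using K that by (intro mult_left_mono) auto
      also have "\<dots> = ennreal e" by (simp add: ennreal_mult'[symmetric])
      finally show ?thesis .
    qed
    then show "\<exists>K. \<forall>m\<ge>K. \<forall>l\<ge>K. sqn QL (\<lambda>p. wick_slice lam n (gs m) p - wick_slice lam n (gs l) p) \<le> ennreal e"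
      by blast
  qed
  then show ?thesis unfolding is_slice_limit_def using gs by blast
qed

end

section \<open>The series of slices\<close>

lemma AE_subseq_tendsto_0:
  fixes a :: "nat \<Rightarrow> 'a \<Rightarrow> ennreal"
  assumes m: "\<And>k. a k \<in> borel_measurable M" and lim: "(\<lambda>k. \<integral>\<^sup>+x. a k x \<partial>M) \<longlonglongrightarrow> 0"
  shows "\<exists>r. strict_mono r \<and> (AE x in M. (\<lambda>k. a (r k) x) \<longlonglongrightarrow> 0)"
proof -
  have "\<exists>K. \<forall>n\<ge>K. (\<integral>\<^sup>+x. a n x \<partial>M) \<le> ennreal ((1 / 2) ^ k)" for k :: nat
  proof -
    have "eventually (\<lambda>n. (\<integral>\<^sup>+x. a n x \<partial>M) < ennreal ((1 / 2) ^ k)) sequentially"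
      using lim by (intro order_tendstoD) auto
    then show ?thesis by (auto simp: eventually_sequentially intro: less_imp_le)
  qed
  then obtain K where K: "\<And>k n. n \<ge> K k \<Longrightarrow> (\<integral>\<^sup>+x. a n x \<partial>M) \<le> ennreal ((1 / 2) ^ k)" by metis
  define r where "r k = (\<Sum>i\<le>k. K i + 1)" for k
  have mono: "strict_mono r" by (rule strict_monoI_Suc) (simp add: r_def)
  have rK: "K k \<le> r k" for k
    unfolding r_def using member_le_sum[of k "{..k}" "\<lambda>i. K i + 1"] by simp
  have "(\<integral>\<^sup>+x. (\<Sum>k. a (r k) x) \<partial>M) = (\<Sum>k. \<integral>\<^sup>+x. a (r k) x \<partial>M)"
    using m by (intro nn_integral_suminf)
  also have "\<dots> \<le> (\<Sum>k. ennreal ((1 / 2) ^ k))" by (intro suminf_le K rK) auto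
  also have "\<dots> < \<infinity>" by (subst suminf_ennreal2) auto
  finally have "(\<integral>\<^sup>+x. (\<Sum>k. a (r k) x) \<partial>M) \<noteq> \<infinity>" by simp
  then have "AE x in M. (\<Sum>k. a (r k) x) \<noteq> \<infinity>"
    using m by (intro nn_integral_PInf_AE) auto
  then have "AE x in M. (\<lambda>k. a (r k) x) \<longlonglongrightarrow> 0"
  proof eventually_elim
    fix x assume fin: "(\<Sum>k. a (r k) x) \<noteq> \<infinity>"
    have "a (r k) x \<noteq> \<infinity>" for k
    proof
      assume "a (r k) x = \<infinity>"
      moreover have "(\<Sum>i\<in>{k}. a (r i) x) \<le> (\<Sum>i. a (r i) x)" by (intro sum_le_suminf) auto
      ultimately show False using fin by (simp add: top_unique)
    qed
    then have e: "ennreal (enn2real (a (r k) x)) = a (r k) x" for k by (simp add: less_top)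
    have "(\<Sum>k. ennreal (enn2real (a (r k) x))) \<noteq> \<infinity>" using fin by (simp add: e)
    then have "summable (\<lambda>k. enn2real (a (r k) x))" by (intro summable_suminf_not_top) auto
    then have "(\<lambda>k. ennreal (enn2real (a (r k) x))) \<longlonglongrightarrow> ennreal 0"
      by (intro tendsto_ennrealI summable_LIMSEQ_zero)
    then show "(\<lambda>k. a (r k) x) \<longlonglongrightarrow> 0" by (simp add: e)
  qed
  then show ?thesis using mono by blast
qed

lemma sqn_add_orthogonal:
  assumes f: "f \<in> L2 M" and g: "g \<in> L2 M" and fg: "(\<integral>x. f x * g x \<partial>M) = 0"
  shows "sqn M (\<lambda>x. f x + g x) = sqn M f + sqn M g"
proof -
  have i: "sqn M h = ennreal (\<integral>x. (h x)\<^sup>2 \<partial>M)" if "h \<in> L2 M" for h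
    unfolding sqn_def using that by (intro nn_integral_eq_integral) (auto simp: L2_def)
  have sq: "integrable M (\<lambda>x. (f x)\<^sup>2)" "integrable M (\<lambda>x. (g x)\<^sup>2)" using f g by (auto simp: L2_def)
  have "(\<integral>x. (f x + g x)\<^sup>2 \<partial>M) = (\<integral>x. (f x)\<^sup>2 + (g x)\<^sup>2 + 2 * (f x * g x) \<partial>M)"
    by (simp add: power2_sum mult.assoc)
  also have "\<dots> = (\<integral>x. (f x)\<^sup>2 \<partial>M) + (\<integral>x. (g x)\<^sup>2 \<partial>M)"
    using sq L2_mult_integrable[OF f g] fg by simp
  finally show ?thesis
    using i[OF L2_add[OF f g]] i[OF f] i[OF g] by (simp add: ennreal_plus)
qed

lemma sqn_sum_orthogonal:
  assumes "finite A" "\<And>n. n \<in> A \<Longrightarrow> h n \<in> L2 M"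
    and "\<And>m n. m \<in> A \<Longrightarrow> n \<in> A \<Longrightarrow> m \<noteq> n \<Longrightarrow> (\<integral>x. h m x * h n x \<partial>M) = 0"
  shows "sqn M (\<lambda>x. \<Sum>n\<in>A. h n x) = (\<Sum>n\<in>A. sqn M (h n))"
  using assms
proof (induction A rule: finite_induct)
  case empty
  then show ?case by (simp add: sqn_def)
next
  case (insert n A)
  have "(\<integral>x. h n x * (\<Sum>m\<in>A. h m x) \<partial>M) = (\<Sum>m\<in>A. \<integral>x. h n x * h m x \<partial>M)"
    unfolding sum_distrib_left using insert.prems by (intro Bochner_Integration.integral_sum L2_mult_integrable) auto
  also have "\<dots> = 0" using insert by (intro sum.neutral) auto
  finally have "sqn M (\<lambda>x. h n x + (\<Sum>m\<in>A. h m x)) = sqn M (h n) + sqn M (\<lambda>x. \<Sum>m\<in>A. h m x)"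
    using insert.prems by (intro sqn_add_orthogonal L2_sum) auto
  then show ?case using insert by simp
qed

section \<open>Sections in the added variable and the derivative series\<close>

context poisson_points
begin

lemma sqn_pow_Suc:
  assumes "h \<in> borel_measurable (pow_measure lam (Suc n))"
  shows "sqn (pow_measure lam (Suc n)) h = (\<integral>\<^sup>+y. sqn (pow_measure lam n) (\<lambda>z. h (z(n := y))) \<partial>lam)"
  unfolding sqn_def lessThan_Suc using assms
  by (intro pow.product_nn_integral_insert_rev) (auto simp: lessThan_Suc)

lemma sqn_PL_sections:
  assumes "h \<in> borel_measurable (P \<Otimes>\<^sub>M lam)"
  shows "sqn (P \<Otimes>\<^sub>M lam) h = (\<integral>\<^sup>+y. sqn P (\<lambda>\<omega>. h (\<omega>, y)) \<partial>lam)"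
  unfolding sqn_def using assms by (subst PL.nn_integral_snd[symmetric]) auto

lemma measurable_sqn_sections:
  assumes "h \<in> borel_measurable (P \<Otimes>\<^sub>M lam)"
  shows "(\<lambda>y. sqn P (\<lambda>\<omega>. h (\<omega>, y))) \<in> borel_measurable lam"
proof -
  have "(\<lambda>p. ennreal ((h (snd p, fst p))\<^sup>2)) \<in> borel_measurable (lam \<Otimes>\<^sub>M P)"
    using measurable_compose[OF _ assms, of "\<lambda>p. (snd p, fst p)"] by measurable
  then show ?thesis unfolding sqn_def by (intro borel_measurable_nn_integral) (simp add: case_prod_unfold)
qed

lemma measurable_upd_pair:
  "(\<lambda>p. (snd p)(n := fst p)) \<in> measurable (lam \<Otimes>\<^sub>M pow_measure lam n) (pow_measure lam (Suc n))"
  unfolding lessThan_Suc by (intro measurable_fun_upd[where J="{..<n}"]) auto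

lemma measurable_upd_const:
  assumes "y \<in> space lam"
  shows "(\<lambda>z. z(n := y)) \<in> measurable (pow_measure lam n) (pow_measure lam (Suc n))"
proof -
  have "(\<lambda>z. (y, z)) \<in> measurable (pow_measure lam n) (lam \<Otimes>\<^sub>M pow_measure lam n)"
    using assms by (rule measurable_Pair1')
  from measurable_compose[OF this measurable_upd_pair] show ?thesis by simp
qed

lemma measurable_sqn_pow_sections:
  assumes "h \<in> borel_measurable (pow_measure lam (Suc n))"
  shows "(\<lambda>y. sqn (pow_measure lam n) (\<lambda>z. h (z(n := y)))) \<in> borel_measurable lam"
proof -
  interpret PN: sigma_finite_measure "pow_measure lam n" by (rule pow.sigma_finite) simp
  have "(\<lambda>p. ennreal ((h ((snd p)(n := fst p)))\<^sup>2)) \<in> borel_measurable (lam \<Otimes>\<^sub>M pow_measure lam n)"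
    using measurable_compose[OF measurable_upd_pair assms] by measurable
  then show ?thesis unfolding sqn_def by (intro PN.borel_measurable_nn_integral) (simp add: case_prod_unfold)
qed

lemma wiener_ito_sum_product_L2:
  assumes "admissible_tuples lam n gs"
  shows "wiener_ito_sum_product lam \<eta> X n gs \<in> L2 P"
proof -
  have "sqn P (wiener_ito_sum_product lam \<eta> X n gs) = sqn P (\<lambda>\<omega>. wick_list lam n gs (\<eta> \<omega>))"
    using wiener_ito_sum_product_AE[OF assms] by (rule sqn_cong_AE)
  also have "\<dots> = sqn Q (wick_list lam n gs)" by (rule sqn_P[OF measurable_wick_list[OF assms]])
  also have "\<dots> < \<infinity>" using wick_list_L2[OF assms] by (simp add: L2_iff)
  finally show ?thesis using measurable_wiener_ito_sum_product[OF assms] by (simp add: L2_iff)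
qed

text \<open>Fixing the last variable turns the last factor of each tuple into a number, which is
  absorbed into the first factor. The section is thus again of sum-product form, and its integral is
  the slice.\<close>

lemma wick_slice_scaled:
  assumes n: "0 < n" and gs: "admissible_tuples lam (Suc n) gs"
  defines "gs' y \<equiv> map (\<lambda>h. scale_first (h n y) h) gs"
  shows "admissible_tuples lam n (gs' y)"
    and "sum_product n (gs' y) z = sum_product (Suc n) gs (z(n := y))"
    and "AE \<omega> in P. wiener_ito_sum_product lam \<eta> X n (gs' y) \<omega> = wick_slice lam n gs (\<eta> \<omega>, y)"
proof -
  have gn: "\<forall>i<n. admissible_factor lam (g i)" if "g \<in> set gs" for g
    using gs that by (auto simp: admissible_tuples_def)
  show "admissible_tuples lam n (gs' y)"
    unfolding gs'_def admissible_tuples_def using admissible_scale_first[OF gn] by auto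
  have "(\<Prod>i<n. scale_first (h n y) h i (z i)) = (\<Prod>i<Suc n. h i ((z(n := y)) i))" for h :: "nat \<Rightarrow> 'a \<Rightarrow> real"
    by (simp add: prod_scale_first[OF n])
  then show "sum_product n (gs' y) z = sum_product (Suc n) gs (z(n := y))"
    unfolding sum_product_def gs'_def by (simp add: comp_def del: prod.lessThan_Suc)
  have "AE \<omega> in P. \<forall>g\<in>set gs. wiener_ito_prod lam \<eta> X n g \<omega> = wick_functional lam {..<n} g (\<eta> \<omega>)"
    using gn by (intro AE_finite_allI wiener_ito_prod_AE) auto
  then show "AE \<omega> in P. wiener_ito_sum_product lam \<eta> X n (gs' y) \<omega> = wick_slice lam n gs (\<eta> \<omega>, y)"
  proof eventually_elim
    fix \<omega> assume e: "\<forall>g\<in>set gs. wiener_ito_prod lam \<eta> X n g \<omega> = wick_functional lam {..<n} g (\<eta> \<omega>)"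
    have "map (\<lambda>g. g n y * wiener_ito_prod lam \<eta> X n g \<omega>) gs = map (\<lambda>g. g n y * wick_functional lam {..<n} g (\<eta> \<omega>)) gs"
      using e by (intro map_cong) auto
    then show "wiener_ito_sum_product lam \<eta> X n (gs' y) \<omega> = wick_slice lam n gs (\<eta> \<omega>, y)"
      unfolding wiener_ito_sum_product_def wick_slice_def gs'_def by (simp only: map_map comp_def wiener_ito_prod_scale[OF n] fst_conv snd_conv)
  qed
qed

lemma is_wiener_ito_AE:
  assumes n: "0 < n" and F: "is_wiener_ito P lam \<eta> X n g F"
  shows "AE \<omega> in P. F \<omega> = wiener_ito P lam \<eta> X n g \<omega>"
proof -
  have "is_wiener_ito P lam \<eta> X n g (wiener_ito P lam \<eta> X n g)"
    unfolding wiener_ito_def using n someI[of "is_wiener_ito P lam \<eta> X n g", OF F] by simp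
  then show ?thesis by (rule is_wiener_ito_unique[OF F])
qed

text \<open>Convergence in L2 of a product space gives, along a subsequence, convergence of almost
  every section in L2. For such y the sections of the approximating forms witness that the section
  of \<open>G\<close> is a version of I_n(g_y).\<close>

lemma slice_limit_wiener_ito:
  assumes g: "g \<in> L2 (pow_measure lam (Suc n))" and lim: "is_slice_limit n g G"
  shows "AE y in lam. AE \<omega> in P. G (\<eta> \<omega>, y) =
    (if slice n g y \<in> L2 (pow_measure lam n) then wiener_ito P lam \<eta> X n (slice n g y) \<omega> else 0)"
proof -
  obtain gs where gs: "\<And>k. admissible_tuples lam (Suc n) (gs k)"
      "L2_tendsto (pow_measure lam (Suc n)) (\<lambda>k. sum_product (Suc n) (gs k)) g"
      "L2_tendsto QL (\<lambda>k. wick_slice lam n (gs k)) G"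
    using lim unfolding is_slice_limit_def by blast
  have GL2: "G \<in> L2 QL" using gs(3) by (simp add: L2_tendsto_iff)
  then have Gm: "G \<in> borel_measurable (N \<Otimes>\<^sub>M lam)" by (simp add: L2_iff measurable_QL)
  note gm = L2_measurable[OF g]
  let ?u = "\<lambda>k p. wick_slice lam n (gs k) (\<eta> (fst p), snd p) - G (\<eta> (fst p), snd p)"
  let ?v = "\<lambda>k z. sum_product (Suc n) (gs k) z - g z"
  \<comment> \<open>The errors of the integrals and of the kernels are added, so that one
    subsequence serves both kinds of sections.\<close>
  let ?a = "\<lambda>k y. sqn P (\<lambda>\<omega>. ?u k (\<omega>, y)) + sqn (pow_measure lam n) (\<lambda>z. ?v k (z(n := y)))"
  have Gm': "(\<lambda>p. G (\<eta> (fst p), snd p)) \<in> borel_measurable (P \<Otimes>\<^sub>M lam)"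
    by (rule measurable_compose[OF measurable_eta_pair Gm])
  have um: "?u k \<in> borel_measurable (P \<Otimes>\<^sub>M lam)" for k
    by (intro borel_measurable_diff Gm' measurable_compose[OF measurable_eta_pair measurable_wick_slice[OF gs(1)]])
  have vm: "?v k \<in> borel_measurable (pow_measure lam (Suc n))" for k
    by (intro borel_measurable_diff gm measurable_sum_product gs(1))
  have ia: "(\<integral>\<^sup>+y. ?a k y \<partial>lam) = sqn (P \<Otimes>\<^sub>M lam) (?u k) + sqn (pow_measure lam (Suc n)) (?v k)" for k
    unfolding sqn_PL_sections[OF um] sqn_pow_Suc[OF vm]
    by (intro nn_integral_add measurable_sqn_sections um measurable_sqn_pow_sections vm)
  have "(\<lambda>k. sqn (P \<Otimes>\<^sub>M lam) (?u k) + sqn (pow_measure lam (Suc n)) (?v k)) \<longlonglongrightarrow> 0 + 0"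
    using L2_tendsto_PL[OF gs(3)] gs(2) by (intro tendsto_add) (simp_all add: L2_tendsto_iff)
  then have "(\<lambda>k. \<integral>\<^sup>+y. ?a k y \<partial>lam) \<longlonglongrightarrow> 0" by (simp only: ia add_0)
  moreover have "?a k \<in> borel_measurable lam" for k
    by (intro borel_measurable_add measurable_sqn_sections um measurable_sqn_pow_sections vm)
  ultimately obtain r where r: "strict_mono r" "AE y in lam. (\<lambda>k. ?a (r k) y) \<longlonglongrightarrow> 0"
    using AE_subseq_tendsto_0[of ?a lam] by blast
  have "sqn (P \<Otimes>\<^sub>M lam) (\<lambda>p. G (\<eta> (fst p), snd p)) \<noteq> \<infinity>" using L2_PL[OF GL2] by (auto simp: L2_iff)
  then have fG: "AE y in lam. sqn P (\<lambda>\<omega>. G (\<eta> \<omega>, y)) \<noteq> \<infinity>"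
    unfolding sqn_PL_sections[OF Gm']
    using nn_integral_PInf_AE[OF measurable_sqn_sections[OF Gm']] by simp
  have "sqn (pow_measure lam (Suc n)) g \<noteq> \<infinity>" using g by (auto simp: L2_iff)
  then have fg: "AE y in lam. sqn (pow_measure lam n) (\<lambda>z. g (z(n := y))) \<noteq> \<infinity>"
    unfolding sqn_pow_Suc[OF gm] using nn_integral_PInf_AE[OF measurable_sqn_pow_sections[OF gm]] by simp
  show ?thesis
    using r(2) fG fg AE_space
  proof eventually_elim
    fix y assume a0: "(\<lambda>k. ?a (r k) y) \<longlonglongrightarrow> 0" and GP: "sqn P (\<lambda>\<omega>. G (\<eta> \<omega>, y)) \<noteq> \<infinity>"
      and gP: "sqn (pow_measure lam n) (\<lambda>z. g (z(n := y))) \<noteq> \<infinity>" and y: "y \<in> space lam"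
    have sl: "slice n g y = (\<lambda>z. g (z(n := y)))" by (simp add: slice_def fun_eq_iff)
    have slL2: "slice n g y \<in> L2 (pow_measure lam n)"
      unfolding sl L2_iff using gP measurable_compose[OF measurable_upd_const[OF y] gm] by (simp add: less_top)
    have sec: "(\<lambda>\<omega>. (\<eta> \<omega>, y)) \<in> measurable P (N \<Otimes>\<^sub>M lam)" using y by measurable
    have GL: "(\<lambda>\<omega>. G (\<eta> \<omega>, y)) \<in> L2 P"
      unfolding L2_iff using GP measurable_compose[OF sec Gm] by (simp add: less_top)
    have Um: "(\<lambda>\<omega>. wick_slice lam n (gs k) (\<eta> \<omega>, y)) \<in> borel_measurable P" for k
      by (rule measurable_compose[OF sec measurable_wick_slice[OF gs(1)]])
    have u0: "(\<lambda>k. sqn P (\<lambda>\<omega>. wick_slice lam n (gs (r k)) (\<eta> \<omega>, y) - G (\<eta> \<omega>, y))) \<longlonglongrightarrow> 0"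
      by (rule tendsto_sandwich[OF _ _ tendsto_const a0]) auto
    have v0: "(\<lambda>k. sqn (pow_measure lam n) (\<lambda>z. sum_product (Suc n) (gs (r k)) (z(n := y)) - g (z(n := y)))) \<longlonglongrightarrow> 0"
      by (rule tendsto_sandwich[OF _ _ tendsto_const a0]) auto
    have "AE \<omega> in P. G (\<eta> \<omega>, y) = wiener_ito P lam \<eta> X n (slice n g y) \<omega>"
    \<comment> \<open>Order 0 is separate: the integral is a constant by definition, and there is no
      first factor to absorb the last one. Both the slices and the kernels are then sequences of
      numbers with the same limit.\<close>
    proof (cases "n = 0")
      case True
      let ?z = "(\<lambda>_. undefined)(0 := y) :: nat \<Rightarrow> 'a"
      let ?c = "\<lambda>k. sum_product (Suc 0) (gs (r k)) ?z"
      have U: "AE \<omega> in P. wick_slice lam n (gs (r k)) (\<eta> \<omega>, y) = ?c k" for k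
      proof -
        have w: "AE \<omega> in P. wick_functional lam {} g (\<eta> \<omega>) = 1" for g :: "nat \<Rightarrow> 'a \<Rightarrow> real"
        proof -
          have [measurable]: "factorial_functional lam {} g \<in> borel_measurable N"
            by (rule measurable_factorial_functional) auto
          show ?thesis using wick_functional_empty_AE[of g] by (subst (asm) AE_Q_iff) auto
        qed
        have "AE \<omega> in P. \<forall>g\<in>set (gs (r k)). wick_functional lam {} g (\<eta> \<omega>) = 1"
          using w by (intro AE_finite_allI) auto
        then show ?thesis
        proof eventually_elim
          fix \<omega> assume e: "\<forall>g\<in>set (gs (r k)). wick_functional lam {} g (\<eta> \<omega>) = 1"
          have "map (\<lambda>g. g 0 y * wick_functional lam {} g (\<eta> \<omega>)) (gs (r k)) = map (\<lambda>g. g 0 y) (gs (r k))"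
            using e by (intro map_cong) auto
          moreover have "?c k = (\<Sum>g\<leftarrow>gs (r k). g 0 y)" by (simp add: sum_product_def)
          ultimately show "wick_slice lam n (gs (r k)) (\<eta> \<omega>, y) = ?c k"
            by (simp only: wick_slice_def True fst_conv snd_conv lessThan_0)
        qed
      qed
      have cL2: "(\<lambda>\<omega>. d) \<in> L2 P" for d :: real by (simp add: L2_def)
      have "L2_tendsto P (\<lambda>k \<omega>. ?c k) (\<lambda>\<omega>. G (\<eta> \<omega>, y))"
        unfolding L2_tendsto_iff
      proof (intro conjI allI GL cL2)
        have "sqn P (\<lambda>\<omega>. ?c k - G (\<eta> \<omega>, y)) = sqn P (\<lambda>\<omega>. wick_slice lam n (gs (r k)) (\<eta> \<omega>, y) - G (\<eta> \<omega>, y))" for k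
          by (rule sqn_cong_AE, use U[of k] in eventually_elim) simp
        then show "(\<lambda>k. sqn P (\<lambda>\<omega>. ?c k - G (\<eta> \<omega>, y))) \<longlonglongrightarrow> 0" using u0 by simp
      qed
      moreover have "L2_tendsto P (\<lambda>k \<omega>. ?c k) (\<lambda>\<omega>. g ?z)"
        unfolding L2_tendsto_iff
      proof (intro conjI allI cL2)
        have "sqn P (\<lambda>\<omega>. ?c k - g ?z) = sqn (pow_measure lam n) (\<lambda>z. sum_product (Suc n) (gs (r k)) (z(n := y)) - g (z(n := y)))" for k
          using True by (simp add: sqn_def PiM_empty nn_integral_count_space_finite emeasure_space_1 fun_upd_def)
        then show "(\<lambda>k. sqn P (\<lambda>\<omega>. ?c k - g ?z)) \<longlonglongrightarrow> 0" using v0 by simp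
      qed
      ultimately have "AE \<omega> in P. G (\<eta> \<omega>, y) = g ?z" by (rule L2_tendsto_unique)
      then show ?thesis using True by (simp add: wiener_ito_def slice_def)
    next
      case False
      then have n: "0 < n" by simp
      let ?gs = "\<lambda>k. map (\<lambda>h. scale_first (h n y) h) (gs (r k))"
      note sc = wick_slice_scaled[OF n gs(1)]
      have "is_wiener_ito P lam \<eta> X n (slice n g y) (\<lambda>\<omega>. G (\<eta> \<omega>, y))"
        unfolding is_wiener_ito_def
      proof (intro exI[of _ ?gs] conjI)
        show "\<forall>k. \<forall>h\<in>set (?gs k). \<forall>i<n. admissible_factor lam (h i)"
          using sc(1) unfolding admissible_tuples_def by blast
        show "L2_tendsto (pow_measure lam n) (\<lambda>k. sum_product n (?gs k)) (slice n g y)"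
          unfolding L2_tendsto_iff
        proof (intro conjI allI slL2)
          show "sum_product n (?gs k) \<in> L2 (pow_measure lam n)" for k by (rule sum_product_L2[OF sc(1)])
          show "(\<lambda>k. sqn (pow_measure lam n) (\<lambda>z. sum_product n (?gs k) z - slice n g y z)) \<longlonglongrightarrow> 0"
            using v0 by (simp add: sc(2) sl)
        qed
        show "L2_tendsto P (\<lambda>k. wiener_ito_sum_product lam \<eta> X n (?gs k)) (\<lambda>\<omega>. G (\<eta> \<omega>, y))"
          unfolding L2_tendsto_iff
        proof (intro conjI allI GL)
          show "wiener_ito_sum_product lam \<eta> X n (?gs k) \<in> L2 P" for k by (rule wiener_ito_sum_product_L2[OF sc(1)])
          have "sqn P (\<lambda>\<omega>. wiener_ito_sum_product lam \<eta> X n (?gs k) \<omega> - G (\<eta> \<omega>, y))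
            = sqn P (\<lambda>\<omega>. wick_slice lam n (gs (r k)) (\<eta> \<omega>, y) - G (\<eta> \<omega>, y))" for k
            by (rule sqn_cong_AE, use wick_slice_scaled(3)[OF n gs(1)[of "r k"], of y] in eventually_elim) simp
          then show "(\<lambda>k. sqn P (\<lambda>\<omega>. wiener_ito_sum_product lam \<eta> X n (?gs k) \<omega> - G (\<eta> \<omega>, y))) \<longlonglongrightarrow> 0"
            using u0 by simp
        qed
      qed
      then show ?thesis by (rule is_wiener_ito_AE[OF n])
    qed
    then show "AE \<omega> in P. G (\<eta> \<omega>, y) = (if slice n g y \<in> L2 (pow_measure lam n)
        then wiener_ito P lam \<eta> X n (slice n g y) \<omega> else 0)"
      using slL2 by simp
  qed
qed

text \<open>The slice limit read along the process satisfies the property by which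
  \<open>wiener_ito_slices\<close> is chosen, so the choice satisfies it too. Both agree with the
  same integrals for almost every y, and joint measurability lets Fubini turn this into equality
  almost everywhere on the product.\<close>

lemma wiener_ito_slices_AE:
  assumes g: "g \<in> L2 (pow_measure lam (Suc n))" and lim: "is_slice_limit n g G"
  shows "wiener_ito_slices P lam \<eta> X n g \<in> borel_measurable (P \<Otimes>\<^sub>M lam)"
    and "AE p in P \<Otimes>\<^sub>M lam. wiener_ito_slices P lam \<eta> X n g p = G (\<eta> (fst p), snd p)"
proof -
  let ?I = "\<lambda>y \<omega>. if slice n g y \<in> L2 (pow_measure lam n) then wiener_ito P lam \<eta> X n (slice n g y) \<omega> else 0"
  let ?S = "\<lambda>G. G \<in> borel_measurable (P \<Otimes>\<^sub>M lam) \<and> (AE y in lam. AE \<omega> in P. G (\<omega>, y) = ?I y \<omega>)"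
  let ?G = "\<lambda>p. G (\<eta> (fst p), snd p)" and ?W = "wiener_ito_slices P lam \<eta> X n g"
  have "G \<in> borel_measurable (N \<Otimes>\<^sub>M lam)"
    using lim unfolding is_slice_limit_def L2_tendsto_iff L2_iff measurable_QL by blast
  then have Gm: "?G \<in> borel_measurable (P \<Otimes>\<^sub>M lam)"
    by (rule measurable_compose[OF measurable_eta_pair])
  have G: "?S ?G" using Gm slice_limit_wiener_ito[OF g lim] by simp
  then have W: "?S ?W" unfolding wiener_ito_slices_def by (rule someI[of ?S])
  then show Wm: "?W \<in> borel_measurable (P \<Otimes>\<^sub>M lam)" by simp
  have ae: "AE y in lam. AE \<omega> in P. ?W (\<omega>, y) = ?G (\<omega>, y)"
    using conjunct2[OF G] conjunct2[OF W]
  proof eventually_elim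
    fix y assume "AE \<omega> in P. ?G (\<omega>, y) = ?I y \<omega>" "AE \<omega> in P. ?W (\<omega>, y) = ?I y \<omega>"
    then show "AE \<omega> in P. ?W (\<omega>, y) = ?G (\<omega>, y)" by eventually_elim simp
  qed
  have pred: "Measurable.pred (P \<Otimes>\<^sub>M lam) (\<lambda>p. ?W p = ?G p)" using Wm Gm by measurable
  have "AE \<omega> in P. AE y in lam. ?W (\<omega>, y) = ?G (\<omega>, y)"
    using ae PL.AE_commute[of "\<lambda>\<omega> y. ?W (\<omega>, y) = ?G (\<omega>, y)"] predE[OF pred] by simp
  then show "AE p in P \<Otimes>\<^sub>M lam. ?W p = ?G p"
    by (rule PL.AE_pair_measure[rotated]) (rule predE[OF pred])
qed

lemma wick_slice_orthogonal:
  assumes gs: "admissible_tuples lam (Suc n) gs" and hs: "admissible_tuples lam (Suc m) hs" and nm: "n \<noteq> m"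
  shows "(\<integral>p. wick_slice lam n gs p * wick_slice lam m hs p \<partial>QL) = 0"
proof -
  obtain B1 c1 where B1: "B1 \<in> sets lam" "emeasure lam B1 < \<infinity>" "0 \<le> c1"
      and s1: "\<forall>g\<in>set gs. \<forall>j<Suc n. supported_in lam B1 c1 (g j)"
    using admissible_tuples_support[OF gs] by blast
  obtain B2 c2 where B2: "B2 \<in> sets lam" "emeasure lam B2 < \<infinity>" "0 \<le> c2"
      and s2: "\<forall>g\<in>set hs. \<forall>j<Suc m. supported_in lam B2 c2 (g j)"
    using admissible_tuples_support[OF hs] by blast
  let ?B = "B1 \<union> B2" and ?c = "max c1 c2"
  have B: "?B \<in> sets lam" using B1 B2 by auto
  have Bf: "emeasure lam ?B < \<infinity>"
    using emeasure_subadditive[OF B1(1) B2(1)] B1(2) B2(2)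
    by (metis ennreal_add_less_top infinity_ennreal_def le_less_trans)
  have c: "0 \<le> ?c" using B1 by simp
  have g: "supported_in lam ?B ?c (g j)" if "g \<in> set gs" "j < Suc n" for g j
    by (rule supported_in_mono[of lam B1 c1]) (use s1 that in auto)
  have h: "supported_in lam ?B ?c (h j)" if "h \<in> set hs" "j < Suc m" for h j
    by (rule supported_in_mono[of lam B2 c2]) (use s2 that in auto)
  let ?t = "\<lambda>a b p. (wick_functional lam {..<n} (gs ! a) (fst p) * wick_functional lam {..<m} (hs ! b) (fst p))
      * ((gs ! a) n (snd p) * (hs ! b) m (snd p))"
  have t: "integrable QL (?t a b) \<and> (\<integral>p. ?t a b p \<partial>QL) = 0"
    if "a < length gs" "b < length hs" for a b
  proof -
    have ga: "gs ! a \<in> set gs" and hb: "hs ! b \<in> set hs" using that by auto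
    have gn: "supported_in lam ?B ?c ((gs ! a) n)" and hm: "supported_in lam ?B ?c ((hs ! b) m)"
      using g[OF ga] h[OF hb] by auto
    have "supported_in lam ?B (?c * ?c) (\<lambda>y. (gs ! a) n y * (hs ! b) m y)"
      using gn hm c unfolding supported_in_def by (auto simp: abs_mult intro!: mult_mono)
    then have i2: "integrable lam (\<lambda>y. (gs ! a) n y * (hs ! b) m y)"
      using B Bf by (rule supported_in_integrable)
    have i1: "integrable Q (\<lambda>\<mu>. wick_functional lam {..<n} (gs ! a) \<mu> * wick_functional lam {..<m} (hs ! b) \<mu>)"
      using g[OF ga] h[OF hb]
      by (intro exp_integrableD(3)[of ?B] exp_integrable_wick_mult[OF B Bf _ _ c] exp_integrable_wick[OF B Bf _ _ c]) auto
    have "(\<integral>\<mu>. wick_functional lam {..<n} (gs ! a) \<mu> * wick_functional lam {..<m} (hs ! b) \<mu> \<partial>Q) = 0"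
      using g[OF ga] h[OF hb] nm by (intro wick_orthogonal[OF B Bf _ _ _ _ c]) auto
    then show ?thesis using QL_integral_product[OF i1 i2] by simp
  qed
  have "wick_slice lam n gs p * wick_slice lam m hs p = (\<Sum>a<length gs. \<Sum>b<length hs. ?t a b p)" for p
    unfolding wick_slice_def sum_list_nth sum_product by (intro sum.cong refl) (simp add: mult_ac)
  then have "(\<integral>p. wick_slice lam n gs p * wick_slice lam m hs p \<partial>QL)
    = (\<integral>p. (\<Sum>a<length gs. \<Sum>b<length hs. ?t a b p) \<partial>QL)" by simp
  also have "\<dots> = (\<Sum>a<length gs. \<integral>p. (\<Sum>b<length hs. ?t a b p) \<partial>QL)"
    using t by (intro Bochner_Integration.integral_sum Bochner_Integration.integrable_sum) auto
  also have "\<dots> = (\<Sum>a<length gs. \<Sum>b<length hs. \<integral>p. ?t a b p \<partial>QL)"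
    using t by (intro sum.cong refl Bochner_Integration.integral_sum) auto
  also have "\<dots> = 0" using t by (intro sum.neutral ballI) auto
  finally show ?thesis .
qed

text \<open>Orthogonality of sum-product slices passes to the limit in one argument at a time, by
  continuity of the inner product.\<close>

lemma slice_limit_orthogonal:
  assumes G: "is_slice_limit n g G" and G': "is_slice_limit m g' G'" and nm: "n \<noteq> m"
  shows "(\<integral>p. G p * G' p \<partial>QL) = 0"
proof -
  obtain gs where gs: "\<And>k. admissible_tuples lam (Suc n) (gs k)"
      "L2_tendsto QL (\<lambda>k. wick_slice lam n (gs k)) G"
    using G unfolding is_slice_limit_def by blast
  obtain hs where hs: "\<And>k. admissible_tuples lam (Suc m) (hs k)"
      "L2_tendsto QL (\<lambda>k. wick_slice lam m (hs k)) G'"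
    using G' unfolding is_slice_limit_def by blast
  have G'L2: "G' \<in> L2 QL" using hs(2) by (simp add: L2_tendsto_iff)
  have "(\<integral>p. wick_slice lam n (gs k) p * G' p \<partial>QL) = 0" for k
  proof -
    have "(\<lambda>l. \<integral>p. wick_slice lam m (hs l) p * wick_slice lam n (gs k) p \<partial>QL)
        \<longlonglongrightarrow> (\<integral>p. G' p * wick_slice lam n (gs k) p \<partial>QL)"
      by (rule L2_tendsto_inner[OF hs(2) wick_slice_L2[OF gs(1)]])
    moreover have "(\<integral>p. wick_slice lam m (hs l) p * wick_slice lam n (gs k) p \<partial>QL) = 0" for l
      using nm by (intro wick_slice_orthogonal hs(1) gs(1)) simp
    ultimately have "(\<integral>p. G' p * wick_slice lam n (gs k) p \<partial>QL) = 0"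
      by (simp add: LIMSEQ_const_iff)
    then show ?thesis by (simp add: mult.commute)
  qed
  then show ?thesis
    using L2_tendsto_inner[OF gs(2) G'L2] by (simp add: LIMSEQ_const_iff)
qed

text \<open>The bound for sum-product slices passes to the limit. The constant 4 stems from two uses
  of the inequality with factor 2 and is immaterial for the convergence of the series.\<close>

lemma slice_limit_norm:
  assumes G: "is_slice_limit n g G"
  shows "sqn QL G \<le> ennreal (4 * fact n) * sqn (pow_measure lam (Suc n)) g"
proof -
  let ?M = "pow_measure lam (Suc n)"
  obtain gs where gs: "\<And>k. admissible_tuples lam (Suc n) (gs k)"
      "L2_tendsto ?M (\<lambda>k. sum_product (Suc n) (gs k)) g"
      "L2_tendsto QL (\<lambda>k. wick_slice lam n (gs k)) G"
    using G unfolding is_slice_limit_def by blast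
  have gm: "g \<in> borel_measurable ?M" and Gm: "G \<in> borel_measurable QL"
    using gs by (auto simp: L2_tendsto_iff L2_iff)
  have Um: "wick_slice lam n (gs k) \<in> borel_measurable QL" for k
    by (rule L2_measurable[OF wick_slice_L2[OF gs(1)]])
  let ?u = "\<lambda>k. sqn QL (\<lambda>p. wick_slice lam n (gs k) p - G p)"
  let ?v = "\<lambda>k. sqn ?M (\<lambda>z. sum_product (Suc n) (gs k) z - g z)"
  have "sqn QL G \<le> 2 * ?u k + 2 * (ennreal (fact n) * (2 * ?v k + 2 * sqn ?M g))" for k
  proof -
    have "sqn QL (\<lambda>p. G p - 0) \<le> 2 * sqn QL (\<lambda>p. G p - wick_slice lam n (gs k) p) + 2 * sqn QL (\<lambda>p. wick_slice lam n (gs k) p - 0)"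
      using Gm Um by (rule sqn_diff_le) simp
    also have "sqn QL (\<lambda>p. wick_slice lam n (gs k) p - 0) \<le> ennreal (fact n) * sqn ?M (\<lambda>z. sum_product (Suc n) (gs k) z - 0)"
      using wick_slice_list_bound[OF gs(1)[of k] admissible_tuples_simps(1)] by simp
    also have "sqn ?M (\<lambda>z. sum_product (Suc n) (gs k) z - 0) \<le> 2 * ?v k + 2 * sqn ?M (\<lambda>z. g z - 0)"
      using measurable_sum_product[OF gs(1)] gm by (rule sqn_diff_le) simp
    finally show ?thesis
      by (simp add: sqn_minus_commute[of "QL" G] mult_left_mono add_left_mono)
  qed
  moreover have "(\<lambda>k. 2 * ?u k + 2 * (ennreal (fact n) * (2 * ?v k + 2 * sqn ?M g)))
      \<longlonglongrightarrow> 2 * 0 + 2 * (ennreal (fact n) * (2 * 0 + 2 * sqn ?M g))"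
    using gs(2,3) unfolding L2_tendsto_iff
    by (intro tendsto_add ennreal_tendsto_cmult tendsto_const) auto
  ultimately have "sqn QL G \<le> 2 * 0 + 2 * (ennreal (fact n) * (2 * 0 + 2 * sqn ?M g))"
    by (intro tendsto_lowerbound[of _ _ sequentially]) auto
  also have "\<dots> = ennreal (4 * fact n) * sqn ?M g"
    by (simp add: ennreal_mult' mult_ac flip: ennreal_numeral)
       (simp add: mult.assoc[symmetric] ennreal_mult'[symmetric])
  finally show ?thesis .
qed

text \<open>The slices of different orders are orthogonal, so the weighted series of slices converges.\<close>

lemma slice_series_converges:
  assumes G: "\<And>n. is_slice_limit n (g n) (G n)"
    and fin: "(\<Sum>n. ennreal (real (Suc n) * fact (Suc n)) * sqn (pow_measure lam (Suc n)) (g n)) < \<infinity>"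
  shows "\<exists>D. L2_tendsto QL (\<lambda>k p. \<Sum>n<k. real (Suc n) * G n p) D"
proof (rule L2_complete)
  have GL2: "G n \<in> L2 QL" for n
    using G[of n] unfolding is_slice_limit_def L2_tendsto_iff by blast
  then have L: "(\<lambda>p. real (Suc n) * G n p) \<in> L2 QL" for n by (rule L2_cmult)
  then show "(\<lambda>p. \<Sum>n<k. real (Suc n) * G n p) \<in> L2 QL" for k by (intro L2_sum)
  \<comment> \<open>The summand of the assumption. Since (n+1)^2 n! = (n+1) (n+1)!, it bounds the
    squared norm of the n-th term of the derivative series up to the factor 4.\<close>
  define a where "a n = ennreal (real (Suc n) * fact (Suc n)) * sqn (pow_measure lam (Suc n)) (g n)" for n
  have a_sum: "(\<Sum>n. a n) < \<infinity>" unfolding a_def by (rule fin)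
  have a_fin: "a n < \<infinity>" for n
  proof -
    have "(\<Sum>i\<in>{n}. a i) \<le> (\<Sum>i. a i)" by (intro sum_le_suminf) auto
    also have "\<dots> < \<infinity>" by (rule a_sum)
    finally show ?thesis by simp
  qed
  have ea: "ennreal (enn2real (a n)) = a n" for n using a_fin[of n] by simp
  have "summable (\<lambda>n. enn2real (a n))"
    using a_sum by (intro summable_suminf_not_top) (simp_all add: ea less_top)
  then have cs: "\<forall>e>0. \<exists>K. \<forall>m\<ge>K. \<forall>n. norm (sum (\<lambda>n. enn2real (a n)) {m..<n}) < e"
    by (simp add: summable_Cauchy)
  fix e :: real assume e: "0 < e"
  then obtain K where K: "\<And>m n. m \<ge> K \<Longrightarrow> norm (sum (\<lambda>n. enn2real (a n)) {m..<n}) < e / 4"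
    using cs by (metis zero_less_divide_iff zero_less_numeral)
  have le: "sqn QL (\<lambda>p. (\<Sum>n<l. real (Suc n) * G n p) - (\<Sum>n<m. real (Suc n) * G n p)) \<le> ennreal e"
    if ml: "m \<le> l" "K \<le> m" for m l
  proof -
    have "(\<Sum>n<l. real (Suc n) * G n p) - (\<Sum>n<m. real (Suc n) * G n p) = (\<Sum>n=m..<l. real (Suc n) * G n p)" for p
      using ml(1) sum.atLeastLessThan_concat[of 0 m l "\<lambda>n. real (Suc n) * G n p"]
      by (simp add: atLeast0LessThan del: of_nat_Suc)
    then have "sqn QL (\<lambda>p. (\<Sum>n<l. real (Suc n) * G n p) - (\<Sum>n<m. real (Suc n) * G n p))
      = sqn QL (\<lambda>p. \<Sum>n=m..<l. real (Suc n) * G n p)" by simp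
    also have "\<dots> = (\<Sum>n=m..<l. sqn QL (\<lambda>p. real (Suc n) * G n p))"
    proof (rule sqn_sum_orthogonal)
      fix i j :: nat assume "i \<noteq> j"
      then have "(\<integral>p. G i p * G j p \<partial>QL) = 0" by (rule slice_limit_orthogonal[OF G G])
      moreover have "(real (Suc i) * G i p) * (real (Suc j) * G j p) = (real (Suc i) * real (Suc j)) * (G i p * G j p)" for p
        by (simp add: mult_ac)
      ultimately show "(\<integral>p. (real (Suc i) * G i p) * (real (Suc j) * G j p) \<partial>QL) = 0"
        by (simp only: integral_mult_right_zero mult_zero_right)
    qed (use L in auto)
    also have "\<dots> \<le> (\<Sum>n=m..<l. 4 * a n)"
    proof (rule sum_mono)
      fix n
      have "sqn QL (\<lambda>p. real (Suc n) * G n p) = ennreal ((real (Suc n))\<^sup>2) * sqn QL (G n)"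
        by (rule sqn_cmult[OF L2_measurable[OF GL2]])
      also have "\<dots> \<le> ennreal ((real (Suc n))\<^sup>2) * (ennreal (4 * fact n) * sqn (pow_measure lam (Suc n)) (g n))"
        by (intro mult_left_mono slice_limit_norm G) simp
      also have "\<dots> = ennreal ((real (Suc n))\<^sup>2 * (4 * fact n)) * sqn (pow_measure lam (Suc n)) (g n)"
        by (simp add: ennreal_mult' mult.assoc)
      also have "(real (Suc n))\<^sup>2 * (4 * fact n) = 4 * (real (Suc n) * fact (Suc n))"
        by (simp add: power2_eq_square mult_ac del: of_nat_Suc)
      also have "ennreal (4 * (real (Suc n) * fact (Suc n))) * sqn (pow_measure lam (Suc n)) (g n) = 4 * a n"
        unfolding a_def by (subst ennreal_mult') (auto simp: mult.assoc)
      finally show "sqn QL (\<lambda>p. real (Suc n) * G n p) \<le> 4 * a n" .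
    qed
    also have "\<dots> = 4 * ennreal (\<Sum>n=m..<l. enn2real (a n))"
      by (subst sum_ennreal[symmetric]) (auto simp: ea sum_distrib_left)
    also have "\<dots> \<le> 4 * ennreal (e / 4)"
      using K[OF ml(2), of l] by (intro mult_left_mono ennreal_leI) auto
    also have "\<dots> = ennreal e" using e by (simp add: ennreal_mult'[symmetric] flip: ennreal_numeral)
    finally show ?thesis .
  qed
  show "\<exists>K. \<forall>m\<ge>K. \<forall>l\<ge>K. sqn QL (\<lambda>p. (\<Sum>n<m. real (Suc n) * G n p) - (\<Sum>n<l. real (Suc n) * G n p)) \<le> ennreal e"
  proof (intro exI[of _ K] allI impI)
    fix m l assume "K \<le> m" "K \<le> l"
    then show "sqn QL (\<lambda>p. (\<Sum>n<m. real (Suc n) * G n p) - (\<Sum>n<l. real (Suc n) * G n p)) \<le> ennreal e"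
      using le[of l m] le[of m l] sqn_minus_commute[of "QL" "\<lambda>p. \<Sum>n<m. real (Suc n) * G n p"]
      by (cases "m \<le> l") auto
  qed
qed

text \<open>Both sides are continuous in L2, so sum-product kernels suffice. There
  \<open>wick_pairing\<close> replaces the multiple integral by the expected differences of
  \<open>\<Phi>\<close>, and the hypothesis \<open>T\<close>, which holds for exponential
  functionals normalized to mean 1, splits everything into one-dimensional integrals.\<close>

lemma slice_limit_pairing:
  assumes G: "is_slice_limit n g G" and \<Phi>: "\<Phi> \<in> L2 Q"
    and C: "C \<in> sets lam" "emeasure lam C < \<infinity>"
    and w: "supported_in lam A d w" and A: "A \<in> sets lam" "emeasure lam A < \<infinity>"
    and T: "\<And>z. z \<in> space (pow_measure lam n) \<Longrightarrow> (\<integral>\<mu>. diff_iter n z \<Phi> \<mu> \<partial>Q) = (\<Prod>i<n. w (z i))"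
  shows "(\<integral>p. G p * (\<Phi> (fst p) * indicator C (snd p)) \<partial>QL)
    = (\<integral>z. g z * ((\<Prod>i<n. w (z i)) * indicator C (z n)) \<partial>pow_measure lam (Suc n))"
proof -
  let ?M = "pow_measure lam (Suc n)"
  obtain gs where gs: "\<And>k. admissible_tuples lam (Suc n) (gs k)"
      "L2_tendsto ?M (\<lambda>k. sum_product (Suc n) (gs k)) g"
      "L2_tendsto QL (\<lambda>k. wick_slice lam n (gs k)) G"
    using G unfolding is_slice_limit_def by blast
  let ?w = "\<lambda>i. if i < n then w else indicator C"
  have iC: "supported_in lam C 1 (indicator C)" using C by (auto simp: supported_in_def indicator_def)
  have wa: "admissible_tuples lam (Suc n) [?w]"
    using supported_in_admissible[OF w A] supported_in_admissible[OF iC C] by (simp add: admissible_tuples_def)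
  have wsp: "sum_product (Suc n) [?w] z = (\<Prod>i<n. w (z i)) * indicator C (z n)" for z
    by (simp add: sum_product_def)
  have "sum_product (Suc n) [?w] = (\<lambda>z. (\<Prod>i<n. w (z i)) * indicator C (z n))"
    by (rule ext) (rule wsp)
  then have wL2: "(\<lambda>z. (\<Prod>i<n. w (z i)) * indicator C (z n)) \<in> L2 ?M"
    using sum_product_L2[OF wa] by (simp only:)
  have iCi: "integrable lam (indicator C :: _ \<Rightarrow> real)" using C by simp
  have \<Phi>L2: "(\<lambda>p. \<Phi> (fst p) * indicator C (snd p)) \<in> L2 QL"
  proof -
    have [measurable]: "\<Phi> \<in> borel_measurable N" using L2_measurable[OF \<Phi>] by simp
    have "integrable QL (\<lambda>p. (\<Phi> (fst p))\<^sup>2 * indicator C (snd p))"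
      using \<Phi> iCi by (intro QL_integral_product) (auto simp: L2_def)
    moreover have "(\<lambda>p. (\<Phi> (fst p))\<^sup>2 * indicator C (snd p)) = (\<lambda>p. (\<Phi> (fst p) * indicator C (snd p))\<^sup>2)"
      by (simp add: fun_eq_iff power_mult_distrib indicator_def)
    moreover have "(\<lambda>p. \<Phi> (fst p) * indicator C (snd p)) \<in> borel_measurable QL"
      using C by measurable
    ultimately show ?thesis by (simp add: L2_def)
  qed
  have eq: "(\<integral>p. wick_slice lam n (gs k) p * (\<Phi> (fst p) * indicator C (snd p)) \<partial>QL)
    = (\<integral>z. sum_product (Suc n) (gs k) z * ((\<Prod>i<n. w (z i)) * indicator C (z n)) \<partial>?M)" for k
  proof -
    obtain B c where B: "B \<in> sets lam" "emeasure lam B < \<infinity>" "0 \<le> c"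
        and s: "\<forall>g\<in>set (gs k). \<forall>j<Suc n. supported_in lam B c (g j)"
      using admissible_tuples_support[OF gs(1)[of k]] by blast
    note \<Phi>e = exp_integrable_L2[OF B(1,2) \<Phi>]
    let ?l = "\<lambda>h p. (wick_functional lam {..<n} h (fst p) * \<Phi> (fst p)) * (h n (snd p) * indicator C (snd p))"
    let ?r = "\<lambda>h z. \<Prod>i<Suc n. h i (z i) * ?w i (z i)"
    have key: "integrable QL (?l h) \<and> integrable ?M (?r h) \<and> (\<integral>p. ?l h p \<partial>QL) = (\<integral>z. ?r h z \<partial>?M)"
      if h: "h \<in> set (gs k)" for h
    proof -
      have hs: "supported_in lam B c (h j)" if "j < Suc n" for j using s h that by auto
      have mult: "integrable lam (\<lambda>y. u y * v y)" if "supported_in lam B c u" "supported_in lam A' d' v" for u v A' d'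
      proof (rule supported_in_integrable[OF _ B(1,2)])
        have d: "\<bar>v y\<bar> \<le> max d' 0" if "y \<in> space lam" for y
          using supported_inD(2)[OF \<open>supported_in lam A' d' v\<close> that] by auto
        have "\<bar>u y * v y\<bar> \<le> c * max d' 0" if "y \<in> space lam" for y
          unfolding abs_mult using supported_inD(2)[OF \<open>supported_in lam B c u\<close> that] d[OF that] B(3)
          by (intro mult_mono) auto
        then show "supported_in lam B (c * max d' 0) (\<lambda>y. u y * v y)"
          using that by (auto simp: supported_in_def)
      qed
      have i2: "integrable lam (\<lambda>y. h n y * indicator C y)" by (rule mult[OF hs iC]) simp
      have i1: "integrable Q (\<lambda>\<mu>. wick_functional lam {..<n} h \<mu> * \<Phi> \<mu>)"
        by (rule exp_integrableD(3)[OF exp_integrable_wick_mult[OF B(1,2) _ _ B(3) \<Phi>e]]) (auto intro: hs)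
      have iw: "integrable lam (\<lambda>y. h i y * w y)" if "i < n" for i using that by (intro mult[OF hs w]) simp
      have "(\<integral>\<mu>. wick_functional lam {..<n} h \<mu> * \<Phi> \<mu> \<partial>Q)
        = (\<integral>z. (\<integral>\<mu>. diff_iter n z \<Phi> \<mu> \<partial>Q) * (\<Prod>i<n. h i (z i)) \<partial>pow_measure lam n)"
        by (rule wick_pairing(2)[OF B(1,2) _ B(3) \<Phi>e]) (auto intro: hs)
      also have "\<dots> = (\<integral>z. (\<Prod>i<n. h i (z i) * w (z i)) \<partial>pow_measure lam n)"
        using T by (intro Bochner_Integration.integral_cong) (auto simp: prod.distrib mult.commute)
      also have "\<dots> = (\<Prod>i<n. \<integral>y. h i y * w y \<partial>lam)"
        using iw by (intro pow.product_integral_prod) auto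
      finally have 1: "(\<integral>\<mu>. wick_functional lam {..<n} h \<mu> * \<Phi> \<mu> \<partial>Q) = (\<Prod>i<n. \<integral>y. h i y * w y \<partial>lam)" .
      have i3: "integrable lam (\<lambda>y. h i y * ?w i y)" if "i < Suc n" for i
        using iw i2 that by (cases "i < n") (auto simp: less_Suc_eq)
      have "(\<integral>z. ?r h z \<partial>?M) = (\<Prod>i<Suc n. \<integral>y. h i y * ?w i y \<partial>lam)"
        using i3 by (intro pow.product_integral_prod) auto
      also have "\<dots> = (\<integral>\<mu>. wick_functional lam {..<n} h \<mu> * \<Phi> \<mu> \<partial>Q) * (\<integral>y. h n y * indicator C y \<partial>lam)"
        by (simp add: 1)
      finally have "(\<integral>p. ?l h p \<partial>QL) = (\<integral>z. ?r h z \<partial>?M)"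
        using QL_integral_product(2)[OF i1 i2] by simp
      moreover have "integrable ?M (?r h)" using i3 by (intro pow.product_integrable_prod) auto
      ultimately show ?thesis using QL_integral_product(1)[OF i1 i2] by simp
    qed
    have "(\<integral>p. wick_slice lam n (gs k) p * (\<Phi> (fst p) * indicator C (snd p)) \<partial>QL)
      = (\<integral>p. (\<Sum>a<length (gs k). ?l (gs k ! a) p) \<partial>QL)"
      unfolding wick_slice_def sum_list_nth sum_distrib_right
      by (intro Bochner_Integration.integral_cong refl sum.cong) (simp add: mult_ac)
    also have "\<dots> = (\<Sum>a<length (gs k). \<integral>p. ?l (gs k ! a) p \<partial>QL)"
      using key by (intro Bochner_Integration.integral_sum) auto
    also have "\<dots> = (\<Sum>a<length (gs k). \<integral>z. ?r (gs k ! a) z \<partial>?M)"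
      using key by (intro sum.cong) auto
    also have "\<dots> = (\<integral>z. (\<Sum>a<length (gs k). ?r (gs k ! a) z) \<partial>?M)"
      using key by (intro Bochner_Integration.integral_sum[symmetric]) auto
    also have "\<dots> = (\<integral>z. sum_product (Suc n) (gs k) z * ((\<Prod>i<n. w (z i)) * indicator C (z n)) \<partial>?M)"
    proof -
      have "?r h z = (\<Prod>i<Suc n. h i (z i)) * ((\<Prod>i<n. w (z i)) * indicator C (z n))" for h :: "nat \<Rightarrow> 'a \<Rightarrow> real" and z
        by (simp add: prod.distrib mult_ac)
      then show ?thesis
        by (simp only: sum_product_def sum_list_nth sum_distrib_right)
    qed
    finally show ?thesis .
  qed
  have "(\<lambda>k. \<integral>p. wick_slice lam n (gs k) p * (\<Phi> (fst p) * indicator C (snd p)) \<partial>QL)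
      \<longlonglongrightarrow> (\<integral>p. G p * (\<Phi> (fst p) * indicator C (snd p)) \<partial>QL)"
    by (rule L2_tendsto_inner[OF gs(3) \<Phi>L2])
  moreover have "(\<lambda>k. \<integral>z. sum_product (Suc n) (gs k) z * ((\<Prod>i<n. w (z i)) * indicator C (z n)) \<partial>?M)
      \<longlonglongrightarrow> (\<integral>z. g z * ((\<Prod>i<n. w (z i)) * indicator C (z n)) \<partial>?M)"
    by (rule L2_tendsto_inner[OF gs(2) wL2])
  ultimately show ?thesis unfolding eq by (rule LIMSEQ_unique)
qed

end

section \<open>Exponential test functionals\<close>

lemma sum_Pow_card:
  fixes F :: "nat \<Rightarrow> real"
  assumes "finite J"
  shows "(\<Sum>K\<in>Pow J. F (card K)) = (\<Sum>k\<le>card J. real (card J choose k) * F k)"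
proof -
  have "(\<Sum>K\<in>Pow J. F (card K)) = (\<Sum>k\<in>{..card J}. \<Sum>K\<in>{K \<in> Pow J. card K = k}. F (card K))"
    using assms by (intro sum.group[symmetric]) (auto simp: card_mono)
  also have "\<dots> = (\<Sum>k\<le>card J. real (card J choose k) * F k)"
  proof (rule sum.cong)
    fix k
    have "(\<Sum>K\<in>{K \<in> Pow J. card K = k}. F (card K)) = real (card {K. K \<subseteq> J \<and> card K = k}) * F k"
      by simp
    then show "(\<Sum>K\<in>{K \<in> Pow J. card K = k}. F (card K)) = real (card J choose k) * F k"
      by (simp add: n_subsets[OF assms])
  qed simp
  finally show ?thesis .
qed

text \<open>\<open>W n\<close> is the multiple integral of the n-fold power of w along a
  configuration with points \<open>I\<close>, where r is the integral of w. Counting subsets by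
  cardinality shows that W n / n! is the Cauchy product of the elementary symmetric series with the
  series of exp(-r). Taking absolute values in both factors gives a bound that is uniform in the
  number of terms.\<close>

lemma wick_sum_generating:
  fixes r :: real
  assumes I: "finite I" and w: "\<And>i. i \<in> I \<Longrightarrow> \<bar>w i\<bar> \<le> 1"
  defines "W n \<equiv> \<Sum>K\<in>Pow {..<n}. (-1) ^ (n - card K) * tuple_sum I K (\<lambda>_. w) * r ^ (n - card K)"
  shows "(\<lambda>n. W n / fact n) sums (exp (- r) * (\<Prod>i\<in>I. 1 + w i))"
    and "\<bar>\<Sum>n<N. W n / fact n\<bar> \<le> exp \<bar>r\<bar> * exp (real (card I))"
proof -
  define a where "a k = tuple_sum I {..<k} (\<lambda>_. w) / fact k" for k
  define b where "b k = (- r) ^ k / fact k" for k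
  define a' where "a' k = tuple_sum I {..<k} (\<lambda>_ i. \<bar>w i\<bar>) / fact k" for k
  define b' where "b' k = \<bar>r\<bar> ^ k / fact k" for k
  have W: "W n / fact n = (\<Sum>k\<le>n. a k * b (n - k))" for n
  proof -
    have "W n = (\<Sum>K\<in>Pow {..<n}. (\<lambda>k. (-1) ^ (n - k) * tuple_sum I {..<k} (\<lambda>_. w) * r ^ (n - k)) (card K))"
      unfolding W_def
    proof (rule sum.cong)
      fix K assume "K \<in> Pow {..<n}"
      then have "finite K" by (auto intro: finite_subset)
      from tuple_sum_const_card[OF I this, of w]
      show "(-1) ^ (n - card K) * tuple_sum I K (\<lambda>_. w) * r ^ (n - card K)
        = (-1) ^ (n - card K) * tuple_sum I {..<card K} (\<lambda>_. w) * r ^ (n - card K)" by (simp only:)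
    qed simp
    also have "\<dots> = (\<Sum>k\<le>n. real (n choose k) * ((-1) ^ (n - k) * tuple_sum I {..<k} (\<lambda>_. w) * r ^ (n - k)))"
      by (subst sum_Pow_card) auto
    finally have "W n / fact n = (\<Sum>k\<le>n. real (n choose k) * ((-1) ^ (n - k) * tuple_sum I {..<k} (\<lambda>_. w) * r ^ (n - k)) / fact n)"
      by (simp only: sum_divide_distrib)
    also have "\<dots> = (\<Sum>k\<le>n. a k * b (n - k))"
      by (intro sum.cong refl) (auto simp: a_def b_def binomial_fact power_minus[of r] field_simps)
    finally show ?thesis .
  qed
  have a': "a' sums (\<Prod>i\<in>I. 1 + \<bar>w i\<bar>)" unfolding a'_def by (rule tuple_sum_generating[OF I])
  have b': "b' sums exp \<bar>r\<bar>"
    using exp_converges[of "\<bar>r\<bar>"] by (simp add: b'_def[abs_def] divide_inverse mult.commute)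
  have a: "a sums (\<Prod>i\<in>I. 1 + w i)" unfolding a_def by (rule tuple_sum_generating[OF I])
  have b: "b sums exp (- r)"
    using exp_converges[of "- r"] by (simp add: b_def[abs_def] divide_inverse mult.commute)
  have na: "norm (a k) \<le> a' k" for k
    unfolding a_def a'_def tuple_sum_def by (auto simp: abs_prod intro!: divide_right_mono sum_abs[THEN order_trans])
  have nb: "norm (b k) = b' k" for k by (simp add: b_def b'_def power_abs)
  have sa: "summable (\<lambda>k. norm (a k))"
    by (rule summable_comparison_test'[OF sums_summable[OF a']]) (use na in auto)
  have sb: "summable (\<lambda>k. norm (b k))" unfolding nb using b' by (rule sums_summable)
  show "(\<lambda>n. W n / fact n) sums (exp (- r) * (\<Prod>i\<in>I. 1 + w i))"
    using Cauchy_product_sums[OF sa sb] sums_unique[OF a] sums_unique[OF b] by (simp add: W mult.commute)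
  have a'0: "0 \<le> a' k" and b'0: "0 \<le> b' k" for k
    using order_trans[OF norm_ge_zero na] by (auto simp: b'_def)
  have sa': "summable (\<lambda>k. norm (a' k))" and sb': "summable (\<lambda>k. norm (b' k))"
    using a' b' a'0 b'0 by (simp_all add: sums_iff)
  have "(\<lambda>n. \<Sum>k\<le>n. a' k * b' (n - k)) sums ((\<Prod>i\<in>I. 1 + \<bar>w i\<bar>) * exp \<bar>r\<bar>)"
    using Cauchy_product_sums[OF sa' sb'] sums_unique[OF a'] sums_unique[OF b'] by simp
  then have s: "(\<Sum>n<N. \<Sum>k\<le>n. a' k * b' (n - k)) \<le> (\<Prod>i\<in>I. 1 + \<bar>w i\<bar>) * exp \<bar>r\<bar>"
    using a'0 b'0 by (intro sum_le_suminf[THEN order_trans]) (auto simp: sums_iff intro!: sum_nonneg)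
  have "\<bar>\<Sum>n<N. W n / fact n\<bar> \<le> (\<Sum>n<N. \<Sum>k\<le>n. a' k * b' (n - k))"
    unfolding W
    by (intro sum_abs[THEN order_trans] sum_mono) (use na nb a'0 b'0 in \<open>auto simp: abs_mult intro!: mult_mono\<close>)
  also note s
  \<comment> \<open>Each factor is at most 2, hence at most e; this makes the majorant an
    exponential of the number of points, which is integrable.\<close>
  also have "(\<Prod>i\<in>I. 1 + \<bar>w i\<bar>) \<le> (\<Prod>i\<in>I. exp 1)"
  proof (rule prod_mono)
    fix i assume "i \<in> I"
    then show "0 \<le> 1 + \<bar>w i\<bar> \<and> 1 + \<bar>w i\<bar> \<le> exp (1::real)"
      using w[of i] exp_ge_add_one_self[of 1] by auto
  qed
  then have "(\<Prod>i\<in>I. 1 + \<bar>w i\<bar>) * exp \<bar>r\<bar> \<le> exp \<bar>r\<bar> * exp (real (card I))"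
    by (simp add: exp_of_nat_mult[symmetric] mult.commute flip: exp_of_nat_mult)
  finally show "\<bar>\<Sum>n<N. W n / fact n\<bar> \<le> exp \<bar>r\<bar> * exp (real (card I))" .
qed

text \<open>The powers of \<open>exp (- N)\<close> determine the restriction of a signed density to \<open>N = m\<close>,
  successively for \<open>m = 0, 1, \<dots>\<close>.\<close>

lemma integral_level_eq_0:
  fixes k :: "'a \<Rightarrow> real" and N :: "'a \<Rightarrow> real"
  assumes k: "integrable M k" and N[measurable]: "N \<in> borel_measurable M" and nat: "\<And>x. x \<in> space M \<Longrightarrow> N x \<in> \<nat>"
    and z: "\<And>j::nat. (\<integral>x. k x * exp (- (real j * N x)) \<partial>M) = 0"
  shows "(\<integral>x. k x * (if N x = real m then 1 else 0) \<partial>M) = 0"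
proof (induction m rule: less_induct)
  case (less m)
  have [measurable]: "k \<in> borel_measurable M" using k by simp
  let ?i = "\<lambda>i x. if N x = real i then 1 else 0 :: real"
  \<comment> \<open>The levels below \<open>m\<close> integrate to 0 by induction and may be
    subtracted. The factor exp(j m) then makes level \<open>m\<close> constant in \<open>j\<close>,
    while higher levels are damped to 0 as \<open>j\<close> grows.\<close>
  let ?s = "\<lambda>j x. (k x * exp (- (real j * N x)) - (\<Sum>i<m. exp (- (real j * real i)) * (k x * ?i i x))) * exp (real j * real m)"
  have ki: "integrable M (\<lambda>x. k x * ?i i x)" for i
    by (rule Bochner_Integration.integrable_bound[OF k]) auto
  have ke: "integrable M (\<lambda>x. k x * exp (- (real j * N x)))" for j :: nat
  proof (rule Bochner_Integration.integrable_bound[OF k])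
    show "AE x in M. norm (k x * exp (- (real j * N x))) \<le> norm (k x)"
    proof (rule AE_I2)
      fix x assume "x \<in> space M"
      then have "0 \<le> N x" using nat[of x] by (auto elim: Nats_cases)
      then show "norm (k x * exp (- (real j * N x))) \<le> norm (k x)"
        by (auto simp: abs_mult intro!: mult_left_le)
    qed
  qed measurable
  have s0: "(\<integral>x. ?s j x \<partial>M) = 0" for j
  proof -
    have "(\<integral>x. k x * exp (- (real j * N x)) - (\<Sum>i<m. exp (- (real j * real i)) * (k x * ?i i x)) \<partial>M)
      = 0 - (\<Sum>i<m. exp (- (real j * real i)) * (\<integral>x. k x * ?i i x \<partial>M))"
      using ki ke z by (subst Bochner_Integration.integral_diff; (subst Bochner_Integration.integral_sum)?; auto)
    also have "\<dots> = 0" using less.IH by simp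
    finally show ?thesis by simp
  qed
  have eq: "?s j x = (if N x < real m then 0 else k x * exp (- (real j * (N x - real m))))" if x: "x \<in> space M" for j x
  proof -
    obtain l where l: "N x = real l" using nat[OF x] by (auto elim: Nats_cases)
    have "(\<Sum>i<m. exp (- (real j * real i)) * (k x * ?i i x)) = (\<Sum>i<m. if i = l then exp (- (real j * real l)) * k x else 0)"
      unfolding l by (intro sum.cong) auto
    also have "\<dots> = (if l < m then exp (- (real j * real l)) * k x else 0)" by simp
    finally show ?thesis
      unfolding l by (auto simp: algebra_simps exp_add[symmetric] simp flip: exp_add)
  qed
  have "(\<lambda>j. \<integral>x. ?s j x \<partial>M) \<longlonglongrightarrow> (\<integral>x. k x * ?i m x \<partial>M)"
  proof (rule integral_dominated_convergence[where w="\<lambda>x. \<bar>k x\<bar>"])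
    show "AE x in M. (\<lambda>j. ?s j x) \<longlonglongrightarrow> k x * ?i m x"
    proof (rule AE_I2)
      fix x assume x: "x \<in> space M"
      consider "N x < real m" | "N x = real m" | "0 < N x - real m" by linarith
      then show "(\<lambda>j. ?s j x) \<longlonglongrightarrow> k x * ?i m x"
      proof cases
        case 3
        have "(\<lambda>j. exp (- (real j * (N x - real m)))) \<longlonglongrightarrow> 0"
        proof -
          have "(\<lambda>j. exp (- (N x - real m)) ^ j) \<longlonglongrightarrow> 0"
            using 3 by (intro LIMSEQ_power_zero) simp
          moreover have "exp (- (real j * d)) = exp (- d) ^ j" for j d by (simp flip: exp_of_nat_mult)
          ultimately show ?thesis by (simp only:)
        qed
        from tendsto_mult_left[OF this, of "k x"] show ?thesis using 3 unfolding eq[OF x] by simp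
      qed (unfold eq[OF x], simp_all)
    qed
    show "AE x in M. norm (?s j x) \<le> \<bar>k x\<bar>" for j
    proof (rule AE_I2)
      fix x assume x: "x \<in> space M"
      show "norm (?s j x) \<le> \<bar>k x\<bar>" unfolding eq[OF x] by (auto simp: abs_mult intro!: mult_left_le)
    qed
  qed (use k in \<open>auto intro!: integrable_abs\<close>)
  then show ?case unfolding s0 by (simp add: LIMSEQ_const_iff)
qed

text \<open>Dynkin class argument for a signed density pulled back along \<open>\<phi>\<close>: the
  total integral \<open>tot\<close> supplies complements and dominated convergence by |k| supplies
  disjoint unions.\<close>

lemma integral_eq_0_Dynkin:
  fixes k :: "'a \<Rightarrow> real"
  assumes k: "integrable M k" and \<phi>[measurable]: "\<phi> \<in> measurable M S"
    and gen: "sets S = sigma_sets (space S) G" "Int_stable G" "G \<subseteq> Pow (space S)"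
    and z: "\<And>A. A \<in> G \<Longrightarrow> (\<integral>x. k x * indicator A (\<phi> x) \<partial>M) = 0" and tot: "(\<integral>x. k x \<partial>M) = 0"
    and A: "A \<in> sets S"
  shows "(\<integral>x. k x * indicator A (\<phi> x) \<partial>M) = 0"
proof -
  have [measurable]: "k \<in> borel_measurable M" using k by simp
  have i: "integrable M (\<lambda>x. k x * indicator A (\<phi> x))" if [measurable]: "A \<in> sets S" for A
    by (rule Bochner_Integration.integrable_bound[OF k]) (auto simp: indicator_def)
  have "A \<in> sigma_sets (space S) G" using A gen(1) by simp
  from gen(2,3) this show ?thesis
  proof (induction rule: sigma_sets_induct_disjoint)
    case (basic A) then show ?case by (rule z)
  next
    case empty show ?case by simp
  next
    case (compl A)
    then have A: "A \<in> sets S" using gen(1) by simp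
    have "(\<integral>x. k x * indicator (space S - A) (\<phi> x) \<partial>M) = (\<integral>x. k x - k x * indicator A (\<phi> x) \<partial>M)"
      using measurable_space[OF \<phi>] by (intro Bochner_Integration.integral_cong) (auto simp: indicator_def)
    also have "\<dots> = 0" using compl i[OF A] k tot by simp
    finally show ?case .
  next
    case (union A)
    then have A: "A n \<in> sets S" for n using gen(1) by auto
    have "(\<lambda>n. \<integral>x. (\<Sum>i<n. k x * indicator (A i) (\<phi> x)) \<partial>M) \<longlonglongrightarrow> (\<integral>x. k x * indicator (\<Union>i. A i) (\<phi> x) \<partial>M)"
    proof (rule integral_dominated_convergence[where w="\<lambda>x. \<bar>k x\<bar>"])
      show "AE x in M. (\<lambda>n. \<Sum>i<n. k x * indicator (A i) (\<phi> x)) \<longlonglongrightarrow> k x * indicator (\<Union>i. A i) (\<phi> x)"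
      proof (rule AE_I2)
        fix x
        have "(\<lambda>i. indicator (A i) (\<phi> x) :: real) sums indicator (\<Union>i. A i) (\<phi> x)"
          by (rule indicator_sums) (use union(1) in \<open>auto simp: disjoint_family_on_def\<close>)
        from sums_mult[OF this, of "k x"]
        show "(\<lambda>n. \<Sum>i<n. k x * indicator (A i) (\<phi> x)) \<longlonglongrightarrow> k x * indicator (\<Union>i. A i) (\<phi> x)"
          by (simp add: sums_def)
      qed
      show "AE x in M. norm (\<Sum>i<n. k x * indicator (A i) (\<phi> x)) \<le> \<bar>k x\<bar>" for n
      proof (rule AE_I2)
        fix x
        have "(\<Sum>i<n. indicator (A i) (\<phi> x)) = (indicator (\<Union>i<n. A i) (\<phi> x) :: real)"
          using union(1) by (intro indicator_UN_disjoint[symmetric]) (auto simp: disjoint_family_on_def)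
        then have e: "(\<Sum>i<n. k x * indicator (A i) (\<phi> x)) = k x * indicator (\<Union>i<n. A i) (\<phi> x)"
          by (simp only: flip: sum_distrib_left)
        show "norm (\<Sum>i<n. k x * indicator (A i) (\<phi> x)) \<le> \<bar>k x\<bar>"
          unfolding e by (simp add: indicator_def)
      qed
      show "(\<lambda>x. k x * indicator (\<Union>i. A i) (\<phi> x)) \<in> borel_measurable M"
        using A by (intro borel_measurable_times measurable_compose[OF \<phi> borel_measurable_indicator]) auto
      show "(\<lambda>x. \<Sum>i<n. k x * indicator (A i) (\<phi> x)) \<in> borel_measurable M" for n
        using A by measurable
    qed (use k in auto)
    moreover have "(\<integral>x. (\<Sum>i<n. k x * indicator (A i) (\<phi> x)) \<partial>M) = 0" for n
      using i[OF A] union(3) by (subst Bochner_Integration.integral_sum) auto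
    ultimately show ?case by (simp add: LIMSEQ_const_iff)
  qed
qed

section \<open>Exponential functionals and their differences\<close>

definition finite_sets :: "'a measure \<Rightarrow> 'a set set" where
  "finite_sets lam = {B \<in> sets lam. emeasure lam B < \<infinity>}"

text \<open>A list instead of a set, so that repeating \<open>B\<close> produces the powers of
  exp(-mu(B)) and concatenation produces products.\<close>

definition test_functional :: "'a set list \<Rightarrow> 'a measure \<Rightarrow> real" where
  "test_functional Bs \<mu> = exp (- (\<Sum>B\<leftarrow>Bs. measure \<mu> B))"

definition test_weight :: "'a set list \<Rightarrow> 'a \<Rightarrow> real" where
  "test_weight Bs y = exp (- (\<Sum>B\<leftarrow>Bs. indicator B y)) - 1"

lemma Union_finite_sets:
  assumes "set Bs \<subseteq> finite_sets lam"
  shows "\<Union>(set Bs) \<in> sets lam" "emeasure lam (\<Union>(set Bs)) < \<infinity>"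
proof -
  show "\<Union>(set Bs) \<in> sets lam"
    using assms by (intro sets.finite_Union) (auto simp: finite_sets_def)
  have "emeasure lam (\<Union>B\<in>set Bs. B) \<le> (\<Sum>B\<in>set Bs. emeasure lam B)"
    using assms by (intro emeasure_subadditive_finite) (auto simp: finite_sets_def)
  also have "\<dots> < \<infinity>" using assms by (auto simp: finite_sets_def less_top)
  finally show "emeasure lam (\<Union>(set Bs)) < \<infinity>" by simp
qed

lemma test_functional_bounds: "0 < test_functional Bs \<mu>" "test_functional Bs \<mu> \<le> 1"
  by (auto simp: test_functional_def intro!: sum_list_nonneg)

lemma test_functional_append: "test_functional (Bs @ Cs) \<mu> = test_functional Bs \<mu> * test_functional Cs \<mu>"
  by (simp add: test_functional_def exp_add[symmetric])

lemma test_functional_replicate: "test_functional (replicate j B) \<mu> = exp (- (real j * measure \<mu> B))"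
  by (simp add: test_functional_def sum_list_replicate)

lemma supported_in_test_weight:
  assumes "set Bs \<subseteq> finite_sets lam"
  shows "supported_in lam (\<Union>(set Bs)) 1 (test_weight Bs)"
proof -
  have m: "(\<lambda>y. \<Sum>B\<leftarrow>Bs. indicator B y :: real) \<in> borel_measurable lam"
    using assms by (induction Bs) (auto simp: finite_sets_def)
  have "0 \<le> (\<Sum>B\<leftarrow>Bs. indicator B y :: real)" for y by (auto intro!: sum_list_nonneg)
  then have "exp (- (\<Sum>B\<leftarrow>Bs. indicator B y :: real)) \<le> 1" for y by simp
  then have "\<bar>test_weight Bs y\<bar> \<le> 1" for y
    using exp_gt_zero[of "- (\<Sum>B\<leftarrow>Bs. indicator B y :: real)"] by (simp add: test_weight_def abs_le_iff)
  moreover have "(\<Sum>B\<leftarrow>Bs. indicator B y :: real) = 0" if "y \<notin> \<Union>(set Bs)" for y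
    using that by (induction Bs) auto
  moreover have "test_weight Bs \<in> borel_measurable lam"
    unfolding test_weight_def[abs_def] using m by measurable
  ultimately show ?thesis by (auto simp: supported_in_def test_weight_def)
qed

text \<open>Finiteness matters because \<open>measure\<close> returns 0 on sets of infinite mass,
  where adding a point would go unnoticed. Almost surely all counts involved are finite.\<close>

lemma test_functional_add_point:
  assumes \<mu>: "\<mu> \<in> int_measures lam" and Bs: "set Bs \<subseteq> finite_sets lam"
    and fin: "\<forall>B\<in>set Bs. emeasure \<mu> B < \<infinity>"
  shows "test_functional Bs (add_point \<mu> y) = test_functional Bs \<mu> * (1 + test_weight Bs y)"
proof -
  have "measure (add_point \<mu> y) B = measure \<mu> B + indicator B y" if "B \<in> set Bs" for B
  proof -
    have "B \<in> sets lam" "emeasure \<mu> B < \<infinity>" using that Bs fin by (auto simp: finite_sets_def)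
    then show ?thesis
      unfolding measure_def by (simp add: emeasure_add_point[OF \<mu>] enn2real_plus indicator_def)
  qed
  then have "(\<Sum>B\<leftarrow>Bs. measure (add_point \<mu> y) B) = (\<Sum>B\<leftarrow>Bs. measure \<mu> B + indicator B y)"
    by (intro arg_cong[where f=sum_list] map_cong) auto
  then show ?thesis
    by (simp add: test_functional_def test_weight_def sum_list_addf exp_add[symmetric])
qed

lemma diff_iter_test_functional:
  assumes "\<mu> \<in> int_measures lam" and Bs: "set Bs \<subseteq> finite_sets lam"
    and "\<forall>B\<in>set Bs. emeasure \<mu> B < \<infinity>"
  shows "diff_iter n z (test_functional Bs) \<mu> = test_functional Bs \<mu> * (\<Prod>i<n. test_weight Bs (z i))"
  using assms(1,3)
proof (induction n arbitrary: z \<mu>)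
  case (Suc n)
  have "\<forall>B\<in>set Bs. emeasure (add_point \<mu> (z 0)) B < \<infinity>"
    using Suc.prems Bs by (auto simp: emeasure_add_point finite_sets_def less_top indicator_def)
  with Suc show ?case
    unfolding prod.lessThan_Suc_shift
    by (simp add: diff_op_def add_point_in_int_measures test_functional_add_point[OF _ Bs] algebra_simps)
qed simp

section \<open>Chaos expansion of the exponential functionals\<close>

context poisson_points
begin

lemma AE_Q_finite_sets: "AE \<mu> in Q. \<forall>B\<in>set Bs. emeasure \<mu> B < \<infinity>"
  if Bs: "set Bs \<subseteq> finite_sets lam"
proof (rule AE_finite_allI)
  fix B assume "B \<in> set Bs"
  then have [measurable]: "B \<in> sets lam" and "emeasure lam B < \<infinity>"
    using Bs by (auto simp: finite_sets_def)
  then have "AE \<omega> in P. emeasure (\<eta> \<omega>) B \<in> range of_nat"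
    by (intro poisson_AE_nat[OF poisson_emeasure])
  then have "AE \<omega> in P. emeasure (\<eta> \<omega>) B < \<infinity>" by eventually_elim (auto simp: of_nat_less_top)
  then show "AE \<mu> in Q. emeasure \<mu> B < \<infinity>" by (subst AE_Q_iff) auto
qed simp

lemma measurable_test_functional [measurable]:
  assumes "set Bs \<subseteq> finite_sets lam"
  shows "test_functional Bs \<in> borel_measurable N"
proof -
  have "(\<lambda>\<mu>. \<Sum>B\<leftarrow>Bs. measure \<mu> B) \<in> borel_measurable N"
    using assms by (induction Bs) (auto simp: finite_sets_def)
  then show ?thesis unfolding test_functional_def[abs_def] by measurable
qed

lemma test_functional_L2: "test_functional Bs \<in> L2 Q" if "set Bs \<subseteq> finite_sets lam"
proof -
  note [measurable] = measurable_test_functional[OF that]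
  have "integrable Q (\<lambda>\<mu>. (test_functional Bs \<mu>)\<^sup>2)"
    using test_functional_bounds[of Bs]
    by (intro Q.integrable_const_bound[where B=1]) (auto simp: power_le_one less_imp_le)
  then show ?thesis by (simp add: L2_def)
qed

lemma T_test_functional:
  assumes Bs: "set Bs \<subseteq> finite_sets lam" and z: "z \<in> space (pow_measure lam n)"
  shows "(\<integral>\<mu>. diff_iter n z (test_functional Bs) \<mu> \<partial>Q)
    = (\<integral>\<mu>. test_functional Bs \<mu> \<partial>Q) * (\<Prod>i<n. test_weight Bs (z i))"
proof -
  have "(\<integral>\<mu>. diff_iter n z (test_functional Bs) \<mu> \<partial>Q) = (\<integral>\<mu>. test_functional Bs \<mu> * (\<Prod>i<n. test_weight Bs (z i)) \<partial>Q)"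
  proof (rule integral_cong_AE)
    show "diff_iter n z (test_functional Bs) \<in> borel_measurable Q"
      using measurable_diff_iter[OF measurable_test_functional[OF Bs], of n] measurable_Pair1'[OF z, of N]
      by (auto dest: measurable_compose[rotated])
    show "AE \<mu> in Q. diff_iter n z (test_functional Bs) \<mu> = test_functional Bs \<mu> * (\<Prod>i<n. test_weight Bs (z i))"
      using AE_Q_finite_sets[OF Bs] AE_space
      by eventually_elim (rule diff_iter_test_functional[OF _ Bs], auto simp: space_int_measure_space)
  qed (use measurable_test_functional[OF Bs] in measurable)
  then show ?thesis by simp
qed

lemma test_functional_eta:
  assumes Bs: "set Bs \<subseteq> finite_sets lam" and A: "\<Union>(set Bs) \<subseteq> A" and w: "\<omega> \<in> space P"
    and fin: "finite (pts_in A \<omega>)"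
  shows "test_functional Bs (\<eta> \<omega>) = (\<Prod>i\<in>pts_in A \<omega>. 1 + test_weight Bs (X i \<omega>))"
proof -
  have m: "measure (\<eta> \<omega>) B = (\<Sum>i\<in>pts_in A \<omega>. indicator B (X i \<omega>))" if "B \<in> set Bs" for B
  proof -
    have "pts_in B \<omega> = {i \<in> pts_in A \<omega>. X i \<omega> \<in> B}" using that A by (auto simp: pts_in_def)
    moreover have "B \<in> sets lam" using that Bs by (auto simp: finite_sets_def)
    ultimately show ?thesis using fin by (simp add: measure_eta_pts_in[OF w] indicator_def sum.If_cases Int_def)
  qed
  have "(\<Sum>B\<leftarrow>Bs. measure (\<eta> \<omega>) B) = (\<Sum>B\<leftarrow>Bs. \<Sum>i\<in>pts_in A \<omega>. indicator B (X i \<omega>))"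
    using m by (intro arg_cong[where f=sum_list] map_cong) auto
  also have "\<dots> = (\<Sum>i\<in>pts_in A \<omega>. \<Sum>B\<leftarrow>Bs. indicator B (X i \<omega>))"
    by (induction Bs) (simp_all add: sum.distrib)
  finally show ?thesis
    using fin by (simp add: test_functional_def test_weight_def exp_sum sum_negf[symmetric] flip: exp_sum)
qed

text \<open>Along a configuration the functional is the product of 1 + w over the points in
  \<open>A\<close>, and the integrals of powers of w are alternating sums of tuple sums;
  \<open>wick_sum_generating\<close> relates the two and supplies the majorant.\<close>

lemma test_functional_expansion_eta:
  assumes Bs: "set Bs \<subseteq> finite_sets lam"
  defines "w \<equiv> test_weight Bs" and "A \<equiv> \<Union>(set Bs)" and "r \<equiv> \<integral>y. test_weight Bs y \<partial>lam"
  shows "AE \<omega> in P. (\<lambda>n. wick_functional lam {..<n} (\<lambda>_. w) (\<eta> \<omega>) / fact n) sums (exp (- r) * test_functional Bs (\<eta> \<omega>))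
    \<and> (\<forall>n. \<bar>\<Sum>k<n. wick_functional lam {..<k} (\<lambda>_. w) (\<eta> \<omega>) / fact k\<bar> \<le> exp \<bar>r\<bar> * exp (measure (\<eta> \<omega>) A))"
proof -
  note A = Union_finite_sets[OF Bs, folded A_def]
  note w = supported_in_test_weight[OF Bs, folded A_def w_def]
  show ?thesis
    using AE_finite_pts_in[OF A] AE_space
  proof eventually_elim
    fix \<omega> assume fin: "finite (pts_in A \<omega>)" and \<omega>: "\<omega> \<in> space P"
    let ?v = "\<lambda>i. w (X i \<omega>)"
    have W: "wick_functional lam {..<n} (\<lambda>_. w) (\<eta> \<omega>)
        = (\<Sum>K\<in>Pow {..<n}. (-1) ^ (n - card K) * tuple_sum (pts_in A \<omega>) K (\<lambda>_. ?v) * r ^ (n - card K))" for n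
      unfolding wick_functional_def
    proof (rule sum.cong)
      fix K assume K: "K \<in> Pow {..<n}"
      then have fK: "finite K" by (auto intro: finite_subset)
      have "factorial_functional lam K (\<lambda>_. w) (\<eta> \<omega>) = tuple_sum (pts_in A \<omega>) K (\<lambda>_. ?v)"
        by (rule factorial_functional_eta[OF \<omega> fin fK]) (rule w)
      moreover have "card ({..<n} - K) = n - card K" using K fK by (subst card_Diff_subset) auto
      ultimately show "(-1) ^ (card {..<n} - card K) * factorial_functional lam K (\<lambda>_. w) (\<eta> \<omega>) * (\<Prod>j\<in>{..<n} - K. \<integral>y. w y \<partial>lam)
        = (-1) ^ (n - card K) * tuple_sum (pts_in A \<omega>) K (\<lambda>_. ?v) * r ^ (n - card K)"
        by (simp add: r_def w_def)
    qed simp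
    have v: "\<bar>?v i\<bar> \<le> 1" for i using supported_inD(2)[OF w X_space[OF \<omega>]] .
    have t: "test_functional Bs (\<eta> \<omega>) = (\<Prod>i\<in>pts_in A \<omega>. 1 + ?v i)"
      unfolding w_def by (rule test_functional_eta[OF Bs _ \<omega> fin]) (simp add: A_def)
    have "(\<lambda>n. wick_functional lam {..<n} (\<lambda>_. w) (\<eta> \<omega>) / fact n) sums (exp (- r) * test_functional Bs (\<eta> \<omega>))"
      unfolding W t by (rule wick_sum_generating(1)[OF fin v])
    moreover have "\<bar>\<Sum>k<n. wick_functional lam {..<k} (\<lambda>_. w) (\<eta> \<omega>) / fact k\<bar> \<le> exp \<bar>r\<bar> * exp (measure (\<eta> \<omega>) A)" for n
      unfolding W measure_eta_pts_in[OF \<omega> A(1)] by (rule wick_sum_generating(2)[OF fin v])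
    ultimately show "(\<lambda>n. wick_functional lam {..<n} (\<lambda>_. w) (\<eta> \<omega>) / fact n) sums (exp (- r) * test_functional Bs (\<eta> \<omega>))
      \<and> (\<forall>n. \<bar>\<Sum>k<n. wick_functional lam {..<k} (\<lambda>_. w) (\<eta> \<omega>) / fact k\<bar> \<le> exp \<bar>r\<bar> * exp (measure (\<eta> \<omega>) A))"
      by blast
  qed
qed

lemma test_functional_expansion:
  assumes Bs: "set Bs \<subseteq> finite_sets lam"
  defines "w \<equiv> test_weight Bs" and "A \<equiv> \<Union>(set Bs)" and "r \<equiv> \<integral>y. test_weight Bs y \<partial>lam"
  shows "AE \<mu> in Q. (\<lambda>n. \<Sum>k<n. wick_functional lam {..<k} (\<lambda>_. w) \<mu> / fact k) \<longlonglongrightarrow> exp (- r) * test_functional Bs \<mu>"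
    and "AE \<mu> in Q. \<bar>\<Sum>k<n. wick_functional lam {..<k} (\<lambda>_. w) \<mu> / fact k\<bar> \<le> exp \<bar>r\<bar> * exp (measure \<mu> A)"
proof -
  note e = test_functional_expansion_eta[OF Bs, folded w_def A_def r_def]
  note A[measurable] = Union_finite_sets(1)[OF Bs, folded A_def]
  note [measurable] = measurable_test_functional[OF Bs]
  have [measurable]: "wick_functional lam {..<k} (\<lambda>_. w) \<in> borel_measurable N" for k
    by (rule measurable_wick_functional) (auto simp: w_def intro: supported_inD(1)[OF supported_in_test_weight[OF Bs]])
  have 1: "AE \<omega> in P. (\<lambda>n. \<Sum>k<n. wick_functional lam {..<k} (\<lambda>_. w) (\<eta> \<omega>) / fact k) \<longlonglongrightarrow> exp (- r) * test_functional Bs (\<eta> \<omega>)"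
    using e by eventually_elim (simp add: sums_def)
  have 2: "AE \<omega> in P. \<bar>\<Sum>k<n. wick_functional lam {..<k} (\<lambda>_. w) (\<eta> \<omega>) / fact k\<bar> \<le> exp \<bar>r\<bar> * exp (measure (\<eta> \<omega>) A)"
    using e by eventually_elim blast
  show "AE \<mu> in Q. (\<lambda>n. \<Sum>k<n. wick_functional lam {..<k} (\<lambda>_. w) \<mu> / fact k) \<longlonglongrightarrow> exp (- r) * test_functional Bs \<mu>"
    using 1 by (subst AE_Q_iff) measurable
  show "AE \<mu> in Q. \<bar>\<Sum>k<n. wick_functional lam {..<k} (\<lambda>_. w) \<mu> / fact k\<bar> \<le> exp \<bar>r\<bar> * exp (measure \<mu> A)"
    using 2 by (subst AE_Q_iff) measurable
qed

text \<open>The expansion is integrated term by term. Integrals of positive order have mean 0 by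
  orthogonality to order 0, so only the constant term 1 survives; hence exp(-r) is the right
  normalization.\<close>

lemma integral_test_functional:
  assumes Bs: "set Bs \<subseteq> finite_sets lam"
  shows "(\<integral>\<mu>. test_functional Bs \<mu> \<partial>Q) = exp (\<integral>y. test_weight Bs y \<partial>lam)"
proof -
  define w where "w = test_weight Bs"
  define A where "A = \<Union>(set Bs)"
  define r where "r = (\<integral>y. test_weight Bs y \<partial>lam)"
  note A = Union_finite_sets[OF Bs, folded A_def]
  note w = supported_in_test_weight[OF Bs, folded A_def w_def]
  note e = test_functional_expansion[OF Bs, folded w_def A_def r_def]
  note [measurable] = measurable_test_functional[OF Bs]
  let ?W = "\<lambda>k. wick_functional lam {..<k} (\<lambda>_. w)"
  have [measurable]: "?W k \<in> borel_measurable N" for k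
    by (rule measurable_wick_functional) (auto intro: supported_inD(1)[OF w])
  have W0: "wick_functional lam {} (\<lambda>_. w) \<in> borel_measurable N" "factorial_functional lam {} (\<lambda>_. w) \<in> borel_measurable N"
    by (rule measurable_wick_functional measurable_factorial_functional; simp)+
  have iW: "integrable Q (?W k)" for k
    using w by (intro exp_integrableD(3)[OF exp_integrable_wick[OF A, of _ 1]]) auto
  have W: "(\<integral>\<mu>. ?W k \<mu> \<partial>Q) = (if k = 0 then 1 else 0)" for k
  proof (cases "k = 0")
    case True
    have "(\<integral>\<mu>. ?W 0 \<mu> \<partial>Q) = (\<integral>\<mu>. 1 \<partial>Q)"
      using wick_functional_empty_AE[of "\<lambda>_. w"] W0 by (intro integral_cong_AE) (auto simp del: wick_functional_empty)
    then show ?thesis using True Q.prob_space by (simp del: wick_functional_empty)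
  next
    case False
    have "(\<integral>\<mu>. ?W k \<mu> * wick_functional lam {} (\<lambda>_. w) \<mu> \<partial>Q) = 0"
      using False w by (intro wick_orthogonal[OF A, of _ 1]) auto
    moreover have "(\<integral>\<mu>. ?W k \<mu> * wick_functional lam {} (\<lambda>_. w) \<mu> \<partial>Q) = (\<integral>\<mu>. ?W k \<mu> \<partial>Q)"
      using wick_functional_empty_AE[of "\<lambda>_. w"] W0
      by (intro integral_cong_AE) (auto simp del: wick_functional_empty elim!: eventually_mono)
    ultimately show ?thesis using False by simp
  qed
  have "(\<lambda>n. \<integral>\<mu>. (\<Sum>k<n. ?W k \<mu> / fact k) \<partial>Q) \<longlonglongrightarrow> (\<integral>\<mu>. exp (- r) * test_functional Bs \<mu> \<partial>Q)"
  proof (rule integral_dominated_convergence[where w="\<lambda>\<mu>. exp \<bar>r\<bar> * exp (measure \<mu> A)"])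
    show "integrable Q (\<lambda>\<mu>. exp \<bar>r\<bar> * exp (measure \<mu> A))" using exp_moment[OF A, of 1] by simp
  qed (use e in auto)
  moreover have "(\<integral>\<mu>. (\<Sum>k<n. ?W k \<mu> / fact k) \<partial>Q) = (if n = 0 then 0 else 1)" for n
  proof -
    have "(\<integral>\<mu>. (\<Sum>k<n. ?W k \<mu> / fact k) \<partial>Q) = (\<Sum>k<n. (\<integral>\<mu>. ?W k \<mu> \<partial>Q) / fact k)"
      using iW by (subst Bochner_Integration.integral_sum) auto
    also have "\<dots> = (\<Sum>k<n. if k = 0 then 1 else 0)"
      unfolding W by (intro sum.cong) auto
    finally have "(\<integral>\<mu>. (\<Sum>k<n. ?W k \<mu> / fact k) \<partial>Q) = (\<Sum>k<n. if k = 0 then 1 else 0)" .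
    then show ?thesis by simp
  qed
  ultimately have "(\<lambda>n. if n = 0 then 0 else 1) \<longlonglongrightarrow> exp (- r) * (\<integral>\<mu>. test_functional Bs \<mu> \<partial>Q)" by simp
  moreover have "(\<lambda>n::nat. if n = 0 then 0 else 1 :: real) \<longlonglongrightarrow> 1"
    by (rule tendsto_eventually) (auto simp: eventually_sequentially intro!: exI[of _ 1])
  ultimately have "exp (- r) * (\<integral>\<mu>. test_functional Bs \<mu> \<partial>Q) = 1" by (rule LIMSEQ_unique)
  then show ?thesis unfolding r_def[symmetric] by (simp add: exp_minus field_simps)
qed

end

text \<open>The functionals are chosen by \<open>SOME\<close> from a predicate mentioning all of
  \<open>g\<close>. Since that predicate reads only the factors with index in the set at hand, the
  predicates coincide as functions and so do the choices.\<close>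

lemma wick_functional_cong:
  assumes "\<And>j. j \<in> J \<Longrightarrow> g j = h j"
  shows "wick_functional lam J g = wick_functional lam J h"
proof -
  have "represents_tuple_sum lam K g = represents_tuple_sum lam K h" if "K \<in> Pow J" for K
  proof -
    have e: "g j = h j" if "j \<in> K" for j using assms that \<open>K \<in> Pow J\<close> by auto
    then have "tuple_sum I K (\<lambda>j i. g j (x i)) = tuple_sum I K (\<lambda>j i. h j (x i))" for I :: "nat set" and x
      by (intro tuple_sum_cong) simp
    then show ?thesis unfolding represents_tuple_sum_def fun_eq_iff using e by simp
  qed
  then have "factorial_functional lam K g = factorial_functional lam K h" if "K \<in> Pow J" for K
    using that by (simp add: factorial_functional_def)
  then show ?thesis
    unfolding wick_functional_def fun_eq_iff using assms
    by (auto intro!: sum.cong prod.cong)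
qed

lemma diff_iter_cmult: "diff_iter n z (\<lambda>\<mu>. c * f \<mu>) \<mu> = c * diff_iter n z f \<mu>"
  by (induction n arbitrary: z \<mu>) (simp_all add: diff_op_def algebra_simps)

section \<open>Level events and determination by test functionals\<close>

definition level_event :: "'a measure \<Rightarrow> ('a set \<times> nat) list \<Rightarrow> 'a measure set" where
  "level_event lam ms = {\<mu> \<in> int_measures lam. \<forall>(B, m)\<in>set ms. emeasure \<mu> B = of_nat m}"

definition level_events :: "'a measure \<Rightarrow> 'a measure set set" where
  "level_events lam = {level_event lam ms | ms. fst ` set ms \<subseteq> finite_sets lam}"

lemma Int_stable_level_events: "Int_stable (level_events lam)"
proof (rule Int_stableI)
  fix a b assume "a \<in> level_events lam" "b \<in> level_events lam"
  then obtain ms ns where "a = level_event lam ms" "b = level_event lam ns"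
      "fst ` set ms \<subseteq> finite_sets lam" "fst ` set ns \<subseteq> finite_sets lam"
    unfolding level_events_def by blast
  then have "a \<inter> b = level_event lam (ms @ ns)" "fst ` set (ms @ ns) \<subseteq> finite_sets lam"
    by (auto simp: level_event_def)
  then show "a \<inter> b \<in> level_events lam" unfolding level_events_def by blast
qed

text \<open>A count of a set of finite intensity takes countably many values, so its level sets,
  together with the complement of all of them for the value infinity, determine it. The count of a
  general set is the supremum of its counts inside an exhaustion.\<close>

lemma sets_int_measure_space_level_events:
  assumes "sigma_finite_measure lam"
  shows "sets (int_measure_space lam) = sigma_sets (int_measures lam) (level_events lam)"
proof
  have lev: "level_event lam ms \<in> sets (int_measure_space lam)" if "fst ` set ms \<subseteq> finite_sets lam" for ms
    using that
  proof (induction ms)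
    case Nil
    have "level_event lam [] = space (int_measure_space lam)"
      by (simp add: level_event_def space_int_measure_space)
    then show ?case by simp
  next
    case (Cons p ms)
    then have [measurable]: "fst p \<in> sets lam" by (auto simp: finite_sets_def)
    have "level_event lam (p # ms) = {\<mu> \<in> space (int_measure_space lam). emeasure \<mu> (fst p) = of_nat (snd p)} \<inter> level_event lam ms"
      by (auto simp: level_event_def space_int_measure_space)
    moreover have "{\<mu> \<in> space (int_measure_space lam). emeasure \<mu> (fst p) = of_nat (snd p)} \<in> sets (int_measure_space lam)"
      by measurable
    ultimately show ?case using Cons by auto
  qed
  then have "level_events lam \<subseteq> sets (int_measure_space lam)" unfolding level_events_def by blast
  then show "sigma_sets (int_measures lam) (level_events lam) \<subseteq> sets (int_measure_space lam)"
    using sets.sigma_sets_subset[of "level_events lam" "int_measure_space lam"] by (simp add: space_int_measure_space)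
next
  interpret lam: sigma_finite_measure lam by fact
  let ?S = "sigma (int_measures lam) (level_events lam)"
  have sp: "space ?S = int_measures lam" by (simp add: space_measure_of_conv)
  have sS: "sets ?S = sigma_sets (int_measures lam) (level_events lam)"
    by (rule sets_measure_of) (auto simp: level_events_def level_event_def)
  have fin: "(\<lambda>\<mu>. emeasure \<mu> B) \<in> borel_measurable ?S" if B: "B \<in> finite_sets lam" for B
  proof (rule measurableI)
    fix U :: "ennreal set" assume "U \<in> sets borel"
    have L: "level_event lam [(B, m)] \<in> sets ?S" for m
      unfolding sS using B by (intro sigma_sets.Basic) (auto simp: level_events_def)
    have "(\<lambda>\<mu>. emeasure \<mu> B) -` U \<inter> space ?S
      = (\<Union>m\<in>{m. of_nat m \<in> U}. level_event lam [(B, m)])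
        \<union> (if \<infinity> \<in> U then space ?S - (\<Union>m. level_event lam [(B, m)]) else {})"
      (is "?L = ?R")
    proof (rule set_eqI)
      fix \<mu>
      show "\<mu> \<in> ?L \<longleftrightarrow> \<mu> \<in> ?R"
      proof (cases "\<mu> \<in> int_measures lam")
        case True
        then consider m where "emeasure \<mu> B = of_nat m" | "emeasure \<mu> B = \<infinity>"
          using B int_measuresD(4)[of \<mu> lam B] by (auto simp: finite_sets_def)
        then show ?thesis
        proof cases
          case (1 m)
          then show ?thesis using True unfolding sp by (simp add: level_event_def)
        next
          case 2
          then show ?thesis using True unfolding sp by (simp add: level_event_def)
        qed
      next
        case False
        then show ?thesis unfolding sp by (simp add: level_event_def)
      qed
    qed
    also have "\<dots> \<in> sets ?S" using L by auto
    finally show "(\<lambda>\<mu>. emeasure \<mu> B) -` U \<inter> space ?S \<in> sets ?S" .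
  qed simp
  obtain A where A: "range A \<subseteq> sets lam" "(\<Union>i. A i) = space lam" "\<And>i. emeasure lam (A i) \<noteq> \<infinity>" "incseq A"
    using lam.sigma_finite_incseq by metis
  have "(\<lambda>\<mu>. \<mu>) \<in> measurable ?S (int_measure_space lam)"
  proof (rule measurable_int_measure_spaceI)
    fix B assume B: "B \<in> sets lam"
    have AB: "B \<inter> A i \<in> finite_sets lam" for i
    proof -
      have "emeasure lam (B \<inter> A i) \<le> emeasure lam (A i)" using A B by (intro emeasure_mono) auto
      also have "\<dots> < \<infinity>" using A(3) by (simp add: less_top)
      finally show ?thesis using A B by (auto simp: finite_sets_def)
    qed
    have "emeasure \<mu> B = (SUP i. emeasure \<mu> (B \<inter> A i))" if "\<mu> \<in> space ?S" for \<mu>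
    proof -
      have s: "sets \<mu> = sets lam" using that by (simp add: sp int_measuresD)
      have "(SUP i. emeasure \<mu> (B \<inter> A i)) = emeasure \<mu> (\<Union>i. B \<inter> A i)"
        using A B s by (intro SUP_emeasure_incseq) (auto simp: incseq_def subset_iff)
      moreover have "(\<Union>i. B \<inter> A i) = B" using A(2) sets.sets_into_space[OF B] by auto
      ultimately show ?thesis by simp
    qed
    moreover have "(\<lambda>\<mu>. SUP i. emeasure \<mu> (B \<inter> A i)) \<in> borel_measurable ?S"
      using fin[OF AB] by measurable
    ultimately show "(\<lambda>\<mu>. emeasure \<mu> B) \<in> borel_measurable ?S" by (simp cong: measurable_cong)
  qed (simp add: sp)
  then have "X \<in> sets ?S" if "X \<in> sets (int_measure_space lam)" for X
    using measurable_sets[OF _ that, of "\<lambda>\<mu>. \<mu>" ?S] sets.sets_into_space[OF that]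
    by (simp add: sp space_int_measure_space Int_absorb2)
  then show "sets (int_measure_space lam) \<subseteq> sigma_sets (int_measures lam) (level_events lam)"
    unfolding sS[symmetric] by blast
qed

context poisson_points
begin

text \<open>Levels are imposed one at a time through \<open>integral_level_eq_0\<close>. The
  statement keeps an arbitrary test functional alongside the event because the exponentials needed
  for the next level are supplied by lengthening \<open>Bs\<close>.\<close>

lemma integral_level_event_eq_0:
  assumes k: "integrable QL k" and C[measurable]: "C \<in> sets lam"
    and z: "\<And>Bs. set Bs \<subseteq> finite_sets lam \<Longrightarrow>
      (\<integral>p. k p * (test_functional Bs (fst p) * indicator C (snd p)) \<partial>QL) = 0"
    and ms: "fst ` set ms \<subseteq> finite_sets lam" and Bs: "set Bs \<subseteq> finite_sets lam"
  shows "(\<integral>p. k p * (test_functional Bs (fst p) * indicator C (snd p)) * indicator (level_event lam ms) (fst p) \<partial>QL) = 0"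
  using ms Bs
proof (induction ms arbitrary: Bs)
  case Nil
  have "(\<integral>p. k p * (test_functional Bs (fst p) * indicator C (snd p)) * indicator (level_event lam []) (fst p) \<partial>QL)
    = (\<integral>p. k p * (test_functional Bs (fst p) * indicator C (snd p)) \<partial>QL)"
    by (intro Bochner_Integration.integral_cong refl)
       (auto simp: level_event_def space_pair_measure space_int_measure_space)
  then show ?case using z Nil by simp
next
  case (Cons a ms)
  obtain B m where a: "a = (B, m)" by fastforce
  have B: "B \<in> finite_sets lam" and ms: "fst ` set ms \<subseteq> finite_sets lam" using Cons.prems a by auto
  then have Bm[measurable]: "B \<in> sets lam" by (simp add: finite_sets_def)
  note [measurable] = measurable_test_functional[OF Cons.prems(2)]
  have [measurable]: "k \<in> borel_measurable QL" using k by simp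
  have [measurable]: "level_event lam ns \<in> sets N" if "fst ` set ns \<subseteq> finite_sets lam" for ns
    unfolding sets_int_measure_space_level_events[OF lam.sigma_finite_measure_axioms]
    using that by (intro sigma_sets.Basic) (auto simp: level_events_def)
  note [measurable] = this[OF ms] this[OF Cons.prems(1)]
  let ?k = "\<lambda>p. k p * (test_functional Bs (fst p) * indicator C (snd p)) * indicator (level_event lam ms) (fst p)"
  have ik: "integrable QL ?k"
  proof (rule Bochner_Integration.integrable_bound[OF k])
    show "AE p in QL. norm (?k p) \<le> norm (k p)"
      using test_functional_bounds[of Bs]
      by (intro AE_I2) (auto simp: abs_mult indicator_def less_imp_le intro!: mult_left_le)
  qed measurable
  have "(\<integral>p. ?k p * (if measure (fst p) B = real m then 1 else 0) \<partial>QL) = 0"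
  proof (rule integral_level_eq_0[OF ik])
    show "(\<lambda>p. measure (fst p) B) \<in> borel_measurable QL" by measurable
    show "measure (fst p) B \<in> \<nat>" if "p \<in> space QL" for p
    proof -
      have "fst p \<in> int_measures lam" using that by (auto simp: space_pair_measure space_int_measure_space)
      from int_measuresD(4)[OF this Bm] show ?thesis
        by (auto simp: measure_def ennreal_of_nat_eq_real_of_nat)
    qed
    fix j
    \<comment> \<open>The induction hypothesis with \<open>j\<close> extra copies of
      \<open>B\<close> is the vanishing of the integral weighted by exp(-j mu(B)).\<close>
    have "set (replicate j B @ Bs) \<subseteq> finite_sets lam" using B Cons.prems by auto
    from Cons.IH[OF ms this]
    show "(\<integral>p. ?k p * exp (- (real j * measure (fst p) B)) \<partial>QL) = 0"
      by (simp add: test_functional_append test_functional_replicate mult_ac)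
  qed
  also have "(\<integral>p. ?k p * (if measure (fst p) B = real m then 1 else 0) \<partial>QL)
    = (\<integral>p. k p * (test_functional Bs (fst p) * indicator C (snd p)) * indicator (level_event lam (a # ms)) (fst p) \<partial>QL)"
  proof (rule integral_cong_AE)
    \<comment> \<open>An infinite count has \<open>measure\<close> 0 and would be mistaken for level
      0; almost surely this does not happen.\<close>
    have "AE \<mu> in Q. \<forall>B\<in>set [B]. emeasure \<mu> B < \<infinity>" using B by (intro AE_Q_finite_sets) simp
    then have "AE \<mu> in Q. emeasure \<mu> B < \<infinity>" by simp
    then have "AE p in QL. emeasure (fst p) B < \<infinity>" by (rule AE_QL_fst) measurable
    then show "AE p in QL. ?k p * (if measure (fst p) B = real m then 1 else 0)
        = k p * (test_functional Bs (fst p) * indicator C (snd p)) * indicator (level_event lam (a # ms)) (fst p)"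
    proof eventually_elim
      fix p :: "'a measure \<times> 'a" assume "emeasure (fst p) B < \<infinity>"
      then have "measure (fst p) B = real m \<longleftrightarrow> emeasure (fst p) B = of_nat m"
        by (metis emeasure_eq_ennreal_measure ennreal_of_nat_eq_real_of_nat infinity_ennreal_def
            less_irrefl measure_eq_emeasure_eq_ennreal of_nat_0_le_iff)
      then show "?k p * (if measure (fst p) B = real m then 1 else 0)
        = k p * (test_functional Bs (fst p) * indicator C (snd p)) * indicator (level_event lam (a # ms)) (fst p)"
        by (simp add: a level_event_def indicator_def)
    qed
  qed measurable
  finally show ?case .
qed

text \<open>Two Dynkin arguments: from level events to all events of the configuration with the
  second factor fixed, then from rectangles to all measurable sets. A density whose integrals over
  all measurable sets vanish is zero almost everywhere.\<close>

theorem test_functionals_determine: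
  assumes k: "integrable QL k"
    and z: "\<And>Bs C. set Bs \<subseteq> finite_sets lam \<Longrightarrow> C \<in> sets lam \<Longrightarrow>
      (\<integral>p. k p * (test_functional Bs (fst p) * indicator C (snd p)) \<partial>QL) = 0"
  shows "AE p in QL. k p = 0"
proof -
  have [measurable]: "k \<in> borel_measurable QL" using k by simp
  have t: "test_functional [] \<mu> = 1" for \<mu> :: "'a measure" by (simp add: test_functional_def)
  have rect: "(\<integral>p. (k p * indicator C (snd p)) * indicator A (fst p) \<partial>QL) = 0"
    if A: "A \<in> sets N" and C: "C \<in> sets lam" for A C
  proof (rule integral_eq_0_Dynkin[where S=N])
    note [measurable] = C
    show "integrable QL (\<lambda>p. k p * indicator C (snd p))"
      by (rule Bochner_Integration.integrable_bound[OF k]) (auto simp: indicator_def)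
    show "fst \<in> measurable QL N" by (simp add: measurable_QL)
    show "sets N = sigma_sets (space N) (level_events lam)"
      using sets_int_measure_space_level_events[OF lam.sigma_finite_measure_axioms] by (simp add: space_int_measure_space)
    show "level_events lam \<subseteq> Pow (space N)"
      by (auto simp: level_events_def level_event_def space_int_measure_space)
    show "(\<integral>p. k p * indicator C (snd p) \<partial>QL) = 0" using z[of "[]" C] C by (simp add: t)
    show "(\<integral>p. (k p * indicator C (snd p)) * indicator A (fst p) \<partial>QL) = 0" if lev: "A \<in> level_events lam" for A
    proof -
      obtain ms where "A = level_event lam ms" "fst ` set ms \<subseteq> finite_sets lam"
        using lev unfolding level_events_def by blast
      then show ?thesis using integral_level_event_eq_0[OF k C z[OF _ C], of ms "[]"] by (simp add: t)
    qed
  qed (rule Int_stable_level_events A)+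
  have all: "(\<integral>p. k p * indicator A p \<partial>QL) = 0" if A: "A \<in> sets QL" for A
  proof (rule integral_eq_0_Dynkin[where S="QL" and \<phi>="\<lambda>p. p", OF k])
    show "sets QL = sigma_sets (space QL) {a \<times> b |a b. a \<in> sets Q \<and> b \<in> sets lam}"
      by (simp only: sets_pair_measure space_pair_measure)
    show "{a \<times> b |a b. a \<in> sets Q \<and> b \<in> sets lam} \<subseteq> Pow (space QL)"
      unfolding space_pair_measure by (rule pair_measure_closed)
    have "(\<integral>p. k p \<partial>QL) = (\<integral>p. k p * (test_functional [] (fst p) * indicator (space lam) (snd p)) \<partial>QL)"
      by (intro Bochner_Integration.integral_cong) (auto simp: t space_pair_measure)
    then show "(\<integral>p. k p \<partial>QL) = 0" using z[of "[]" "space lam"] by simp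
    fix A assume "A \<in> {a \<times> b |a b. a \<in> sets Q \<and> b \<in> sets lam}"
    then obtain a b where "A = a \<times> b" "a \<in> sets N" "b \<in> sets lam" by auto
    then show "(\<integral>p. k p * indicator A p \<partial>QL) = 0"
      using rect[of a b] by (simp add: indicator_times mult_ac)
  qed (use A in \<open>simp_all add: Int_stable_pair_measure_generator\<close>)
  show ?thesis
    using density_unique_real[OF k, of "\<lambda>_. 0"] all by (simp add: set_lebesgue_integral_def mult.commute)
qed

end

context poisson_points
begin

section \<open>Identification of the derivative\<close>

lemma indicator_snd_L2:
  assumes C[measurable]: "C \<in> sets lam" and Cf: "emeasure lam C < \<infinity>"
  shows "(\<lambda>p. indicator C (snd p)) \<in> L2 QL"
proof -
  have "integrable QL (\<lambda>p. 1 * indicator C (snd p) :: real)"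
    using Cf by (intro QL_integral_product) auto
  moreover have "(\<lambda>p :: 'a measure \<times> 'a. (indicator C (snd p))\<^sup>2) = (\<lambda>p. 1 * indicator C (snd p) :: real)"
    by (simp add: fun_eq_iff indicator_def)
  ultimately have "integrable QL (\<lambda>p. (indicator C (snd p) :: real)\<^sup>2)" by (simp only:)
  then show ?thesis by (simp add: L2_def)
qed

text \<open>The only integrability of Df available a priori: local in y, against exponentials of the
  count. With c = 1 it is the majorant for integrating the expansion of a test functional against
  Df, with c = 0 it gives local integrability.\<close>

lemma integrable_diff_op_exp:
  assumes f: "f \<in> L2 Q" and B[measurable]: "B \<in> sets lam" and Bf: "emeasure lam B < \<infinity>" and c: "0 \<le> c"
  shows "integrable QL (\<lambda>p. diff_op (snd p) f (fst p) * exp (c * measure (fst p) B) * indicator B (snd p))"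
proof (rule integrableI_bounded)
  have [measurable]: "f \<in> borel_measurable N" using L2_measurable[OF f] by simp
  have [measurable]: "(\<lambda>p. diff_op (snd p) f (fst p)) \<in> borel_measurable (N \<Otimes>\<^sub>M lam)"
    using measurable_diff_op[of f] by (simp add: case_prod_beta')
  show "(\<lambda>p. diff_op (snd p) f (fst p) * exp (c * measure (fst p) B) * indicator B (snd p)) \<in> borel_measurable QL"
    unfolding measurable_QL by measurable
  have "(\<integral>\<^sup>+p. ennreal (norm (diff_op (snd p) f (fst p) * exp (c * measure (fst p) B) * indicator B (snd p))) \<partial>QL)
    = (\<integral>\<^sup>+p. indicator B (snd p) * ennreal (\<bar>diff_op (snd p) f (fst p)\<bar> * exp (c * measure (fst p) B)) \<partial>QL)"
    by (intro nn_integral_cong) (auto simp: abs_mult indicator_def)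
  also have "\<dots> \<le> (1 + emeasure lam B) * (\<integral>\<^sup>+\<mu>. ennreal (\<bar>f \<mu>\<bar> * exp ((c + 1) * measure \<mu> B)) \<partial>Q)"
    by (rule nn_integral_diff_op[OF B Bf _ c]) measurable
  also have "\<dots> < \<infinity>"
    using exp_integrableD(2)[OF exp_integrable_L2[OF B Bf f], of "c + 1"] Bf
    by (auto simp: ennreal_mult_less_top integrable_iff_bounded abs_mult)
  finally show "(\<integral>\<^sup>+p. ennreal (norm (diff_op (snd p) f (fst p) * exp (c * measure (fst p) B) * indicator B (snd p))) \<partial>QL) < \<infinity>" .
qed

text \<open>Integration by parts is used backwards: the pairing of D_y f with I_k of the k-th power
  of w over y in \<open>C\<close> equals E I_{k+1} f(eta) for the product of that power with the
  indicator of \<open>C\<close>, and \<open>wick_pairing\<close> turns this into an integral of the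
  expected difference of order k + 1. Dominated convergence sums over k.\<close>

lemma diff_op_expansion:
  assumes f: "f \<in> L2 Q" and Bs: "set Bs \<subseteq> finite_sets lam" and C: "C \<in> finite_sets lam"
  defines "w \<equiv> test_weight Bs" and "r \<equiv> \<integral>y. test_weight Bs y \<partial>lam"
  shows "(\<lambda>n. \<Sum>k<n. (\<integral>z. (\<integral>\<mu>. diff_iter (Suc k) z f \<mu> \<partial>Q) * ((\<Prod>i<k. w (z i)) * indicator C (z k)) \<partial>pow_measure lam (Suc k)) / fact k)
    \<longlonglongrightarrow> (\<integral>p. diff_op (snd p) f (fst p) * (exp (- r) * test_functional Bs (fst p) * indicator C (snd p)) \<partial>QL)"
proof -
  define A where "A = \<Union>(set Bs)"
  \<comment> \<open>One set of finite intensity has to carry both the weight and the indicator of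
    \<open>C\<close>.\<close>
  define B where "B = A \<union> C"
  have "set (C # Bs) \<subseteq> finite_sets lam" and BC: "B = \<Union>(set (C # Bs))" using Bs C by (auto simp: B_def A_def)
  note B = Union_finite_sets[OF this(1), folded BC]
  note A = Union_finite_sets[OF Bs, folded A_def]
  have Cm[measurable]: "C \<in> sets lam" using C by (simp add: finite_sets_def)
  note e = test_functional_expansion[OF Bs, folded w_def A_def r_def]
  note [measurable] = measurable_test_functional[OF Bs] A(1) B(1)
  have w: "supported_in lam B 1 w"
    using supported_in_mono[OF supported_in_test_weight[OF Bs], of B 1] by (auto simp: w_def B_def A_def)
  have wC: "supported_in lam B 1 (indicator C)" using Cm by (auto simp: supported_in_def B_def indicator_def)
  note fe = exp_integrable_L2[OF B f]
  have [measurable]: "f \<in> borel_measurable N" using L2_measurable[OF f] by simp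
  have [measurable]: "(\<lambda>p. diff_op (snd p) f (fst p)) \<in> borel_measurable (N \<Otimes>\<^sub>M lam)"
    using measurable_diff_op[of f] by (simp add: case_prod_beta')
  let ?W = "\<lambda>k. wick_functional lam {..<k} (\<lambda>_. w)"
  have [measurable]: "?W k \<in> borel_measurable N" for k
    by (rule measurable_wick_functional) (auto intro: supported_inD(1)[OF w])
  have W_term: "integrable QL (\<lambda>p. indicator C (snd p) * ?W k (fst p) * diff_op (snd p) f (fst p)) \<and>
     (\<integral>p. indicator C (snd p) * ?W k (fst p) * diff_op (snd p) f (fst p) \<partial>QL)
     = (\<integral>z. (\<integral>\<mu>. diff_iter (Suc k) z f \<mu> \<partial>Q) * ((\<Prod>i<k. w (z i)) * indicator C (z k)) \<partial>pow_measure lam (Suc k))" for k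
  proof -
    \<comment> \<open>The k-th power of the weight with the indicator of \<open>C\<close> in the
      last place, so that splitting off coordinate \<open>k\<close> leaves the integral of order
      \<open>k\<close> of the weight alone.\<close>
    let ?g = "\<lambda>i. if i < k then w else indicator C"
    have g: "supported_in lam B 1 (?g i)" for i using w wC by simp
    have W: "wick_functional lam {..<k} ?g = ?W k" by (rule wick_functional_cong) simp
    have p: "integrable QL (\<lambda>p. ?g k (snd p) * wick_functional lam {..<k} ?g (fst p) * diff_op (snd p) f (fst p))"
      "(\<integral>\<mu>. wick_functional lam (insert k {..<k}) ?g \<mu> * f \<mu> \<partial>Q)
        = (\<integral>p. ?g k (snd p) * wick_functional lam {..<k} ?g (fst p) * diff_op (snd p) f (fst p) \<partial>QL)"
      by (rule wick_by_parts[OF B _ _ _ _ fe, of "{..<k}" k 1 ?g]; use g in auto)+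
    have "(\<integral>\<mu>. wick_functional lam {..<Suc k} ?g \<mu> * f \<mu> \<partial>Q)
        = (\<integral>z. (\<integral>\<mu>. diff_iter (Suc k) z f \<mu> \<partial>Q) * (\<Prod>i<Suc k. ?g i (z i)) \<partial>pow_measure lam (Suc k))"
      by (rule wick_pairing(2)[OF B _ _ fe, of "Suc k" 1 ?g]) (use g in auto)
    moreover have "(\<Prod>i<Suc k. ?g i (z i)) = (\<Prod>i<k. w (z i)) * indicator C (z k)" for z
      by simp
    ultimately show ?thesis using p unfolding W lessThan_Suc[symmetric] by (simp only: if_False less_irrefl)
  qed
  have "(\<lambda>n. \<integral>p. diff_op (snd p) f (fst p) * ((\<Sum>k<n. ?W k (fst p) / fact k) * indicator C (snd p)) \<partial>QL)
    \<longlonglongrightarrow> (\<integral>p. diff_op (snd p) f (fst p) * (exp (- r) * test_functional Bs (fst p) * indicator C (snd p)) \<partial>QL)"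
  proof (rule integral_dominated_convergence[where w="\<lambda>p. exp \<bar>r\<bar> * \<bar>diff_op (snd p) f (fst p) * exp (1 * measure (fst p) B) * indicator B (snd p)\<bar>"])
    show "integrable QL (\<lambda>p. exp \<bar>r\<bar> * \<bar>diff_op (snd p) f (fst p) * exp (1 * measure (fst p) B) * indicator B (snd p)\<bar>)"
      using integrable_diff_op_exp[OF f B, of 1] by (intro integrable_mult_right integrable_abs) simp
    show "AE p in QL. (\<lambda>n. diff_op (snd p) f (fst p) * ((\<Sum>k<n. ?W k (fst p) / fact k) * indicator C (snd p)))
      \<longlonglongrightarrow> diff_op (snd p) f (fst p) * (exp (- r) * test_functional Bs (fst p) * indicator C (snd p))"
    proof -
      have "AE p in QL. (\<lambda>n. \<Sum>k<n. ?W k (fst p) / fact k) \<longlonglongrightarrow> exp (- r) * test_functional Bs (fst p)"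
        by (rule AE_QL_fst[OF e(1)]) measurable
      then show ?thesis by eventually_elim (intro tendsto_intros)
    qed
    fix n
    \<comment> \<open>Monotonicity of \<open>measure\<close> needs the larger count to be finite, as
      infinite mass is read as 0.\<close>
    have "AE \<mu> in Q. \<forall>B'\<in>set (C # Bs). emeasure \<mu> B' < \<infinity>" using Bs C by (intro AE_Q_finite_sets) auto
    then have "AE \<mu> in Q. measure \<mu> A \<le> measure \<mu> B"
      using AE_space
    proof eventually_elim
      fix \<mu> assume fin: "\<forall>B'\<in>set (C # Bs). emeasure \<mu> B' < \<infinity>" and "\<mu> \<in> space Q"
      then have s: "sets \<mu> = sets lam" by (simp add: space_int_measure_space int_measuresD)
      have "emeasure \<mu> B \<le> (\<Sum>B'\<in>set (C # Bs). emeasure \<mu> B')"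
        unfolding BC using emeasure_subadditive_finite[of "set (C # Bs)" "\<lambda>B. B" \<mu>] Bs C s
        by (auto simp: finite_sets_def)
      also have "\<dots> < \<infinity>" using fin by (simp add: less_top)
      finally show "measure \<mu> A \<le> measure \<mu> B"
        unfolding measure_def using s B(1) by (intro enn2real_mono emeasure_mono) (auto simp: B_def)
    qed
    with e(2)[of n] have "AE \<mu> in Q. \<bar>\<Sum>k<n. ?W k \<mu> / fact k\<bar> \<le> exp \<bar>r\<bar> * exp (measure \<mu> B)"
    proof eventually_elim
      fix \<mu> assume "\<bar>\<Sum>k<n. ?W k \<mu> / fact k\<bar> \<le> exp \<bar>r\<bar> * exp (measure \<mu> A)" "measure \<mu> A \<le> measure \<mu> B"
      moreover from this(2) have "exp \<bar>r\<bar> * exp (measure \<mu> A) \<le> exp \<bar>r\<bar> * exp (measure \<mu> B)" by simp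
      ultimately show "\<bar>\<Sum>k<n. ?W k \<mu> / fact k\<bar> \<le> exp \<bar>r\<bar> * exp (measure \<mu> B)" by linarith
    qed
    then have "AE p in QL. \<bar>\<Sum>k<n. ?W k (fst p) / fact k\<bar> \<le> exp \<bar>r\<bar> * exp (measure (fst p) B)"
      by (rule AE_QL_fst) measurable
    then show "AE p in QL. norm (diff_op (snd p) f (fst p) * ((\<Sum>k<n. ?W k (fst p) / fact k) * indicator C (snd p)))
      \<le> exp \<bar>r\<bar> * \<bar>diff_op (snd p) f (fst p) * exp (1 * measure (fst p) B) * indicator B (snd p)\<bar>"
    proof eventually_elim
      fix p :: "'a measure \<times> 'a"
      let ?S = "\<Sum>k<n. ?W k (fst p) / fact k"
      assume le: "\<bar>?S\<bar> \<le> exp \<bar>r\<bar> * exp (measure (fst p) B)"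
      have "norm (diff_op (snd p) f (fst p) * (?S * indicator C (snd p))) = \<bar>diff_op (snd p) f (fst p)\<bar> * (\<bar>?S\<bar> * indicator C (snd p))"
        by (simp add: abs_mult)
      also have "\<dots> \<le> \<bar>diff_op (snd p) f (fst p)\<bar> * ((exp \<bar>r\<bar> * exp (measure (fst p) B)) * indicator B (snd p))"
        using le by (intro mult_left_mono mult_mono) (auto simp: B_def indicator_def)
      finally show "norm (diff_op (snd p) f (fst p) * (?S * indicator C (snd p)))
        \<le> exp \<bar>r\<bar> * \<bar>diff_op (snd p) f (fst p) * exp (1 * measure (fst p) B) * indicator B (snd p)\<bar>"
        by (simp add: abs_mult mult_ac)
    qed
  qed (unfold measurable_QL, measurable)
  moreover have "(\<integral>p. diff_op (snd p) f (fst p) * ((\<Sum>k<n. ?W k (fst p) / fact k) * indicator C (snd p)) \<partial>QL)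
    = (\<Sum>k<n. (\<integral>z. (\<integral>\<mu>. diff_iter (Suc k) z f \<mu> \<partial>Q) * ((\<Prod>i<k. w (z i)) * indicator C (z k)) \<partial>pow_measure lam (Suc k)) / fact k)" for n
  proof -
    have "(\<integral>p. diff_op (snd p) f (fst p) * ((\<Sum>k<n. ?W k (fst p) / fact k) * indicator C (snd p)) \<partial>QL)
      = (\<integral>p. (\<Sum>k<n. (indicator C (snd p) * ?W k (fst p) * diff_op (snd p) f (fst p)) / fact k) \<partial>QL)"
      unfolding sum_distrib_left sum_distrib_right
      by (intro Bochner_Integration.integral_cong refl sum.cong) (simp add: mult_ac)
    also have "\<dots> = (\<Sum>k<n. (\<integral>p. indicator C (snd p) * ?W k (fst p) * diff_op (snd p) f (fst p) \<partial>QL) / fact k)"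
      using W_term by (subst Bochner_Integration.integral_sum) auto
    finally show ?thesis using W_term by (simp only:)
  qed
  ultimately show ?thesis by simp
qed

lemma chaos_kernel_eq:
  assumes f: "f \<in> borel_measurable N" and z: "z \<in> space (pow_measure lam n)"
  shows "chaos_kernel P \<eta> f n z = (\<integral>\<mu>. diff_iter n z f \<mu> \<partial>Q) / fact n"
proof -
  have "diff_iter n z f \<in> borel_measurable N"
    using measurable_compose[OF measurable_Pair1'[OF z] measurable_diff_iter[OF f]] by simp
  then show ?thesis by (simp add: chaos_kernel_def T_op_def integral_distr)
qed

lemma measurable_chaos_kernel:
  assumes f: "f \<in> borel_measurable N"
  shows "chaos_kernel P \<eta> f n \<in> borel_measurable (pow_measure lam n)"
proof -
  have "(\<lambda>z. (\<integral>\<mu>. diff_iter n z f \<mu> \<partial>Q) / fact n) \<in> borel_measurable (pow_measure lam n)"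
    using measurable_T[OF f] by measurable
  then show ?thesis by (subst measurable_cong[OF chaos_kernel_eq[OF f]])
qed

text \<open>The factor n + 1 of the derivative series cancels against the factorial in the kernel:
  (n+1) f_{n+1} is the expected difference of order n + 1 divided by n!. After
  \<open>slice_limit_pairing\<close> the partial sums for D'f are therefore literally those of
  \<open>diff_op_expansion\<close>, and the limits agree.\<close>

lemma chaos_series_pairing:
  assumes f: "f \<in> L2 Q" and Bs: "set Bs \<subseteq> finite_sets lam" and C: "C \<in> finite_sets lam"
    and G: "\<And>n. is_slice_limit n (chaos_kernel P \<eta> f (Suc n)) (G n)"
    and D: "L2_tendsto QL (\<lambda>k p. \<Sum>n<k. real (Suc n) * G n p) D"
  shows "(\<integral>p. diff_op (snd p) f (fst p) * (test_functional Bs (fst p) * indicator C (snd p)) \<partial>QL)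
    = (\<integral>p. D p * (test_functional Bs (fst p) * indicator C (snd p)) \<partial>QL)"
proof -
  define w where "w = test_weight Bs"
  define r where "r = (\<integral>y. test_weight Bs y \<partial>lam)"
  let ?\<Phi> = "\<lambda>\<mu>. exp (- r) * test_functional Bs \<mu>"
  let ?I = "\<lambda>n. \<integral>z. chaos_kernel P \<eta> f (Suc n) z * ((\<Prod>i<n. w (z i)) * indicator C (z n)) \<partial>pow_measure lam (Suc n)"
  have [measurable]: "f \<in> borel_measurable N" using L2_measurable[OF f] by simp
  have Cm[measurable]: "C \<in> sets lam" and Cf: "emeasure lam C < \<infinity>" using C by (auto simp: finite_sets_def)
  note A = Union_finite_sets[OF Bs]
  note [measurable] = measurable_test_functional[OF Bs]
  have \<Phi>: "?\<Phi> \<in> L2 Q" by (rule L2_cmult[OF test_functional_L2[OF Bs]])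
  have T: "(\<integral>\<mu>. diff_iter n z ?\<Phi> \<mu> \<partial>Q) = (\<Prod>i<n. w (z i))" if "z \<in> space (pow_measure lam n)" for n z
    using T_test_functional[OF Bs that] integral_test_functional[OF Bs]
    by (simp add: diff_iter_cmult w_def r_def exp_minus)
  have pair: "(\<integral>p. G n p * (?\<Phi> (fst p) * indicator C (snd p)) \<partial>QL) = ?I n" for n
    by (rule slice_limit_pairing[OF G \<Phi> Cm Cf supported_in_test_weight[OF Bs, folded w_def] A T])
  have GL2: "G n \<in> L2 QL" for n
    using G[of n] unfolding is_slice_limit_def L2_tendsto_iff by blast
  have \<Phi>C: "(\<lambda>p. ?\<Phi> (fst p) * indicator C (snd p)) \<in> L2 QL"
  proof -
    have "integrable QL (\<lambda>p. (?\<Phi> (fst p))\<^sup>2 * indicator C (snd p))"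
      using \<Phi> Cf by (intro QL_integral_product) (auto simp: L2_def)
    moreover have "(\<lambda>p. (?\<Phi> (fst p))\<^sup>2 * indicator C (snd p)) = (\<lambda>p. (?\<Phi> (fst p) * indicator C (snd p))\<^sup>2)"
      by (simp add: fun_eq_iff power_mult_distrib indicator_def)
    moreover have "(\<lambda>p. ?\<Phi> (fst p) * indicator C (snd p)) \<in> borel_measurable QL"
      by measurable
    ultimately show ?thesis by (simp add: L2_def)
  qed
  have "(\<lambda>k. \<integral>p. (\<Sum>n<k. real (Suc n) * G n p) * (?\<Phi> (fst p) * indicator C (snd p)) \<partial>QL)
      \<longlonglongrightarrow> (\<integral>p. D p * (?\<Phi> (fst p) * indicator C (snd p)) \<partial>QL)"
    by (rule L2_tendsto_inner[OF D \<Phi>C])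
  moreover have "(\<integral>p. (\<Sum>n<k. real (Suc n) * G n p) * (?\<Phi> (fst p) * indicator C (snd p)) \<partial>QL)
    = (\<Sum>n<k. (\<integral>z. (\<integral>\<mu>. diff_iter (Suc n) z f \<mu> \<partial>Q) * ((\<Prod>i<n. w (z i)) * indicator C (z n)) \<partial>pow_measure lam (Suc n)) / fact n)" for k
  proof -
    have "(\<integral>p. (\<Sum>n<k. real (Suc n) * G n p) * (?\<Phi> (fst p) * indicator C (snd p)) \<partial>QL)
      = (\<integral>p. (\<Sum>n<k. real (Suc n) * (G n p * (?\<Phi> (fst p) * indicator C (snd p)))) \<partial>QL)"
      by (simp only: sum_distrib_right mult.assoc)
    also have "\<dots> = (\<Sum>n<k. real (Suc n) * (\<integral>p. G n p * (?\<Phi> (fst p) * indicator C (snd p)) \<partial>QL))"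
      using L2_mult_integrable[OF GL2 \<Phi>C]
      by (subst Bochner_Integration.integral_sum) (simp_all del: of_nat_Suc)
    also have "\<dots> = (\<Sum>n<k. (\<integral>z. (\<integral>\<mu>. diff_iter (Suc n) z f \<mu> \<partial>Q) * ((\<Prod>i<n. w (z i)) * indicator C (z n)) \<partial>pow_measure lam (Suc n)) / fact n)"
    proof (rule sum.cong)
      fix n
      have "?I n = (\<integral>z. ((\<integral>\<mu>. diff_iter (Suc n) z f \<mu> \<partial>Q) * ((\<Prod>i<n. w (z i)) * indicator C (z n))) / fact (Suc n) \<partial>pow_measure lam (Suc n))"
        by (intro Bochner_Integration.integral_cong refl)
           (simp add: chaos_kernel_eq del: diff_iter.simps fact_Suc)
      then have I: "?I n = (\<integral>z. ((\<integral>\<mu>. diff_iter (Suc n) z f \<mu> \<partial>Q) * ((\<Prod>i<n. w (z i)) * indicator C (z n))) \<partial>pow_measure lam (Suc n)) / fact (Suc n)"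
        by (simp only: integral_divide_zero)
      have "real (Suc n) * (x / fact (Suc n)) = x / fact n" for x :: real
        by (simp add: divide_simps del: of_nat_Suc)
      then show "real (Suc n) * (\<integral>p. G n p * (?\<Phi> (fst p) * indicator C (snd p)) \<partial>QL)
        = (\<integral>z. (\<integral>\<mu>. diff_iter (Suc n) z f \<mu> \<partial>Q) * ((\<Prod>i<n. w (z i)) * indicator C (z n)) \<partial>pow_measure lam (Suc n)) / fact n"
        unfolding pair I .
    qed simp
    finally show ?thesis .
  qed
  ultimately have "(\<integral>p. D p * (?\<Phi> (fst p) * indicator C (snd p)) \<partial>QL)
    = (\<integral>p. diff_op (snd p) f (fst p) * (?\<Phi> (fst p) * indicator C (snd p)) \<partial>QL)"
    using diff_op_expansion[OF f Bs C, folded w_def r_def] by (simp only: LIMSEQ_unique)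
  moreover have e: "h p * (?\<Phi> (fst p) * indicator C (snd p)) = exp (- r) * (h p * (test_functional Bs (fst p) * indicator C (snd p)))"
    for h :: "'a measure \<times> 'a \<Rightarrow> real" and p
    by (simp add: mult_ac)
  ultimately show ?thesis by (simp only: e[of D] e[of "\<lambda>p. diff_op (snd p) f (fst p)"] integral_mult_right_zero) simp
qed

text \<open>The difference of the two sides is integrable only over y in a set of finite intensity.
  It is cut down to the sets of a countable exhaustion, and the cut-off is merged into the set
  \<open>C\<close> of the test function.\<close>

lemma diff_op_eq_chaos_series:
  assumes f: "f \<in> L2 Q"
    and G: "\<And>n. is_slice_limit n (chaos_kernel P \<eta> f (Suc n)) (G n)"
    and D: "L2_tendsto QL (\<lambda>k p. \<Sum>n<k. real (Suc n) * G n p) D"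
  shows "AE p in QL. diff_op (snd p) f (fst p) = D p"
proof -
  obtain A :: "nat \<Rightarrow> 'a set" where A: "range A \<subseteq> sets lam" "(\<Union>i. A i) = space lam" "\<And>i. emeasure lam (A i) \<noteq> \<infinity>"
    using lam.sigma_finite by metis
  have DL2: "D \<in> L2 QL" using D by (simp add: L2_tendsto_iff)
  have "AE p in QL. (diff_op (snd p) f (fst p) - D p) * indicator (A i) (snd p) = 0" for i
  proof (rule test_functionals_determine)
    have Ai[measurable]: "A i \<in> sets lam" and Af: "emeasure lam (A i) < \<infinity>" using A by (auto simp: less_top)
    have i1: "integrable QL (\<lambda>p. diff_op (snd p) f (fst p) * indicator (A i) (snd p))"
      using integrable_diff_op_exp[OF f Ai Af, of 0] by simp
    have i2: "integrable QL (\<lambda>p. D p * indicator (A i) (snd p))"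
      by (rule L2_mult_integrable[OF DL2 indicator_snd_L2[OF Ai Af]])
    show "integrable QL (\<lambda>p. (diff_op (snd p) f (fst p) - D p) * indicator (A i) (snd p))"
      using Bochner_Integration.integrable_diff[OF i1 i2] by (simp add: left_diff_distrib)
    fix Bs C assume Bs: "set Bs \<subseteq> finite_sets lam" and C[measurable]: "C \<in> sets lam"
    note [measurable] = measurable_test_functional[OF Bs]
    have AC: "A i \<inter> C \<in> finite_sets lam"
      using emeasure_mono[of "A i \<inter> C" "A i" lam] Af by (auto simp: finite_sets_def intro: le_less_trans)
    have b: "integrable QL (\<lambda>p. h p * (test_functional Bs (fst p) * indicator (A i \<inter> C) (snd p)))"
      if h: "integrable QL (\<lambda>p. h p * indicator (A i) (snd p))" for h
    proof -
      have "integrable QL (\<lambda>p. (h p * indicator (A i) (snd p)) * (test_functional Bs (fst p) * indicator C (snd p)))"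
      proof (rule Bochner_Integration.integrable_bound[OF h])
        show "(\<lambda>p. (h p * indicator (A i) (snd p)) * (test_functional Bs (fst p) * indicator C (snd p))) \<in> borel_measurable QL"
          by (intro borel_measurable_times borel_measurable_integrable[OF h]) measurable
        show "AE p in QL. norm ((h p * indicator (A i) (snd p)) * (test_functional Bs (fst p) * indicator C (snd p)))
          \<le> norm (h p * indicator (A i) (snd p))"
          using test_functional_bounds[of Bs]
          by (intro AE_I2) (auto simp: abs_mult indicator_def less_imp_le intro!: mult_left_le)
      qed
      moreover have "(h p * indicator (A i) (snd p)) * (test_functional Bs (fst p) * indicator C (snd p))
        = h p * (test_functional Bs (fst p) * indicator (A i \<inter> C) (snd p))" for p
        by (simp add: indicator_inter_arith mult_ac)
      ultimately show ?thesis by simp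
    qed
    have "(diff_op (snd p) f (fst p) - D p) * indicator (A i) (snd p) * (test_functional Bs (fst p) * indicator C (snd p))
      = diff_op (snd p) f (fst p) * (test_functional Bs (fst p) * indicator (A i \<inter> C) (snd p))
        - D p * (test_functional Bs (fst p) * indicator (A i \<inter> C) (snd p))" for p
      by (simp add: indicator_inter_arith algebra_simps)
    then show "(\<integral>p. (diff_op (snd p) f (fst p) - D p) * indicator (A i) (snd p) * (test_functional Bs (fst p) * indicator C (snd p)) \<partial>QL) = 0"
      using Bochner_Integration.integral_diff[OF b[OF i1] b[OF i2]] chaos_series_pairing[OF f Bs AC G D]
      by (simp only: diff_self)
  qed
  then have "AE p in QL. \<forall>i. (diff_op (snd p) f (fst p) - D p) * indicator (A i) (snd p) = 0"
    unfolding AE_all_countable by blast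
  then show ?thesis
    using AE_space
  proof eventually_elim
    fix p assume z: "\<forall>i. (diff_op (snd p) f (fst p) - D p) * indicator (A i) (snd p) = 0" and "p \<in> space QL"
    then have "snd p \<in> (\<Union>i. A i)" using A(2) by (auto simp: space_pair_measure)
    then obtain i where "snd p \<in> A i" by blast
    with z[rule_format, of i] show "diff_op (snd p) f (fst p) = D p" by simp
  qed
qed

text \<open>What remains is to pass from the configuration space to \<open>P\<close> and from the
  slice limits to the chosen versions: the slices agree almost everywhere with
  \<open>wiener_ito_slices\<close>, simultaneously for all orders, so both series have the same L2
  limit. Fubini finally puts the quantifier over y in front.\<close>

theorem diff_op_eq_chaos_derivative:
  assumes f: "f \<in> L2 Q"
    and fin: "(\<Sum>n. ennreal (real (Suc n) * fact (Suc n)) *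
      (\<integral>\<^sup>+ y. ennreal ((chaos_kernel P \<eta> f (Suc n) y)\<^sup>2) \<partial>pow_measure lam (Suc n))) < \<infinity>"
  shows "AE y in lam. AE \<omega> in P. diff_op y f (\<eta> \<omega>) = chaos_derivative P lam \<eta> X f (\<omega>, y)"
proof -
  let ?K = "\<lambda>n. chaos_kernel P \<eta> f (Suc n)"
  have fm[measurable]: "f \<in> borel_measurable N" using L2_measurable[OF f] by simp
  have Dfm: "(\<lambda>p. diff_op (snd p) f (fst p)) \<in> borel_measurable (N \<Otimes>\<^sub>M lam)"
    using measurable_diff_op[of f] by (simp add: case_prod_beta')
  note fin' = fin[folded sqn_def]
  have K: "?K n \<in> L2 (pow_measure lam (Suc n))" for n
  proof -
    have "(\<Sum>i\<in>{n}. ennreal (real (Suc i) * fact (Suc i)) * sqn (pow_measure lam (Suc i)) (?K i))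
      \<le> (\<Sum>i. ennreal (real (Suc i) * fact (Suc i)) * sqn (pow_measure lam (Suc i)) (?K i))"
      by (intro sum_le_suminf) auto
    also note fin'
    finally have "ennreal (real (Suc n) * fact (Suc n)) * sqn (pow_measure lam (Suc n)) (?K n) < \<infinity>" by simp
    moreover have "0 < real (Suc n) * fact (Suc n)" by (intro mult_pos_pos) (simp_all del: fact_Suc)
    then have "ennreal (real (Suc n) * fact (Suc n)) \<noteq> 0" by (simp only: ennreal_eq_0_iff not_le)
    ultimately have "sqn (pow_measure lam (Suc n)) (?K n) < \<infinity>"
      unfolding ennreal_mult_less_top infinity_ennreal_def by auto
    then show ?thesis using measurable_chaos_kernel[OF fm] by (simp add: L2_iff)
  qed
  have "\<forall>n. \<exists>G. is_slice_limit n (?K n) G" using slice_limit_exists[OF K] by blast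
  then obtain G where G: "\<And>n. is_slice_limit n (?K n) (G n)" by metis
  obtain D where D: "L2_tendsto QL (\<lambda>k p. \<Sum>n<k. real (Suc n) * G n p) D"
    using slice_series_converges[OF G fin'] by blast
  let ?D = "\<lambda>p. D (\<eta> (fst p), snd p)" and ?C = "chaos_derivative P lam \<eta> X f"
  let ?h = "\<lambda>N p. \<Sum>n<N. real (Suc n) * wiener_ito_slices P lam \<eta> X n (?K n) p"
  have Dm: "D \<in> borel_measurable (N \<Otimes>\<^sub>M lam)"
    using D L2_measurable unfolding L2_tendsto_iff measurable_QL[symmetric] by blast
  have "L2_tendsto (P \<Otimes>\<^sub>M lam) ?h ?D"
  proof (rule L2_tendsto_cong_AE[OF L2_tendsto_PL[OF D]])
    show "?h k \<in> borel_measurable (P \<Otimes>\<^sub>M lam)" for k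
      using wiener_ito_slices_AE(1)[OF K G] by measurable
    have "AE p in P \<Otimes>\<^sub>M lam. \<forall>n. wiener_ito_slices P lam \<eta> X n (?K n) p = G n (\<eta> (fst p), snd p)"
      unfolding AE_all_countable using wiener_ito_slices_AE(2)[OF K G] by blast
    then show "AE p in P \<Otimes>\<^sub>M lam. (\<Sum>n<k. real (Suc n) * G n (\<eta> (fst p), snd p)) = ?h k p" for k
      by eventually_elim simp
    show "?D \<in> borel_measurable (P \<Otimes>\<^sub>M lam)" by (rule measurable_compose[OF measurable_eta_pair Dm])
  qed simp
  \<comment> \<open>\<open>chaos_derivative\<close> is a choice among L2 limits of this series; the
    limit just exhibited shows that the choice is such a limit, and uniqueness identifies the
    two.\<close>
  moreover from this have C: "L2_tendsto (P \<Otimes>\<^sub>M lam) ?h ?C"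
    unfolding chaos_derivative_def by (rule someI[of "L2_tendsto (P \<Otimes>\<^sub>M lam) ?h"])
  ultimately have "AE p in P \<Otimes>\<^sub>M lam. ?D p = ?C p" by (rule L2_tendsto_unique)
  moreover have "AE p in P \<Otimes>\<^sub>M lam. diff_op (snd p) f (\<eta> (fst p)) = ?D p"
  proof -
    have "Measurable.pred (N \<Otimes>\<^sub>M lam) (\<lambda>p. diff_op (snd p) f (fst p) = D p)"
      using Dfm Dm by measurable
    from AE_QL_iff[OF this] show ?thesis using diff_op_eq_chaos_series[OF f G D] by simp
  qed
  ultimately have eq: "AE p in P \<Otimes>\<^sub>M lam. diff_op (snd p) f (\<eta> (fst p)) = ?C p"
    by eventually_elim simp
  have Cm: "?C \<in> borel_measurable (P \<Otimes>\<^sub>M lam)" using C L2_measurable unfolding L2_tendsto_iff by blast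
  have Em: "(\<lambda>p. diff_op (snd p) f (\<eta> (fst p))) \<in> borel_measurable (P \<Otimes>\<^sub>M lam)"
    using measurable_compose[OF measurable_eta_pair Dfm] by simp
  have "Measurable.pred (P \<Otimes>\<^sub>M lam) (\<lambda>p. diff_op (snd p) f (\<eta> (fst p)) = ?C p)"
    using Em Cm by measurable
  then have "{p \<in> space (P \<Otimes>\<^sub>M lam). diff_op (snd p) f (\<eta> (fst p)) = ?C (fst p, snd p)} \<in> sets (P \<Otimes>\<^sub>M lam)"
    by simp
  from PL.AE_commute[OF this] show ?thesis using PL.AE_pair[OF eq] by simp
qed

end

theorem theorem3p3:
  fixes P :: "'w measure" and lam :: "'a measure"
    and \<eta> :: "'w \<Rightarrow> 'a measure" and X :: "nat \<Rightarrow> 'w \<Rightarrow> 'a"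
    and f :: "'a measure \<Rightarrow> real"
  assumes "prob_space P"
    and "sigma_finite_measure lam"
    and "poisson_process P lam \<eta>"
    and "point_representation P lam \<eta> X"
    and "f \<in> L2 (distr P (int_measure_space lam) \<eta>)"
    and "(\<Sum>n. ennreal (real (Suc n) * fact (Suc n)) *
            (\<integral>\<^sup>+ y. ennreal ((chaos_kernel P \<eta> f (Suc n) y)\<^sup>2) \<partial>pow_measure lam (Suc n))) < \<infinity>"
  shows "AE y in lam. AE \<omega> in P.
           diff_op y f (\<eta> \<omega>) = chaos_derivative P lam \<eta> X f (\<omega>, y)"
proof -
  interpret prob_space P by fact
  interpret sigma_finite_measure lam by fact
  interpret poisson_points P lam \<eta> X by unfold_locales fact+
  show ?thesis by (rule diff_op_eq_chaos_derivative) fact+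
qed

end
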